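(* Let $K$ be a simplicial complex on $[m]$ and $(\underline X,\underline A)=\{(X_k,A_k)\}_{k=1}^m$ a sequence of simplicial pairs on $[n_1],\dots,[n_m]$ such that the polyhedral product complex $\mathcal S(K;\underline X,\underline A)$ is homology split, i.e. for each $k$ the homomorphism $\iota_k\colon\widetilde H_*(A_k)\to\widetilde H_*(X_k)$ induced by inclusion has free kernel, free cokernel and free image. Then $$\widetilde H_{*-1}(\mathcal S(K;\underline X,\underline A))\cong H_*^{\mathscr X_m}(K)\,\widehat\otimes\,H_*^{\mathscr X_m}(\underline X,\underline A)=H_*^{\mathscr X_m}(K)\,\widehat\otimes\,\big(H_*^{\mathscr X}(X_1,A_1)\otimes\cdots\otimes H_*^{\mathscr X}(X_m,A_m)\big),$$ $$\widetilde H^{*-1}(\mathcal S(K;\underline X,\underline A))\cong H^*_{\mathscr X_m}(K)\,\widehat\otimes\,H^*_{\mathscr X_m}(\underline X,\underline A)=H^*_{\mathscr X_m}(K)\,\widehat\otimes\,\big(H^*_{\mathscr X}(X_1,A_1)\otimes\cdots\otimes H^*_{\mathscr X}(X_m,A_m)\big).$$ If each $\iota_k$ is an epimorphism, then all $\mathscr X$ may be replaced by $\mathscr R$ (so $\mathscr X_m$ by $\mathscr R_m$), and $H_*^{\mathscr R}(X_k,A_k)=\widetilde H_{*-1}(A_k)$ (identifying image with coimage). If the reduced simplicial (co)homology is taken over a field, then the conclusion holds for all polyhedral product complexes $\mathcal S(K;\underline X,\underline A)$.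
   Context: Simplicial complexes are sets of subsets of a finite set closed under taking subsets; ghost vertices, $\{\emptyset\}$ and the void complex $\{\,\}$ are allowed. $\widetilde H$ is reduced simplicial (co)homology, where $\emptyset$ is a simplex of degree $-1$: $\widetilde H_*(\{\emptyset\})=\mathbb Z$ in degree $-1$ and $\widetilde H_*(\{\,\})=0$. Let $n_k>0$, $s_k=n_1+\cdots+n_k$, $n=s_m$; $[n_k]$ is identified with $\{s_{k-1}+1,\dots,s_k\}\subset[n]$. A simplicial pair on $[n_k]$ is a pair $A_k\subset X_k$ of simplicial complexes on $[n_k]$. For complexes $Y_k$ on $[n_k]$, $Y_1*\cdots*Y_m=\{\sigma\subset[n]\mid\sigma\cap[n_k]\in Y_k\ \forall k\}$. The polyhedral product complex is $\mathcal S(K;\underline X,\underline A)=\bigcup_{\tau\in K}Y_1^\tau*\cdots*Y_m^\tau$, with $Y^\tau_k=X_k$ if $k\in\tau$, $Y^\tau_k=A_k$ if $k\notin\tau$ (void complex if $K=\{\,\}$). Index sets: $\mathscr X_m=\{(\sigma,\omega)\mid\sigma,\omega\subset[m],\ \sigma\cap\omega=\emptyset\}$, $\mathscr X=\mathscr X_1=\{(\{1\},\emptyset),(\emptyset,\{1\}),(\emptyset,\emptyset)\}$, $\mathscr R=\{(\emptyset,\emptyset),(\emptyset,\{1\})\}$, $\mathscr R_m=\{(\emptyset,\omega)\mid\omega\subset[m]\}$. One identifies $\mathscr X_m=\mathscr X\times\cdots\times\mathscr X$ and $\mathscr R_m=\mathscr R\times\cdots\times\mathscr R$ ($m$ factors).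 For groups $A_*=\bigoplus_{\alpha\in\Lambda}A_*^\alpha$, $B_*=\bigoplus_{\alpha\in\Lambda}B_*^\alpha$ indexed by the same set, the diagonal tensor product is $A_*\widehat\otimes B_*=\bigoplus_{\alpha\in\Lambda}A_*^\alpha\otimes B_*^\alpha$. For $(\sigma,\omega)\in\mathscr X_m$, $K_{\sigma,\omega}=\{\tau\subset\omega\mid\sigma\cup\tau\in K\}$ (so it is $\{\,\}$ if $\sigma\notin K$). $H_*^{\mathscr X_m}(K)=\bigoplus_{(\sigma,\omega)\in\mathscr X_m}H_*^{\sigma,\omega}(K)$ with $H_*^{\sigma,\omega}(K)=\widetilde H_{*-1}(K_{\sigma,\omega})$; $H^*_{\mathscr X_m}(K)=\bigoplus_{(\sigma,\omega)} H^*_{\sigma,\omega}(K)$ with $H^*_{\sigma,\omega}(K)=\widetilde H^{*-1}(K_{\sigma,\omega})$. Let $\Sigma$ denote suspension (degree shift by $+1$) and $\iota_k^\circ\colon\widetilde H^*(X_k)\to\widetilde H^*(A_k)$ the dual of $\iota_k$. $H_*^{\mathscr X}(X_k,A_k)$ is the direct sum of $\Sigma\,\mathrm{coker}\,\iota_k$ (index $(\{1\},\emptyset)$), $\Sigma\ker\iota_k$ (index $(\emptyset,\{1\})$), $\Sigma\,\mathrm{im}\,\iota_k$ (index $(\emptyset,\emptyset)$). $H^*_{\mathscr X}(X_k,A_k)$ is the direct sum of $\Sigma\ker\iota_k^\circ$ (index $(\{1\},\emptyset)$), $\Sigma\,\mathrm{coker}\,\iota_k^\circ$ (index $(\emptyset,\{1\})$),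 $\Sigma\,\mathrm{im}\,\iota_k^\circ$ (index $(\emptyset,\emptyset)$). $H^{\mathscr R}_*$ and $H_{\mathscr R}^*$ are obtained by keeping only the indices in $\mathscr R$. $H_*^{\mathscr X_m}(\underline X,\underline A)=\bigoplus_{(\sigma,\omega)\in\mathscr X_m} H_*^{\sigma,\omega}(\underline X,\underline A)$, where $H_*^{\sigma,\omega}(\underline X,\underline A)=H_1\otimes\cdots\otimes H_m$ with $H_k=\Sigma\,\mathrm{coker}\,\iota_k$ if $k\in\sigma$, $\Sigma\ker\iota_k$ if $k\in\omega$, $\Sigma\,\mathrm{im}\,\iota_k$ otherwise. Similarly $H^*_{\mathscr X_m}(\underline X,\underline A)=\bigoplus H^*_{\sigma,\omega}(\underline X,\underline A)$, with $H^*_{\sigma,\omega}(\underline X,\underline A)=H^1\otimes\cdots\otimes H^m$ and $H^k=\Sigma\ker\iota_k^\circ$ if $k\in\sigma$, $\Sigma\,\mathrm{coker}\,\iota_k^\circ$ if $k\in\omega$, $\Sigma\,\mathrm{im}\,\iota_k^\circ$ otherwise. *)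

theory Defs
  imports "HOL-Algebra.IntRing" "HOL-Algebra.Module"
begin

section \<open>Modules over a commutative ring\<close>

text \<open>
  All (co)homology is taken with coefficients in a commutative ring \<open>R\<close>; for \<open>R = \<Z>\<close> modules are
  abelian groups.  The ring multiplication and unit that the record type of modules inherits play
  no role and are left \<open>undefined\<close>.
\<close>

definition mod_hom :: "('r, 's) ring_scheme \<Rightarrow> ('r, 'a) module \<Rightarrow> ('r, 'b) module \<Rightarrow> ('a \<Rightarrow> 'b) set"
  where "mod_hom R M N = {h \<in> carrier M \<rightarrow> carrier N.
    (\<forall>x\<in>carrier M. \<forall>y\<in>carrier M. h (x \<oplus>\<^bsub>M\<^esub> y) = h x \<oplus>\<^bsub>N\<^esub> h y) \<and>
    (\<forall>r\<in>carrier R. \<forall>x\<in>carrier M. h (r \<odot>\<^bsub>M\<^esub> x) = r \<odot>\<^bsub>N\<^esub> h x)}"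

definition mod_iso :: "('r, 's) ring_scheme \<Rightarrow> ('r, 'a) module \<Rightarrow> ('r, 'b) module \<Rightarrow> ('a \<Rightarrow> 'b) set"
  where "mod_iso R M N = {h \<in> mod_hom R M N. bij_betw h (carrier M) (carrier N)}"

definition mod_isomorphic :: "('r, 's) ring_scheme \<Rightarrow> ('r, 'a) module \<Rightarrow> ('r, 'b) module \<Rightarrow> bool"
  where "mod_isomorphic R M N \<longleftrightarrow> mod_iso R M N \<noteq> {}"

definition restrict_mod :: "('r, 'a) module \<Rightarrow> 'a set \<Rightarrow> ('r, 'a) module"
  where "restrict_mod M N = M\<lparr>carrier := N\<rparr>"

definition quot_mod :: "('r, 'a) module \<Rightarrow> 'a set \<Rightarrow> ('r, 'a set) module"
  where "quot_mod M N =
    \<lparr>carrier = a_rcosets\<^bsub>M\<^esub> N, mult = undefined, one = undefined,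
     zero = N, add = (\<lambda>Z W. Z <+>\<^bsub>M\<^esub> W), smult = (\<lambda>r Z. \<Union>z\<in>Z. N +>\<^bsub>M\<^esub> (r \<odot>\<^bsub>M\<^esub> z))\<rparr>"

text \<open>The map \<open>_ / _ \<rightarrow> M / N\<close> induced on cosets by \<open>f\<close>.\<close>

definition quot_map :: "('r, 'b) module \<Rightarrow> 'b set \<Rightarrow> ('a \<Rightarrow> 'b) \<Rightarrow> 'a set \<Rightarrow> 'b set"
  where "quot_map M N f Z = (\<Union>z\<in>Z. N +>\<^bsub>M\<^esub> f z)"

definition ker_mod :: "('r, 'a) module \<Rightarrow> ('r, 'b) module \<Rightarrow> ('a \<Rightarrow> 'b) \<Rightarrow> ('r, 'a) module"
  where "ker_mod M N h = restrict_mod M (a_kernel M N h)"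

definition im_mod :: "('r, 'a) module \<Rightarrow> ('r, 'b) module \<Rightarrow> ('a \<Rightarrow> 'b) \<Rightarrow> ('r, 'b) module"
  where "im_mod M N h = restrict_mod N (h ` carrier M)"

definition coker_mod :: "('r, 'a) module \<Rightarrow> ('r, 'b) module \<Rightarrow> ('a \<Rightarrow> 'b) \<Rightarrow> ('r, 'b set) module"
  where "coker_mod M N h = quot_mod N (h ` carrier M)"

text \<open>
  Transport of structure along an injection \<open>f\<close> with left inverse \<open>g\<close>.  It is only used with the
  injections of a sum type, to give kernels, images and cokernels a common element type.
\<close>

definition transport_mod :: "('a \<Rightarrow> 'b) \<Rightarrow> ('b \<Rightarrow> 'a) \<Rightarrow> ('r, 'a) module \<Rightarrow> ('r, 'b) module"
  where "transport_mod f g M =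
    \<lparr>carrier = f ` carrier M, mult = undefined, one = undefined,
     zero = f \<zero>\<^bsub>M\<^esub>, add = (\<lambda>x y. f (g x \<oplus>\<^bsub>M\<^esub> g y)), smult = (\<lambda>r x. f (r \<odot>\<^bsub>M\<^esub> g x))\<rparr>"

text \<open>The free module on \<open>S\<close>: finitely supported functions that vanish outside \<open>S\<close>.\<close>

definition free_mod :: "('r, 's) ring_scheme \<Rightarrow> 'a set \<Rightarrow> ('r, 'a \<Rightarrow> 'r) module"
  where "free_mod R S =
    \<lparr>carrier = {f. (\<forall>x. f x \<in> carrier R) \<and> (\<forall>x. x \<notin> S \<longrightarrow> f x = \<zero>\<^bsub>R\<^esub>) \<and> finite {x. f x \<noteq> \<zero>\<^bsub>R\<^esub>}},
     mult = undefined, one = undefined, zero = (\<lambda>_. \<zero>\<^bsub>R\<^esub>),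
     add = (\<lambda>f g x. f x \<oplus>\<^bsub>R\<^esub> g x), smult = (\<lambda>r f x. r \<otimes>\<^bsub>R\<^esub> f x)\<rparr>"

definition generator :: "('r, 's) ring_scheme \<Rightarrow> 'a \<Rightarrow> 'a \<Rightarrow> 'r"
  where "generator R x = (\<lambda>y. if y = x then \<one>\<^bsub>R\<^esub> else \<zero>\<^bsub>R\<^esub>)"

definition mod_basis :: "('r, 's) ring_scheme \<Rightarrow> ('r, 'a) module \<Rightarrow> 'a set \<Rightarrow> bool"
  where "mod_basis R M B \<longleftrightarrow> B \<subseteq> carrier M \<and>
    (\<forall>x\<in>carrier M. \<exists>!c. c \<in> carrier (free_mod R B) \<and>
       x = (\<Oplus>\<^bsub>M\<^esub>b\<in>{b. c b \<noteq> \<zero>\<^bsub>R\<^esub>}. c b \<odot>\<^bsub>M\<^esub> b))"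

definition is_free :: "('r, 's) ring_scheme \<Rightarrow> ('r, 'a) module \<Rightarrow> bool"
  where "is_free R M \<longleftrightarrow> (\<exists>B. mod_basis R M B)"

definition span_mod :: "('r, 's) ring_scheme \<Rightarrow> ('r, 'a) module \<Rightarrow> 'a set \<Rightarrow> 'a set"
  where "span_mod R M S = \<Inter>{N. submodule N R M \<and> S \<subseteq> N}"

definition direct_sum :: "'i set \<Rightarrow> ('i \<Rightarrow> ('r, 'a) module) \<Rightarrow> ('r, 'i \<Rightarrow> 'a) module"
  where "direct_sum I M =
    \<lparr>carrier = {f \<in> \<Pi>\<^sub>E i\<in>I. carrier (M i). finite {i \<in> I. f i \<noteq> \<zero>\<^bsub>M i\<^esub>}},
     mult = undefined, one = undefined, zero = (\<lambda>i\<in>I. \<zero>\<^bsub>M i\<^esub>),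
     add = (\<lambda>f g. \<lambda>i\<in>I. f i \<oplus>\<^bsub>M i\<^esub> g i), smult = (\<lambda>r f. \<lambda>i\<in>I. r \<odot>\<^bsub>M i\<^esub> f i)\<rparr>"


section \<open>Tensor products\<close>

definition bilinear_relations ::
  "('r, 's) ring_scheme \<Rightarrow> ('r, 'a) module \<Rightarrow> ('r, 'b) module \<Rightarrow> ('a \<times> 'b \<Rightarrow> 'r) set"
  where "bilinear_relations R M N = (let F = free_mod R (carrier M \<times> carrier N); e = generator R in
    {e (x \<oplus>\<^bsub>M\<^esub> x', y) \<ominus>\<^bsub>F\<^esub> (e (x, y) \<oplus>\<^bsub>F\<^esub> e (x', y)) | x x' y.
       x \<in> carrier M \<and> x' \<in> carrier M \<and> y \<in> carrier N} \<union>
    {e (x, y \<oplus>\<^bsub>N\<^esub> y') \<ominus>\<^bsub>F\<^esub> (e (x, y) \<oplus>\<^bsub>F\<^esub> e (x, y')) | x y y'.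
       x \<in> carrier M \<and> y \<in> carrier N \<and> y' \<in> carrier N} \<union>
    {e (r \<odot>\<^bsub>M\<^esub> x, y) \<ominus>\<^bsub>F\<^esub> r \<odot>\<^bsub>F\<^esub> e (x, y) | r x y.
       r \<in> carrier R \<and> x \<in> carrier M \<and> y \<in> carrier N} \<union>
    {e (x, r \<odot>\<^bsub>N\<^esub> y) \<ominus>\<^bsub>F\<^esub> r \<odot>\<^bsub>F\<^esub> e (x, y) | r x y.
       r \<in> carrier R \<and> x \<in> carrier M \<and> y \<in> carrier N})"

definition tensor ::
  "('r, 's) ring_scheme \<Rightarrow> ('r, 'a) module \<Rightarrow> ('r, 'b) module \<Rightarrow> ('r, ('a \<times> 'b \<Rightarrow> 'r) set) module"
  where "tensor R M N = (let F = free_mod R (carrier M \<times> carrier N) in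
    quot_mod F (span_mod R F (bilinear_relations R M N)))"

text \<open>
  The tensor product of a finite family \<open>(M k)\<^sub>k\<^sub>\<in>\<^sub>I\<close> is built in one step, since iterating the binary
  tensor product would change the type at every factor.
\<close>

definition multilinear_relations ::
  "('r, 's) ring_scheme \<Rightarrow> 'i set \<Rightarrow> ('i \<Rightarrow> ('r, 'a) module) \<Rightarrow> (('i \<Rightarrow> 'a) \<Rightarrow> 'r) set"
  where "multilinear_relations R I M =
    (let P = (\<Pi>\<^sub>E k\<in>I. carrier (M k)); F = free_mod R P; e = generator R in
    {e (p(k := x \<oplus>\<^bsub>M k\<^esub> y)) \<ominus>\<^bsub>F\<^esub> (e (p(k := x)) \<oplus>\<^bsub>F\<^esub> e (p(k := y))) | p k x y.
       p \<in> P \<and> k \<in> I \<and> x \<in> carrier (M k) \<and> y \<in> carrier (M k)} \<union>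
    {e (p(k := r \<odot>\<^bsub>M k\<^esub> x)) \<ominus>\<^bsub>F\<^esub> r \<odot>\<^bsub>F\<^esub> e (p(k := x)) | p k r x.
       p \<in> P \<and> k \<in> I \<and> r \<in> carrier R \<and> x \<in> carrier (M k)})"

definition tensor_family ::
  "('r, 's) ring_scheme \<Rightarrow> 'i set \<Rightarrow> ('i \<Rightarrow> ('r, 'a) module) \<Rightarrow> ('r, (('i \<Rightarrow> 'a) \<Rightarrow> 'r) set) module"
  where "tensor_family R I M = (let F = free_mod R (\<Pi>\<^sub>E k\<in>I. carrier (M k)) in
    quot_mod F (span_mod R F (multilinear_relations R I M)))"


section \<open>Graded modules\<close>

text \<open>
  A graded module is the family of its homogeneous parts.  A graded module that is a direct sum
  indexed by a set \<open>\<Lambda>\<close> is given by its summands, as a function of the index in \<open>\<Lambda>\<close>.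
\<close>

type_synonym ('r, 'a) graded = "int \<Rightarrow> ('r, 'a) module"

definition suspension :: "('r, 'a) graded \<Rightarrow> ('r, 'a) graded"
  where "suspension M d = M (d - 1)"

definition graded_isomorphic :: "('r, 's) ring_scheme \<Rightarrow> ('r, 'a) graded \<Rightarrow> ('r, 'b) graded \<Rightarrow> bool"
  where "graded_isomorphic R M N \<longleftrightarrow> (\<forall>d. mod_isomorphic R (M d) (N d))"

definition graded_direct_sum :: "'i set \<Rightarrow> ('i \<Rightarrow> ('r, 'a) graded) \<Rightarrow> ('r, 'i \<Rightarrow> 'a) graded"
  where "graded_direct_sum \<Lambda> M d = direct_sum \<Lambda> (\<lambda>\<alpha>. M \<alpha> d)"

definition graded_tensor ::
  "('r, 's) ring_scheme \<Rightarrow> ('r, 'a) graded \<Rightarrow> ('r, 'b) graded \<Rightarrow>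
     ('r, int \<times> int \<Rightarrow> ('a \<times> 'b \<Rightarrow> 'r) set) graded"
  where "graded_tensor R M N d =
    direct_sum {(i, j). i + j = d} (\<lambda>(i, j). tensor R (M i) (N j))"

definition graded_tensor_family ::
  "('r, 's) ring_scheme \<Rightarrow> 'i set \<Rightarrow> ('i \<Rightarrow> ('r, 'a) graded) \<Rightarrow>
     ('r, ('i \<Rightarrow> int) \<Rightarrow> (('i \<Rightarrow> 'a) \<Rightarrow> 'r) set) graded"
  where "graded_tensor_family R I M d =
    direct_sum {e \<in> \<Pi>\<^sub>E k\<in>I. UNIV. (\<Sum>k\<in>I. e k) = d} (\<lambda>e. tensor_family R I (\<lambda>k. M k (e k)))"

text \<open>
  If the \<open>k\<close>-th factor is a direct sum indexed by \<open>\<Lambda> k\<close>, the tensor product of the factors is a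
  direct sum indexed by \<open>f \<in> \<Pi>\<^sub>E k\<in>I. \<Lambda> k\<close>, whose summands are the following.
\<close>

definition indexed_tensor_family ::
  "('r, 's) ring_scheme \<Rightarrow> 'i set \<Rightarrow> ('i \<Rightarrow> 'l \<Rightarrow> ('r, 'a) graded) \<Rightarrow>
     ('i \<Rightarrow> 'l) \<Rightarrow> ('r, ('i \<Rightarrow> int) \<Rightarrow> (('i \<Rightarrow> 'a) \<Rightarrow> 'r) set) graded"
  where "indexed_tensor_family R I M f = graded_tensor_family R I (\<lambda>k. M k (f k))"

definition diagonal_tensor ::
  "('r, 's) ring_scheme \<Rightarrow> 'l set \<Rightarrow> ('l \<Rightarrow> ('r, 'a) graded) \<Rightarrow> ('l \<Rightarrow> ('r, 'b) graded) \<Rightarrow>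
     ('r, 'l \<Rightarrow> int \<times> int \<Rightarrow> ('a \<times> 'b \<Rightarrow> 'r) set) graded"
  where "diagonal_tensor R \<Lambda> M N = graded_direct_sum \<Lambda> (\<lambda>\<alpha>. graded_tensor R (M \<alpha>) (N \<alpha>))"


section \<open>Reduced simplicial homology and cohomology\<close>

definition simplicial_complex :: "'v set \<Rightarrow> 'v set set \<Rightarrow> bool"
  where "simplicial_complex V K \<longleftrightarrow> finite V \<and> K \<subseteq> Pow V \<and> (\<forall>\<sigma>\<in>K. \<forall>\<tau>. \<tau> \<subseteq> \<sigma> \<longrightarrow> \<tau> \<in> K)"

definition simplicial_pair :: "'v set \<Rightarrow> 'v set set \<Rightarrow> 'v set set \<Rightarrow> bool"
  where "simplicial_pair V X A \<longleftrightarrow> simplicial_complex V X \<and> simplicial_complex V A \<and> A \<subseteq> X"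

definition simplices :: "'v set set \<Rightarrow> int \<Rightarrow> 'v set set"
  where "simplices K d = {\<sigma> \<in> K. int (card \<sigma>) = d + 1}"

text \<open>
  Simplices are oriented by the order of their vertices.  As the complexes are finite, both chains
  and cochains of degree \<open>d\<close> are the \<open>R\<close>-valued functions on the \<open>d\<close>-simplices, extended by zero.
\<close>

definition chains :: "('r, 's) ring_scheme \<Rightarrow> 'v set set \<Rightarrow> ('r, 'v set \<Rightarrow> 'r) graded"
  where "chains R K d = free_mod R (simplices K d)"

definition orientation_sign :: "('r, 's) ring_scheme \<Rightarrow> 'v::linorder \<Rightarrow> 'v set \<Rightarrow> 'r"
  where "orientation_sign R v \<sigma> = (\<ominus>\<^bsub>R\<^esub> \<one>\<^bsub>R\<^esub>) [^]\<^bsub>R\<^esub> card {u \<in> \<sigma>. u < v}"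

text \<open>
  \<open>boundary\<close> is the linear extension of \<open>\<sigma> \<mapsto> \<Sum>\<^sub>v\<^sub>\<in>\<^sub>\<sigma> \<plusminus> (\<sigma> - {v})\<close>, written as the coefficient of the
  result at \<open>\<tau>\<close>; \<open>coboundary\<close> is its transpose.
\<close>

definition boundary ::
  "('r, 's) ring_scheme \<Rightarrow> 'v::linorder set set \<Rightarrow> ('v set \<Rightarrow> 'r) \<Rightarrow> 'v set \<Rightarrow> 'r"
  where "boundary R K c \<tau> =
    (\<Oplus>\<^bsub>R\<^esub>v\<in>\<Union>K - \<tau>. orientation_sign R v (insert v \<tau>) \<otimes>\<^bsub>R\<^esub> c (insert v \<tau>))"

definition coboundary ::
  "('r, 's) ring_scheme \<Rightarrow> 'v::linorder set set \<Rightarrow> ('v set \<Rightarrow> 'r) \<Rightarrow> 'v set \<Rightarrow> 'r"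
  where "coboundary R K c \<sigma> =
    (if \<sigma> \<in> K then \<Oplus>\<^bsub>R\<^esub>v\<in>\<sigma>. orientation_sign R v \<sigma> \<otimes>\<^bsub>R\<^esub> c (\<sigma> - {v}) else \<zero>\<^bsub>R\<^esub>)"

definition cycles :: "('r, 's) ring_scheme \<Rightarrow> 'v::linorder set set \<Rightarrow> int \<Rightarrow> ('v set \<Rightarrow> 'r) set"
  where "cycles R K d = {c \<in> carrier (chains R K d). boundary R K c = (\<lambda>_. \<zero>\<^bsub>R\<^esub>)}"

definition boundaries :: "('r, 's) ring_scheme \<Rightarrow> 'v::linorder set set \<Rightarrow> int \<Rightarrow> ('v set \<Rightarrow> 'r) set"
  where "boundaries R K d = boundary R K ` carrier (chains R K (d + 1))"

definition cocycles :: "('r, 's) ring_scheme \<Rightarrow> 'v::linorder set set \<Rightarrow> int \<Rightarrow> ('v set \<Rightarrow> 'r) set"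
  where "cocycles R K d = {c \<in> carrier (chains R K d). coboundary R K c = (\<lambda>_. \<zero>\<^bsub>R\<^esub>)}"

definition coboundaries :: "('r, 's) ring_scheme \<Rightarrow> 'v::linorder set set \<Rightarrow> int \<Rightarrow> ('v set \<Rightarrow> 'r) set"
  where "coboundaries R K d = coboundary R K ` carrier (chains R K (d - 1))"

definition homology ::
  "('r, 's) ring_scheme \<Rightarrow> 'v::linorder set set \<Rightarrow> ('r, ('v set \<Rightarrow> 'r) set) graded"
  where "homology R K d = quot_mod (restrict_mod (chains R K d) (cycles R K d)) (boundaries R K d)"

definition cohomology ::
  "('r, 's) ring_scheme \<Rightarrow> 'v::linorder set set \<Rightarrow> ('r, ('v set \<Rightarrow> 'r) set) graded"
  where "cohomology R K d =
    quot_mod (restrict_mod (chains R K d) (cocycles R K d)) (coboundaries R K d)"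

text \<open>
  The maps induced by an inclusion \<open>A \<subseteq> X\<close>.  A chain of \<open>A\<close> is literally a chain of \<open>X\<close>, and the
  dual of this inclusion restricts a cochain of \<open>X\<close> to the simplices of \<open>A\<close>.
\<close>

definition homology_incl ::
  "('r, 's) ring_scheme \<Rightarrow> 'v::linorder set set \<Rightarrow> 'v set set \<Rightarrow> int \<Rightarrow>
     ('v set \<Rightarrow> 'r) set \<Rightarrow> ('v set \<Rightarrow> 'r) set"
  where "homology_incl R X A d = quot_map (chains R X d) (boundaries R X d) (\<lambda>c. c)"

definition cohomology_incl ::
  "('r, 's) ring_scheme \<Rightarrow> 'v::linorder set set \<Rightarrow> 'v set set \<Rightarrow> int \<Rightarrow>
     ('v set \<Rightarrow> 'r) set \<Rightarrow> ('v set \<Rightarrow> 'r) set"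
  where "cohomology_incl R X A d =
    quot_map (chains R A d) (coboundaries R A d) (\<lambda>c \<sigma>. if \<sigma> \<in> A then c \<sigma> else \<zero>\<^bsub>R\<^esub>)"


section \<open>Polyhedral product complexes\<close>

text \<open>The copy \<open>{s\<^sub>k\<^sub>-\<^sub>1 + 1, \<dots>, s\<^sub>k}\<close> of \<open>[n\<^sub>k]\<close> inside \<open>[n]\<close>, for \<open>k \<ge> 1\<close>.\<close>

definition block :: "(nat \<Rightarrow> nat) \<Rightarrow> nat \<Rightarrow> nat set"
  where "block n k = {(\<Sum>i=1..k - 1. n i) + 1..(\<Sum>i=1..k. n i)}"

definition join_complexes :: "nat \<Rightarrow> (nat \<Rightarrow> nat) \<Rightarrow> (nat \<Rightarrow> nat set set) \<Rightarrow> nat set set"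
  where "join_complexes m n Y =
    {\<sigma>. \<sigma> \<subseteq> {1..\<Sum>i=1..m. n i} \<and> (\<forall>k\<in>{1..m}. \<sigma> \<inter> block n k \<in> Y k)}"

definition polyhedral_product ::
  "nat \<Rightarrow> (nat \<Rightarrow> nat) \<Rightarrow> nat set set \<Rightarrow> (nat \<Rightarrow> nat set set) \<Rightarrow> (nat \<Rightarrow> nat set set) \<Rightarrow> nat set set"
  where "polyhedral_product m n K X A =
    (\<Union>\<tau>\<in>K. join_complexes m n (\<lambda>k. if k \<in> \<tau> then X k else A k))"

definition homology_split ::
  "('r, 's) ring_scheme \<Rightarrow> nat \<Rightarrow> (nat \<Rightarrow> nat set set) \<Rightarrow> (nat \<Rightarrow> nat set set) \<Rightarrow> bool"
  where "homology_split R m X A \<longleftrightarrow> (\<forall>k\<in>{1..m}. \<forall>d.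
    is_free R (ker_mod (homology R (A k) d) (homology R (X k) d) (homology_incl R (X k) (A k) d)) \<and>
    is_free R (coker_mod (homology R (A k) d) (homology R (X k) d) (homology_incl R (X k) (A k) d)) \<and>
    is_free R (im_mod (homology R (A k) d) (homology R (X k) d) (homology_incl R (X k) (A k) d)))"

definition homology_epi ::
  "('r, 's) ring_scheme \<Rightarrow> nat \<Rightarrow> (nat \<Rightarrow> nat set set) \<Rightarrow> (nat \<Rightarrow> nat set set) \<Rightarrow> bool"
  where "homology_epi R m X A \<longleftrightarrow> (\<forall>k\<in>{1..m}. \<forall>d.
    homology_incl R (X k) (A k) d ` carrier (homology R (A k) d) = carrier (homology R (X k) d))"


section \<open>The index sets\<close>

type_synonym index = "nat set \<times> nat set"

definition index_X :: "nat \<Rightarrow> index set"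
  where "index_X m = {(\<sigma>, \<omega>). \<sigma> \<subseteq> {1..m} \<and> \<omega> \<subseteq> {1..m} \<and> \<sigma> \<inter> \<omega> = {}}"

definition index_R :: "nat \<Rightarrow> index set"
  where "index_R m = {({}, \<omega>) | \<omega>. \<omega> \<subseteq> {1..m}}"

text \<open>The identification of \<open>index_X m\<close> and \<open>index_R m\<close> with \<open>m\<close>-fold products.\<close>

definition index_factors :: "nat \<Rightarrow> index \<Rightarrow> nat \<Rightarrow> index"
  where "index_factors m = (\<lambda>(\<sigma>, \<omega>). \<lambda>k\<in>{1..m}.
    (if k \<in> \<sigma> then {1} else {}, if k \<in> \<omega> then {1} else {}))"

lemma index_X_1: "index_X 1 = {({1}, {}), ({}, {1}), ({}, {})}"
  by (auto simp: index_X_def subset_singleton_iff)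

lemma index_R_1: "index_R 1 = {({}, {}), ({}, {1})}"
  by (auto simp: index_R_def subset_singleton_iff)

lemma index_factors_apply:
  "index_factors m \<alpha> k = (if k \<in> {1..m}
     then (if k \<in> fst \<alpha> then {1} else {}, if k \<in> snd \<alpha> then {1} else {}) else undefined)"
  by (cases \<alpha>) (simp add: index_factors_def)

lemma bij_betw_index_factors_X:
  "bij_betw (index_factors m) (index_X m) (\<Pi>\<^sub>E k\<in>{1..m}. index_X 1)"
proof -
  define g where "g = (\<lambda>f::nat \<Rightarrow> index. ({k\<in>{1..m}. 1 \<in> fst (f k)}, {k\<in>{1..m}. 1 \<in> snd (f k)}))"
  show ?thesis
  proof (rule bij_betw_byWitness[where f' = g])
    show "\<forall>\<alpha>\<in>index_X m. g (index_factors m \<alpha>) = \<alpha>"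
    proof
      fix \<alpha> assume "\<alpha> \<in> index_X m"
      then show "g (index_factors m \<alpha>) = \<alpha>"
        by (cases \<alpha>) (auto simp: g_def index_factors_apply index_X_def)
    qed
    show "\<forall>f\<in>\<Pi>\<^sub>E k\<in>{1..m}. index_X 1. index_factors m (g f) = f"
    proof (intro ballI ext)
      fix f :: "nat \<Rightarrow> index" and k assume f: "f \<in> (\<Pi>\<^sub>E k\<in>{1..m}. index_X 1)"
      show "index_factors m (g f) k = f k"
      proof (cases "k \<in> {1..m}")
        case True
        then have "f k = ({1}, {}) \<or> f k = ({}, {1}) \<or> f k = ({}, {})"
          using PiE_mem[OF f True] unfolding index_X_1 by blast
        with True show ?thesis by (elim disjE) (simp_all add: index_factors_apply g_def)
      next
        case False
        show ?thesis unfolding index_factors_apply PiE_arb[OF f False] by (simp only: False if_False)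
      qed
    qed
    show "index_factors m ` index_X m \<subseteq> (\<Pi>\<^sub>E k\<in>{1..m}. index_X 1)"
    proof (intro image_subsetI PiE_I)
      fix \<alpha> k assume "\<alpha> \<in> index_X m" and k: "k \<in> {1..m}"
      then have "\<not> (k \<in> fst \<alpha> \<and> k \<in> snd \<alpha>)" unfolding index_X_def by auto
      with k show "index_factors m \<alpha> k \<in> index_X 1"
        unfolding index_factors_apply index_X_1 by simp
    qed (simp only: index_factors_apply if_False)
    show "g ` (\<Pi>\<^sub>E k\<in>{1..m}. index_X 1) \<subseteq> index_X m"
    proof (intro image_subsetI)
      fix f assume f: "f \<in> (\<Pi>\<^sub>E k\<in>{1..m}. index_X 1)"
      have "\<not> (1 \<in> fst (f k) \<and> 1 \<in> snd (f k))" if "k \<in> {1..m}" for k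
        using PiE_mem[OF f that] unfolding index_X_1 by auto
      then show "g f \<in> index_X m" unfolding index_X_def g_def by blast
    qed
  qed
qed

lemma bij_betw_index_factors_R:
  "bij_betw (index_factors m) (index_R m) (\<Pi>\<^sub>E k\<in>{1..m}. index_R 1)"
proof -
  have "index_factors m ` index_R m = (\<Pi>\<^sub>E k\<in>{1..m}. index_R 1)"
  proof
    show "index_factors m ` index_R m \<subseteq> (\<Pi>\<^sub>E k\<in>{1..m}. index_R 1)"
    proof (intro image_subsetI PiE_I)
      fix \<alpha> k assume "\<alpha> \<in> index_R m" and k: "k \<in> {1..m}"
      then have "fst \<alpha> = {}" unfolding index_R_def by auto
      with k show "index_factors m \<alpha> k \<in> index_R 1"
        unfolding index_factors_apply index_R_1 by simp
    qed (simp only: index_factors_apply if_False)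
    show "(\<Pi>\<^sub>E k\<in>{1..m}. index_R 1) \<subseteq> index_factors m ` index_R m"
    proof
      fix f assume f: "f \<in> (\<Pi>\<^sub>E k\<in>{1..m}. index_R 1)"
      have "f k = index_factors m ({}, {k\<in>{1..m}. 1 \<in> snd (f k)}) k" for k
      proof (cases "k \<in> {1..m}")
        case True
        then have "f k = ({}, {}) \<or> f k = ({}, {1})"
          using PiE_mem[OF f True] unfolding index_R_1 by blast
        with True show ?thesis by (elim disjE) (simp_all add: index_factors_apply)
      next
        case False
        show ?thesis unfolding index_factors_apply PiE_arb[OF f False] by (simp only: False if_False)
      qed
      then have "f = index_factors m ({}, {k\<in>{1..m}. 1 \<in> snd (f k)})" by blast
      moreover have "({}, {k\<in>{1..m}. 1 \<in> snd (f k)}) \<in> index_R m" unfolding index_R_def by blast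
      ultimately show "f \<in> index_factors m ` index_R m" by blast
    qed
  qed
  moreover have "index_R m \<subseteq> index_X m" unfolding index_R_def index_X_def by blast
  ultimately show ?thesis
    using bij_betw_index_factors_X[of m] unfolding bij_betw_def by (metis inj_on_subset)
qed


section \<open>The indexed (co)homology modules\<close>

definition link_restriction :: "nat set set \<Rightarrow> index \<Rightarrow> nat set set"
  where "link_restriction K = (\<lambda>(\<sigma>, \<omega>). {\<tau>. \<tau> \<subseteq> \<omega> \<and> \<sigma> \<union> \<tau> \<in> K})"

definition complex_homology ::
  "('r, 's) ring_scheme \<Rightarrow> nat set set \<Rightarrow> index \<Rightarrow> ('r, (nat set \<Rightarrow> 'r) set) graded"
  where "complex_homology R K \<alpha> = suspension (homology R (link_restriction K \<alpha>))"

definition complex_cohomology ::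
  "('r, 's) ring_scheme \<Rightarrow> nat set set \<Rightarrow> index \<Rightarrow> ('r, (nat set \<Rightarrow> 'r) set) graded"
  where "complex_cohomology R K \<alpha> = suspension (cohomology R (link_restriction K \<alpha>))"

text \<open>Elements of kernels and images are tagged with \<open>Inl\<close>, elements of cokernels with \<open>Inr\<close>.\<close>

type_synonym 'r pair_element = "(nat set \<Rightarrow> 'r) set + (nat set \<Rightarrow> 'r) set set"

definition homology_ker ::
  "('r, 's) ring_scheme \<Rightarrow> nat set set \<Rightarrow> nat set set \<Rightarrow> ('r, 'r pair_element) graded"
  where "homology_ker R X A d = transport_mod Inl projl
    (ker_mod (homology R A d) (homology R X d) (homology_incl R X A d))"

definition homology_im ::
  "('r, 's) ring_scheme \<Rightarrow> nat set set \<Rightarrow> nat set set \<Rightarrow> ('r, 'r pair_element) graded"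
  where "homology_im R X A d = transport_mod Inl projl
    (im_mod (homology R A d) (homology R X d) (homology_incl R X A d))"

definition homology_coker ::
  "('r, 's) ring_scheme \<Rightarrow> nat set set \<Rightarrow> nat set set \<Rightarrow> ('r, 'r pair_element) graded"
  where "homology_coker R X A d = transport_mod Inr projr
    (coker_mod (homology R A d) (homology R X d) (homology_incl R X A d))"

definition cohomology_ker ::
  "('r, 's) ring_scheme \<Rightarrow> nat set set \<Rightarrow> nat set set \<Rightarrow> ('r, 'r pair_element) graded"
  where "cohomology_ker R X A d = transport_mod Inl projl
    (ker_mod (cohomology R X d) (cohomology R A d) (cohomology_incl R X A d))"

definition cohomology_im ::
  "('r, 's) ring_scheme \<Rightarrow> nat set set \<Rightarrow> nat set set \<Rightarrow> ('r, 'r pair_element) graded"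
  where "cohomology_im R X A d = transport_mod Inl projl
    (im_mod (cohomology R X d) (cohomology R A d) (cohomology_incl R X A d))"

definition cohomology_coker ::
  "('r, 's) ring_scheme \<Rightarrow> nat set set \<Rightarrow> nat set set \<Rightarrow> ('r, 'r pair_element) graded"
  where "cohomology_coker R X A d = transport_mod Inr projr
    (coker_mod (cohomology R X d) (cohomology R A d) (cohomology_incl R X A d))"

text \<open>The summands of the (co)homology of one simplicial pair, indexed by \<open>index_X 1\<close>.\<close>

definition pair_homology ::
  "('r, 's) ring_scheme \<Rightarrow> nat set set \<Rightarrow> nat set set \<Rightarrow> index \<Rightarrow> ('r, 'r pair_element) graded"
  where "pair_homology R X A \<alpha> = suspension
    (if \<alpha> = ({1}, {}) then homology_coker R X A
     else if \<alpha> = ({}, {1}) then homology_ker R X A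
     else homology_im R X A)"

definition pair_cohomology ::
  "('r, 's) ring_scheme \<Rightarrow> nat set set \<Rightarrow> nat set set \<Rightarrow> index \<Rightarrow> ('r, 'r pair_element) graded"
  where "pair_cohomology R X A \<alpha> = suspension
    (if \<alpha> = ({1}, {}) then cohomology_ker R X A
     else if \<alpha> = ({}, {1}) then cohomology_coker R X A
     else cohomology_im R X A)"

text \<open>The summands of the (co)homology of a sequence of \<open>m\<close> pairs, indexed by \<open>index_X m\<close>.\<close>

definition pairs_homology ::
  "('r, 's) ring_scheme \<Rightarrow> nat \<Rightarrow> (nat \<Rightarrow> nat set set) \<Rightarrow> (nat \<Rightarrow> nat set set) \<Rightarrow> index \<Rightarrow>
     ('r, (nat \<Rightarrow> int) \<Rightarrow> ((nat \<Rightarrow> 'r pair_element) \<Rightarrow> 'r) set) graded"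
  where "pairs_homology R m X A = (\<lambda>(\<sigma>, \<omega>). graded_tensor_family R {1..m} (\<lambda>k. suspension
    (if k \<in> \<sigma> then homology_coker R (X k) (A k)
     else if k \<in> \<omega> then homology_ker R (X k) (A k)
     else homology_im R (X k) (A k))))"

definition pairs_cohomology ::
  "('r, 's) ring_scheme \<Rightarrow> nat \<Rightarrow> (nat \<Rightarrow> nat set set) \<Rightarrow> (nat \<Rightarrow> nat set set) \<Rightarrow> index \<Rightarrow>
     ('r, (nat \<Rightarrow> int) \<Rightarrow> ((nat \<Rightarrow> 'r pair_element) \<Rightarrow> 'r) set) graded"
  where "pairs_cohomology R m X A = (\<lambda>(\<sigma>, \<omega>). graded_tensor_family R {1..m} (\<lambda>k. suspension
    (if k \<in> \<sigma> then cohomology_ker R (X k) (A k)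
     else if k \<in> \<omega> then cohomology_coker R (X k) (A k)
     else cohomology_im R (X k) (A k))))"


section \<open>The two conclusions, for coefficients in a ring\<close>

text \<open>\<open>\<Lambda>\<close> is one of the index sets \<open>index_X m\<close> and \<open>index_R m\<close>.\<close>

definition homology_decomposition ::
  "('r, 's) ring_scheme \<Rightarrow> index set \<Rightarrow> nat \<Rightarrow> (nat \<Rightarrow> nat) \<Rightarrow> nat set set \<Rightarrow>
     (nat \<Rightarrow> nat set set) \<Rightarrow> (nat \<Rightarrow> nat set set) \<Rightarrow> bool"
  where "homology_decomposition R \<Lambda> m n K X A \<longleftrightarrow>
    graded_isomorphic R (suspension (homology R (polyhedral_product m n K X A)))
      (diagonal_tensor R \<Lambda> (complex_homology R K) (pairs_homology R m X A)) \<and>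
    diagonal_tensor R \<Lambda> (complex_homology R K) (pairs_homology R m X A) =
      diagonal_tensor R \<Lambda> (complex_homology R K)
        (\<lambda>\<alpha>. indexed_tensor_family R {1..m} (\<lambda>k. pair_homology R (X k) (A k)) (index_factors m \<alpha>))"

definition cohomology_decomposition ::
  "('r, 's) ring_scheme \<Rightarrow> index set \<Rightarrow> nat \<Rightarrow> (nat \<Rightarrow> nat) \<Rightarrow> nat set set \<Rightarrow>
     (nat \<Rightarrow> nat set set) \<Rightarrow> (nat \<Rightarrow> nat set set) \<Rightarrow> bool"
  where "cohomology_decomposition R \<Lambda> m n K X A \<longleftrightarrow>
    graded_isomorphic R (suspension (cohomology R (polyhedral_product m n K X A)))
      (diagonal_tensor R \<Lambda> (complex_cohomology R K) (pairs_cohomology R m X A)) \<and>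
    diagonal_tensor R \<Lambda> (complex_cohomology R K) (pairs_cohomology R m X A) =
      diagonal_tensor R \<Lambda> (complex_cohomology R K)
        (\<lambda>\<alpha>. indexed_tensor_family R {1..m} (\<lambda>k. pair_cohomology R (X k) (A k)) (index_factors m \<alpha>))"

text \<open>
  The identification of the sum of the two summands indexed by \<open>index_R 1\<close>, \<open>ker \<iota>\<close> and \<open>im \<iota>\<close>, with
  the homology of \<open>A\<close>: the isomorphism \<open>\<phi>\<close> is the inclusion on \<open>ker \<iota>\<close>, and the identification of
  coimage and image, that is \<open>\<iota>\<close>, takes \<open>\<phi> w\<close> to the image component of \<open>w\<close>.
\<close>

definition pair_homology_R_identification ::
  "('r, 's) ring_scheme \<Rightarrow> nat set set \<Rightarrow> nat set set \<Rightarrow> bool"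
  where "pair_homology_R_identification R X A \<longleftrightarrow> (\<forall>d.
    \<exists>\<phi> \<in> mod_iso R (graded_direct_sum (index_R 1) (pair_homology R X A) d)
                   (suspension (homology R A) d).
      \<forall>w \<in> carrier (graded_direct_sum (index_R 1) (pair_homology R X A) d).
        homology_incl R X A (d - 1) (\<phi> w) = projl (w ({}, {})) \<and>
        (w ({}, {}) = \<zero>\<^bsub>pair_homology R X A ({}, {}) d\<^esub> \<longrightarrow> \<phi> w = projl (w ({}, {1}))))"

end

theory Submission
imports Defs
begin

text \<open>
The idea is to choose, for every pair of complexes \<open>(X\<^sub>k, A\<^sub>k)\<close>, a basis of the chains of \<open>X\<^sub>k\<close> in
which everything becomes combinatorial.  If the kernel, the image and the cokernel of
\<open>\<iota>\<^sub>k\<close> are free, then over a principal ideal domain one can choose homogeneous bases of all groups of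
boundaries and cycles step by step, so that a part \<open>BA\<close> of the basis \<open>B\<close> spans the chains of \<open>A\<^sub>k\<close> and the
differential is a partial matching \<open>G\<close>: every basis element is sent to another one or to zero, and no
two to the same one (\<open>adapted_basis\<close>).  The unmatched elements outside \<open>BA\<close> then represent the cokernel
of \<open>\<iota>\<^sub>k\<close>, those inside \<open>BA\<close> its image, and the elements of \<open>BA\<close> that are matched in \<open>B\<close> but not in \<open>BA\<close>
represent its kernel (\<open>pair_homology_parts\<close>, \<open>pair_cohomology_parts\<close>).

The chain complex of the polyhedral product is the subcomplex of the tensor product of the chain
complexes of the \<open>X\<^sub>k\<close> that is spanned by the tuples of simplices whose set of positions outside
the \<open>A\<^sub>k\<close> lies in \<open>K\<close>.  The products of the adapted bases form a basis of this
subcomplex, described by the same condition with \<open>B\<close> and \<open>BA\<close> (\<open>tensor_base_change\<close>).  In this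
basis the differential changes one entry along an arrow of a matching, so the complex splits into blocks, one for
each tuple \<open>t\<close> of basis elements that are not targets of arrows; a generator of the block is given by the set of positions
at which an arrow has been applied.  Up to signs the block is the simplicial chain complex of a
simplicial complex on these positions.  This complex is a cone, unless \<open>t\<close> consists of
representatives of cokernels, images and kernels, and then it is \<open>K\<^sub>\<sigma>\<^sub>,\<^sub>\<omega>\<close>, where \<open>\<sigma>\<close> and \<open>\<omega>\<close> are the positions of the
representatives of cokernels and kernels (\<open>matching_tensor_homology\<close>).  Summing over all \<open>t\<close> gives the left side as
a direct sum of shifted copies of the homology of the \<open>K\<^sub>\<sigma>\<^sub>,\<^sub>\<omega>\<close> (\<open>polyhedral_product_homology\<close>).

On the right side the homology of the pairs is free on the same representatives; tensor products of
free modules are free on the products of the bases, and a tensor product with a free module is a direct sum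
of copies.  So the diagonal tensor product is the same direct sum (\<open>diagonal_tensor_core\<close>).
Cohomology is treated with the same bases: all complexes are given by matrices, and cohomology is the homology
of the transposed matrices with negated degrees.

If \<open>\<iota>\<^sub>k\<close> is onto, there are no representatives of cokernels, so only the indices with
\<open>\<sigma> = {}\<close> occur; and a splitting of the map onto the free module \<open>im \<iota>\<^sub>k\<close> identifies \<open>ker \<iota>\<^sub>k \<oplus> im \<iota>\<^sub>k\<close> with the homology of
\<open>A\<^sub>k\<close> (\<open>pair_identification\<close>).  The ring \<open>\<Z>\<close> and all fields are principal ideal domains,
and over a field the freeness assumption holds, since finitely generated modules are free (\<open>vector_space_rank\<close>).
\<close>

section \<open>Homomorphisms, submodules and quotients\<close>

lemma mod_homI:
assumes "!!x. x \<in> carrier M ==> h x \<in> carrier N"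
 and "!!x y. x \<in> carrier M ==> y \<in> carrier M ==> h (x \<oplus>\<^bsub>M\<^esub> y) = h x \<oplus>\<^bsub>N\<^esub> h y"
 and "!!r x. r \<in> carrier R ==> x \<in> carrier M ==> h (r \<odot>\<^bsub>M\<^esub> x) = r \<odot>\<^bsub>N\<^esub> h x"
shows "h \<in> mod_hom R M N"
using assms by (auto simp: mod_hom_def)

lemma mod_hom_closed: "h \<in> mod_hom R M N ==> x \<in> carrier M ==> h x \<in> carrier N"
by (auto simp: mod_hom_def)

lemma mod_hom_add:
"h \<in> mod_hom R M N ==> x \<in> carrier M ==> y \<in> carrier M ==> h (x \<oplus>\<^bsub>M\<^esub> y) = h x \<oplus>\<^bsub>N\<^esub> h y"
by (auto simp: mod_hom_def)

lemma mod_hom_smult: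
"h \<in> mod_hom R M N ==> r \<in> carrier R ==> x \<in> carrier M ==> h (r \<odot>\<^bsub>M\<^esub> x) = r \<odot>\<^bsub>N\<^esub> h x"
by (auto simp: mod_hom_def)

lemma mod_hom_zero:
assumes "module R M" "module R N" "h \<in> mod_hom R M N"
shows "h \<zero>\<^bsub>M\<^esub> = \<zero>\<^bsub>N\<^esub>"
proof -
interpret M: module R M by fact
interpret N: module R N by fact
have "h (\<zero>\<^bsub>R\<^esub> \<odot>\<^bsub>M\<^esub> \<zero>\<^bsub>M\<^esub>) = \<zero>\<^bsub>R\<^esub> \<odot>\<^bsub>N\<^esub> h \<zero>\<^bsub>M\<^esub>"
 using assms(3) by (intro mod_hom_smult) auto
then show ?thesis using mod_hom_closed[OF assms(3) M.zero_closed] by simp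
qed

lemma (in module) neg_as_smult: "x \<in> carrier M ==> \<ominus>\<^bsub>M\<^esub> x = (\<ominus> \<one>) \<odot>\<^bsub>M\<^esub> x"
by (simp add: smult_l_minus)

lemma (in abelian_group) diff_eq_zero_iff:
assumes "x \<in> carrier G" "y \<in> carrier G"
shows "x \<ominus> y = \<zero> \<longleftrightarrow> x = y"
proof
assume "x \<ominus> y = \<zero>"
then have "(x \<oplus> \<ominus> y) \<oplus> y = y" using assms by (simp add: a_minus_def)
then show "x = y" using assms by (simp add: a_assoc l_neg)
qed (use assms in \<open>simp add: a_minus_def r_neg\<close>)

lemma mod_hom_neg:
assumes "module R M" "module R N" "h \<in> mod_hom R M N" "x \<in> carrier M"
shows "h (\<ominus>\<^bsub>M\<^esub> x) = \<ominus>\<^bsub>N\<^esub> h x"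
proof -
interpret M: module R M by fact
interpret N: module R N by fact
show ?thesis using assms(3,4) mod_hom_closed[OF assms(3,4)]
 by (simp add: M.neg_as_smult N.neg_as_smult mod_hom_smult del: M.smult_l_minus N.smult_l_minus)
qed

lemma mod_hom_diff:
assumes "module R M" "module R N" "h \<in> mod_hom R M N" "x \<in> carrier M" "y \<in> carrier M"
shows "h (x \<ominus>\<^bsub>M\<^esub> y) = h x \<ominus>\<^bsub>N\<^esub> h y"
proof -
interpret M: module R M by fact
interpret N: module R N by fact
show ?thesis using assms by (simp add: a_minus_def mod_hom_add mod_hom_neg)
qed

lemma mod_hom_compose:
"f \<in> mod_hom R M N ==> g \<in> mod_hom R N L ==> (%x. g (f x)) \<in> mod_hom R M L"
by (auto simp: mod_hom_def Pi_def)

lemma mod_hom_finsum: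
assumes "module R M" "module R N" "h \<in> mod_hom R M N" "finite I" "a \<in> I \<rightarrow> carrier M"
shows "h (\<Oplus>\<^bsub>M\<^esub>i\<in>I. a i) = (\<Oplus>\<^bsub>N\<^esub>i\<in>I. h (a i))"
proof -
interpret M: module R M by fact
interpret N: module R N by fact
show ?thesis using assms(4,5)
proof (induction I rule: finite_induct)
 case empty then show ?case using mod_hom_zero[OF assms(1-3)] by simp
next
 case (insert i I)
 then have "a \<in> I \<rightarrow> carrier M" "a i \<in> carrier M" by auto
 with insert show ?case
 using assms(3) by (simp add: mod_hom_add mod_hom_closed Pi_def)
qed
qed

lemma submodule_criterion:
assumes "module R M" "N <= carrier M" "\<zero>\<^bsub>M\<^esub> \<in> N"
 and "!!x y. x \<in> N ==> y \<in> N ==> x \<oplus>\<^bsub>M\<^esub> y \<in> N"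
 and "!!r x. r \<in> carrier R ==> x \<in> N ==> r \<odot>\<^bsub>M\<^esub> x \<in> N"
shows "submodule N R M"
proof -
interpret M: module R M by fact
have "\<ominus>\<^bsub>M\<^esub> x \<in> N" if "x \<in> N" for x
 using M.neg_as_smult[of x] that assms(2,5) by (auto simp: subset_iff)
then show ?thesis using assms by (intro M.submoduleI) auto
qed

lemma submodule_zero_mem: "submodule N R M ==> \<zero>\<^bsub>M\<^esub> \<in> N"
using subgroup.one_closed[of N "add_monoid M"] by (auto simp: submodule_def)

lemma submodule_add_mem: "submodule N R M ==> x \<in> N ==> y \<in> N ==> x \<oplus>\<^bsub>M\<^esub> y \<in> N"
using subgroup.m_closed[of N "add_monoid M"] by (auto simp: submodule_def)

lemma submodule_smult_mem:
"submodule N R M ==> r \<in> carrier R ==> x \<in> N ==> r \<odot>\<^bsub>M\<^esub> x \<in> N"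
by (rule submodule.smult_closed)

lemma submodule_subset: "submodule N R M ==> N <= carrier M"
using subgroup.subset[of N "add_monoid M"] by (auto simp: submodule_def)

lemma submodule_self: "module R M ==> submodule (carrier M) R M"
by (rule module.carrier_is_submodule)

lemma submodule_vimage:
assumes "module R M" "module R N" "h \<in> mod_hom R M N" "submodule L R N"
shows "submodule {x \<in> carrier M. h x \<in> L} R M"
proof -
interpret M: module R M by fact
show ?thesis
 using assms mod_hom_zero[OF assms(1-3)] submodule_zero_mem[OF assms(4)]
 by (intro submodule_criterion)
  (auto simp: mod_hom_add mod_hom_smult submodule_add_mem submodule_smult_mem)
qed

lemma submodule_trivial: "module R N ==> submodule {\<zero>\<^bsub>N\<^esub>} R N"
proof -
assume N: "module R N"
interpret N: module R N by fact
show ?thesis by (intro submodule_criterion N) auto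
qed

lemma submodule_kernel:
assumes "module R M" "module R N" "h \<in> mod_hom R M N"
shows "submodule {x \<in> carrier M. h x = \<zero>\<^bsub>N\<^esub>} R M"
using submodule_vimage[OF assms submodule_trivial[OF assms(2)]] by simp

lemma submodule_image:
assumes "module R M" "module R N" "h \<in> mod_hom R M N" "submodule L R M"
shows "submodule (h ` L) R N"
proof (intro submodule_criterion assms(2))
have L: "L <= carrier M" using assms(4) by (rule submodule_subset)
show "h ` L <= carrier N" using L assms(3) by (auto intro: mod_hom_closed)
show "\<zero>\<^bsub>N\<^esub> \<in> h ` L"
 using mod_hom_zero[OF assms(1-3)] submodule_zero_mem[OF assms(4)] by (metis image_eqI)
show "x \<oplus>\<^bsub>N\<^esub> y \<in> h ` L" if xy: "x \<in> h ` L" "y \<in> h ` L" for x y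
proof -
 obtain a b where ab: "x = h a" "y = h b" "a \<in> L" "b \<in> L" using xy by blast
 then have "h (a \<oplus>\<^bsub>M\<^esub> b) = x \<oplus>\<^bsub>N\<^esub> y" using L mod_hom_add[OF assms(3)] by blast
 with ab show ?thesis using assms(4) by (metis image_eqI submodule_add_mem)
qed
show "r \<odot>\<^bsub>N\<^esub> x \<in> h ` L" if rx: "r \<in> carrier R" "x \<in> h ` L" for r x
proof -
 obtain a where ab: "x = h a" "a \<in> L" using rx by blast
 then have "h (r \<odot>\<^bsub>M\<^esub> a) = r \<odot>\<^bsub>N\<^esub> x" using rx L mod_hom_smult[OF assms(3)] by blast
 with ab rx show ?thesis using assms(4) by (metis image_eqI submodule_smult_mem)
qed
qed

lemma submodule_equalizer:
assumes "module R M" "module R N" "f \<in> mod_hom R M N" "g \<in> mod_hom R M N"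
shows "submodule {x \<in> carrier M. f x = g x} R M"
proof -
interpret M: module R M by fact
show ?thesis using assms mod_hom_zero[OF assms(1-3)] mod_hom_zero[OF assms(1,2,4)]
 by (intro submodule_criterion) (auto simp: mod_hom_add mod_hom_smult)
qed

lemma restrict_mod_simps [simp]:
"carrier (restrict_mod M N) = N" "add (restrict_mod M N) = add M"
"zero (restrict_mod M N) = zero M" "smult (restrict_mod M N) = smult M"
by (simp_all add: restrict_mod_def)

lemma restrict_mod_module: "module R M ==> submodule N R M ==> module R (restrict_mod M N)"
unfolding restrict_mod_def by (rule submodule.submodule_is_module)

lemma submodule_restrict:
assumes "module R M" "submodule N R M" "submodule L R M" "N <= L"
shows "submodule N R (restrict_mod M L)"
by (intro submodule_criterion restrict_mod_module[OF assms(1,3)])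
 (use assms in \<open>auto simp: submodule_zero_mem submodule_add_mem submodule_smult_mem\<close>)

lemma submodule_of_restrict:
assumes "module R M" "submodule L R M" "submodule N R (restrict_mod M L)"
shows "submodule N R M"
using assms submodule_subset[OF assms(2)] submodule_subset[OF assms(3)]
 submodule_zero_mem[OF assms(3)] submodule_add_mem[OF assms(3)] submodule_smult_mem[OF assms(3)]
by (intro submodule_criterion) auto

text \<open>Only the addition enters a coset, so that cosets are insensitive to the ambient carrier.\<close>

lemma coset_cong: "add M = add N ==> H +>\<^bsub>M\<^esub> x = H +>\<^bsub>N\<^esub> x"
by (simp add: a_r_coset_def')

lemma quot_mod_zero [simp]: "\<zero>\<^bsub>quot_mod M N\<^esub> = N"
by (simp add: quot_mod_def)

lemma quot_mod_carrier: "carrier (quot_mod M N) = {N +>\<^bsub>M\<^esub> x | x. x \<in> carrier M}"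
by (auto simp: quot_mod_def A_RCOSETS_def')

lemma coset_mem_quot_mod: "x \<in> carrier M ==> N +>\<^bsub>M\<^esub> x \<in> carrier (quot_mod M N)"
by (auto simp: quot_mod_carrier)

lemma submodule_abelian_subgroup:
assumes "module R M" "submodule N R M" shows "abelian_subgroup N M"
proof -
interpret M: module R M by fact
show ?thesis
 using assms(2) M.abelian_group_axioms
 by (intro abelian_subgroupI3) (auto simp: additive_subgroup_def submodule_def)
qed

context
fixes R :: "('r, 's) ring_scheme" and M :: "('r, 'a) module" and N :: "'a set"
assumes M: "module R M" and N: "submodule N R M"
begin

interpretation M: module R M by (rule M)
interpretation N: abelian_subgroup N M by (rule submodule_abelian_subgroup[OF M N])

lemma coset_eq_iff:
assumes "x \<in> carrier M" "y \<in> carrier M"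
shows "N +>\<^bsub>M\<^esub> x = N +>\<^bsub>M\<^esub> y \<longleftrightarrow> x \<ominus>\<^bsub>M\<^esub> y \<in> N"
proof
assume "N +>\<^bsub>M\<^esub> x = N +>\<^bsub>M\<^esub> y"
then have "x \<in> N +>\<^bsub>M\<^esub> y" using N.a_rcos_self[OF assms(1)] by simp
then show "x \<ominus>\<^bsub>M\<^esub> y \<in> N" using N.a_rcos_module_imp[OF assms(2)] by (simp add: a_minus_def)
next
assume "x \<ominus>\<^bsub>M\<^esub> y \<in> N"
then have "x \<in> N +>\<^bsub>M\<^esub> y" using assms by (simp add: N.a_rcos_module a_minus_def)
then show "N +>\<^bsub>M\<^esub> x = N +>\<^bsub>M\<^esub> y" using N.a_repr_independence' assms(2) by blast
qed

lemma coset_self_mem: "x \<in> carrier M ==> x \<in> N +>\<^bsub>M\<^esub> x"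
by (rule N.a_rcos_self)

lemma coset_subset: "x \<in> carrier M ==> N +>\<^bsub>M\<^esub> x <= carrier M"
using M.a_r_coset_subset_G submodule_subset[OF N] by blast

lemma coset_mem_eq: "x \<in> carrier M ==> z \<in> N +>\<^bsub>M\<^esub> x ==> N +>\<^bsub>M\<^esub> z = N +>\<^bsub>M\<^esub> x"
using N.a_repr_independence' by blast

lemma coset_eq_zero_iff:
assumes "x \<in> carrier M" shows "N +>\<^bsub>M\<^esub> x = N \<longleftrightarrow> x \<in> N"
using coset_eq_iff[OF assms M.zero_closed] assms M.a_coset_add_zero[OF submodule_subset[OF N]]
 M.minus_equality[of "\<zero>\<^bsub>M\<^esub>" "\<zero>\<^bsub>M\<^esub>"]
by (simp add: a_minus_def)

lemma quot_mod_add: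
"x \<in> carrier M ==> y \<in> carrier M ==>
 (N +>\<^bsub>M\<^esub> x) \<oplus>\<^bsub>quot_mod M N\<^esub> (N +>\<^bsub>M\<^esub> y) = N +>\<^bsub>M\<^esub> (x \<oplus>\<^bsub>M\<^esub> y)"
by (simp add: quot_mod_def N.a_rcos_sum)

lemma quot_mod_smult:
assumes "r \<in> carrier R" "x \<in> carrier M"
shows "r \<odot>\<^bsub>quot_mod M N\<^esub> (N +>\<^bsub>M\<^esub> x) = N +>\<^bsub>M\<^esub> (r \<odot>\<^bsub>M\<^esub> x)"
proof -
have "N +>\<^bsub>M\<^esub> (r \<odot>\<^bsub>M\<^esub> z) = N +>\<^bsub>M\<^esub> (r \<odot>\<^bsub>M\<^esub> x)" if z: "z \<in> N +>\<^bsub>M\<^esub> x" for z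
proof -
 have zc: "z \<in> carrier M" using z coset_subset assms by blast
 then have "z \<ominus>\<^bsub>M\<^esub> x \<in> N" using coset_mem_eq[OF assms(2) z] coset_eq_iff assms(2) by blast
 then have "r \<odot>\<^bsub>M\<^esub> (z \<ominus>\<^bsub>M\<^esub> x) \<in> N" using submodule_smult_mem[OF N] assms by blast
 moreover have "r \<odot>\<^bsub>M\<^esub> (z \<ominus>\<^bsub>M\<^esub> x) = r \<odot>\<^bsub>M\<^esub> z \<ominus>\<^bsub>M\<^esub> r \<odot>\<^bsub>M\<^esub> x"
 using assms zc by (simp add: a_minus_def M.smult_r_distr M.smult_r_minus)
 ultimately show ?thesis using coset_eq_iff assms zc by simp
qed
then have "(\<Union>z\<in>N +>\<^bsub>M\<^esub> x. N +>\<^bsub>M\<^esub> (r \<odot>\<^bsub>M\<^esub> z)) = N +>\<^bsub>M\<^esub> (r \<odot>\<^bsub>M\<^esub> x)"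
 by (intro UN_constant_eq[OF coset_self_mem[OF assms(2)]]) blast
then show ?thesis by (simp add: quot_mod_def)
qed

lemma quot_mod_module: "module R (quot_mod M N)"
proof -
let ?Q = "quot_mod M N"
have N0: "N +>\<^bsub>M\<^esub> \<zero>\<^bsub>M\<^esub> = N" using M.a_coset_add_zero[OF submodule_subset[OF N]] by simp
show ?thesis
proof (rule moduleI)
 show "cring R" by (rule M.R.is_cring)
 show "abelian_group ?Q"
 proof (rule abelian_groupI)
 fix x y z assume "x \<in> carrier ?Q" "y \<in> carrier ?Q" "z \<in> carrier ?Q"
 then obtain a b c where "x = N +>\<^bsub>M\<^esub> a" "y = N +>\<^bsub>M\<^esub> b" "z = N +>\<^bsub>M\<^esub> c"
  "a \<in> carrier M" "b \<in> carrier M" "c \<in> carrier M" by (auto simp: quot_mod_carrier)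
 then show "x \<oplus>\<^bsub>?Q\<^esub> y \<oplus>\<^bsub>?Q\<^esub> z = x \<oplus>\<^bsub>?Q\<^esub> (y \<oplus>\<^bsub>?Q\<^esub> z)"
  by (simp add: quot_mod_add M.a_assoc)
 next
 fix x y assume "x \<in> carrier ?Q" "y \<in> carrier ?Q"
 then obtain a b where ab: "x = N +>\<^bsub>M\<^esub> a" "y = N +>\<^bsub>M\<^esub> b"
  "a \<in> carrier M" "b \<in> carrier M" by (auto simp: quot_mod_carrier)
 then show "x \<oplus>\<^bsub>?Q\<^esub> y = y \<oplus>\<^bsub>?Q\<^esub> x" by (simp add: quot_mod_add M.a_comm)
 from ab show "x \<oplus>\<^bsub>?Q\<^esub> y \<in> carrier ?Q" by (simp add: quot_mod_add coset_mem_quot_mod)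
 next
 show "\<zero>\<^bsub>?Q\<^esub> \<in> carrier ?Q" using coset_mem_quot_mod[of "\<zero>\<^bsub>M\<^esub>" M N] N0 by simp
 next
 fix x assume "x \<in> carrier ?Q"
 then obtain a where a: "x = N +>\<^bsub>M\<^esub> a" "a \<in> carrier M" by (auto simp: quot_mod_carrier)
 then show "\<zero>\<^bsub>?Q\<^esub> \<oplus>\<^bsub>?Q\<^esub> x = x"
  using quot_mod_add[of "\<zero>\<^bsub>M\<^esub>" a] N0 by simp
 from a show "EX y:carrier ?Q. y \<oplus>\<^bsub>?Q\<^esub> x = \<zero>\<^bsub>?Q\<^esub>"
  using N0 by (intro bexI[of _ "N +>\<^bsub>M\<^esub> (\<ominus>\<^bsub>M\<^esub> a)"])
  (auto simp: quot_mod_add M.l_neg coset_mem_quot_mod)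
 qed
next
 fix a b x assume "a \<in> carrier R" "b \<in> carrier R" "x \<in> carrier ?Q"
 moreover then obtain u where "x = N +>\<^bsub>M\<^esub> u" "u \<in> carrier M" by (auto simp: quot_mod_carrier)
 ultimately show "(a \<oplus>\<^bsub>R\<^esub> b) \<odot>\<^bsub>?Q\<^esub> x = a \<odot>\<^bsub>?Q\<^esub> x \<oplus>\<^bsub>?Q\<^esub> b \<odot>\<^bsub>?Q\<^esub> x"
 and "(a \<otimes>\<^bsub>R\<^esub> b) \<odot>\<^bsub>?Q\<^esub> x = a \<odot>\<^bsub>?Q\<^esub> (b \<odot>\<^bsub>?Q\<^esub> x)"
 by (simp_all add: quot_mod_smult quot_mod_add M.smult_l_distr M.smult_assoc1)
next
 fix a x y assume "a \<in> carrier R" "x \<in> carrier ?Q" "y \<in> carrier ?Q"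
 moreover then obtain u v where "x = N +>\<^bsub>M\<^esub> u" "u \<in> carrier M" "y = N +>\<^bsub>M\<^esub> v" "v \<in> carrier M"
 by (auto simp: quot_mod_carrier)
 ultimately show "a \<odot>\<^bsub>?Q\<^esub> (x \<oplus>\<^bsub>?Q\<^esub> y) = a \<odot>\<^bsub>?Q\<^esub> x \<oplus>\<^bsub>?Q\<^esub> a \<odot>\<^bsub>?Q\<^esub> y"
 by (simp add: quot_mod_smult quot_mod_add M.smult_r_distr)
next
 fix a x assume "a \<in> carrier R" "x \<in> carrier ?Q"
 moreover then obtain u where "x = N +>\<^bsub>M\<^esub> u" "u \<in> carrier M" by (auto simp: quot_mod_carrier)
 ultimately show "a \<odot>\<^bsub>?Q\<^esub> x \<in> carrier ?Q" by (simp add: quot_mod_smult coset_mem_quot_mod)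
next
 fix x assume "x \<in> carrier ?Q"
 then obtain u where "x = N +>\<^bsub>M\<^esub> u" "u \<in> carrier M" by (auto simp: quot_mod_carrier)
 then show "\<one>\<^bsub>R\<^esub> \<odot>\<^bsub>?Q\<^esub> x = x" by (simp add: quot_mod_smult)
qed
qed

lemma coset_mod_hom: "(%x. N +>\<^bsub>M\<^esub> x) \<in> mod_hom R M (quot_mod M N)"
by (intro mod_homI) (simp_all add: coset_mem_quot_mod quot_mod_add quot_mod_smult)

end

definition quot_lift :: "('a => 'b) => 'a set => 'b"
where "quot_lift f Z = f (SOME z. z \<in> Z)"

lemma quot_lift_coset:
assumes M: "module R M" and N: "submodule N R M" and G: "module R G" and f: "f \<in> mod_hom R M G"
 and zero: "!!x. x \<in> N ==> f x = \<zero>\<^bsub>G\<^esub>" and x: "x \<in> carrier M"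
shows "quot_lift f (N +>\<^bsub>M\<^esub> x) = f x"
proof -
interpret M: module R M by fact
interpret G: module R G by fact
let ?z = "SOME z. z \<in> N +>\<^bsub>M\<^esub> x"
have z: "?z \<in> N +>\<^bsub>M\<^esub> x" using coset_self_mem[OF M N x] by (rule someI)
have zc: "?z \<in> carrier M" using z coset_subset[OF M N x] by blast
have "?z \<ominus>\<^bsub>M\<^esub> x \<in> N" using coset_eq_iff[OF M N zc x] coset_mem_eq[OF M N x z] by blast
then have "f ?z \<ominus>\<^bsub>G\<^esub> f x = \<zero>\<^bsub>G\<^esub>" using zero mod_hom_diff[OF M G f zc x] by metis
then show ?thesis using mod_hom_closed[OF f] zc x by (simp add: quot_lift_def G.diff_eq_zero_iff)
qed

lemma quot_lift_hom:
assumes M: "module R M" and N: "submodule N R M" and G: "module R G" and f: "f \<in> mod_hom R M G"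
 and zero: "!!x. x \<in> N ==> f x = \<zero>\<^bsub>G\<^esub>"
shows "quot_lift f \<in> mod_hom R (quot_mod M N) G"
proof -
interpret M: module R M by fact
note * = quot_lift_coset[OF M N G f zero]
show ?thesis
 by (intro mod_homI)
 (auto simp: quot_mod_carrier quot_mod_add[OF M N] quot_mod_smult[OF M N] *
  mod_hom_closed[OF f] mod_hom_add[OF f] mod_hom_smult[OF f])
qed

text \<open>The first isomorphism theorem.\<close>

lemma quot_lift_iso:
assumes M: "module R M" and N: "submodule N R M" and G: "module R G" and f: "f \<in> mod_hom R M G"
 and ker: "!!x. x \<in> carrier M ==> f x = \<zero>\<^bsub>G\<^esub> \<longleftrightarrow> x \<in> N"
 and surj: "!!y. y \<in> carrier G ==> EX x:carrier M. f x = y"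
shows "quot_lift f \<in> mod_iso R (quot_mod M N) G"
proof -
interpret M: module R M by fact
interpret G: module R G by fact
have zero: "!!x. x \<in> N ==> f x = \<zero>\<^bsub>G\<^esub>" using ker submodule_subset[OF N] by blast
note * = quot_lift_coset[OF M N G f zero]
have "inj_on (quot_lift f) (carrier (quot_mod M N))"
proof (rule inj_onI)
 fix Z W assume "Z \<in> carrier (quot_mod M N)" "W \<in> carrier (quot_mod M N)"
 and eq: "quot_lift f Z = quot_lift f W"
 then obtain x y where xy: "Z = N +>\<^bsub>M\<^esub> x" "W = N +>\<^bsub>M\<^esub> y" "x \<in> carrier M" "y \<in> carrier M"
 by (auto simp: quot_mod_carrier)
 then have "f x = f y" using eq * by simp
 then have "f (x \<ominus>\<^bsub>M\<^esub> y) = \<zero>\<^bsub>G\<^esub>" using mod_hom_diff[OF M G f] xy mod_hom_closed[OF f]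
 by (simp add: G.diff_eq_zero_iff)
 then show "Z = W" using xy ker coset_eq_iff[OF M N] by simp
qed
moreover have "quot_lift f ` carrier (quot_mod M N) = carrier G"
proof
 show "quot_lift f ` carrier (quot_mod M N) <= carrier G"
 using mod_hom_closed[OF quot_lift_hom[OF M N G f zero]] by blast
 show "carrier G <= quot_lift f ` carrier (quot_mod M N)"
 using surj * coset_mem_quot_mod by (metis (no_types, lifting) image_iff subsetI)
qed
ultimately show ?thesis
 using quot_lift_hom[OF M N G f zero] by (simp add: mod_iso_def bij_betw_def)
qed

section \<open>Isomorphisms\<close>

lemma mod_isoI:
assumes "h \<in> mod_hom R M N" "bij_betw h (carrier M) (carrier N)"
shows "h \<in> mod_iso R M N"
using assms by (simp add: mod_iso_def)

lemma mod_iso_hom: "h \<in> mod_iso R M N ==> h \<in> mod_hom R M N"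
by (simp add: mod_iso_def)

lemma mod_iso_bij: "h \<in> mod_iso R M N ==> bij_betw h (carrier M) (carrier N)"
by (simp add: mod_iso_def)

lemma mod_iso_inverse:
assumes M: "module R M" and h: "h \<in> mod_iso R M N"
shows "inv_into (carrier M) h \<in> mod_iso R N M"
proof -
interpret M: module R M by fact
let ?g = "inv_into (carrier M) h"
have b: "bij_betw h (carrier M) (carrier N)" and hom: "h \<in> mod_hom R M N"
 using h by (auto simp: mod_iso_def)
have g: "?g y \<in> carrier M" "h (?g y) = y" if "y \<in> carrier N" for y
 using b that by (auto simp: bij_betw_def inv_into_into f_inv_into_f)
have gh: "?g (h x) = x" if "x \<in> carrier M" for x
 using b that by (simp add: bij_betw_def)
show ?thesis
proof (intro mod_isoI mod_homI bij_betw_inv_into[OF b])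
 fix x y assume "x \<in> carrier N" "y \<in> carrier N"
 then show "?g (x \<oplus>\<^bsub>N\<^esub> y) = ?g x \<oplus>\<^bsub>M\<^esub> ?g y"
 using gh[of "?g x \<oplus>\<^bsub>M\<^esub> ?g y"] g by (simp add: mod_hom_add[OF hom])
next
 fix r x assume "r \<in> carrier R" "x \<in> carrier N"
 then show "?g (r \<odot>\<^bsub>N\<^esub> x) = r \<odot>\<^bsub>M\<^esub> ?g x"
 using gh[of "r \<odot>\<^bsub>M\<^esub> ?g x"] g by (simp add: mod_hom_smult[OF hom])
qed (use g in auto)
qed

lemma mod_isomorphic_refl: "mod_isomorphic R M M"
proof -
have "(%x. x) \<in> mod_iso R M M"
 by (simp add: mod_iso_def mod_hom_def bij_betw_def)
then show ?thesis by (auto simp: mod_isomorphic_def)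
qed

lemma mod_isomorphic_sym: "module R M ==> mod_isomorphic R M N ==> mod_isomorphic R N M"
using mod_iso_inverse by (fastforce simp: mod_isomorphic_def)

lemma mod_iso_compose:
"f \<in> mod_iso R M N ==> g \<in> mod_iso R N L ==> (%x. g (f x)) \<in> mod_iso R M L"
using bij_betw_trans[of f "carrier M" "carrier N" g "carrier L"]
by (auto simp: mod_iso_def comp_def intro: mod_hom_compose)

lemma mod_isomorphic_trans [trans]:
"mod_isomorphic R M N ==> mod_isomorphic R N L ==> mod_isomorphic R M L"
using mod_iso_compose by (fastforce simp: mod_isomorphic_def)

lemma mod_isomorphicI: "h \<in> mod_iso R M N ==> mod_isomorphic R M N"
by (auto simp: mod_isomorphic_def)

lemma mod_iso_injD:
"h \<in> mod_iso R M N ==> x \<in> carrier M ==> y \<in> carrier M ==> h x = h y ==> x = y"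
by (auto simp: mod_iso_def bij_betw_def inj_on_def)

lemma mod_iso_surjD:
assumes "h \<in> mod_iso R M N" "y \<in> carrier N" shows "EX x:carrier M. h x = y"
proof -
have "y \<in> h ` carrier M" using assms by (simp add: mod_iso_def bij_betw_def)
then show ?thesis by blast
qed

lemma mod_iso_zero_iff:
assumes "module R M" "module R N" "h \<in> mod_iso R M N" "x \<in> carrier M"
shows "h x = \<zero>\<^bsub>N\<^esub> \<longleftrightarrow> x = \<zero>\<^bsub>M\<^esub>"
proof -
interpret M: module R M by fact
show ?thesis using mod_hom_zero[OF assms(1,2) mod_iso_hom[OF assms(3)]] mod_iso_injD[OF assms(3)]
 assms(4) M.zero_closed by metis
qed

lemma quot_mod_isomorphic:
assumes "module R M" "submodule N R M" "module R G" "f \<in> mod_hom R M G"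
 and "!!x. x \<in> carrier M ==> f x = \<zero>\<^bsub>G\<^esub> \<longleftrightarrow> x \<in> N"
 and "!!y. y \<in> carrier G ==> EX x:carrier M. f x = y"
shows "mod_isomorphic R (quot_mod M N) G"
using quot_lift_iso[OF assms] by (rule mod_isomorphicI)

lemma transport_mod_simps [simp]:
"carrier (transport_mod f g M) = f ` carrier M" "zero (transport_mod f g M) = f \<zero>\<^bsub>M\<^esub>"
"add (transport_mod f g M) = (%x y. f (g x \<oplus>\<^bsub>M\<^esub> g y))"
"smult (transport_mod f g M) = (%r x. f (r \<odot>\<^bsub>M\<^esub> g x))"
by (simp_all add: transport_mod_def)

lemma transport_mod_module:
assumes M: "module R M" and gf: "!!x. g (f x) = x"
shows "module R (transport_mod f g M)"
proof -
interpret M: module R M by fact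
show ?thesis
proof (rule moduleI)
 show "cring R" by (rule M.R.is_cring)
 show "abelian_group (transport_mod f g M)"
 proof (rule abelian_groupI)
 fix x assume "x \<in> carrier (transport_mod f g M)"
 then obtain a where "a \<in> carrier M" "x = f a" by auto
 then show "EX y:carrier (transport_mod f g M). y \<oplus>\<^bsub>transport_mod f g M\<^esub> x = \<zero>\<^bsub>transport_mod f g M\<^esub>"
  by (intro bexI[of _ "f (\<ominus>\<^bsub>M\<^esub> a)"]) (auto simp: gf M.l_neg)
 qed (auto simp: gf M.a_ac)
qed (auto simp: gf M.smult_l_distr M.smult_r_distr M.smult_assoc1)
qed

lemma transport_mod_iso:
assumes "module R M" and gf: "!!x. g (f x) = x"
shows "g \<in> mod_iso R (transport_mod f g M) M"
proof -
interpret M: module R M by fact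
have "bij_betw g (f ` carrier M) (carrier M)"
 by (rule bij_betwI[where g = f]) (auto simp: gf)
then show ?thesis by (auto simp: mod_iso_def mod_hom_def gf)
qed

section \<open>Free modules\<close>

lemma free_mod_simps [simp]:
"\<zero>\<^bsub>free_mod R S\<^esub> = (%_. \<zero>\<^bsub>R\<^esub>)" "f \<oplus>\<^bsub>free_mod R S\<^esub> g = (%x. f x \<oplus>\<^bsub>R\<^esub> g x)"
"r \<odot>\<^bsub>free_mod R S\<^esub> f = (%x. r \<otimes>\<^bsub>R\<^esub> f x)"
by (simp_all add: free_mod_def)

lemma free_mod_carrier:
"f \<in> carrier (free_mod R S) \<longleftrightarrow>
 (ALL x. f x \<in> carrier R) & (ALL x. x \<notin> S --> f x = \<zero>\<^bsub>R\<^esub>) & finite {x. f x ~= \<zero>\<^bsub>R\<^esub>}"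
by (simp add: free_mod_def)

lemma free_mod_carrier_finite:
"finite S ==> f \<in> carrier (free_mod R S) \<longleftrightarrow>
 (ALL x. f x \<in> carrier R) & (ALL x. x \<notin> S --> f x = \<zero>\<^bsub>R\<^esub>)"
unfolding free_mod_carrier by (metis (mono_tags, lifting) mem_Collect_eq rev_finite_subset subsetI)

lemma free_mod_closed: "f \<in> carrier (free_mod R S) ==> f x \<in> carrier R"
by (simp add: free_mod_carrier)

lemma free_mod_outside: "f \<in> carrier (free_mod R S) ==> x \<notin> S ==> f x = \<zero>\<^bsub>R\<^esub>"
by (simp add: free_mod_carrier)

lemma free_mod_module:
assumes "cring R" shows "module R (free_mod R S)"
proof -
interpret cring R by fact
have fin: "finite {x. f x \<oplus>\<^bsub>R\<^esub> g x ~= \<zero>\<^bsub>R\<^esub>}"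
 if "finite {x. f x ~= \<zero>\<^bsub>R\<^esub>}" "finite {x. g x ~= \<zero>\<^bsub>R\<^esub>}" for f g :: "'c => 'a"
 by (rule finite_subset[OF _ finite_UnI[OF that]]) auto
have fin2: "finite {x. r \<otimes>\<^bsub>R\<^esub> f x ~= \<zero>\<^bsub>R\<^esub>}"
 if "finite {x. f x ~= \<zero>\<^bsub>R\<^esub>}" "r \<in> carrier R" for f :: "'c => 'a" and r
 by (rule finite_subset[OF _ that(1)]) (use that in auto)
show ?thesis
proof (rule moduleI)
 show "abelian_group (free_mod R S)"
 proof (rule abelian_groupI)
 fix f assume f: "f \<in> carrier (free_mod R S)"
 then show "EX g:carrier (free_mod R S). g \<oplus>\<^bsub>free_mod R S\<^esub> f = \<zero>\<^bsub>free_mod R S\<^esub>"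
  using fin2[of f "\<ominus>\<^bsub>R\<^esub> \<one>\<^bsub>R\<^esub>"]
  by (intro bexI[of _ "%x. \<ominus>\<^bsub>R\<^esub> \<one>\<^bsub>R\<^esub> \<otimes>\<^bsub>R\<^esub> f x"]) (auto simp: free_mod_carrier l_neg l_minus)
 qed (auto simp: free_mod_carrier fin a_ac)
qed (auto simp: free_mod_carrier fin2 l_distr r_distr m_assoc assms)
qed

lemma generator_simps [simp]: "generator R s s = \<one>\<^bsub>R\<^esub>" "t ~= s ==> generator R s t = \<zero>\<^bsub>R\<^esub>"
by (simp_all add: generator_def)

lemma generator_mem: "cring R ==> s \<in> S ==> generator R s \<in> carrier (free_mod R S)"
proof -
assume "cring R" "s \<in> S"
interpret cring R by fact
have "finite {x. generator R s x ~= \<zero>\<^bsub>R\<^esub>}"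
 by (rule finite_subset[of _ "{s}"]) (auto simp: generator_def)
then show ?thesis using \<open>s \<in> S\<close> by (auto simp: free_mod_carrier generator_def)
qed

text \<open>A free module is spanned by its generators.\<close>

lemma free_mod_span:
assumes "cring R" and L: "submodule L R (free_mod R S)"
 and gen: "!!s. s \<in> S ==> generator R s \<in> L" and c: "c \<in> carrier (free_mod R S)"
shows "c \<in> L"
proof -
interpret cring R by fact
have "finite {x. c x ~= \<zero>\<^bsub>R\<^esub>}" using c by (simp add: free_mod_carrier)
moreover have "c \<in> L" if "finite T" "{x. c x ~= \<zero>\<^bsub>R\<^esub>} <= T" "c \<in> carrier (free_mod R S)" for T c
 using that
proof (induction T arbitrary: c rule: finite_induct)
 case empty
 then have "c = (%_. \<zero>\<^bsub>R\<^esub>)" by auto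
 then show ?case using submodule_zero_mem[OF L] by simp
next
 case (insert t T)
 show ?case
 proof (cases "t \<in> S")
 case False
 then have "{x. c x ~= \<zero>\<^bsub>R\<^esub>} <= T" using insert.prems by (auto simp: free_mod_carrier)
 with insert show ?thesis by blast
 next
 case True
 let ?c = "c(t := \<zero>\<^bsub>R\<^esub>)"
 have "finite {x. ?c x ~= \<zero>\<^bsub>R\<^esub>}"
  by (rule finite_subset[of _ "{x. c x ~= \<zero>\<^bsub>R\<^esub>}"]) (use insert.prems in \<open>auto simp: free_mod_carrier\<close>)
 then have "?c \<in> carrier (free_mod R S)" using insert.prems by (auto simp: free_mod_carrier)
 moreover have "{x. ?c x ~= \<zero>\<^bsub>R\<^esub>} <= T" using insert.prems by auto
 ultimately have cL: "?c \<in> L" using insert.IH by blast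
 have ct: "c t \<in> carrier R" using insert.prems by (simp add: free_mod_carrier)
 have "c t \<odot>\<^bsub>free_mod R S\<^esub> generator R t \<in> L"
  using submodule_smult_mem[OF L ct gen[OF True]] .
 from submodule_add_mem[OF L cL this]
 have "(%x. ?c x \<oplus>\<^bsub>R\<^esub> c t \<otimes>\<^bsub>R\<^esub> generator R t x) \<in> L" by simp
 also have "(%x. ?c x \<oplus>\<^bsub>R\<^esub> c t \<otimes>\<^bsub>R\<^esub> generator R t x) = c"
  using insert.prems ct by (auto simp: free_mod_carrier generator_def)
 finally show ?thesis .
 qed
qed
ultimately show ?thesis using c by blast
qed

definition lin_ext :: "('r, 's) ring_scheme => ('r, 'a) module => ('b => 'a) => ('b => 'r) => 'a"
where "lin_ext R A a c = (\<Oplus>\<^bsub>A\<^esub>s\<in>{s. c s ~= \<zero>\<^bsub>R\<^esub>}. c s \<odot>\<^bsub>A\<^esub> a s)"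

context
fixes R :: "('r, 's) ring_scheme" and A :: "('r, 'a) module" and a :: "'b => 'a" and S :: "'b set"
assumes A: "module R A" and a: "!!s. s \<in> S ==> a s \<in> carrier A"
begin

interpretation A: module R A by (rule A)

lemma lin_ext_superset:
assumes "finite T" "{s. c s ~= \<zero>\<^bsub>R\<^esub>} <= T" "T <= S" "!!s. c s \<in> carrier R"
shows "lin_ext R A a c = (\<Oplus>\<^bsub>A\<^esub>s\<in>T. c s \<odot>\<^bsub>A\<^esub> a s)"
unfolding lin_ext_def
by (rule A.add.finprod_mono_neutral_cong_left) (use assms a in \<open>auto simp: subset_iff\<close>)

lemma lin_ext_hom: "lin_ext R A a \<in> mod_hom R (free_mod R S) A"
proof (rule mod_homI)
fix c assume c: "c \<in> carrier (free_mod R S)"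
have a': "a s \<in> carrier A" if "c s ~= \<zero>\<^bsub>R\<^esub>" for s using a c that by (auto simp: free_mod_carrier)
show "lin_ext R A a c \<in> carrier A"
 unfolding lin_ext_def using c a' by (intro A.finsum_closed) (auto simp: free_mod_carrier)
fix r assume r: "r \<in> carrier R"
let ?T = "{s. c s ~= \<zero>\<^bsub>R\<^esub>}"
have T: "finite ?T" "?T <= S" using c by (auto simp: free_mod_carrier)
have "lin_ext R A a (r \<odot>\<^bsub>free_mod R S\<^esub> c) = (\<Oplus>\<^bsub>A\<^esub>s\<in>?T. (r \<otimes>\<^bsub>R\<^esub> c s) \<odot>\<^bsub>A\<^esub> a s)"
 using c r T by (subst lin_ext_superset[of ?T]) (auto simp: free_mod_carrier)
also have "\<dots> = (\<Oplus>\<^bsub>A\<^esub>s\<in>?T. r \<odot>\<^bsub>A\<^esub> (c s \<odot>\<^bsub>A\<^esub> a s))"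
 using c r a' by (intro A.finsum_cong') (auto simp: free_mod_carrier A.smult_assoc1)
also have "\<dots> = r \<odot>\<^bsub>A\<^esub> lin_ext R A a c"
 unfolding lin_ext_def using T r a' c
 by (intro A.finsum_smult_ldistr[symmetric]) (auto simp: free_mod_carrier)
finally show "lin_ext R A a (r \<odot>\<^bsub>free_mod R S\<^esub> c) = r \<odot>\<^bsub>A\<^esub> lin_ext R A a c" .
next
fix c d assume c: "c \<in> carrier (free_mod R S)" and d: "d \<in> carrier (free_mod R S)"
let ?T = "{s. c s ~= \<zero>\<^bsub>R\<^esub>} \<union> {s. d s ~= \<zero>\<^bsub>R\<^esub>}"
have T: "finite ?T" "?T <= S" using c d by (auto simp: free_mod_carrier)
have a': "a s \<in> carrier A" if "s \<in> ?T" for s using a T that by blast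
have R: "c s \<in> carrier R" "d s \<in> carrier R" for s using c d by (auto simp: free_mod_carrier)
have "lin_ext R A a (c \<oplus>\<^bsub>free_mod R S\<^esub> d) = (\<Oplus>\<^bsub>A\<^esub>s\<in>?T. (c s \<oplus>\<^bsub>R\<^esub> d s) \<odot>\<^bsub>A\<^esub> a s)"
 using T R by (subst lin_ext_superset[of ?T]) auto
also have "\<dots> = (\<Oplus>\<^bsub>A\<^esub>s\<in>?T. c s \<odot>\<^bsub>A\<^esub> a s \<oplus>\<^bsub>A\<^esub> d s \<odot>\<^bsub>A\<^esub> a s)"
 using R a' by (intro A.finsum_cong') (auto simp: A.smult_l_distr)
also have "\<dots> = (\<Oplus>\<^bsub>A\<^esub>s\<in>?T. c s \<odot>\<^bsub>A\<^esub> a s) \<oplus>\<^bsub>A\<^esub> (\<Oplus>\<^bsub>A\<^esub>s\<in>?T. d s \<odot>\<^bsub>A\<^esub> a s)"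
 using R a' by (intro A.finsum_addf) auto
also have "\<dots> = lin_ext R A a c \<oplus>\<^bsub>A\<^esub> lin_ext R A a d"
 using T R by (subst (1 2) lin_ext_superset[of ?T]) auto
finally show "lin_ext R A a (c \<oplus>\<^bsub>free_mod R S\<^esub> d) = lin_ext R A a c \<oplus>\<^bsub>A\<^esub> lin_ext R A a d" .
qed

lemma lin_ext_generator:
assumes "s \<in> S" shows "lin_ext R A a (generator R s) = a s"
proof -
have "lin_ext R A a (generator R s) = (\<Oplus>\<^bsub>A\<^esub>t\<in>{s}. generator R s t \<odot>\<^bsub>A\<^esub> a t)"
 using assms by (intro lin_ext_superset) (auto simp: generator_def)
then show ?thesis using a[OF assms] by simp
qed

end

lemma free_mod_hom_eq:
assumes "cring R" "module R A" "f \<in> mod_hom R (free_mod R S) A" "g \<in> mod_hom R (free_mod R S) A"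
 and "!!s. s \<in> S ==> f (generator R s) = g (generator R s)" and "c \<in> carrier (free_mod R S)"
shows "f c = g c"
proof -
have "c \<in> {x \<in> carrier (free_mod R S). f x = g x}"
 by (rule free_mod_span[OF assms(1) submodule_equalizer[OF free_mod_module[OF assms(1)] assms(2-4)] _ assms(6)])
 (simp add: assms(5) generator_mem[OF assms(1)])
then show ?thesis by simp
qed

section \<open>Direct sums\<close>

lemma direct_sum_simps [simp]:
"zero (direct_sum I M) = (\<lambda>i\<in>I. \<zero>\<^bsub>M i\<^esub>)"
"f \<oplus>\<^bsub>direct_sum I M\<^esub> g = (\<lambda>i\<in>I. f i \<oplus>\<^bsub>M i\<^esub> g i)"
"r \<odot>\<^bsub>direct_sum I M\<^esub> f = (\<lambda>i\<in>I. r \<odot>\<^bsub>M i\<^esub> f i)"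
by (simp_all add: direct_sum_def)

lemma direct_sum_carrier:
"f \<in> carrier (direct_sum I M) \<longleftrightarrow>
 (ALL i:I. f i \<in> carrier (M i)) & f \<in> extensional I & finite {i \<in> I. f i ~= \<zero>\<^bsub>M i\<^esub>}"
by (auto simp: direct_sum_def PiE_def)

lemma direct_sum_module:
assumes R: "cring R" and M: "!!i. i \<in> I ==> module R (M i)"
shows "module R (direct_sum I M)"
proof -
have fin: "finite {i \<in> I. f i \<oplus>\<^bsub>M i\<^esub> g i ~= \<zero>\<^bsub>M i\<^esub>}"
 if "finite {i \<in> I. f i ~= \<zero>\<^bsub>M i\<^esub>}" "finite {i \<in> I. g i ~= \<zero>\<^bsub>M i\<^esub>}" for f g
 by (rule finite_subset[OF _ finite_UnI[OF that]])
  (auto simp: abelian_monoid.l_zero abelian_monoid.zero_closed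
  abelian_group.axioms(1)[OF module.axioms(2)[OF M]])
have fin2: "finite {i \<in> I. r \<odot>\<^bsub>M i\<^esub> f i ~= \<zero>\<^bsub>M i\<^esub>}"
 if "finite {i \<in> I. f i ~= \<zero>\<^bsub>M i\<^esub>}" "r \<in> carrier R" for f r
 by (rule finite_subset[OF _ that(1)]) (use that module.smult_r_null[OF M] in auto)
have ag: "abelian_group (M i)" if "i \<in> I" for i using M[OF that] by (rule module.axioms(2))
have am: "abelian_monoid (M i)" if "i \<in> I" for i using ag[OF that] by (rule abelian_group.axioms(1))
show ?thesis
proof (rule moduleI[OF R])
 show "abelian_group (direct_sum I M)"
 proof (rule abelian_groupI)
 fix f assume f: "f \<in> carrier (direct_sum I M)"
 let ?g = "\<lambda>i\<in>I. (\<ominus>\<^bsub>R\<^esub> \<one>\<^bsub>R\<^esub>) \<odot>\<^bsub>M i\<^esub> f i"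
 have m1: "\<ominus>\<^bsub>R\<^esub> \<one>\<^bsub>R\<^esub> \<in> carrier R" using R by (simp add: cring.cring_simprules(3,6))
 have "finite {i \<in> I. ?g i ~= \<zero>\<^bsub>M i\<^esub>}"
  by (rule finite_subset[OF _ fin2[OF _ m1]]) (use f in \<open>auto simp: direct_sum_carrier\<close>)
 then have g: "?g \<in> carrier (direct_sum I M)"
  using f m1 by (auto simp: direct_sum_carrier module.smult_closed[OF M])
 have "?g i \<oplus>\<^bsub>M i\<^esub> f i = \<zero>\<^bsub>M i\<^esub>" if "i \<in> I" for i
  using that f abelian_group.l_neg[OF ag[OF that]]
  by (simp add: direct_sum_carrier module.neg_as_smult[OF M, symmetric])
 then show "EX g:carrier (direct_sum I M). g \<oplus>\<^bsub>direct_sum I M\<^esub> f = \<zero>\<^bsub>direct_sum I M\<^esub>"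
  using g by (intro bexI[of _ ?g]) (auto intro!: ext)
 next
 fix f g h assume "f \<in> carrier (direct_sum I M)" "g \<in> carrier (direct_sum I M)" "h \<in> carrier (direct_sum I M)"
 then show "f \<oplus>\<^bsub>direct_sum I M\<^esub> g \<oplus>\<^bsub>direct_sum I M\<^esub> h = f \<oplus>\<^bsub>direct_sum I M\<^esub> (g \<oplus>\<^bsub>direct_sum I M\<^esub> h)"
  by (auto intro!: ext simp: direct_sum_carrier abelian_monoid.a_assoc[OF am])
 next
 fix f g assume fg: "f \<in> carrier (direct_sum I M)" "g \<in> carrier (direct_sum I M)"
 then show "f \<oplus>\<^bsub>direct_sum I M\<^esub> g = g \<oplus>\<^bsub>direct_sum I M\<^esub> f"
  by (auto intro!: ext simp: direct_sum_carrier abelian_monoid.a_comm[OF am])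
 have "{i \<in> I. (\<lambda>i\<in>I. f i \<oplus>\<^bsub>M i\<^esub> g i) i ~= \<zero>\<^bsub>M i\<^esub>} = {i \<in> I. f i \<oplus>\<^bsub>M i\<^esub> g i ~= \<zero>\<^bsub>M i\<^esub>}" by auto
 then show "f \<oplus>\<^bsub>direct_sum I M\<^esub> g \<in> carrier (direct_sum I M)"
  using fg fin by (auto simp: direct_sum_carrier abelian_monoid.a_closed[OF am])
 next
 have "{i \<in> I. (\<lambda>i\<in>I. \<zero>\<^bsub>M i\<^esub>) i ~= \<zero>\<^bsub>M i\<^esub>} = {}" by auto
 then show "\<zero>\<^bsub>direct_sum I M\<^esub> \<in> carrier (direct_sum I M)"
  by (auto simp: direct_sum_carrier abelian_monoid.zero_closed[OF am])
 next
 fix f assume "f \<in> carrier (direct_sum I M)"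
 then show "\<zero>\<^bsub>direct_sum I M\<^esub> \<oplus>\<^bsub>direct_sum I M\<^esub> f = f"
  by (auto intro!: ext simp: direct_sum_carrier extensional_def abelian_monoid.l_zero[OF am])
 qed
next
 fix r f assume rf: "r \<in> carrier R" "f \<in> carrier (direct_sum I M)"
 have "{i \<in> I. (\<lambda>i\<in>I. r \<odot>\<^bsub>M i\<^esub> f i) i ~= \<zero>\<^bsub>M i\<^esub>} = {i \<in> I. r \<odot>\<^bsub>M i\<^esub> f i ~= \<zero>\<^bsub>M i\<^esub>}" by auto
 then show "r \<odot>\<^bsub>direct_sum I M\<^esub> f \<in> carrier (direct_sum I M)"
 using rf fin2 by (auto simp: direct_sum_carrier module.smult_closed[OF M])
next
 fix f assume "f \<in> carrier (direct_sum I M)"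
 then show "\<one>\<^bsub>R\<^esub> \<odot>\<^bsub>direct_sum I M\<^esub> f = f"
 by (auto intro!: ext simp: direct_sum_carrier extensional_def module.smult_one[OF M])
qed (auto intro!: ext simp: direct_sum_carrier module.smult_l_distr[OF M]
  module.smult_r_distr[OF M] module.smult_assoc1[OF M])
qed

lemma direct_sum_reindex:
assumes R: "cring R" and inj: "inj_on \<phi> J" and img: "\<phi> ` J <= I"
 and M: "!!i. i \<in> I ==> module R (M i)" and N: "!!j. j \<in> J ==> module R (N j)"
 and triv: "!!i. i \<in> I ==> i \<notin> \<phi> ` J ==> carrier (M i) = {\<zero>\<^bsub>M i\<^esub>}"
 and iso: "!!j. j \<in> J ==> mod_isomorphic R (M (\<phi> j)) (N j)"
shows "mod_isomorphic R (direct_sum I M) (direct_sum J N)"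
proof -
have "EX h. ALL j:J. h j \<in> mod_iso R (M (\<phi> j)) (N j)"
 using iso by (intro bchoice) (auto simp: mod_isomorphic_def)
then obtain h where h: "!!j. j \<in> J ==> h j \<in> mod_iso R (M (\<phi> j)) (N j)" by blast
note hh = mod_iso_hom[OF h]
have \<phi>: "\<phi> j \<in> I" if "j \<in> J" for j using img that by blast
note hz = mod_iso_zero_iff[OF M[OF \<phi>] N h]
define f where "f = (%c. \<lambda>j\<in>J. h j (c (\<phi> j)))"
define k where "k = (%j. inv_into (carrier (M (\<phi> j))) (h j))"
define \<psi> where "\<psi> = inv_into J \<phi>"
have \<psi>: "\<psi> (\<phi> j) = j" if "j \<in> J" for j unfolding \<psi>_def using inj that by simp
have k: "k j y \<in> carrier (M (\<phi> j))" "h j (k j y) = y" if "j \<in> J" "y \<in> carrier (N j)" for j y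
 using mod_iso_bij[OF h[OF that(1)]] that(2)
 by (auto simp: k_def bij_betw_def inv_into_into f_inv_into_f)
have kh: "k j (h j x) = x" if "j \<in> J" "x \<in> carrier (M (\<phi> j))" for j x
 using mod_iso_bij[OF h[OF that(1)]] that(2) by (simp add: k_def bij_betw_def)
define g where "g = (%c. \<lambda>i\<in>I. if i \<in> \<phi> ` J then k (\<psi> i) (c (\<psi> i)) else \<zero>\<^bsub>M i\<^esub>)"
have fc: "f c \<in> carrier (direct_sum J N)" if c: "c \<in> carrier (direct_sum I M)" for c
proof -
 have "{j \<in> J. f c j ~= \<zero>\<^bsub>N j\<^esub>} <= {j \<in> J. \<phi> j \<in> {i \<in> I. c i ~= \<zero>\<^bsub>M i\<^esub>}}"
 using c hz \<phi> by (auto simp: f_def direct_sum_carrier)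
 moreover have "finite {j \<in> J. \<phi> j \<in> {i \<in> I. c i ~= \<zero>\<^bsub>M i\<^esub>}}"
 using c finite_vimage_IntI[OF _ inj, of "{i \<in> I. c i ~= \<zero>\<^bsub>M i\<^esub>}"]
 by (simp add: direct_sum_carrier vimage_def Int_def conj_commute)
 ultimately have "finite {j \<in> J. f c j ~= \<zero>\<^bsub>N j\<^esub>}" by (rule finite_subset)
 then show ?thesis using c mod_hom_closed[OF hh] \<phi> by (auto simp: direct_sum_carrier f_def)
qed
have "f \<in> mod_hom R (direct_sum I M) (direct_sum J N)"
 by (intro mod_homI fc)
 (auto intro!: ext simp: f_def direct_sum_carrier \<phi> mod_hom_add[OF hh] mod_hom_smult[OF hh])
moreover have "bij_betw f (carrier (direct_sum I M)) (carrier (direct_sum J N))"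
proof (rule bij_betwI[where g = g])
 show "f \<in> carrier (direct_sum I M) \<rightarrow> carrier (direct_sum J N)" using fc by blast
 show "g \<in> carrier (direct_sum J N) \<rightarrow> carrier (direct_sum I M)"
 proof
 fix c assume c: "c \<in> carrier (direct_sum J N)"
 have gi: "g c i \<in> carrier (M i)" if "i \<in> I" for i
 proof (cases "i \<in> \<phi> ` J")
  case True
  then obtain j where "j \<in> J" "i = \<phi> j" by blast
  then show ?thesis using that k(1) c by (auto simp: g_def \<psi> direct_sum_carrier)
 next
  case False then show ?thesis
  using that abelian_monoid.zero_closed[OF abelian_group.axioms(1)[OF module.axioms(2)[OF M]]]
  by (auto simp: g_def)
 qed
 have "{i \<in> I. g c i ~= \<zero>\<^bsub>M i\<^esub>} <= \<phi> ` {j \<in> J. c j ~= \<zero>\<^bsub>N j\<^esub>}"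
 proof
  fix i assume "i \<in> {i \<in> I. g c i ~= \<zero>\<^bsub>M i\<^esub>}"
  then have i: "i \<in> I" "g c i ~= \<zero>\<^bsub>M i\<^esub>" by auto
  then obtain j where j: "j \<in> J" "i = \<phi> j" by (auto simp: g_def split: if_splits)
  then have "k j (c j) ~= \<zero>\<^bsub>M i\<^esub>" using i by (auto simp: g_def \<psi>)
  then have "h j (k j (c j)) ~= \<zero>\<^bsub>N j\<^esub>"
  using j(2) hz[OF j(1) j(1) j(1) k(1)[OF j(1)]] c j(1) by (auto simp: direct_sum_carrier)
  moreover have "h j (k j (c j)) = c j" using j k(2) c by (simp add: direct_sum_carrier)
  ultimately show "i \<in> \<phi> ` {j \<in> J. c j ~= \<zero>\<^bsub>N j\<^esub>}" using j by simp
 qed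
 then have "finite {i \<in> I. g c i ~= \<zero>\<^bsub>M i\<^esub>}"
  using c by (auto simp: direct_sum_carrier intro: finite_subset)
 then show "g c \<in> carrier (direct_sum I M)" using gi by (auto simp: direct_sum_carrier g_def)
 qed
next
 fix c assume c: "c \<in> carrier (direct_sum I M)"
 show "g (f c) = c"
 proof
 fix i show "g (f c) i = c i"
 proof (cases "i \<in> \<phi> ` J")
  case True
  then obtain j where "j \<in> J" "i = \<phi> j" by blast
  then show ?thesis using \<phi> kh c by (auto simp: g_def f_def \<psi> direct_sum_carrier)
 next
  case False then show ?thesis
  using c triv[of i] by (cases "i \<in> I") (auto simp: g_def direct_sum_carrier extensional_def)
 qed
 qed
next
 fix c assume c: "c \<in> carrier (direct_sum J N)"
 show "f (g c) = c"
 proof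
 fix j show "f (g c) j = c j"
  using c k(2) \<phi> by (cases "j \<in> J") (auto simp: g_def f_def \<psi> direct_sum_carrier extensional_def)
 qed
qed
ultimately show ?thesis by (auto intro: mod_isomorphicI mod_isoI)
qed

lemma direct_sum_cong:
assumes "cring R" "!!i. i \<in> I ==> module R (M i)" "!!i. i \<in> I ==> module R (N i)"
 and "!!i. i \<in> I ==> mod_isomorphic R (M i) (N i)"
shows "mod_isomorphic R (direct_sum I M) (direct_sum I N)"
using direct_sum_reindex[of R "%i. i" I I M N] assms by simp

lemma direct_sum_Sigma:
fixes M :: "'i => 'j => ('r, 'a) module"
assumes R: "cring R" and M: "!!i j. i \<in> I ==> j \<in> J i ==> module R (M i j)"
shows "mod_isomorphic R (direct_sum I (%i. direct_sum (J i) (M i)))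
 (direct_sum (Sigma I J) (%(i, j). M i j))" (is "mod_isomorphic R ?A ?B")
proof -
define f where "f = (%(c :: 'i => 'j => 'a). \<lambda>(i, j)\<in>Sigma I J. c i j)"
define g where "g = (%(c :: 'i \<times> 'j => 'a). \<lambda>i\<in>I. \<lambda>j\<in>J i. c (i, j))"
have nz: "c i = (\<lambda>j\<in>J i. \<zero>\<^bsub>M i j\<^esub>) \<longleftrightarrow> (ALL j:J i. c i j = \<zero>\<^bsub>M i j\<^esub>)"
 if "c \<in> carrier ?A" "i \<in> I" for c i
proof
 assume "ALL j:J i. c i j = \<zero>\<^bsub>M i j\<^esub>"
 then show "c i = (\<lambda>j\<in>J i. \<zero>\<^bsub>M i j\<^esub>)"
 using that by (intro ext) (auto simp: direct_sum_carrier extensional_def)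
qed auto
have fc: "f c \<in> carrier ?B" if c: "c \<in> carrier ?A" for c
proof -
 let ?I = "{i \<in> I. c i ~= (\<lambda>j\<in>J i. \<zero>\<^bsub>M i j\<^esub>)}"
 have "{p \<in> Sigma I J. f c p ~= \<zero>\<^bsub>(case p of (i, j) => M i j)\<^esub>} <=
 Sigma ?I (%i. {j \<in> J i. c i j ~= \<zero>\<^bsub>M i j\<^esub>})"
 using nz[OF c] by (auto simp: f_def)
 moreover have "finite (Sigma ?I (%i. {j \<in> J i. c i j ~= \<zero>\<^bsub>M i j\<^esub>}))"
 using c by (intro finite_SigmaI) (auto simp: direct_sum_carrier)
 ultimately have "finite {p \<in> Sigma I J. f c p ~= \<zero>\<^bsub>(case p of (i, j) => M i j)\<^esub>}"
 by (rule finite_subset)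
 then show ?thesis using c by (auto simp: direct_sum_carrier f_def)
qed
have gc: "g c \<in> carrier ?A" if c: "c \<in> carrier ?B" for c
proof -
 let ?S = "{p \<in> Sigma I J. c p ~= \<zero>\<^bsub>(case p of (i, j) => M i j)\<^esub>}"
 have S: "finite ?S" using c by (simp add: direct_sum_carrier)
 have 1: "finite {j \<in> J i. g c i j ~= \<zero>\<^bsub>M i j\<^esub>}" if "i \<in> I" for i
 by (rule finite_subset[OF _ finite_imageI[OF S, of snd]]) (use that in \<open>force simp: g_def\<close>)
 have "g c i = (\<lambda>j\<in>J i. \<zero>\<^bsub>M i j\<^esub>)" if "i \<in> I" "i \<notin> fst ` ?S" for i
 proof
 fix j show "g c i j = (\<lambda>j\<in>J i. \<zero>\<^bsub>M i j\<^esub>) j"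
  using that by (cases "j \<in> J i") (force simp: g_def)+
 qed
 then have "finite {i \<in> I. g c i ~= (\<lambda>j\<in>J i. \<zero>\<^bsub>M i j\<^esub>)}"
 by (intro finite_subset[OF _ finite_imageI[OF S, of fst]]) blast
 then show ?thesis using c 1 by (auto simp: direct_sum_carrier g_def)
qed
have "f \<in> mod_hom R ?A ?B" by (intro mod_homI fc) (auto intro!: ext simp: f_def)
moreover have "bij_betw f (carrier ?A) (carrier ?B)"
proof (rule bij_betwI[where g = g])
 fix c assume c: "c \<in> carrier ?A"
 show "g (f c) = c"
 proof (intro ext)
 fix i j show "g (f c) i j = c i j"
  using c by (cases "i \<in> I"; cases "j \<in> J i") (auto simp: g_def f_def direct_sum_carrier extensional_def)
 qed
next
 fix c assume c: "c \<in> carrier ?B"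
 show "f (g c) = c"
 proof
 fix p show "f (g c) p = c p"
  using c by (cases p; cases "p \<in> Sigma I J") (auto simp: g_def f_def direct_sum_carrier extensional_def)
 qed
qed (use fc gc in auto)
ultimately show ?thesis by (auto intro: mod_isomorphicI mod_isoI)
qed

lemma direct_sum_free:
fixes R :: "('r, 's) ring_scheme" and T :: "'i => 't set"
assumes R: "cring R"
shows "mod_isomorphic R (direct_sum I (%i. free_mod R (T i))) (free_mod R (Sigma I T))"
 (is "mod_isomorphic R ?A ?B")
proof -
interpret R: cring R by fact
define f where "f = (%(c :: 'i => 't => 'r). %(i, t). if i \<in> I then c i t else \<zero>\<^bsub>R\<^esub>)"
define g where "g = (%(c :: 'i \<times> 't => 'r). \<lambda>i\<in>I. %t. c (i, t))"
have fc: "f c \<in> carrier ?B" if c: "c \<in> carrier ?A" for c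
proof -
 have "{p. f c p ~= \<zero>\<^bsub>R\<^esub>} <= Sigma {i \<in> I. c i ~= (%_. \<zero>\<^bsub>R\<^esub>)} (%i. {t. c i t ~= \<zero>\<^bsub>R\<^esub>})"
 by (auto simp: f_def split: if_splits)
 moreover have "finite (Sigma {i \<in> I. c i ~= (%_. \<zero>\<^bsub>R\<^esub>)} (%i. {t. c i t ~= \<zero>\<^bsub>R\<^esub>}))"
 using c by (intro finite_SigmaI) (auto simp: direct_sum_carrier free_mod_carrier)
 ultimately have "finite {p. f c p ~= \<zero>\<^bsub>R\<^esub>}" by (rule finite_subset)
 then show ?thesis using c by (auto simp: direct_sum_carrier free_mod_carrier f_def)
qed
have gc: "g c \<in> carrier ?A" if c: "c \<in> carrier ?B" for c
proof -
 let ?S = "{p. c p ~= \<zero>\<^bsub>R\<^esub>}"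
 have S: "finite ?S" using c by (simp add: free_mod_carrier)
 have 1: "finite {t. c (i, t) ~= \<zero>\<^bsub>R\<^esub>}" for i
 by (rule finite_subset[OF _ finite_imageI[OF S, of snd]]) force
 have "finite {i \<in> I. g c i ~= (%_. \<zero>\<^bsub>R\<^esub>)}"
 proof (rule finite_subset[OF _ finite_imageI[OF S, of fst]])
 show "{i \<in> I. g c i ~= (%_. \<zero>\<^bsub>R\<^esub>)} <= fst ` ?S"
 proof
  fix i assume "i \<in> {i \<in> I. g c i ~= (%_. \<zero>\<^bsub>R\<^esub>)}"
  then obtain t where "c (i, t) ~= \<zero>\<^bsub>R\<^esub>" by (auto simp: g_def fun_eq_iff)
  then show "i \<in> fst ` ?S" by force
 qed
 qed
 then show ?thesis using c 1 by (auto simp: direct_sum_carrier free_mod_carrier g_def)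
qed
have "f \<in> mod_hom R ?A ?B" by (intro mod_homI fc) (auto intro!: ext simp: f_def)
moreover have "bij_betw f (carrier ?A) (carrier ?B)"
proof (rule bij_betwI[where g = g])
 fix c assume c: "c \<in> carrier ?A"
 show "g (f c) = c"
 proof
 fix i show "g (f c) i = c i"
  using c by (cases "i \<in> I") (auto simp: g_def f_def direct_sum_carrier extensional_def)
 qed
next
 fix c assume c: "c \<in> carrier ?B"
 show "f (g c) = c"
 proof
 fix p show "f (g c) p = c p"
  using c by (cases p) (auto simp: g_def f_def free_mod_carrier)
 qed
qed (use fc gc in auto)
ultimately show ?thesis by (auto intro: mod_isomorphicI mod_isoI)
qed

section \<open>Tensor products of free modules\<close>

lemma span_mod_superset: "S <= span_mod R F S"
by (auto simp: span_mod_def)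

lemma span_mod_least: "submodule N R F ==> S <= N ==> span_mod R F S <= N"
by (auto simp: span_mod_def)

lemma span_mod_submodule:
assumes "module R F" "S <= carrier F" shows "submodule (span_mod R F S) R F"
proof (intro submodule_criterion assms(1))
show "span_mod R F S <= carrier F" by (rule span_mod_least[OF submodule_self[OF assms(1)] assms(2)])
qed (auto simp: span_mod_def submodule_zero_mem submodule_add_mem submodule_smult_mem)

lemma mod_iso_of_inverses:
assumes "f \<in> mod_hom R M N" "g \<in> mod_hom R N M"
 and "!!x. x \<in> carrier M ==> g (f x) = x" "!!y. y \<in> carrier N ==> f (g y) = y"
shows "f \<in> mod_iso R M N"
by (intro mod_isoI assms(1) bij_betwI[where g = g])
 (use assms mod_hom_closed[OF assms(1)] mod_hom_closed[OF assms(2)] in auto)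

text \<open>
Both kinds of tensor product are quotients of a free module by the span of a set of relations.
Such a module is generated by the classes of the generators, and a map on the generators that
respects the relations extends to it.
\<close>

definition presented :: "('r, 's) ring_scheme => 'p set => ('p => 'r) set => ('r, ('p => 'r) set) module"
where "presented R P Rel = quot_mod (free_mod R P) (span_mod R (free_mod R P) Rel)"

definition pres_gen :: "('r, 's) ring_scheme => 'p set => ('p => 'r) set => 'p => ('p => 'r) set"
where "pres_gen R P Rel p = span_mod R (free_mod R P) Rel +>\<^bsub>free_mod R P\<^esub> generator R p"

context
fixes R :: "('r, 's) ring_scheme" and P :: "'p set" and Rel :: "('p => 'r) set"
assumes R: "cring R" and Rel: "Rel <= carrier (free_mod R P)"
begin

interpretation R: cring R by (rule R)
interpretation F: module R "free_mod R P" by (rule free_mod_module[OF R])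

lemma presented_span: "submodule (span_mod R (free_mod R P) Rel) R (free_mod R P)"
by (rule span_mod_submodule[OF free_mod_module[OF R] Rel])

lemma presented_module: "module R (presented R P Rel)"
unfolding presented_def by (rule quot_mod_module[OF free_mod_module[OF R] presented_span])

lemma pres_gen_mem: "p \<in> P ==> pres_gen R P Rel p \<in> carrier (presented R P Rel)"
by (simp add: pres_gen_def presented_def coset_mem_quot_mod generator_mem[OF R])

lemma presented_generated:
assumes L: "submodule L R (presented R P Rel)" and gen: "!!p. p \<in> P ==> pres_gen R P Rel p \<in> L"
 and x: "x \<in> carrier (presented R P Rel)"
shows "x \<in> L"
proof -
let ?c = "%c. span_mod R (free_mod R P) Rel +>\<^bsub>free_mod R P\<^esub> c"
obtain c where c: "c \<in> carrier (free_mod R P)" "x = ?c c"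
 using x by (auto simp: presented_def quot_mod_carrier)
have "c \<in> {c \<in> carrier (free_mod R P). ?c c \<in> L}"
 using gen generator_mem[OF R]
 by (intro free_mod_span[OF R submodule_vimage[OF free_mod_module[OF R] presented_module _ L] _ c(1)])
 (auto simp: presented_def coset_mod_hom[OF free_mod_module[OF R] presented_span] pres_gen_def)
then show ?thesis using c by simp
qed

lemma pres_gen_add:
assumes "p \<in> P" "q \<in> P" "r \<in> P"
 and "generator R p \<ominus>\<^bsub>free_mod R P\<^esub> (generator R q \<oplus>\<^bsub>free_mod R P\<^esub> generator R r) \<in> Rel"
shows "pres_gen R P Rel p = pres_gen R P Rel q \<oplus>\<^bsub>presented R P Rel\<^esub> pres_gen R P Rel r"
proof -
note FM = free_mod_module[OF R, of P] and g = generator_mem[OF R, of _ P]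
have "pres_gen R P Rel q \<oplus>\<^bsub>presented R P Rel\<^esub> pres_gen R P Rel r =
 span_mod R (free_mod R P) Rel +>\<^bsub>free_mod R P\<^esub> (generator R q \<oplus>\<^bsub>free_mod R P\<^esub> generator R r)"
 unfolding presented_def pres_gen_def by (rule quot_mod_add[OF FM presented_span g g]) fact+
moreover have "\<dots> = pres_gen R P Rel p"
 unfolding pres_gen_def
 by (rule sym, rule iffD2[OF coset_eq_iff[OF FM presented_span g[OF assms(1)]
  F.a_closed[OF g[OF assms(2)] g[OF assms(3)]]]], rule subsetD[OF span_mod_superset assms(4)])
ultimately show ?thesis by simp
qed

lemma pres_gen_smult:
assumes "p \<in> P" "q \<in> P" "r \<in> carrier R"
 and "generator R p \<ominus>\<^bsub>free_mod R P\<^esub> r \<odot>\<^bsub>free_mod R P\<^esub> generator R q \<in> Rel"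
shows "pres_gen R P Rel p = r \<odot>\<^bsub>presented R P Rel\<^esub> pres_gen R P Rel q"
proof -
note FM = free_mod_module[OF R, of P] and g = generator_mem[OF R, of _ P]
have "r \<odot>\<^bsub>presented R P Rel\<^esub> pres_gen R P Rel q =
 span_mod R (free_mod R P) Rel +>\<^bsub>free_mod R P\<^esub> (r \<odot>\<^bsub>free_mod R P\<^esub> generator R q)"
 unfolding presented_def pres_gen_def by (rule quot_mod_smult[OF FM presented_span assms(3) g]) fact
moreover have "\<dots> = pres_gen R P Rel p"
 unfolding pres_gen_def
 by (rule sym, rule iffD2[OF coset_eq_iff[OF FM presented_span g[OF assms(1)]
  F.smult_closed[OF assms(3) g[OF assms(2)]]]], rule subsetD[OF span_mod_superset assms(4)])
ultimately show ?thesis by simp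
qed

lemma presented_extend:
assumes G: "module R G" and \<beta>: "!!p. p \<in> P ==> \<beta> p \<in> carrier G"
 and rel: "!!c. c \<in> Rel ==> lin_ext R G \<beta> c = \<zero>\<^bsub>G\<^esub>"
obtains \<phi> where "\<phi> \<in> mod_hom R (presented R P Rel) G" "!!p. p \<in> P ==> \<phi> (pres_gen R P Rel p) = \<beta> p"
proof
note FM = free_mod_module[OF R, of P]
have h: "lin_ext R G \<beta> \<in> mod_hom R (free_mod R P) G" by (rule lin_ext_hom[OF G \<beta>])
have e: "lin_ext R G \<beta> (generator R p) = \<beta> p" if "p \<in> P" for p by (rule lin_ext_generator[OF G \<beta> that])
have "span_mod R (free_mod R P) Rel <= {c \<in> carrier (free_mod R P). lin_ext R G \<beta> c = \<zero>\<^bsub>G\<^esub>}"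
 by (rule span_mod_least[OF submodule_kernel[OF FM G h]]) (use rel Rel in auto)
then have z: "lin_ext R G \<beta> c = \<zero>\<^bsub>G\<^esub>" if "c \<in> span_mod R (free_mod R P) Rel" for c using that by auto
show "quot_lift (lin_ext R G \<beta>) \<in> mod_hom R (presented R P Rel) G"
 unfolding presented_def by (rule quot_lift_hom[OF FM presented_span G h z])
show "quot_lift (lin_ext R G \<beta>) (pres_gen R P Rel p) = \<beta> p" if "p \<in> P" for p
 unfolding pres_gen_def using e[OF that]
 quot_lift_coset[OF FM presented_span G h z generator_mem[OF R that]] by simp
qed

lemma lin_ext_add_relation:
assumes G: "module R G" and \<beta>: "!!p. p \<in> P ==> \<beta> p \<in> carrier G"
 and p: "p \<in> P" "q \<in> P" "r \<in> P" and eq: "\<beta> p = \<beta> q \<oplus>\<^bsub>G\<^esub> \<beta> r"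
shows "lin_ext R G \<beta> (generator R p \<ominus>\<^bsub>free_mod R P\<^esub> (generator R q \<oplus>\<^bsub>free_mod R P\<^esub> generator R r)) = \<zero>\<^bsub>G\<^esub>"
proof -
interpret G: module R G by (rule G)
note FM = free_mod_module[OF R, of P] and g = generator_mem[OF R, of _ P]
have h: "lin_ext R G \<beta> \<in> mod_hom R (free_mod R P) G" by (rule lin_ext_hom[OF G \<beta>])
have e: "lin_ext R G \<beta> (generator R p) = \<beta> p" if "p \<in> P" for p by (rule lin_ext_generator[OF G \<beta> that])
have "lin_ext R G \<beta> (generator R q \<oplus>\<^bsub>free_mod R P\<^esub> generator R r) = \<beta> q \<oplus>\<^bsub>G\<^esub> \<beta> r"
 using mod_hom_add[OF h g[OF p(2)] g[OF p(3)]] e p by simp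
then show ?thesis
 using mod_hom_diff[OF FM G h g[OF p(1)] F.a_closed[OF g[OF p(2)] g[OF p(3)]]] e[OF p(1)] eq \<beta>[OF p(1)]
 by (simp add: G.diff_eq_zero_iff)
qed

lemma lin_ext_smult_relation:
assumes G: "module R G" and \<beta>: "!!p. p \<in> P ==> \<beta> p \<in> carrier G"
 and p: "p \<in> P" "q \<in> P" "r \<in> carrier R" and eq: "\<beta> p = r \<odot>\<^bsub>G\<^esub> \<beta> q"
shows "lin_ext R G \<beta> (generator R p \<ominus>\<^bsub>free_mod R P\<^esub> r \<odot>\<^bsub>free_mod R P\<^esub> generator R q) = \<zero>\<^bsub>G\<^esub>"
proof -
interpret G: module R G by (rule G)
note FM = free_mod_module[OF R, of P] and g = generator_mem[OF R, of _ P]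
have h: "lin_ext R G \<beta> \<in> mod_hom R (free_mod R P) G" by (rule lin_ext_hom[OF G \<beta>])
have e: "lin_ext R G \<beta> (generator R p) = \<beta> p" if "p \<in> P" for p by (rule lin_ext_generator[OF G \<beta> that])
have "lin_ext R G \<beta> (r \<odot>\<^bsub>free_mod R P\<^esub> generator R q) = r \<odot>\<^bsub>G\<^esub> \<beta> q"
 using mod_hom_smult[OF h p(3) g[OF p(2)]] e p by simp
then show ?thesis
 using mod_hom_diff[OF FM G h g[OF p(1)] F.smult_closed[OF p(3) g[OF p(2)]]] e[OF p(1)] eq \<beta>[OF p(1)]
 by (simp add: G.diff_eq_zero_iff)
qed

end

lemma free_mod_diff_mem:
"cring R ==> x \<in> carrier (free_mod R P) ==> y \<in> carrier (free_mod R P) ==>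
 x \<ominus>\<^bsub>free_mod R P\<^esub> y \<in> carrier (free_mod R P)"
by (rule abelian_group.minus_closed[OF module.axioms(2)[OF free_mod_module]])

lemma free_mod_add_mem:
"cring R ==> x \<in> carrier (free_mod R P) ==> y \<in> carrier (free_mod R P) ==>
 x \<oplus>\<^bsub>free_mod R P\<^esub> y \<in> carrier (free_mod R P)"
by (rule submodule_add_mem[OF submodule_self[OF free_mod_module]])

lemma free_mod_smult_mem:
"cring R ==> r \<in> carrier R ==> x \<in> carrier (free_mod R P) ==>
 r \<odot>\<^bsub>free_mod R P\<^esub> x \<in> carrier (free_mod R P)"
by (rule submodule_smult_mem[OF submodule_self[OF free_mod_module]])

lemma tensor_presented:
"tensor R M N = presented R (carrier M \<times> carrier N) (bilinear_relations R M N)"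
by (simp add: tensor_def presented_def Let_def)

lemma tensor_family_presented:
"tensor_family R I M = presented R (\<Pi>\<^sub>E k\<in>I. carrier (M k)) (multilinear_relations R I M)"
by (simp add: tensor_family_def presented_def Let_def)

lemma bilinear_relations_subset:
assumes "cring R" "module R M" "module R N"
shows "bilinear_relations R M N <= carrier (free_mod R (carrier M \<times> carrier N))"
proof -
interpret M: module R M by fact
interpret N: module R N by fact
show ?thesis unfolding bilinear_relations_def Let_def
 by (intro Un_least subsetI; elim CollectE exE conjE; hypsubst;
 intro free_mod_diff_mem[OF assms(1)] free_mod_add_mem[OF assms(1)]
  free_mod_smult_mem[OF assms(1)] generator_mem[OF assms(1)]; simp)
qed

lemma multilinear_relations_subset:
assumes "cring R" "!!k. k \<in> I ==> module R (M k)"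
shows "multilinear_relations R I M <= carrier (free_mod R (\<Pi>\<^sub>E k\<in>I. carrier (M k)))"
proof -
have "x \<oplus>\<^bsub>M k\<^esub> y \<in> carrier (M k)" if "k \<in> I" "x \<in> carrier (M k)" "y \<in> carrier (M k)" for k x y
 using that by (intro submodule_add_mem[OF submodule_self[OF assms(2)]])
moreover have "r \<odot>\<^bsub>M k\<^esub> x \<in> carrier (M k)" if "k \<in> I" "x \<in> carrier (M k)" "r \<in> carrier R" for k x r
 using that by (intro submodule_smult_mem[OF submodule_self[OF assms(2)]])
ultimately show ?thesis unfolding multilinear_relations_def Let_def
 by (intro Un_least subsetI; elim CollectE exE conjE; hypsubst;
 intro free_mod_diff_mem[OF assms(1)] free_mod_add_mem[OF assms(1)]
  free_mod_smult_mem[OF assms(1)] generator_mem[OF assms(1)];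
 auto simp: PiE_iff extensional_def)
qed

lemma tensor_free:
fixes R :: "('r, 's) ring_scheme" and M :: "('r, 'a) module" and N :: "('r, 'b) module"
assumes R: "cring R" and M: "module R M" and N: "module R N"
 and f: "f \<in> mod_iso R N (free_mod R W)" and W: "finite W"
shows "mod_isomorphic R (tensor R M N) (direct_sum W (%_. M))"
proof -
interpret M: module R M by fact
interpret N: module R N by fact
let ?P = "carrier M \<times> carrier N" and ?Rel = "bilinear_relations R M N"
let ?T = "presented R ?P ?Rel" and ?D = "direct_sum W (%_. M)"
note sub = bilinear_relations_subset[OF R M N]
note FM = free_mod_module[OF R]
have T: "module R ?T" by (rule presented_module[OF R sub])
interpret T: module R ?T by (rule T)
have D: "module R ?D" by (intro direct_sum_module R M)
interpret D: module R ?D by (rule D)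
define tn where "tn = (%x y. pres_gen R ?P ?Rel (x, y))"
have tn: "tn x y \<in> carrier ?T" if "x \<in> carrier M" "y \<in> carrier N" for x y
 unfolding tn_def using that by (intro pres_gen_mem[OF R sub]) auto
have tn_add1: "tn (x \<oplus>\<^bsub>M\<^esub> x') y = tn x y \<oplus>\<^bsub>?T\<^esub> tn x' y"
 if "x \<in> carrier M" "x' \<in> carrier M" "y \<in> carrier N" for x x' y
 unfolding tn_def using that
 by (intro pres_gen_add[OF R sub]) (auto simp: bilinear_relations_def Let_def simp del: free_mod_simps)
have tn_add2: "tn x (y \<oplus>\<^bsub>N\<^esub> y') = tn x y \<oplus>\<^bsub>?T\<^esub> tn x y'"
 if "x \<in> carrier M" "y' \<in> carrier N" "y \<in> carrier N" for x y y'
 unfolding tn_def using that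
 by (intro pres_gen_add[OF R sub]) (auto simp: bilinear_relations_def Let_def simp del: free_mod_simps)
have tn_smult1: "tn (r \<odot>\<^bsub>M\<^esub> x) y = r \<odot>\<^bsub>?T\<^esub> tn x y"
 if "x \<in> carrier M" "r \<in> carrier R" "y \<in> carrier N" for x r y
 unfolding tn_def using that
 by (intro pres_gen_smult[OF R sub]) (auto simp: bilinear_relations_def Let_def simp del: free_mod_simps)
have tn_smult2: "tn x (r \<odot>\<^bsub>N\<^esub> y) = r \<odot>\<^bsub>?T\<^esub> tn x y"
 if "x \<in> carrier M" "r \<in> carrier R" "y \<in> carrier N" for x r y
 unfolding tn_def using that
 by (intro pres_gen_smult[OF R sub]) (auto simp: bilinear_relations_def Let_def simp del: free_mod_simps)
have hom1: "(%x. tn x y) \<in> mod_hom R M ?T" if "y \<in> carrier N" for y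
 using that by (intro mod_homI) (auto simp: tn tn_add1 tn_smult1)
have hom2: "tn x \<in> mod_hom R N ?T" if "x \<in> carrier M" for x
 using that by (intro mod_homI) (auto simp: tn tn_add2 tn_smult2)
note fh = mod_iso_hom[OF f]
have fR: "f y w \<in> carrier R" if "y \<in> carrier N" for y w
 using mod_hom_closed[OF fh that] by (rule free_mod_closed)
define \<beta> where "\<beta> = (%(x, y). \<lambda>w\<in>W. f y w \<odot>\<^bsub>M\<^esub> x)"
have \<beta>: "\<beta> p \<in> carrier ?D" if "p \<in> ?P" for p
 using that W fR by (auto simp: \<beta>_def direct_sum_carrier)
have rel: "lin_ext R ?D \<beta> c = \<zero>\<^bsub>?D\<^esub>" if "c \<in> ?Rel" for c
 using that unfolding bilinear_relations_def Let_def
proof (elim UnE CollectE exE conjE; hypsubst)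
 fix x x' y assume a: "x \<in> carrier M" "x' \<in> carrier M" "y \<in> carrier N"
 show "lin_ext R ?D \<beta> (generator R (x \<oplus>\<^bsub>M\<^esub> x', y) \<ominus>\<^bsub>free_mod R ?P\<^esub>
 (generator R (x, y) \<oplus>\<^bsub>free_mod R ?P\<^esub> generator R (x', y))) = \<zero>\<^bsub>?D\<^esub>"
 by (rule lin_ext_add_relation[OF R sub D \<beta>])
  (use a in \<open>auto intro!: ext simp: \<beta>_def fR M.smult_r_distr\<close>)
next
 fix x y y' assume a: "x \<in> carrier M" "y \<in> carrier N" "y' \<in> carrier N"
 show "lin_ext R ?D \<beta> (generator R (x, y \<oplus>\<^bsub>N\<^esub> y') \<ominus>\<^bsub>free_mod R ?P\<^esub>
 (generator R (x, y) \<oplus>\<^bsub>free_mod R ?P\<^esub> generator R (x, y'))) = \<zero>\<^bsub>?D\<^esub>"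
 by (rule lin_ext_add_relation[OF R sub D \<beta>])
  (use a in \<open>auto intro!: ext simp: \<beta>_def fR M.smult_l_distr mod_hom_add[OF fh]\<close>)
next
 fix r x y assume a: "r \<in> carrier R" "x \<in> carrier M" "y \<in> carrier N"
 show "lin_ext R ?D \<beta> (generator R (r \<odot>\<^bsub>M\<^esub> x, y) \<ominus>\<^bsub>free_mod R ?P\<^esub>
 r \<odot>\<^bsub>free_mod R ?P\<^esub> generator R (x, y)) = \<zero>\<^bsub>?D\<^esub>"
 by (rule lin_ext_smult_relation[OF R sub D \<beta>])
  (use a in \<open>auto intro!: ext simp: \<beta>_def fR M.smult_assoc1[symmetric] M.R.m_comm\<close>)
 show "lin_ext R ?D \<beta> (generator R (x, r \<odot>\<^bsub>N\<^esub> y) \<ominus>\<^bsub>free_mod R ?P\<^esub>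
 r \<odot>\<^bsub>free_mod R ?P\<^esub> generator R (x, y)) = \<zero>\<^bsub>?D\<^esub>"
 by (rule lin_ext_smult_relation[OF R sub D \<beta>])
  (use a in \<open>auto intro!: ext simp: \<beta>_def fR M.smult_assoc1 mod_hom_smult[OF fh]\<close>)
qed
obtain \<phi> where \<phi>: "\<phi> \<in> mod_hom R ?T ?D" "!!p. p \<in> ?P ==> \<phi> (pres_gen R ?P ?Rel p) = \<beta> p"
 using presented_extend[OF R sub D \<beta> rel] by blast
have \<phi>tn: "\<phi> (tn x y) = (\<lambda>w\<in>W. f y w \<odot>\<^bsub>M\<^esub> x)" if "x \<in> carrier M" "y \<in> carrier N" for x y
 using \<phi>(2)[of "(x, y)"] that by (simp add: tn_def \<beta>_def)
define fi where "fi = inv_into (carrier N) f"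
have fi: "fi \<in> mod_iso R (free_mod R W) N" unfolding fi_def by (rule mod_iso_inverse[OF N f])
note fih = mod_iso_hom[OF fi]
have ffi: "f (fi c) = c" if "c \<in> carrier (free_mod R W)" for c
 using mod_iso_bij[OF f] that by (simp add: fi_def bij_betw_def f_inv_into_f)
have fif: "fi (f y) = y" if "y \<in> carrier N" for y
 using mod_iso_bij[OF f] that by (simp add: fi_def bij_betw_def)
define b where "b = (%w. fi (generator R w))"
have b: "b w \<in> carrier N" "f (b w) = generator R w" if "w \<in> W" for w
 using generator_mem[OF R that] ffi mod_hom_closed[OF fih] by (auto simp: b_def)
define \<psi> where "\<psi> = (%z. \<Oplus>\<^bsub>?T\<^esub>w\<in>W. tn (z w) (b w))"
have \<psi>: "\<psi> \<in> mod_hom R ?D ?T"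
proof (rule mod_homI)
 fix z assume z: "z \<in> carrier ?D"
 then have zc: "z w \<in> carrier M" if "w \<in> W" for w using that by (auto simp: direct_sum_carrier)
 show "\<psi> z \<in> carrier ?T" unfolding \<psi>_def using zc tn b by (intro T.finsum_closed) auto
 fix r assume r: "r \<in> carrier R"
 have "\<psi> (r \<odot>\<^bsub>?D\<^esub> z) = (\<Oplus>\<^bsub>?T\<^esub>w\<in>W. r \<odot>\<^bsub>?T\<^esub> tn (z w) (b w))"
 unfolding \<psi>_def using zc tn b r by (intro T.finsum_cong') (auto simp: tn_smult1)
 also have "\<dots> = r \<odot>\<^bsub>?T\<^esub> \<psi> z"
 unfolding \<psi>_def using zc tn b r W by (intro T.finsum_smult_ldistr[symmetric]) auto
 finally show "\<psi> (r \<odot>\<^bsub>?D\<^esub> z) = r \<odot>\<^bsub>?T\<^esub> \<psi> z" .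
next
 fix z z' assume z: "z \<in> carrier ?D" "z' \<in> carrier ?D"
 then have zc: "z w \<in> carrier M" "z' w \<in> carrier M" if "w \<in> W" for w
 using that by (auto simp: direct_sum_carrier)
 have "\<psi> (z \<oplus>\<^bsub>?D\<^esub> z') = (\<Oplus>\<^bsub>?T\<^esub>w\<in>W. tn (z w) (b w) \<oplus>\<^bsub>?T\<^esub> tn (z' w) (b w))"
 unfolding \<psi>_def using zc tn b by (intro T.finsum_cong') (auto simp: tn_add1)
 also have "\<dots> = \<psi> z \<oplus>\<^bsub>?T\<^esub> \<psi> z'"
 unfolding \<psi>_def using zc tn b by (intro T.finsum_addf) auto
 finally show "\<psi> (z \<oplus>\<^bsub>?D\<^esub> z') = \<psi> z \<oplus>\<^bsub>?T\<^esub> \<psi> z'" .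
qed
have \<phi>\<psi>: "\<phi> (\<psi> z) = z" if z: "z \<in> carrier ?D" for z
proof -
 have zc: "z w \<in> carrier M" if "w \<in> W" for w using that z by (auto simp: direct_sum_carrier)
 let ?s = "%w. (\<lambda>v\<in>W. if v = w then z w else \<zero>\<^bsub>M\<^esub>)"
 have s: "?s w \<in> carrier ?D" if "w \<in> W" for w using zc that W by (auto simp: direct_sum_carrier)
 have "\<phi> (tn (z w) (b w)) = ?s w" if "w \<in> W" for w
 using that zc b by (auto intro!: ext simp: \<phi>tn generator_def)
 then have "\<phi> (\<psi> z) = (\<Oplus>\<^bsub>?D\<^esub>w\<in>W. ?s w)"
 unfolding \<psi>_def using zc b tn s W
 by (subst mod_hom_finsum[OF T D \<phi>(1)]) (auto intro!: D.finsum_cong')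
 also have "\<dots> = z"
 proof
 fix v
 have fs: "(\<Oplus>\<^bsub>?D\<^esub>w\<in>W. ?s w) \<in> carrier ?D" using s by (intro D.finsum_closed) auto
 show "(\<Oplus>\<^bsub>?D\<^esub>w\<in>W. ?s w) v = z v"
 proof (cases "v \<in> W")
  case True
  have "(%g. g v) \<in> mod_hom R ?D M" using True by (intro mod_homI) (auto simp: direct_sum_carrier)
  then have "(\<Oplus>\<^bsub>?D\<^esub>w\<in>W. ?s w) v = (\<Oplus>\<^bsub>M\<^esub>w\<in>W. ?s w v)"
  using mod_hom_finsum[OF D M, of "%g. g v" W ?s] s W by blast
  also have "\<dots> = (\<Oplus>\<^bsub>M\<^esub>w\<in>W. if v = w then z w else \<zero>\<^bsub>M\<^esub>)"
  using True zc by (intro M.finsum_cong') auto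
  also have "\<dots> = z v" using True W zc by (intro M.finsum_singleton) auto
  finally show ?thesis .
 next
  case False then show ?thesis using fs z by (simp add: direct_sum_carrier extensional_def)
 qed
 qed
 finally show ?thesis .
qed
have pure: "\<psi> (\<phi> (tn x y)) = tn x y" if x: "x \<in> carrier M" and y: "y \<in> carrier N" for x y
proof -
 have A: "(%c. \<psi> (\<phi> (tn x (fi c)))) \<in> mod_hom R (free_mod R W) ?T"
 by (rule mod_hom_compose[OF mod_hom_compose[OF mod_hom_compose[OF fih hom2[OF x]] \<phi>(1)] \<psi>])
 have B: "(%c. tn x (fi c)) \<in> mod_hom R (free_mod R W) ?T" by (rule mod_hom_compose[OF fih hom2[OF x]])
 have gen: "\<psi> (\<phi> (tn x (fi (generator R w)))) = tn x (fi (generator R w))" if w: "w \<in> W" for w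
 proof -
 have z0: "tn \<zero>\<^bsub>M\<^esub> (b v) = \<zero>\<^bsub>?T\<^esub>" if "v \<in> W" for v
  using mod_hom_zero[OF M T hom1[OF b(1)[OF that]]] .
 have "\<psi> (\<phi> (tn x (b w))) = (\<Oplus>\<^bsub>?T\<^esub>v\<in>W. if w = v then tn x (b v) else \<zero>\<^bsub>?T\<^esub>)"
  unfolding \<psi>_def using x w b z0 tn by (intro T.finsum_cong') (auto simp: \<phi>tn generator_def)
 also have "\<dots> = tn x (b w)" using w W tn x b by (intro T.finsum_singleton) auto
 finally show ?thesis by (simp add: b_def)
 qed
 show ?thesis
 using free_mod_hom_eq[OF R T A B gen mod_hom_closed[OF fh y]] fif[OF y] by simp
qed
have idT: "(%x. x) \<in> mod_hom R ?T ?T" by (rule mod_homI) auto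
have "\<psi> (\<phi> t) = t" if t: "t \<in> carrier ?T" for t
proof -
 have "t \<in> {t \<in> carrier ?T. \<psi> (\<phi> t) = t}"
 proof (rule presented_generated[OF R sub submodule_equalizer[OF T T mod_hom_compose[OF \<phi>(1) \<psi>] idT] _ t])
 fix p assume "p \<in> ?P"
 then show "pres_gen R ?P ?Rel p \<in> {t \<in> carrier ?T. \<psi> (\<phi> t) = t}"
  using pure tn by (cases p) (auto simp: tn_def)
 qed
 then show ?thesis by simp
qed
then have "\<phi> \<in> mod_iso R ?T ?D" by (rule mod_iso_of_inverses[OF \<phi>(1) \<psi> _ \<phi>\<psi>])
then show ?thesis unfolding tensor_presented by (rule mod_isomorphicI)
qed

lemma (in comm_monoid) finprod_split_at:
assumes "finite I" "j \<in> I" "g \<in> I \<rightarrow> carrier G"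
shows "finprod G g I = g j \<otimes> finprod G g (I - {j})"
proof -
have "finprod G g (insert j (I - {j})) = g j \<otimes> finprod G g (I - {j})"
 using assms by (intro finprod_insert) auto
then show ?thesis using assms(2) by (simp add: insert_absorb)
qed

lemma (in cring) finprod_delta:
assumes "finite I"
shows "(\<Otimes>k\<in>I. if s k = t k then \<one> else \<zero>) = (if ALL k:I. s k = t k then \<one> else \<zero>)"
using assms
proof (induction I rule: finite_induct)
case (insert k I)
then show ?case by (subst finprod_insert) auto
qed auto

lemma tensor_family_free:
fixes R :: "('r, 's) ring_scheme" and M :: "'i => ('r, 'a) module" and T :: "'i => 't set"
assumes R: "cring R" and I: "finite I" and M: "!!k. k \<in> I ==> module R (M k)"
 and T: "!!k. k \<in> I ==> finite (T k)"
 and f: "!!k. k \<in> I ==> f k \<in> mod_iso R (M k) (free_mod R (T k))"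
shows "mod_isomorphic R (tensor_family R I M) (free_mod R (\<Pi>\<^sub>E k\<in>I. T k))"
proof -
interpret R: cring R by fact
let ?P = "\<Pi>\<^sub>E k\<in>I. carrier (M k)" and ?Rel = "multilinear_relations R I M" and ?W = "\<Pi>\<^sub>E k\<in>I. T k"
let ?T = "presented R ?P ?Rel" and ?F = "free_mod R ?W"
have sub: "?Rel <= carrier (free_mod R ?P)" by (rule multilinear_relations_subset[OF R M])
have Tm: "module R ?T" by (rule presented_module[OF R sub])
have F: "module R ?F" by (rule free_mod_module[OF R])
have finW: "finite ?W" using I T by (intro finite_PiE) auto
interpret T: module R ?T by (rule Tm)
have fh: "f k \<in> mod_hom R (M k) (free_mod R (T k))" if "k \<in> I" for k using f[OF that] by (rule mod_iso_hom)
have fc: "f k x \<in> carrier (free_mod R (T k))" if "k \<in> I" "x \<in> carrier (M k)" for k x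
 using mod_hom_closed[OF fh[OF that(1)] that(2)] .
have fR: "f k x t \<in> carrier R" if "k \<in> I" "x \<in> carrier (M k)" for k x t
 using fc[OF that] by (rule free_mod_closed)
have upd: "p(k := x) \<in> ?P" if "p \<in> ?P" "k \<in> I" "x \<in> carrier (M k)" for p k x
 using that by (auto simp: PiE_iff extensional_def)
have Mop: "x \<oplus>\<^bsub>M k\<^esub> y \<in> carrier (M k)" "r \<odot>\<^bsub>M k\<^esub> x \<in> carrier (M k)"
 if "k \<in> I" "x \<in> carrier (M k)" "y \<in> carrier (M k)" "r \<in> carrier R" for k x y r
 using that submodule_add_mem[OF submodule_self[OF M[OF that(1)]]]
 submodule_smult_mem[OF submodule_self[OF M[OF that(1)]]] by simp_all
define cl where "cl = pres_gen R ?P ?Rel"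
have cl: "cl p \<in> carrier ?T" if "p \<in> ?P" for p
 unfolding cl_def by (rule pres_gen_mem[OF R sub that])
have cl_hom: "(%x. cl (p(k := x))) \<in> mod_hom R (M k) ?T" if p: "p \<in> ?P" "k \<in> I" for p k
proof (rule mod_homI)
 fix x assume x: "x \<in> carrier (M k)"
 show "cl (p(k := x)) \<in> carrier ?T" by (rule cl[OF upd[OF p x]])
 show "cl (p(k := r \<odot>\<^bsub>M k\<^esub> x)) = r \<odot>\<^bsub>?T\<^esub> cl (p(k := x))" if r: "r \<in> carrier R" for r
 unfolding cl_def
 proof (rule pres_gen_smult[OF R sub upd[OF p Mop(2)[OF p(2) x x r]] upd[OF p x] r])
 show "generator R (p(k := r \<odot>\<^bsub>M k\<^esub> x)) \<ominus>\<^bsub>free_mod R ?P\<^esub> r \<odot>\<^bsub>free_mod R ?P\<^esub> generator R (p(k := x)) \<in> ?Rel"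
  unfolding multilinear_relations_def Let_def
  by (intro UnI2 CollectI exI[of _ p] exI[of _ k] exI[of _ r] exI[of _ x] conjI refl p x r)
 qed
 show "cl (p(k := x \<oplus>\<^bsub>M k\<^esub> y)) = cl (p(k := x)) \<oplus>\<^bsub>?T\<^esub> cl (p(k := y))" if y: "y \<in> carrier (M k)" for y
 unfolding cl_def
 proof (rule pres_gen_add[OF R sub upd[OF p Mop(1)[OF p(2) x y R.one_closed]] upd[OF p x] upd[OF p y]])
 show "generator R (p(k := x \<oplus>\<^bsub>M k\<^esub> y)) \<ominus>\<^bsub>free_mod R ?P\<^esub>
  (generator R (p(k := x)) \<oplus>\<^bsub>free_mod R ?P\<^esub> generator R (p(k := y))) \<in> ?Rel"
  unfolding multilinear_relations_def Let_def
  by (intro UnI1 CollectI exI[of _ p] exI[of _ k] exI[of _ x] exI[of _ y] conjI refl p x y)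
 qed
qed
define \<beta> where "\<beta> = (%p t. if t \<in> ?W then \<Otimes>\<^bsub>R\<^esub>k\<in>I. f k (p k) (t k) else \<zero>\<^bsub>R\<^esub>)"
have \<beta>: "\<beta> p \<in> carrier ?F" if "p \<in> ?P" for p
 using that fR by (auto simp: free_mod_carrier_finite[OF finW] \<beta>_def PiE_iff intro!: R.finprod_closed)
have \<beta>upd: "\<beta> (p(k := x)) t = (if t \<in> ?W then f k x (t k) \<otimes>\<^bsub>R\<^esub> (\<Otimes>\<^bsub>R\<^esub>j\<in>I - {k}. f j (p j) (t j)) else \<zero>\<^bsub>R\<^esub>)"
 if p: "p \<in> ?P" "k \<in> I" "x \<in> carrier (M k)" for p k x t
proof -
 have "(\<Otimes>\<^bsub>R\<^esub>j\<in>I. f j ((p(k := x)) j) (t j)) =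
 f k x (t k) \<otimes>\<^bsub>R\<^esub> (\<Otimes>\<^bsub>R\<^esub>j\<in>I - {k}. f j ((p(k := x)) j) (t j))"
 using p fR by (subst R.finprod_split_at[OF I p(2)]) (auto simp: PiE_iff)
 also have "(\<Otimes>\<^bsub>R\<^esub>j\<in>I - {k}. f j ((p(k := x)) j) (t j)) = (\<Otimes>\<^bsub>R\<^esub>j\<in>I - {k}. f j (p j) (t j))"
 using p fR by (intro R.finprod_cong') (auto simp: PiE_iff)
 finally show ?thesis by (simp add: \<beta>_def)
qed
have rest: "(\<Otimes>\<^bsub>R\<^esub>j\<in>I - {k}. f j (p j) (t j)) \<in> carrier R" if "p \<in> ?P" for p k t
 using that fR by (intro R.finprod_closed) (auto simp: PiE_iff)
have rel: "lin_ext R ?F \<beta> c = \<zero>\<^bsub>?F\<^esub>" if "c \<in> ?Rel" for c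
 using that unfolding multilinear_relations_def Let_def
proof (elim UnE CollectE exE conjE; hypsubst)
 fix p k x y assume a: "p \<in> ?P" "k \<in> I" "x \<in> carrier (M k)" "y \<in> carrier (M k)"
 note Mo = Mop(1)[OF a(2-4) R.one_closed]
 show "lin_ext R ?F \<beta> (generator R (p(k := x \<oplus>\<^bsub>M k\<^esub> y)) \<ominus>\<^bsub>free_mod R ?P\<^esub>
 (generator R (p(k := x)) \<oplus>\<^bsub>free_mod R ?P\<^esub> generator R (p(k := y)))) = \<zero>\<^bsub>?F\<^esub>"
 proof (rule lin_ext_add_relation[OF R sub F \<beta>])
 show "\<beta> (p(k := x \<oplus>\<^bsub>M k\<^esub> y)) = \<beta> (p(k := x)) \<oplus>\<^bsub>?F\<^esub> \<beta> (p(k := y))"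
  using a Mo rest[OF a(1)] fR
  by (intro ext) (simp add: \<beta>upd mod_hom_add[OF fh[OF a(2)]] R.l_distr del: fun_upd_apply)
 qed (use a Mo upd in auto)
next
 fix p k r x assume a: "p \<in> ?P" "k \<in> I" "r \<in> carrier R" "x \<in> carrier (M k)"
 note Mo = Mop(2)[OF a(2) a(4) a(4) a(3)]
 show "lin_ext R ?F \<beta> (generator R (p(k := r \<odot>\<^bsub>M k\<^esub> x)) \<ominus>\<^bsub>free_mod R ?P\<^esub>
 r \<odot>\<^bsub>free_mod R ?P\<^esub> generator R (p(k := x))) = \<zero>\<^bsub>?F\<^esub>"
 proof (rule lin_ext_smult_relation[OF R sub F \<beta>])
 show "\<beta> (p(k := r \<odot>\<^bsub>M k\<^esub> x)) = r \<odot>\<^bsub>?F\<^esub> \<beta> (p(k := x))"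
  using a Mo rest[OF a(1)] fR
  by (intro ext) (simp add: \<beta>upd mod_hom_smult[OF fh[OF a(2)]] R.m_assoc del: fun_upd_apply)
 qed (use a Mo upd in auto)
qed
obtain \<phi> where \<phi>: "\<phi> \<in> mod_hom R ?T ?F" "!!p. p \<in> ?P ==> \<phi> (cl p) = \<beta> p"
 unfolding cl_def using presented_extend[OF R sub F \<beta> rel] by metis
define fi where "fi = (%k. inv_into (carrier (M k)) (f k))"
have fih: "fi k \<in> mod_hom R (free_mod R (T k)) (M k)" if "k \<in> I" for k
 unfolding fi_def by (rule mod_iso_hom[OF mod_iso_inverse[OF M[OF that] f[OF that]]])
have ffi: "f k (fi k c) = c" if "k \<in> I" "c \<in> carrier (free_mod R (T k))" for k c
 using mod_iso_bij[OF f[OF that(1)]] that(2) by (simp add: fi_def bij_betw_def f_inv_into_f)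
have fif: "fi k (f k y) = y" if "k \<in> I" "y \<in> carrier (M k)" for k y
 using mod_iso_bij[OF f[OF that(1)]] that(2) by (simp add: fi_def bij_betw_def)
have fic: "fi k (generator R s) \<in> carrier (M k)" if "k \<in> I" "s \<in> T k" for k s
 using mod_hom_closed[OF fih[OF that(1)] generator_mem[OF R that(2)]] .
define bb where "bb = (%t. \<lambda>k\<in>I. fi k (generator R (t k)))"
have bb: "bb t \<in> ?P" if "t \<in> ?W" for t using that fic by (auto simp: bb_def PiE_iff)
define \<psi> where "\<psi> = lin_ext R ?T (%t. cl (bb t))"
have \<psi>: "\<psi> \<in> mod_hom R ?F ?T" unfolding \<psi>_def by (rule lin_ext_hom[OF Tm]) (rule cl[OF bb])
have \<psi>gen: "\<psi> (generator R t) = cl (bb t)" if "t \<in> ?W" for t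
 unfolding \<psi>_def by (rule lin_ext_generator[OF Tm _ that]) (rule cl[OF bb])
have \<phi>bb: "\<phi> (cl (bb t)) = generator R t" if t: "t \<in> ?W" for t
proof
 fix s
 have "(\<Otimes>\<^bsub>R\<^esub>k\<in>I. f k (bb t k) (s k)) = (\<Otimes>\<^bsub>R\<^esub>k\<in>I. if s k = t k then \<one>\<^bsub>R\<^esub> else \<zero>\<^bsub>R\<^esub>)"
 proof (rule R.finprod_cong'[OF refl])
 fix k assume k: "k \<in> I"
 then have "t k \<in> T k" using t by auto
 then show "f k (bb t k) (s k) = (if s k = t k then \<one>\<^bsub>R\<^esub> else \<zero>\<^bsub>R\<^esub>)"
  using k ffi[OF k generator_mem[OF R]] by (simp add: bb_def generator_def)
 qed auto
 then have "\<beta> (bb t) s = (if s \<in> ?W & (ALL k:I. s k = t k) then \<one>\<^bsub>R\<^esub> else \<zero>\<^bsub>R\<^esub>)"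
 by (simp add: \<beta>_def R.finprod_delta[OF I])
 also have "\<dots> = generator R t s"
 proof -
 have "s \<in> ?W & (ALL k:I. s k = t k) \<longleftrightarrow> s = t" using t PiE_ext[of s I T t] by metis
 then show ?thesis by (simp only: generator_def)
 qed
 finally show "\<phi> (cl (bb t)) s = generator R t s" using \<phi>(2)[OF bb[OF t]] by simp
qed
have idF: "(%x. x) \<in> mod_hom R ?F ?F" and idT: "(%x. x) \<in> mod_hom R ?T ?T"
 by (simp_all add: mod_hom_def)
have 1: "\<phi> (\<psi> c) = c" if c: "c \<in> carrier ?F" for c
 by (rule free_mod_hom_eq[OF R F mod_hom_compose[OF \<psi> \<phi>(1)] idF _ c])
 (simp add: \<psi>gen \<phi>bb)
\<comment> \<open>The factors are expanded in their bases one at a time; \<open>J\<close> holds the ones already treated.\<close>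
have gen: "\<psi> (\<phi> (cl p)) = cl p"
 if "J <= I" "p \<in> ?P" "ALL k:I - J. EX s:T k. p k = fi k (generator R s)" for J p
 using finite_subset[OF that(1) I] that
proof (induction J arbitrary: p rule: finite_induct)
 case empty
 then obtain t where t: "!!k. k \<in> I ==> t k \<in> T k & p k = fi k (generator R (t k))" by simp metis
 let ?t = "restrict t I"
 have "?t \<in> ?W" using t by auto
 moreover have "p = bb ?t"
 proof
 fix k show "p k = bb ?t k"
  using t empty.prems(2) by (cases "k \<in> I") (auto simp: bb_def PiE_iff extensional_def)
 qed
 ultimately show ?case using \<phi>bb \<psi>gen by simp
next
 case (insert j J)
 then have j: "j \<in> I" by auto
 then have pj: "p j \<in> carrier (M j)" using insert.prems by auto
 have h: "(%c. cl (p(j := fi j c))) \<in> mod_hom R (free_mod R (T j)) ?T"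
 by (rule mod_hom_compose[OF fih[OF j] cl_hom[OF insert.prems(2) j]])
 have "\<psi> (\<phi> (cl (p(j := fi j (f j (p j)))))) = cl (p(j := fi j (f j (p j))))"
 proof (rule free_mod_hom_eq[OF R Tm mod_hom_compose[OF mod_hom_compose[OF h \<phi>(1)] \<psi>] h _ fc[OF j pj]])
 fix s assume s: "s \<in> T j"
 show "\<psi> (\<phi> (cl (p(j := fi j (generator R s))))) = cl (p(j := fi j (generator R s)))"
 proof (rule insert.IH)
  show "p(j := fi j (generator R s)) \<in> ?P" using upd[OF insert.prems(2) j fic[OF j s]] .
  show "ALL k:I - J. EX sa:T k. (p(j := fi j (generator R s))) k = fi k (generator R sa)"
  using insert.prems(3) s by auto
 qed (use insert.prems in auto)
 qed
 then show ?case using fif[OF j pj] by simp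
qed
have 2: "\<psi> (\<phi> t) = t" if t: "t \<in> carrier ?T" for t
proof -
 have "t \<in> {t \<in> carrier ?T. \<psi> (\<phi> t) = t}"
 by (rule presented_generated[OF R sub submodule_equalizer[OF Tm Tm mod_hom_compose[OF \<phi>(1) \<psi>] idT] _ t])
  (use gen[of I] cl in \<open>simp add: cl_def[symmetric]\<close>)
 then show ?thesis by simp
qed
have "\<phi> \<in> mod_iso R ?T ?F" by (rule mod_iso_of_inverses[OF \<phi>(1) \<psi> 2 1])
then show ?thesis unfolding tensor_family_presented by (rule mod_isomorphicI)
qed

lemma tensor_module: "cring R ==> module R M ==> module R N ==> module R (tensor R M N)"
unfolding tensor_presented by (intro presented_module bilinear_relations_subset)

lemma tensor_family_module:
"cring R ==> (!!k. k \<in> I ==> module R (M k)) ==> module R (tensor_family R I M)"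
unfolding tensor_family_presented by (intro presented_module multilinear_relations_subset)

section \<open>Finite sums and matrices over a ring\<close>

context cring begin

lemma finsum_single:
assumes "finite S" "!!t. t \<in> S ==> f t \<in> carrier R" "!!t. t \<in> S ==> t ~= s ==> f t = \<zero>"
shows "(\<Oplus>t\<in>S. f t) = (if s \<in> S then f s else \<zero>)"
proof (cases "s \<in> S")
case True
have "(\<Oplus>t\<in>S. f t) = (\<Oplus>t\<in>S. if s = t then f t else \<zero>)"
 using assms by (intro finsum_cong') auto
also have "\<dots> = f s" using True assms by (intro finsum_singleton) auto
finally show ?thesis using True by simp
next
case False
have "(\<Oplus>t\<in>S. f t) = (\<Oplus>t\<in>S. \<zero>)" using assms False by (intro finsum_cong') auto
then show ?thesis using False by simp
qed

lemma finsum_swap: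
assumes "finite I" "finite J" "!!i j. i \<in> I ==> j \<in> J ==> f i j \<in> carrier R"
shows "(\<Oplus>i\<in>I. \<Oplus>j\<in>J. f i j) = (\<Oplus>j\<in>J. \<Oplus>i\<in>I. f i j)"
using assms(1,3)
proof (induction I rule: finite_induct)
case (insert a I)
have 1: "(%i. \<Oplus>j\<in>J. f i j) \<in> I \<rightarrow> carrier R" "(\<Oplus>j\<in>J. f a j) \<in> carrier R"
 using insert.prems by auto
have "(\<Oplus>j\<in>J. \<Oplus>i\<in>insert a I. f i j) = (\<Oplus>j\<in>J. f a j \<oplus> (\<Oplus>i\<in>I. f i j))"
 using insert by (intro finsum_cong') (auto simp: Pi_def)
also have "\<dots> = (\<Oplus>j\<in>J. f a j) \<oplus> (\<Oplus>j\<in>J. \<Oplus>i\<in>I. f i j)"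
 using insert.prems by (intro finsum_addf) (auto intro!: finsum_closed)
also have "\<dots> = (\<Oplus>i\<in>insert a I. \<Oplus>j\<in>J. f i j)"
 using insert 1 by simp
finally show ?case by simp
qed simp

end

definition mat_app :: "('r, 's) ring_scheme => 'a set => 'b set => ('a => 'b => 'r) => ('b => 'r) => 'a => 'r"
where "mat_app R T S D c t = (if t \<in> T then \<Oplus>\<^bsub>R\<^esub>s\<in>S. D t s \<otimes>\<^bsub>R\<^esub> c s else \<zero>\<^bsub>R\<^esub>)"

definition mat_mul :: "('r, 's) ring_scheme => 'b set => ('a => 'b => 'r) => ('b => 'c => 'r) => 'a => 'c => 'r"
where "mat_mul R S D E t u = (\<Oplus>\<^bsub>R\<^esub>s\<in>S. D t s \<otimes>\<^bsub>R\<^esub> E s u)"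

definition delta :: "('r, 's) ring_scheme => 'a => 'a => 'r"
where "delta R s t = (if s = t then \<one>\<^bsub>R\<^esub> else \<zero>\<^bsub>R\<^esub>)"

definition is_mat :: "('r, 's) ring_scheme => 'a set => 'b set => ('a => 'b => 'r) => bool"
where "is_mat R T S D \<longleftrightarrow> finite T & finite S & (ALL t:T. ALL s:S. D t s \<in> carrier R)"

lemma is_matD: "is_mat R T S D ==> t \<in> T ==> s \<in> S ==> D t s \<in> carrier R"
by (simp add: is_mat_def)

lemma is_mat_transpose: "is_mat R T S D ==> is_mat R S T (%s t. D t s)"
by (simp add: is_mat_def)

context cring begin

lemma delta_closed [simp]: "delta R s t \<in> carrier R"
by (simp add: delta_def)

lemma mat_mul_closed: "is_mat R T S D ==> is_mat R S U E ==> t \<in> T ==> u \<in> U ==> mat_mul R S D E t u \<in> carrier R"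
unfolding mat_mul_def by (intro finsum_closed) (auto simp: is_matD)

lemma is_mat_mul: "is_mat R T S D ==> is_mat R S U E ==> is_mat R T U (mat_mul R S D E)"
using mat_mul_closed[of T S D U E] by (auto simp: is_mat_def)

lemma mat_app_mem:
assumes "is_mat R T S D" "c \<in> carrier (free_mod R S)"
shows "mat_app R T S D c \<in> carrier (free_mod R T)"
using assms by (auto simp: free_mod_carrier_finite is_mat_def mat_app_def intro!: finsum_closed m_closed)

lemma mat_app_hom:
assumes "is_mat R T S D"
shows "mat_app R T S D \<in> mod_hom R (free_mod R S) (free_mod R T)"
proof (intro mod_homI mat_app_mem assms)
have D: "D t s \<in> carrier R" if "t \<in> T" "s \<in> S" for t s using assms that by (rule is_matD)
show "mat_app R T S D (c \<oplus>\<^bsub>free_mod R S\<^esub> d) = mat_app R T S D c \<oplus>\<^bsub>free_mod R T\<^esub> mat_app R T S D d"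
 if c: "c \<in> carrier (free_mod R S)" and d: "d \<in> carrier (free_mod R S)" for c d
proof
 fix t
 have "(\<Oplus>s\<in>S. D t s \<otimes> (c s \<oplus> d s)) = (\<Oplus>s\<in>S. D t s \<otimes> c s) \<oplus> (\<Oplus>s\<in>S. D t s \<otimes> d s)" if "t \<in> T"
 proof -
 have "(\<Oplus>s\<in>S. D t s \<otimes> (c s \<oplus> d s)) = (\<Oplus>s\<in>S. D t s \<otimes> c s \<oplus> D t s \<otimes> d s)"
  using that D free_mod_closed[OF c] free_mod_closed[OF d] by (intro finsum_cong') (auto simp: r_distr)
 also have "\<dots> = (\<Oplus>s\<in>S. D t s \<otimes> c s) \<oplus> (\<Oplus>s\<in>S. D t s \<otimes> d s)"
  using that D free_mod_closed[OF c] free_mod_closed[OF d] by (intro finsum_addf) auto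
 finally show ?thesis .
 qed
 then show "mat_app R T S D (c \<oplus>\<^bsub>free_mod R S\<^esub> d) t =
  (mat_app R T S D c \<oplus>\<^bsub>free_mod R T\<^esub> mat_app R T S D d) t"
 by (simp add: mat_app_def)
qed
show "mat_app R T S D (r \<odot>\<^bsub>free_mod R S\<^esub> c) = r \<odot>\<^bsub>free_mod R T\<^esub> mat_app R T S D c"
 if r: "r \<in> carrier R" and c: "c \<in> carrier (free_mod R S)" for r c
proof
 fix t
 have "(\<Oplus>s\<in>S. D t s \<otimes> (r \<otimes> c s)) = r \<otimes> (\<Oplus>s\<in>S. D t s \<otimes> c s)" if "t \<in> T"
 using that D free_mod_closed[OF c] r assms
 by (subst finsum_rdistr) (auto simp: is_mat_def m_lcomm intro!: finsum_cong')
 then show "mat_app R T S D (r \<odot>\<^bsub>free_mod R S\<^esub> c) t = (r \<odot>\<^bsub>free_mod R T\<^esub> mat_app R T S D c) t"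
 using r by (simp add: mat_app_def)
qed
qed

lemma mat_app_mul:
assumes "is_mat R T S D" "is_mat R U T E" "c \<in> carrier (free_mod R S)"
shows "mat_app R U T E (mat_app R T S D c) = mat_app R U S (mat_mul R T E D) c"
proof
fix u
have fin: "finite S" "finite T" using assms by (auto simp: is_mat_def)
have c: "c s \<in> carrier R" for s using free_mod_closed[OF assms(3)] .
show "mat_app R U T E (mat_app R T S D c) u = mat_app R U S (mat_mul R T E D) c u"
proof (cases "u \<in> U")
 case True
 note D = is_matD[OF assms(1)] and E = is_matD[OF assms(2) True]
 have "(\<Oplus>t\<in>T. E u t \<otimes> mat_app R T S D c t) = (\<Oplus>t\<in>T. \<Oplus>s\<in>S. E u t \<otimes> (D t s \<otimes> c s))"
 using D E c fin by (intro finsum_cong') (auto simp: mat_app_def finsum_rdistr)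
 also have "\<dots> = (\<Oplus>s\<in>S. \<Oplus>t\<in>T. E u t \<otimes> (D t s \<otimes> c s))"
 using D E c fin by (intro finsum_swap) auto
 also have "\<dots> = (\<Oplus>s\<in>S. (\<Oplus>t\<in>T. E u t \<otimes> D t s) \<otimes> c s)"
 using D E c fin by (intro finsum_cong') (auto simp: finsum_ldistr m_assoc intro!: finsum_cong')
 finally show ?thesis using True by (simp add: mat_app_def mat_mul_def)
qed (simp add: mat_app_def)
qed

lemma mat_app_generator:
assumes "is_mat R T S D" "s \<in> S" "t \<in> T"
shows "mat_app R T S D (generator R s) t = D t s"
proof -
have "(\<Oplus>u\<in>S. D t u \<otimes> generator R s u) = (if s \<in> S then D t s \<otimes> generator R s s else \<zero>)"
 using assms is_matD[OF assms(1,3)] by (intro finsum_single) (auto simp: generator_def is_mat_def)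
then show ?thesis using assms is_matD[OF assms(1,3,2)] by (simp add: mat_app_def)
qed

lemma mat_app_cong:
assumes "!!t s. t \<in> T ==> s \<in> S ==> D t s = E t s" "is_mat R T S E" "c \<in> carrier (free_mod R S)"
shows "mat_app R T S D c = mat_app R T S E c"
using assms free_mod_closed[OF assms(3)]
by (intro ext) (auto simp: mat_app_def is_matD intro!: finsum_cong')

lemma mat_mul_transpose:
"is_mat R B A N ==> is_mat R A C M ==> v \<in> B ==> u \<in> C ==>
 mat_mul R A (%u a. M a u) (%a v. N v a) u v = mat_mul R A N M v u"
by (auto simp: mat_mul_def is_matD m_comm intro!: finsum_cong')

lemma mat_app_delta:
assumes "finite S" "c \<in> carrier (free_mod R S)"
shows "mat_app R S S (delta R) c = c"
proof
fix t
have "(\<Oplus>s\<in>S. delta R t s \<otimes> c s) = (if t \<in> S then delta R t t \<otimes> c t else \<zero>)"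
 using assms free_mod_closed[OF assms(2)] by (intro finsum_single) (auto simp: delta_def)
then show "mat_app R S S (delta R) c t = c t"
 using free_mod_outside[OF assms(2)] free_mod_closed[OF assms(2)] by (simp add: mat_app_def delta_def)
qed

end

section \<open>Based complexes\<close>

text \<open>
A finite based complex is a finite graded set with the matrix of a differential of degree \<open>-1\<close>.
Transposing the matrix and negating the degrees turns chains into cochains, so each statement
about homology below also covers cohomology.
\<close>

definition mchains :: "('r, 's) ring_scheme => 'a set => ('a => int) => int => ('r, 'a => 'r) module"
where "mchains R S sz d = free_mod R {s \<in> S. sz s = d}"

definition mcycles :: "('r, 's) ring_scheme => 'a set => ('a => int) => ('a => 'a => 'r) => int => ('a => 'r) set"
where "mcycles R S sz D d = {c \<in> carrier (mchains R S sz d). mat_app R S S D c = (%_. \<zero>\<^bsub>R\<^esub>)}"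

definition mbounds :: "('r, 's) ring_scheme => 'a set => ('a => int) => ('a => 'a => 'r) => int => ('a => 'r) set"
where "mbounds R S sz D d = mat_app R S S D ` carrier (mchains R S sz (d + 1))"

definition mhom :: "('r, 's) ring_scheme => 'a set => ('a => int) => ('a => 'a => 'r) => int => ('r, ('a => 'r) set) module"
where "mhom R S sz D d = quot_mod (restrict_mod (mchains R S sz d) (mcycles R S sz D d)) (mbounds R S sz D d)"

definition mcomplex :: "('r, 's) ring_scheme => 'a set => ('a => int) => ('a => 'a => 'r) => bool"
where "mcomplex R S sz D \<longleftrightarrow> is_mat R S S D &
 (ALL s:S. ALL t:S. D s t ~= \<zero>\<^bsub>R\<^esub> --> sz t = sz s + 1) &
 (ALL s:S. ALL t:S. mat_mul R S D D s t = \<zero>\<^bsub>R\<^esub>)"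

lemma mcomplex_mat: "mcomplex R S sz D ==> is_mat R S S D"
by (simp add: mcomplex_def)

lemma mcomplex_finite: "mcomplex R S sz D ==> finite S"
by (simp add: mcomplex_def is_mat_def)

lemma mchains_carrier:
"finite S ==> c \<in> carrier (mchains R S sz d) \<longleftrightarrow>
 (ALL x. c x \<in> carrier R) & (ALL x. x \<in> S & sz x = d | c x = \<zero>\<^bsub>R\<^esub>)"
by (auto simp: mchains_def free_mod_carrier_finite)

lemma mchains_simps [simp]:
"\<zero>\<^bsub>mchains R S sz d\<^esub> = (%_. \<zero>\<^bsub>R\<^esub>)" "f \<oplus>\<^bsub>mchains R S sz d\<^esub> g = (%x. f x \<oplus>\<^bsub>R\<^esub> g x)"
"r \<odot>\<^bsub>mchains R S sz d\<^esub> f = (%x. r \<otimes>\<^bsub>R\<^esub> f x)"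
by (simp_all add: mchains_def)

lemma mchains_subset: "finite S ==> c \<in> carrier (mchains R S sz d) ==> c \<in> carrier (free_mod R S)"
by (auto simp: mchains_carrier free_mod_carrier_finite)

context cring begin

lemma mchains_module: "module R (mchains R S sz d)"
unfolding mchains_def by (rule free_mod_module[OF is_cring])

lemma mcomplex_square:
assumes "mcomplex R S sz D" "c \<in> carrier (free_mod R S)"
shows "mat_app R S S D (mat_app R S S D c) = (%_. \<zero>)"
proof -
note D = mcomplex_mat[OF assms(1)]
have "mat_app R S S D (mat_app R S S D c) = mat_app R S S (%_ _. \<zero>) c"
 unfolding mat_app_mul[OF D D assms(2)] using assms
 by (intro mat_app_cong) (auto simp: mcomplex_def is_mat_def)
also have "\<dots> = (%_. \<zero>)" using free_mod_closed[OF assms(2)] by (auto simp: mat_app_def)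
finally show ?thesis .
qed

lemma mcomplex_degree:
assumes C: "mcomplex R S sz D" and c: "c \<in> carrier (mchains R S sz (d + 1))"
shows "mat_app R S S D c \<in> carrier (mchains R S sz d)"
proof -
note fin = mcomplex_finite[OF C] and D = mcomplex_mat[OF C]
have "mat_app R S S D c x = \<zero>" if "x \<in> S" "sz x ~= d" for x
proof -
 have "D x s \<otimes> c s = \<zero>" if s: "s \<in> S" for s
 proof (cases "sz s = d + 1")
 case True
 then have "D x s = \<zero>" using C s \<open>x \<in> S\<close> \<open>sz x ~= d\<close> by (auto simp: mcomplex_def)
 then show ?thesis using c fin by (simp add: mchains_carrier)
 next
 case False
 then have "c s = \<zero>" using c fin by (auto simp: mchains_carrier)
 then show ?thesis using is_matD[OF D \<open>x \<in> S\<close> s] by simp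
 qed
 then have "(\<Oplus>s\<in>S. D x s \<otimes> c s) = (\<Oplus>s\<in>S. \<zero>)" by (intro finsum_cong') auto
 then show ?thesis by (simp add: mat_app_def)
qed
then show ?thesis
 using mat_app_mem[OF D mchains_subset[OF fin c]] fin
 by (auto simp: mchains_carrier free_mod_carrier_finite)
qed

lemma mat_app_mchains_hom:
assumes "is_mat R T S D"
shows "mat_app R T S D \<in> mod_hom R (mchains R S sz d) (free_mod R T)"
proof -
have fin: "finite S" using assms by (simp add: is_mat_def)
note h = mat_app_hom[OF assms] and s = mchains_subset[OF fin, of _ R sz d]
show ?thesis
 using mod_hom_add[OF h s s] mod_hom_smult[OF h _ s] mod_hom_closed[OF h s] by (intro mod_homI) auto
qed

lemma mcycles_submodule:
assumes "mcomplex R S sz D"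
shows "submodule (mcycles R S sz D d) R (mchains R S sz d)"
using submodule_kernel[OF mchains_module free_mod_module[OF is_cring] mat_app_mchains_hom[OF mcomplex_mat[OF assms]]]
by (simp add: mcycles_def)

lemma mbounds_subset: "mcomplex R S sz D ==> mbounds R S sz D d <= mcycles R S sz D d"
by (auto simp: mbounds_def mcycles_def mcomplex_degree mcomplex_square mchains_subset mcomplex_finite)

lemma mbounds_submodule:
assumes "mcomplex R S sz D"
shows "submodule (mbounds R S sz D d) R (mchains R S sz d)"
proof -
have "mat_app R S S D \<in> mod_hom R (mchains R S sz (d + 1)) (mchains R S sz d)"
 using mat_app_mchains_hom[OF mcomplex_mat[OF assms], of sz "d + 1"] mcomplex_degree[OF assms]
 by (auto simp: mod_hom_def)
then show ?thesis unfolding mbounds_def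
 by (intro submodule_image[OF mchains_module mchains_module _ submodule_self[OF mchains_module]])
qed

lemma mcycles_module: "mcomplex R S sz D ==> module R (restrict_mod (mchains R S sz d) (mcycles R S sz D d))"
by (intro restrict_mod_module mchains_module mcycles_submodule)

lemma mbounds_submodule_mcycles:
"mcomplex R S sz D ==> submodule (mbounds R S sz D d) R (restrict_mod (mchains R S sz d) (mcycles R S sz D d))"
by (intro submodule_restrict mchains_module mbounds_submodule mcycles_submodule mbounds_subset)

lemma mhom_module: "mcomplex R S sz D ==> module R (mhom R S sz D d)"
unfolding mhom_def by (intro quot_mod_module mcycles_module mbounds_submodule_mcycles)

end

text \<open>The matrices \<open>V\<close> and \<open>W\<close> are inverse to each other; \<open>V\<close> has the new basis as its columns.\<close>

definition base_change :: "('r, 's) ring_scheme => 'a set => ('a => int) => ('a => 'a => 'r) =>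
 'b set => ('b => int) => ('b => 'b => 'r) => ('a => 'b => 'r) => ('b => 'a => 'r) => bool"
where "base_change R S sz D T tz E V W \<longleftrightarrow>
 is_mat R S T V & is_mat R T S W & is_mat R T T E &
 (ALL s:S. ALL t:T. V s t ~= \<zero>\<^bsub>R\<^esub> --> sz s = tz t) &
 (ALL t:T. ALL s:S. W t s ~= \<zero>\<^bsub>R\<^esub> --> sz s = tz t) &
 (ALL s:S. ALL s':S. mat_mul R T V W s s' = delta R s s') &
 (ALL t:T. ALL t':T. mat_mul R S W V t t' = delta R t t') &
 (ALL s:S. ALL t:T. mat_mul R S D V s t = mat_mul R T V E s t)"

lemma mchains_iff:
"finite S ==> c \<in> carrier (mchains R S sz d) \<longleftrightarrow>
 c \<in> carrier (free_mod R S) & (ALL x:S. sz x ~= d --> c x = \<zero>\<^bsub>R\<^esub>)"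
by (auto simp: mchains_carrier free_mod_carrier_finite)

context cring begin

lemma mat_app_degree:
assumes V: "is_mat R S T V" and deg: "!!s t. s \<in> S ==> t \<in> T ==> V s t ~= \<zero> ==> tz t = d ==> sz s = e"
 and c: "c \<in> carrier (mchains R T tz d)"
shows "mat_app R S T V c \<in> carrier (mchains R S sz e)"
proof -
have fin: "finite S" "finite T" using V by (auto simp: is_mat_def)
note cT = mchains_subset[OF fin(2) c]
have "mat_app R S T V c s = \<zero>" if s: "s \<in> S" "sz s ~= e" for s
proof -
 have "V s t \<otimes> c t = \<zero>" if t: "t \<in> T" for t
 proof (cases "tz t = d")
 case True
 then have "V s t = \<zero>" using deg s t by blast
 then show ?thesis using free_mod_closed[OF cT] by simp
 next
 case False
 then have "c t = \<zero>" using c t fin by (auto simp: mchains_iff)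
 then show ?thesis using is_matD[OF V s(1) t] by simp
 qed
 then have "(\<Oplus>t\<in>T. V s t \<otimes> c t) = (\<Oplus>t\<in>T. \<zero>)" by (intro finsum_cong') auto
 then show ?thesis by (simp add: mat_app_def)
qed
then show ?thesis using mat_app_mem[OF V cT] fin by (simp add: mchains_iff)
qed

context
fixes S :: "'x set" and sz :: "'x => int" and D :: "'x => 'x => 'a"
 and T :: "'y set" and tz :: "'y => int" and E :: "'y => 'y => 'a"
 and V :: "'x => 'y => 'a" and W :: "'y => 'x => 'a"
assumes C: "mcomplex R S sz D" and bc: "base_change R S sz D T tz E V W"
begin

lemma bc_mats: "is_mat R S S D" "is_mat R T T E" "is_mat R S T V" "is_mat R T S W"
using C bc by (auto simp: mcomplex_def base_change_def)

lemma bc_finite: "finite S" "finite T"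
using bc_mats by (auto simp: is_mat_def)

lemma bc_VW: "c \<in> carrier (free_mod R S) ==> mat_app R S T V (mat_app R T S W c) = c"
using bc bc_mats(3,4) bc_finite
by (simp add: mat_app_mul mat_app_cong[of S S "mat_mul R T V W" "delta R"] base_change_def is_mat_def mat_app_delta)

lemma bc_WV: "c \<in> carrier (free_mod R T) ==> mat_app R T S W (mat_app R S T V c) = c"
using bc bc_mats(3,4) bc_finite
by (simp add: mat_app_mul mat_app_cong[of T T "mat_mul R S W V" "delta R"] base_change_def is_mat_def mat_app_delta)

lemma bc_DV:
assumes "c \<in> carrier (free_mod R T)"
shows "mat_app R S S D (mat_app R S T V c) = mat_app R S T V (mat_app R T T E c)"
proof -
have "mat_app R S S D (mat_app R S T V c) = mat_app R S T (mat_mul R S D V) c"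
 by (rule mat_app_mul[OF bc_mats(3,1) assms])
also have "\<dots> = mat_app R S T (mat_mul R T V E) c"
 using bc is_mat_mul[OF bc_mats(3,2)] assms by (intro mat_app_cong) (auto simp: base_change_def)
also have "\<dots> = mat_app R S T V (mat_app R T T E c)"
 by (rule mat_app_mul[OF bc_mats(2,3) assms, symmetric])
finally show ?thesis .
qed

lemma bc_WD:
assumes "c \<in> carrier (free_mod R S)"
shows "mat_app R T S W (mat_app R S S D c) = mat_app R T T E (mat_app R T S W c)"
using bc_VW[OF assms] bc_DV[OF mat_app_mem[OF bc_mats(4) assms]]
 bc_WV[OF mat_app_mem[OF bc_mats(2) mat_app_mem[OF bc_mats(4) assms]]] by simp

lemma bc_W_mem: "c \<in> carrier (mchains R S sz d) ==> mat_app R T S W c \<in> carrier (mchains R T tz d)"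
using bc by (intro mat_app_degree[OF bc_mats(4)]) (auto simp: base_change_def)

lemma bc_V_mem: "c \<in> carrier (mchains R T tz d) ==> mat_app R S T V c \<in> carrier (mchains R S sz d)"
using bc by (intro mat_app_degree[OF bc_mats(3)]) (auto simp: base_change_def)

lemma mat_app_zero: "is_mat R A B M ==> mat_app R A B M (%_. \<zero>) = (%_. \<zero>)"
using mod_hom_zero[OF free_mod_module free_mod_module mat_app_hom] by (simp add: is_cring)

lemma bc_W_cycles: "c \<in> mcycles R S sz D d ==> mat_app R T S W c \<in> mcycles R T tz E d"
using bc_WD[of c, symmetric] bc_W_mem[of c d] mchains_subset[OF bc_finite(1), of c R sz d]
by (simp add: mcycles_def mat_app_zero[OF bc_mats(4)])

lemma bc_V_cycles: "c \<in> mcycles R T tz E d ==> mat_app R S T V c \<in> mcycles R S sz D d"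
using bc_DV[of c] bc_V_mem[of c d] mchains_subset[OF bc_finite(2), of c R tz d]
by (simp add: mcycles_def mat_app_zero[OF bc_mats(3)])

lemma bc_W_bounds:
assumes "c \<in> mbounds R S sz D d" shows "mat_app R T S W c \<in> mbounds R T tz E d"
proof -
obtain b where b: "b \<in> carrier (mchains R S sz (d + 1))" "c = mat_app R S S D b"
 using assms by (auto simp: mbounds_def)
then show ?thesis
 using bc_WD[OF mchains_subset[OF bc_finite(1) b(1)]] bc_W_mem[OF b(1)] by (auto simp: mbounds_def)
qed

lemma bc_V_bounds:
assumes "c \<in> mbounds R T tz E d" shows "mat_app R S T V c \<in> mbounds R S sz D d"
proof -
obtain b where b: "b \<in> carrier (mchains R T tz (d + 1))" "c = mat_app R T T E b"
 using assms by (auto simp: mbounds_def)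
then show ?thesis
 using bc_DV[OF mchains_subset[OF bc_finite(2) b(1)], symmetric] bc_V_mem[OF b(1)] by (auto simp: mbounds_def)
qed

lemma bc_W_bounds_iff:
assumes "c \<in> carrier (free_mod R S)"
shows "mat_app R T S W c \<in> mbounds R T tz E d \<longleftrightarrow> c \<in> mbounds R S sz D d"
using bc_W_bounds bc_V_bounds[of "mat_app R T S W c" d] bc_VW[OF assms] by auto

lemma bc_mcomplex:
assumes "!!t t'. t \<in> T ==> t' \<in> T ==> E t t' ~= \<zero> ==> tz t' = tz t + 1"
shows "mcomplex R T tz E"
proof -
have "mat_mul R T E E t t' = \<zero>" if t: "t \<in> T" "t' \<in> T" for t t'
proof -
 note g = generator_mem[OF is_cring t(2)]
 note Vg = mat_app_mem[OF bc_mats(3) g] and Eg = mat_app_mem[OF bc_mats(2) g]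
 have "mat_app R T T E (mat_app R T T E (generator R t')) =
 mat_app R T S W (mat_app R S S D (mat_app R S S D (mat_app R S T V (generator R t'))))"
 using bc_DV[OF g] bc_DV[OF Eg] bc_WV[OF mat_app_mem[OF bc_mats(2) Eg]] by simp
 also have "\<dots> = (%_. \<zero>)" using mcomplex_square[OF C Vg] mat_app_zero[OF bc_mats(4)] by simp
 finally have "mat_app R T T (mat_mul R T E E) (generator R t') t = \<zero>"
 using mat_app_mul[OF bc_mats(2,2) g] by simp
 then show ?thesis using mat_app_generator[OF is_mat_mul[OF bc_mats(2,2)]] t by simp
qed
then show ?thesis using assms bc_mats by (auto simp: mcomplex_def)
qed

lemma base_change_transpose:
"base_change R S (%s. - sz s) (%s t. D t s) T (%t. - tz t) (%s t. E t s) (%s t. W t s) (%t s. V s t)"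
proof -
have "mat_mul R T E W t s = mat_mul R S W D t s" if "s \<in> S" "t \<in> T" for s t
proof -
 note g = generator_mem[OF is_cring that(1)]
 have "mat_app R T S (mat_mul R S W D) (generator R s) = mat_app R T S (mat_mul R T E W) (generator R s)"
 using bc_WD[OF g] mat_app_mul[OF bc_mats(1,4) g] mat_app_mul[OF bc_mats(4,2) g] by simp
 then show ?thesis
 using mat_app_generator[OF is_mat_mul[OF bc_mats(4,1)] that]
  mat_app_generator[OF is_mat_mul[OF bc_mats(2,4)] that] by simp
qed
moreover have "mat_mul R T (%s t. W t s) (%t s. V s t) s s' = mat_mul R T V W s' s" if "s \<in> S" "s' \<in> S" for s s'
 using that bc_mats by (intro mat_mul_transpose) auto
moreover have "mat_mul R S (%t s. V s t) (%s t. W t s) t t' = mat_mul R S W V t' t" if "t \<in> T" "t' \<in> T" for t t'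
 using that bc_mats by (intro mat_mul_transpose) auto
moreover have "mat_mul R S (%s t. D t s) (%s t. W t s) s t = mat_mul R S W D t s" if "s \<in> S" "t \<in> T" for s t
 using that bc_mats by (intro mat_mul_transpose) auto
moreover have "mat_mul R T (%s t. W t s) (%s t. E t s) s t = mat_mul R T E W t s" if "s \<in> S" "t \<in> T" for s t
 using that bc_mats by (intro mat_mul_transpose) auto
ultimately show ?thesis
 using bc bc_mats by (auto simp: base_change_def delta_def is_mat_transpose)
qed

theorem base_change_iso:
assumes E: "mcomplex R T tz E"
shows "mod_isomorphic R (mhom R S sz D d) (mhom R T tz E d)"
unfolding mhom_def[of R S]
proof (rule quot_mod_isomorphic[OF mcycles_module[OF C] mbounds_submodule_mcycles[OF C] mhom_module[OF E]])
let ?Z = "restrict_mod (mchains R T tz d) (mcycles R T tz E d)"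
let ?f = "%c. mbounds R T tz E d +>\<^bsub>?Z\<^esub> mat_app R T S W c"
note Zm = mcycles_module[OF E] and Bm = mbounds_submodule_mcycles[OF E]
have "mat_app R T S W \<in> mod_hom R (restrict_mod (mchains R S sz d) (mcycles R S sz D d)) ?Z"
 using mat_app_mchains_hom[OF bc_mats(4), of sz d] submodule_subset[OF mcycles_submodule[OF C]] bc_W_cycles
 by (auto simp: mod_hom_def subset_iff)
from mod_hom_compose[OF this coset_mod_hom[OF Zm Bm]]
show "?f \<in> mod_hom R (restrict_mod (mchains R S sz d) (mcycles R S sz D d)) (mhom R T tz E d)"
 by (simp add: mhom_def)
show "?f c = \<zero>\<^bsub>mhom R T tz E d\<^esub> \<longleftrightarrow> c \<in> mbounds R S sz D d"
 if c: "c \<in> carrier (restrict_mod (mchains R S sz d) (mcycles R S sz D d))" for c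
proof -
 have "c \<in> carrier (free_mod R S)" using c mchains_subset[OF bc_finite(1)] by (auto simp: mcycles_def)
 then show ?thesis using coset_eq_zero_iff[OF Zm Bm] bc_W_cycles c bc_W_bounds_iff by (simp add: mhom_def)
qed
show "EX c:carrier (restrict_mod (mchains R S sz d) (mcycles R S sz D d)). ?f c = y"
 if y: "y \<in> carrier (mhom R T tz E d)" for y
proof -
 obtain c where c: "c \<in> mcycles R T tz E d" "y = mbounds R T tz E d +>\<^bsub>?Z\<^esub> c"
 using y by (auto simp: mhom_def quot_mod_carrier)
 then have "mat_app R T S W (mat_app R S T V c) = c"
 using mchains_subset[OF bc_finite(2)] by (intro bc_WV) (auto simp: mcycles_def)
 then show ?thesis using c bc_V_cycles by (intro bexI[of _ "mat_app R S T V c"]) auto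
qed
qed

end

end

context cring begin

text \<open>Renaming the basis and rescaling it by self-inverse units.\<close>

lemma base_change_relabel:
assumes C: "mcomplex R S sz D" and \<phi>: "bij_betw \<phi> S T" and E: "is_mat R T T E"
 and \<epsilon>: "!!s. s \<in> S ==> \<epsilon> s \<in> carrier R" "!!s. s \<in> S ==> \<epsilon> s \<otimes> \<epsilon> s = \<one>"
 and deg: "!!s. s \<in> S ==> tz (\<phi> s) = sz s"
 and DE: "!!s t. s \<in> S ==> t \<in> S ==> D s t \<otimes> \<epsilon> t = \<epsilon> s \<otimes> E (\<phi> s) (\<phi> t)"
shows "base_change R S sz D T tz E (%s t. if \<phi> s = t then \<epsilon> s else \<zero>) (%t s. if \<phi> s = t then \<epsilon> s else \<zero>)"
proof -
have fin: "finite S" "finite T" using mcomplex_finite[OF C] E by (auto simp: is_mat_def)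
note D = is_matD[OF mcomplex_mat[OF C]] and Ec = is_matD[OF E]
have \<phi>T: "\<phi> s \<in> T" if "s \<in> S" for s using \<phi> that by (auto simp: bij_betw_def)
have inj: "\<phi> s = \<phi> t \<longleftrightarrow> s = t" if "s \<in> S" "t \<in> S" for s t
 using \<phi> that by (auto simp: bij_betw_def inj_on_def)
let ?V = "%s t. if \<phi> s = t then \<epsilon> s else \<zero>" and ?W = "%t s. if \<phi> s = t then \<epsilon> s else \<zero>"
have "mat_mul R T ?V ?W s s' = delta R s s'" if s: "s \<in> S" "s' \<in> S" for s s'
proof -
 have "mat_mul R T ?V ?W s s' = (if \<phi> s \<in> T then ?V s (\<phi> s) \<otimes> ?W (\<phi> s) s' else \<zero>)"
 unfolding mat_mul_def using fin s \<epsilon> by (intro finsum_single) auto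
 then show ?thesis using s \<epsilon> \<phi>T inj by (auto simp: delta_def)
qed
moreover have "mat_mul R S ?W ?V t t' = delta R t t'" if t: "t \<in> T" "t' \<in> T" for t t'
proof -
 obtain s where s: "s \<in> S" "t = \<phi> s" using t \<phi> by (auto simp: bij_betw_def)
 have "mat_mul R S ?W ?V t t' = (if s \<in> S then ?W t s \<otimes> ?V s t' else \<zero>)"
 unfolding mat_mul_def using fin s \<epsilon> inj by (intro finsum_single) auto
 then show ?thesis using s \<epsilon> by (auto simp: delta_def)
qed
moreover have "mat_mul R S D ?V s t = mat_mul R T ?V E s t" if st: "s \<in> S" "t \<in> T" for s t
proof -
 obtain u where u: "u \<in> S" "t = \<phi> u" using st \<phi> by (auto simp: bij_betw_def)
 have "mat_mul R S D ?V s t = (if u \<in> S then D s u \<otimes> ?V u t else \<zero>)"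
 unfolding mat_mul_def using fin u \<epsilon> inj D st by (intro finsum_single) auto
 moreover have "mat_mul R T ?V E s t = (if \<phi> s \<in> T then ?V s (\<phi> s) \<otimes> E (\<phi> s) t else \<zero>)"
 unfolding mat_mul_def using fin \<epsilon> st Ec by (intro finsum_single) auto
 ultimately show ?thesis using u st DE \<phi>T by simp
qed
ultimately show ?thesis
 using fin \<epsilon> deg E by (auto simp: base_change_def is_mat_def)
qed

lemma contractible_trivial:
assumes C: "mcomplex R S sz D" and H: "is_mat R S S H"
 and deg: "!!s t. s \<in> S ==> t \<in> S ==> H s t ~= \<zero> ==> sz s = sz t + 1"
 and htpy: "!!s t. s \<in> S ==> t \<in> S ==> mat_mul R S D H s t \<oplus> mat_mul R S H D s t = delta R s t"
shows "carrier (mhom R S sz D d) = {\<zero>\<^bsub>mhom R S sz D d\<^esub>}"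
proof -
let ?Z = "restrict_mod (mchains R S sz d) (mcycles R S sz D d)"
note Zm = mcycles_module[OF C, of d] and Bm = mbounds_submodule_mcycles[OF C, of d]
note D = mcomplex_mat[OF C] and fin = mcomplex_finite[OF C]
have "c \<in> mbounds R S sz D d" if c: "c \<in> mcycles R S sz D d" for c
proof -
 have cS: "c \<in> carrier (mchains R S sz d)" "c \<in> carrier (free_mod R S)"
 and z: "mat_app R S S D c = (%_. \<zero>)"
 using c mchains_subset[OF fin] by (auto simp: mcycles_def)
 have "mat_app R S S D (mat_app R S S H c) = c"
 proof
 fix s
 show "mat_app R S S D (mat_app R S S H c) s = c s"
 proof (cases "s \<in> S")
  case True
  have "mat_app R S S H (mat_app R S S D c) s = \<zero>"
  unfolding z using is_matD[OF H True] True by (auto simp: mat_app_def intro!: add.finprod_one_eqI)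
  then have "(\<Oplus>t\<in>S. mat_mul R S H D s t \<otimes> c t) = \<zero>"
  using mat_app_mul[OF D H cS(2)] True by (simp add: mat_app_def)
  moreover have "(\<Oplus>t\<in>S. (mat_mul R S D H s t \<oplus> mat_mul R S H D s t) \<otimes> c t) =
   (\<Oplus>t\<in>S. mat_mul R S D H s t \<otimes> c t) \<oplus> (\<Oplus>t\<in>S. mat_mul R S H D s t \<otimes> c t)"
  proof -
  note cl = mat_mul_closed[OF D H True] mat_mul_closed[OF H D True] free_mod_closed[OF cS(2)]
  have "(\<Oplus>t\<in>S. (mat_mul R S D H s t \<oplus> mat_mul R S H D s t) \<otimes> c t) =
   (\<Oplus>t\<in>S. mat_mul R S D H s t \<otimes> c t \<oplus> mat_mul R S H D s t \<otimes> c t)"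
   using cl by (intro finsum_cong') (auto simp: l_distr)
  also have "\<dots> = (\<Oplus>t\<in>S. mat_mul R S D H s t \<otimes> c t) \<oplus> (\<Oplus>t\<in>S. mat_mul R S H D s t \<otimes> c t)"
   using cl by (intro finsum_addf) auto
  finally show ?thesis .
  qed
  moreover have "(\<Oplus>t\<in>S. (mat_mul R S D H s t \<oplus> mat_mul R S H D s t) \<otimes> c t) = mat_app R S S (delta R) c s"
  using True htpy free_mod_closed[OF cS(2)] by (auto simp: mat_app_def intro!: finsum_cong')
  moreover have "(\<Oplus>t\<in>S. mat_mul R S D H s t \<otimes> c t) \<in> carrier R"
  using mat_mul_closed[OF D H True] free_mod_closed[OF cS(2)] by (intro finsum_closed) auto
  ultimately have "(\<Oplus>t\<in>S. mat_mul R S D H s t \<otimes> c t) = c s"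
  using mat_app_delta[OF fin cS(2)] by simp
  then show ?thesis using mat_app_mul[OF H D cS(2)] True by (simp add: mat_app_def)
 next
  case False then show ?thesis using free_mod_outside[OF cS(2)] by (simp add: mat_app_def)
 qed
 qed
 moreover have "mat_app R S S H c \<in> carrier (mchains R S sz (d + 1))"
 using deg cS(1) by (intro mat_app_degree[OF H]) auto
 ultimately show ?thesis unfolding mbounds_def by (metis image_eqI)
qed
then have "mbounds R S sz D d +>\<^bsub>?Z\<^esub> c = mbounds R S sz D d" if "c \<in> mcycles R S sz D d" for c
 using coset_eq_zero_iff[OF Zm Bm] that by simp
moreover have "mcycles R S sz D d ~= {}" using submodule_zero_mem[OF mcycles_submodule[OF C]] by blast
ultimately show ?thesis by (auto simp: mhom_def quot_mod_carrier)
qed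

lemma mcomplex_transpose:
assumes "mcomplex R S sz D" shows "mcomplex R S (%s. - sz s) (%s t. D t s)"
proof -
have D: "is_mat R S S D" using assms by (rule mcomplex_mat)
then have "mat_mul R S (%s t. D t s) (%s t. D t s) s t = mat_mul R S D D t s" if "s \<in> S" "t \<in> S" for s t
 using mat_mul_transpose[OF D D] that by blast
then show ?thesis using assms is_mat_transpose[OF D] by (auto simp: mcomplex_def)
qed

lemma contractible_trivial_transpose:
assumes C: "mcomplex R S sz D" and H: "is_mat R S S H"
 and deg: "!!s t. s \<in> S ==> t \<in> S ==> H s t ~= \<zero> ==> sz s = sz t + 1"
 and htpy: "!!s t. s \<in> S ==> t \<in> S ==> mat_mul R S D H s t \<oplus> mat_mul R S H D s t = delta R s t"
shows "carrier (mhom R S (%s. - sz s) (%s t. D t s) d) = {\<zero>\<^bsub>mhom R S (%s. - sz s) (%s t. D t s) d\<^esub>}"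
proof (rule contractible_trivial[OF mcomplex_transpose[OF C] is_mat_transpose[OF H]])
note D = mcomplex_mat[OF C]
fix s t assume st: "s \<in> S" "t \<in> S"
show "mat_mul R S (%s t. D t s) (%s t. H t s) s t \<oplus> mat_mul R S (%s t. H t s) (%s t. D t s) s t = delta R s t"
 using mat_mul_transpose[OF D H, of s t] mat_mul_transpose[OF H D] htpy[OF st(2,1)] st
 mat_mul_closed[OF D H st(2,1)] mat_mul_closed[OF H D st(2,1)]
 by (simp add: mat_mul_transpose[OF H D] mat_mul_transpose[OF D H] a_comm delta_def)
show "- sz s = - sz t + 1" if "H t s ~= \<zero>" using deg[OF st(2,1) that] by simp
qed

subsection \<open>Decomposition into blocks\<close>

context
fixes S :: "'x set" and sz :: "'x => int" and D :: "'x => 'x => 'a" and blk :: "'x => 'i" and I :: "'i set"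
assumes C: "mcomplex R S sz D" and fin: "finite I" and blk: "!!s. s \<in> S ==> blk s \<in> I"
 and off: "!!s t. s \<in> S ==> t \<in> S ==> D s t ~= \<zero> ==> blk s = blk t"
begin

definition block_part :: "'i => 'x set" where "block_part i = {s \<in> S. blk s = i}"

definition block_proj :: "'i => ('x => 'a) => 'x => 'a"
where "block_proj i c x = (if x \<in> block_part i then c x else \<zero>)"

lemma block_sum:
assumes "s \<in> block_part i" "!!t. t \<in> S ==> c t \<in> carrier R"
shows "(\<Oplus>t\<in>block_part i. D s t \<otimes> c t) = (\<Oplus>t\<in>S. D s t \<otimes> c t)"
proof (rule add.finprod_mono_neutral_cong_left)
show "finite S" using mcomplex_finite[OF C] .
show "D s t \<otimes> c t = \<zero>" if t: "t \<in> S - block_part i" for t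
proof -
 have "D s t = \<zero>" using t off[of s t] assms(1) by (cases "D s t = \<zero>") (auto simp: block_part_def)
 then show "D s t \<otimes> c t = \<zero>" using assms(2) t by simp
qed
qed (use assms is_matD[OF mcomplex_mat[OF C]] in \<open>auto simp: block_part_def\<close>)

lemma block_mcomplex: "mcomplex R (block_part i) sz D"
proof -
have D: "D s t \<in> carrier R" if "s \<in> S" "t \<in> S" for s t using is_matD[OF mcomplex_mat[OF C]] that by blast
have "mat_mul R (block_part i) D D s t = mat_mul R S D D s t" if "s \<in> block_part i" "t \<in> block_part i" for s t
 using block_sum[OF that(1), of "%u. D u t"] D that by (auto simp: mat_mul_def block_part_def)
then show ?thesis using C by (auto simp: mcomplex_def is_mat_def block_part_def)
qed

lemma block_proj_mchains:
assumes "c \<in> carrier (mchains R S sz d)"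
shows "block_proj i c \<in> carrier (mchains R (block_part i) sz d)"
using assms mcomplex_finite[OF C] mcomplex_finite[OF block_mcomplex]
by (auto simp: mchains_carrier block_proj_def block_part_def)

lemma block_proj_app:
assumes "c \<in> carrier (free_mod R S)"
shows "block_proj i (mat_app R S S D c) = mat_app R (block_part i) (block_part i) D (block_proj i c)"
proof
fix s
show "block_proj i (mat_app R S S D c) s = mat_app R (block_part i) (block_part i) D (block_proj i c) s"
proof (cases "s \<in> block_part i")
 case True
 then have "s \<in> S" by (simp add: block_part_def)
 have D: "D s t \<in> carrier R" if "t \<in> block_part i" for t
 using is_matD[OF mcomplex_mat[OF C] \<open>s \<in> S\<close>] that by (simp add: block_part_def)
 have 1: "(%t. D s t \<otimes> c t) \<in> block_part i \<rightarrow> carrier R"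
 by (rule Pi_I, rule m_closed, erule D, rule free_mod_closed[OF assms])
 have 2: "D s t \<otimes> block_proj i c t = D s t \<otimes> c t" if "t \<in> block_part i" for t
 using that by (simp only: block_proj_def if_True)
 have "(\<Oplus>t\<in>block_part i. D s t \<otimes> block_proj i c t) = (\<Oplus>t\<in>block_part i. D s t \<otimes> c t)"
 by (rule finsum_cong'[OF refl 1 2])
 also have "\<dots> = (\<Oplus>t\<in>S. D s t \<otimes> c t)" by (rule block_sum[OF True free_mod_closed[OF assms]])
 finally show ?thesis using True \<open>s \<in> S\<close> by (simp only: mat_app_def block_proj_def[of i "mat_app R S S D c"] if_True)
qed (simp add: mat_app_def block_proj_def)
qed

lemma block_glue:
assumes e: "!!i. i \<in> I ==> e i \<in> carrier (mchains R (block_part i) sz d)"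
defines "c \<equiv> %x. if x \<in> S then e (blk x) x else \<zero>"
shows "c \<in> carrier (mchains R S sz d)" "!!i. i \<in> I ==> block_proj i c = e i"
proof -
have f: "finite (block_part i)" for i using mcomplex_finite[OF block_mcomplex] .
show "c \<in> carrier (mchains R S sz d)"
 unfolding mchains_carrier[OF mcomplex_finite[OF C]]
proof (intro conjI allI)
 fix x
 show "c x \<in> carrier R" "x \<in> S & sz x = d | c x = \<zero>"
 using e[of "blk x"] blk[of x] by (auto simp: mchains_carrier[OF f] c_def)
qed
show "block_proj i c = e i" if "i \<in> I" for i
proof
 fix x
 have "e i x = \<zero>" if "x \<notin> block_part i" using e[OF \<open>i \<in> I\<close>] that by (auto simp: mchains_carrier[OF f])
 then show "block_proj i c x = e i x" by (auto simp: c_def block_proj_def block_part_def)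
qed
qed

lemma block_ext:
assumes "c \<in> carrier (free_mod R S)" "c' \<in> carrier (free_mod R S)" "!!i. i \<in> I ==> block_proj i c = block_proj i c'"
shows "c = c'"
proof
fix x show "c x = c' x"
proof (cases "x \<in> S")
 case True
 then show ?thesis using fun_cong[OF assms(3)[OF blk[OF True]], of x] by (simp add: block_proj_def block_part_def)
qed (use free_mod_outside[OF assms(1)] free_mod_outside[OF assms(2)] in simp)
qed

theorem block_decomposition:
"mod_isomorphic R (mhom R S sz D d) (direct_sum I (%i. mhom R (block_part i) sz D d))"
unfolding mhom_def[of R S]
proof (rule quot_mod_isomorphic[OF mcycles_module[OF C] mbounds_submodule_mcycles[OF C]])
let ?Z = "restrict_mod (mchains R S sz d) (mcycles R S sz D d)"
let ?Zi = "%i. restrict_mod (mchains R (block_part i) sz d) (mcycles R (block_part i) sz D d)"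
let ?B = "%i. mbounds R (block_part i) sz D d"
let ?G = "direct_sum I (%i. mhom R (block_part i) sz D d)"
let ?f = "%c. \<lambda>i\<in>I. ?B i +>\<^bsub>?Zi i\<^esub> block_proj i c"
note Cb = block_mcomplex
note Zm = mcycles_module[OF Cb] and Bm = mbounds_submodule_mcycles[OF Cb]
note finS = mcomplex_finite[OF C] and finb = mcomplex_finite[OF Cb]
have zero: "mat_app R T T D (%_. \<zero>) = (%_. \<zero>)" if "is_mat R T T D" for T
 using mod_hom_zero[OF free_mod_module free_mod_module mat_app_hom[OF that]] by (simp add: is_cring)
have Zi: "block_proj i c \<in> mcycles R (block_part i) sz D d" if c: "c \<in> mcycles R S sz D d" for c i
proof -
 have "c \<in> carrier (mchains R S sz d)" "mat_app R S S D c = (%_. \<zero>)" using c by (auto simp: mcycles_def)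
 then show ?thesis using block_proj_mchains block_proj_app[OF mchains_subset[OF finS], symmetric]
 by (auto simp: mcycles_def block_proj_def)
qed
show "module R ?G" by (intro direct_sum_module is_cring mhom_module Cb)
have comp: "(%c. ?B i +>\<^bsub>?Zi i\<^esub> block_proj i c) \<in> mod_hom R ?Z (mhom R (block_part i) sz D d)" for i
 unfolding mhom_def
proof (rule mod_hom_compose[OF _ coset_mod_hom[OF Zm Bm]])
 show "block_proj i \<in> mod_hom R ?Z (?Zi i)"
 using Zi by (intro mod_homI) (auto intro!: ext simp: block_proj_def)
qed
show "?f \<in> mod_hom R ?Z ?G"
proof (rule mod_homI)
 show "?f c \<in> carrier ?G" if "c \<in> carrier ?Z" for c
 using mod_hom_closed[OF comp that] fin by (simp add: direct_sum_carrier)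
 show "?f (x \<oplus>\<^bsub>?Z\<^esub> y) = ?f x \<oplus>\<^bsub>?G\<^esub> ?f y" if "x \<in> carrier ?Z" "y \<in> carrier ?Z" for x y
 using mod_hom_add[OF comp that] by (auto intro!: ext)
 show "?f (r \<odot>\<^bsub>?Z\<^esub> x) = r \<odot>\<^bsub>?G\<^esub> ?f x" if "r \<in> carrier R" "x \<in> carrier ?Z" for r x
 using mod_hom_smult[OF comp that] by (auto intro!: ext)
qed
show "?f c = \<zero>\<^bsub>?G\<^esub> \<longleftrightarrow> c \<in> mbounds R S sz D d" if c: "c \<in> carrier ?Z" for c
proof
 have cS: "c \<in> carrier (free_mod R S)" using c mchains_subset[OF finS] by (auto simp: mcycles_def)
 assume eq: "?f c = \<zero>\<^bsub>?G\<^esub>"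
 have "block_proj i c \<in> ?B i" if "i \<in> I" for i
 using fun_cong[OF eq, of i] that coset_eq_zero_iff[OF Zm Bm] Zi c by (simp add: mhom_def)
 then have "ALL i:I. EX e. e \<in> carrier (mchains R (block_part i) sz (d + 1)) &
  block_proj i c = mat_app R (block_part i) (block_part i) D e"
 unfolding mbounds_def by blast
 then have "EX e. ALL i:I. e i \<in> carrier (mchains R (block_part i) sz (d + 1)) &
  block_proj i c = mat_app R (block_part i) (block_part i) D (e i)" by (rule bchoice)
 then obtain e where e: "!!i. i \<in> I ==> e i \<in> carrier (mchains R (block_part i) sz (d + 1))"
  "!!i. i \<in> I ==> block_proj i c = mat_app R (block_part i) (block_part i) D (e i)" by auto
 let ?b = "%x. if x \<in> S then e (blk x) x else \<zero>"
 have b: "?b \<in> carrier (mchains R S sz (d + 1))" "block_proj i ?b = e i" if "i \<in> I" for i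
 using block_glue[of e "d + 1", OF e(1)] that by simp_all
 have bm: "?b \<in> carrier (mchains R S sz (d + 1))" using block_glue(1)[of e "d + 1", OF e(1)] by simp
 have bS: "?b \<in> carrier (free_mod R S)" using mchains_subset[OF finS bm] .
 have "c = mat_app R S S D ?b"
 by (rule block_ext[OF cS mat_app_mem[OF mcomplex_mat[OF C] bS]])
  (simp add: block_proj_app[OF bS] b(2) e(2))
 then show "c \<in> mbounds R S sz D d" using bm by (auto simp: mbounds_def)
next
 assume "c \<in> mbounds R S sz D d"
 then obtain b where b: "b \<in> carrier (mchains R S sz (d + 1))" "c = mat_app R S S D b"
 by (auto simp: mbounds_def)
 have "block_proj i c \<in> ?B i" for i
 using block_proj_mchains[OF b(1)] block_proj_app[OF mchains_subset[OF finS b(1)]] b(2)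
 by (auto simp: mbounds_def)
 then show "?f c = \<zero>\<^bsub>?G\<^esub>"
 using coset_eq_zero_iff[OF Zm Bm] Zi c
 by (simp add: mhom_def fun_eq_iff[where 'b = "('x => 'a) set"] restrict_apply)
qed
show "EX c:carrier ?Z. ?f c = y" if y: "y \<in> carrier ?G" for y
proof -
 have "ALL i:I. EX e. e \<in> mcycles R (block_part i) sz D d & y i = ?B i +>\<^bsub>?Zi i\<^esub> e"
 using y by (auto simp: direct_sum_carrier mhom_def quot_mod_carrier)
 then have "EX e. ALL i:I. e i \<in> mcycles R (block_part i) sz D d & y i = ?B i +>\<^bsub>?Zi i\<^esub> e i" by (rule bchoice)
 then obtain e where e: "!!i. i \<in> I ==> e i \<in> mcycles R (block_part i) sz D d"
 "!!i. i \<in> I ==> y i = ?B i +>\<^bsub>?Zi i\<^esub> e i" by auto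
 then have ec: "e i \<in> carrier (mchains R (block_part i) sz d)"
 "mat_app R (block_part i) (block_part i) D (e i) = (%_. \<zero>)" if "i \<in> I" for i
 using that by (auto simp: mcycles_def)
 let ?c = "%x. if x \<in> S then e (blk x) x else \<zero>"
 have cm: "?c \<in> carrier (mchains R S sz d)" using block_glue(1)[of e d, OF ec(1)] by simp
 have cp: "block_proj i ?c = e i" if "i \<in> I" for i using block_glue(2)[of e d, OF ec(1)] that by simp
 have cS: "?c \<in> carrier (free_mod R S)" using mchains_subset[OF finS cm] .
 have "mat_app R S S D ?c = (%_. \<zero>)"
 proof (rule block_ext[OF mat_app_mem[OF mcomplex_mat[OF C] cS]])
 show "(%_. \<zero>) \<in> carrier (free_mod R S)" by (simp add: free_mod_carrier)
 qed (simp add: block_proj_app[OF cS] cp ec(2), simp add: block_proj_def fun_eq_iff)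
 then have "?c \<in> mcycles R S sz D d" using cm by (simp add: mcycles_def)
 moreover have "?f ?c = y"
 using cp e(2) y by (intro ext) (auto simp: direct_sum_carrier extensional_def)
 ultimately show ?thesis by (intro bexI[of _ ?c]) auto
qed
qed

end

subsection \<open>Matchings\<close>

text \<open>
In a matching complex each basis element is a cycle that bounds nothing, or belongs to a pair
\<open>(p, q)\<close> with \<open>\<partial>q = p\<close>; the unmatched elements are a basis of the homology.
\<close>

definition match_mat :: "('x \<times> 'x) set => 'x => 'x => 'a"
where "match_mat G s t = (if (s, t) \<in> G then \<one> else \<zero>)"

lemma match_mat_transpose: "(%s t. match_mat G t s) = match_mat (G\<inverse>)"
by (intro ext) (simp add: match_mat_def)

lemma is_mat_match: "finite S ==> is_mat R S S (match_mat G)"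
by (auto simp: is_mat_def match_mat_def)

end

definition matching :: "'x set => ('x => int) => ('x \<times> 'x) set => bool"
where "matching S sz G \<longleftrightarrow> finite S & G <= S \<times> S & single_valued G & single_valued (G\<inverse>) &
 Domain G \<inter> Range G = {} & (\<forall>(p, q)\<in>G. sz q = sz p + 1)"

lemma matching_converse: "matching S sz G ==> matching S (%s. - sz s) (G\<inverse>)"
by (auto simp: matching_def)

context cring begin

context
fixes S :: "'x set" and sz :: "'x => int" and G :: "('x \<times> 'x) set"
assumes m: "matching S sz G"
begin

lemma match_app:
assumes c: "c \<in> carrier (free_mod R S)"
shows "(p, q) \<in> G ==> mat_app R S S (match_mat G) c p = c q"
 and "p \<notin> Domain G ==> mat_app R S S (match_mat G) c p = \<zero>"
proof -
have fin: "finite S" using m by (simp add: matching_def)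
show "mat_app R S S (match_mat G) c p = c q" if "(p, q) \<in> G"
proof -
 have "(\<Oplus>t\<in>S. match_mat G p t \<otimes> c t) = (if q \<in> S then match_mat G p q \<otimes> c q else \<zero>)"
 using fin that m free_mod_closed[OF c]
 by (intro finsum_single) (auto simp: match_mat_def matching_def single_valued_def)
 then show ?thesis using that m free_mod_closed[OF c] by (auto simp: mat_app_def match_mat_def matching_def)
qed
show "mat_app R S S (match_mat G) c p = \<zero>" if "p \<notin> Domain G"
proof -
 have "(\<Oplus>t\<in>S. match_mat G p t \<otimes> c t) = (\<Oplus>t\<in>S. \<zero>)"
 using that free_mod_closed[OF c] by (intro finsum_cong') (auto simp: match_mat_def Domain_iff)
 then show ?thesis by (simp add: mat_app_def)
qed
qed

lemma match_mcomplex: "mcomplex R S sz (match_mat G)"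
proof -
have "mat_mul R S (match_mat G) (match_mat G) s t = \<zero>" for s t
 unfolding mat_mul_def using m by (intro add.finprod_one_eqI) (auto simp: match_mat_def matching_def)
then show ?thesis
 using m is_mat_match[of S G] by (auto simp: mcomplex_def match_mat_def matching_def split: if_splits)
qed

lemma match_cycles:
"c \<in> mcycles R S sz (match_mat G) d \<longleftrightarrow>
 c \<in> carrier (mchains R S sz d) & (ALL q:Range G. c q = \<zero>)"
proof -
have fin: "finite S" using m by (simp add: matching_def)
have "mat_app R S S (match_mat G) c = (%_. \<zero>) \<longleftrightarrow> (ALL q:Range G. c q = \<zero>)"
 if "c \<in> carrier (free_mod R S)"
proof
 assume z: "mat_app R S S (match_mat G) c = (%_. \<zero>)"
 show "ALL q:Range G. c q = \<zero>"
 proof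
 fix q assume "q \<in> Range G"
 then obtain p where "(p, q) \<in> G" by blast
 then show "c q = \<zero>" using match_app(1)[OF that] fun_cong[OF z, of p] by metis
 qed
next
 assume z: "ALL q:Range G. c q = \<zero>"
 show "mat_app R S S (match_mat G) c = (%_. \<zero>)"
 proof
 fix p show "mat_app R S S (match_mat G) c p = \<zero>"
 proof (cases "p \<in> Domain G")
  case True
  then obtain q where q: "(p, q) \<in> G" by blast
  then have "c q = \<zero>" using z by blast
  then show ?thesis using match_app(1)[OF that q] by simp
 qed (rule match_app(2)[OF that])
 qed
qed
then show ?thesis using mchains_subset[OF fin] by (auto simp: mcycles_def)
qed

lemma match_bounds:
"c \<in> mbounds R S sz (match_mat G) d \<longleftrightarrow>
 c \<in> carrier (mchains R S sz d) & (ALL x. x \<notin> Domain G --> c x = \<zero>)"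
proof -
have fin: "finite S" using m by (simp add: matching_def)
show ?thesis
proof
 assume c: "c \<in> mbounds R S sz (match_mat G) d"
 then obtain b where b: "b \<in> carrier (mchains R S sz (d + 1))" "c = mat_app R S S (match_mat G) b"
 unfolding mbounds_def by blast
 show "c \<in> carrier (mchains R S sz d) & (ALL x. x \<notin> Domain G --> c x = \<zero>)"
 unfolding b(2)
 by (intro conjI allI impI mcomplex_degree[OF match_mcomplex b(1)] match_app(2)[OF mchains_subset[OF fin b(1)]])
next
 assume c: "c \<in> carrier (mchains R S sz d) & (ALL x. x \<notin> Domain G --> c x = \<zero>)"
 define b where "b = (%q. if q \<in> Range G then c (THE p. (p, q) \<in> G) else \<zero>)"
 have bq: "b q = c p" if "(p, q) \<in> G" for p q
 proof -
 have "(THE p. (p, q) \<in> G) = p" using that m by (auto simp: matching_def single_valued_def)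
 then show ?thesis using that by (auto simp: b_def)
 qed
 have b: "b \<in> carrier (mchains R S sz (d + 1))"
 unfolding mchains_carrier[OF fin]
 proof (intro conjI allI)
 fix q
 show "b q \<in> carrier R" using c by (auto simp: b_def mchains_carrier[OF fin])
 show "q \<in> S & sz q = d + 1 | b q = \<zero>"
 proof (cases "q \<in> Range G")
  case True
  then obtain p where p: "(p, q) \<in> G" by blast
  then have "q \<in> S" "sz q = sz p + 1" using m by (auto simp: matching_def)
  then show ?thesis using bq[OF p] c by (auto simp: mchains_carrier[OF fin])
 qed (simp add: b_def)
 qed
 have "mat_app R S S (match_mat G) b x = c x" for x
 using match_app[OF mchains_subset[OF fin b], of x] c bq by (cases "x \<in> Domain G") auto
 then have "c = mat_app R S S (match_mat G) b" by auto
 then show "c \<in> mbounds R S sz (match_mat G) d" using b by (auto simp: mbounds_def)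
qed
qed

end

text \<open>
If a base change turns \<open>D\<close> into a matching, then the coordinates of a cycle at the unmatched basis
elements determine its homology class.
\<close>

definition class_coord :: "'x set => ('y => int) => 'y set => ('y \<times> 'y) set => ('y => 'x => 'a) => int => ('x => 'a) => 'y => 'a"
where "class_coord S tz T G W d c u =
 (if u \<in> T - Field G & tz u = d then \<Oplus>s\<in>S. W u s \<otimes> c s else \<zero>)"

theorem matching_homology:
assumes C: "mcomplex R S sz D" and m: "matching T tz G" and bc: "base_change R S sz D T tz (match_mat G) V W"
obtains f where "f \<in> mod_iso R (mhom R S sz D d) (free_mod R {u \<in> T - Field G. tz u = d})"
 "!!c. c \<in> mcycles R S sz D d ==>
 f (mbounds R S sz D d +>\<^bsub>mchains R S sz d\<^esub> c) = class_coord S tz T G W d c"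
proof -
let ?Z = "restrict_mod (mchains R S sz d) (mcycles R S sz D d)"
let ?U = "{u \<in> T - Field G. tz u = d}" and ?f = "class_coord S tz T G W d"
have fin: "finite T" "finite S" using m mcomplex_finite[OF C] by (auto simp: matching_def)
have finU: "finite ?U" using fin by simp
have W: "is_mat R T S W" and V: "is_mat R S T V" using bc by (auto simp: base_change_def)
have f: "?f c = (%u. if u \<in> ?U then mat_app R T S W c u else \<zero>)" for c
 by (auto simp: class_coord_def mat_app_def)
have F: "module R (free_mod R ?U)" by (rule free_mod_module[OF is_cring])
note Zm = mcycles_module[OF C, of d] and Bm = mbounds_submodule_mcycles[OF C, of d]
have ZS: "c \<in> carrier (free_mod R S)" "c \<in> carrier (mchains R S sz d)" if "c \<in> mcycles R S sz D d" for c
 using that mchains_subset[OF fin(2)] by (auto simp: mcycles_def)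
note Wh = mat_app_hom[OF W]
have hom: "?f \<in> mod_hom R ?Z (free_mod R ?U)"
proof (rule mod_homI)
 show "?f c \<in> carrier (free_mod R ?U)" if "c \<in> carrier ?Z" for c
 using mat_app_mem[OF W ZS(1)] that by (auto simp: f free_mod_carrier_finite fin)
 show "?f (x \<oplus>\<^bsub>?Z\<^esub> y) = ?f x \<oplus>\<^bsub>free_mod R ?U\<^esub> ?f y" if "x \<in> carrier ?Z" "y \<in> carrier ?Z" for x y
 using mod_hom_add[OF Wh ZS(1) ZS(1), of x y] that by (auto simp: f)
 show "?f (r \<odot>\<^bsub>?Z\<^esub> x) = r \<odot>\<^bsub>free_mod R ?U\<^esub> ?f x" if "r \<in> carrier R" "x \<in> carrier ?Z" for r x
 using mod_hom_smult[OF Wh _ ZS(1), of r x] that by (auto simp: f)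
qed
have ker: "?f c = \<zero>\<^bsub>free_mod R ?U\<^esub> \<longleftrightarrow> c \<in> mbounds R S sz D d" if c: "c \<in> carrier ?Z" for c
proof -
 have "mat_app R T S W c \<in> mcycles R T tz (match_mat G) d" using bc_W_cycles[OF C bc] c by simp
 then have w: "mat_app R T S W c \<in> carrier (mchains R T tz d)" "!!q. q \<in> Range G ==> mat_app R T S W c q = \<zero>"
 by (auto simp: match_cycles[OF m])
 have "?f c = \<zero>\<^bsub>free_mod R ?U\<^esub> \<longleftrightarrow> (ALL x. x \<notin> Domain G --> mat_app R T S W c x = \<zero>)"
 proof
 assume z: "?f c = \<zero>\<^bsub>free_mod R ?U\<^esub>"
 show "ALL x. x \<notin> Domain G --> mat_app R T S W c x = \<zero>"
 proof (intro allI impI)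
  fix x assume x: "x \<notin> Domain G"
  show "mat_app R T S W c x = \<zero>"
  proof (cases "x \<in> ?U")
  case True
  then show ?thesis using fun_cong[OF z, of x] by (simp add: f)
  next
  case False
  then have "x \<notin> T | tz x ~= d | x \<in> Range G" using x by (auto simp: Field_def)
  then show ?thesis using w unfolding mchains_carrier[OF fin(1)] by blast
  qed
 qed
 qed (auto simp: f fun_eq_iff Field_def)
 then show ?thesis
 using bc_W_bounds_iff[OF C bc ZS(1), of c d] c w by (simp add: match_bounds[OF m])
qed
have surj: "EX c:carrier ?Z. ?f c = y" if y: "y \<in> carrier (free_mod R ?U)" for y
proof -
 note y' = y[unfolded free_mod_carrier_finite[OF finU]]
 have yc: "y \<in> mcycles R T tz (match_mat G) d"
 unfolding match_cycles[OF m] mchains_carrier[OF fin(1)]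
 proof (intro conjI allI ballI)
 fix x
 show "y x \<in> carrier R" using y' by blast
 show "x \<in> T & tz x = d | y x = \<zero>" using y' by blast
 show "y x = \<zero>" if "x \<in> Range G" using y' that by (auto simp: Field_def)
 qed
 then have "mat_app R T S W (mat_app R S T V y) = y"
 using mchains_subset[OF fin(1)] by (intro bc_WV[OF C bc]) (auto simp: mcycles_def)
 then have "?f (mat_app R S T V y) = y"
 using y' unfolding f by auto
 then show ?thesis using bc_V_cycles[OF C bc yc] by (intro bexI[of _ "mat_app R S T V y"]) auto
qed
show ?thesis
proof (rule that)
 show "quot_lift ?f \<in> mod_iso R (mhom R S sz D d) (free_mod R ?U)"
 unfolding mhom_def by (rule quot_lift_iso[OF Zm Bm F hom ker surj])
 fix c assume c: "c \<in> mcycles R S sz D d"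
 have "mbounds R S sz D d +>\<^bsub>mchains R S sz d\<^esub> c = mbounds R S sz D d +>\<^bsub>?Z\<^esub> c"
 by (rule coset_cong) simp
 then show "quot_lift ?f (mbounds R S sz D d +>\<^bsub>mchains R S sz d\<^esub> c) = ?f c"
 using quot_lift_coset[OF Zm Bm F hom, of c] ker c mbounds_subset[OF C] by auto
qed
qed

end

section \<open>Simplicial complexes as based complexes\<close>

definition simp_mat :: "('r, 's) ring_scheme => 'v::linorder set => 'v set => 'r"
where "simp_mat R \<tau> \<sigma> = (if \<tau> <= \<sigma> & card (\<sigma> - \<tau>) = 1
 then orientation_sign R (the_elem (\<sigma> - \<tau>)) \<sigma> else \<zero>\<^bsub>R\<^esub>)"

lemma simp_mat_remove: "v \<in> \<sigma> ==> simp_mat R (\<sigma> - {v}) \<sigma> = orientation_sign R v \<sigma>"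
proof -
assume "v \<in> \<sigma>"
then have "\<sigma> - (\<sigma> - {v}) = {v}" by auto
then show ?thesis by (simp add: simp_mat_def Diff_subset)
qed

lemma simp_mat_insert: "v \<notin> \<tau> ==> simp_mat R \<tau> (insert v \<tau>) = orientation_sign R v (insert v \<tau>)"
using simp_mat_remove[of v "insert v \<tau>" R] by simp

lemma simp_mat_nonzero:
assumes "simp_mat R \<tau> \<sigma> ~= \<zero>\<^bsub>R\<^esub>" obtains v where "v \<in> \<sigma>" "\<tau> = \<sigma> - {v}"
proof -
have "\<tau> <= \<sigma>" "card (\<sigma> - \<tau>) = 1" using assms by (auto simp: simp_mat_def split: if_splits)
then obtain v where "\<sigma> - \<tau> = {v}" by (auto simp: card_1_singleton_iff)
then show ?thesis using that[of v] \<open>\<tau> <= \<sigma>\<close> by blast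
qed

context cring begin

definition neg_pow :: "nat => 'a" where "neg_pow n = (\<ominus> \<one>) [^] n"

lemma neg_pow_closed [simp]: "neg_pow n \<in> carrier R"
by (simp add: neg_pow_def)

lemma neg_pow_0 [simp]: "neg_pow 0 = \<one>"
by (simp add: neg_pow_def)

lemma neg_pow_Suc [simp]: "neg_pow (Suc n) = \<ominus> neg_pow n"
by (simp add: neg_pow_def r_minus)

lemma neg_pow_square [simp]: "neg_pow n \<otimes> neg_pow n = \<one>"
by (induction n) (simp_all add: l_minus r_minus)

lemma orientation_sign_neg_pow: "orientation_sign R v \<sigma> = neg_pow (card {u \<in> \<sigma>. u < v})"
by (simp add: orientation_sign_def neg_pow_def)

lemma orientation_sign_closed [simp]: "orientation_sign R v \<sigma> \<in> carrier R"
by (simp add: orientation_sign_neg_pow)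

lemma orientation_sign_remove:
assumes "finite \<sigma>" "u \<in> \<sigma>"
shows "orientation_sign R v (\<sigma> - {u}) = (if u < v then \<ominus> orientation_sign R v \<sigma> else orientation_sign R v \<sigma>)"
proof (cases "u < v")
case True
have "{w \<in> \<sigma>. w < v} = insert u {w \<in> \<sigma> - {u}. w < v}" using assms True by auto
then have "card {w \<in> \<sigma>. w < v} = Suc (card {w \<in> \<sigma> - {u}. w < v})" using assms by simp
then show ?thesis using True by (simp add: orientation_sign_neg_pow)
next
case False
then have "{w \<in> \<sigma> - {u}. w < v} = {w \<in> \<sigma>. w < v}" by auto
then show ?thesis using False by (simp add: orientation_sign_neg_pow)
qed

lemma simp_mat_closed [simp]: "simp_mat R \<tau> \<sigma> \<in> carrier R"
by (simp add: simp_mat_def)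

lemma complex_finite: "simplicial_complex V K ==> finite K"
by (auto simp: simplicial_complex_def intro: finite_subset)

lemma complex_face_finite: "simplicial_complex V K ==> \<sigma> \<in> K ==> finite \<sigma>"
by (auto simp: simplicial_complex_def intro: finite_subset)

lemma complex_closed: "simplicial_complex V K ==> \<sigma> \<in> K ==> \<tau> <= \<sigma> ==> \<tau> \<in> K"
by (auto simp: simplicial_complex_def)

lemma simplicial_mcomplex:
assumes K: "simplicial_complex V K"
shows "mcomplex R K (%\<sigma>. int (card \<sigma>)) (simp_mat R)"
proof -
note finK = complex_finite[OF K]
have "mat_mul R K (simp_mat R) (simp_mat R) \<tau> \<sigma> = \<zero>" if \<tau>: "\<tau> \<in> K" and \<sigma>: "\<sigma> \<in> K" for \<tau> \<sigma>
proof (cases "EX v w. v \<in> \<sigma> & w \<in> \<sigma> & v < w & \<tau> = \<sigma> - {v, w}")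
 case True
 then obtain v w where vw: "v \<in> \<sigma>" "w \<in> \<sigma>" "v < w" "\<tau> = \<sigma> - {v, w}" by blast
 note fin = complex_face_finite[OF K \<sigma>]
 have ne: "\<sigma> - {v} ~= \<sigma> - {w}" using vw by auto
 have mem: "\<sigma> - {v} \<in> K" "\<sigma> - {w} \<in> K" using complex_closed[OF K \<sigma>] by auto
 have t: "\<tau> = (\<sigma> - {v}) - {w}" "\<tau> = (\<sigma> - {w}) - {v}" using vw by auto
 have "mat_mul R K (simp_mat R) (simp_mat R) \<tau> \<sigma> =
 (\<Oplus>\<rho>\<in>{\<sigma> - {v}, \<sigma> - {w}}. simp_mat R \<tau> \<rho> \<otimes> simp_mat R \<rho> \<sigma>)"
 unfolding mat_mul_def
 proof (rule add.finprod_mono_neutral_cong_right[OF finK])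
 show "simp_mat R \<tau> \<rho> \<otimes> simp_mat R \<rho> \<sigma> = \<zero>" if \<rho>: "\<rho> \<in> K - {\<sigma> - {v}, \<sigma> - {w}}" for \<rho>
 proof (rule ccontr)
  assume "simp_mat R \<tau> \<rho> \<otimes> simp_mat R \<rho> \<sigma> ~= \<zero>"
  then have "simp_mat R \<tau> \<rho> ~= \<zero>" "simp_mat R \<rho> \<sigma> ~= \<zero>" by auto
  then obtain x y where "\<rho> = \<sigma> - {x}" "x \<in> \<sigma>" "\<tau> = \<rho> - {y}" "y \<in> \<rho>"
  by (metis simp_mat_nonzero)
  then have "\<sigma> - {v, w} = \<sigma> - {x, y}" using vw by auto
  then have "x = v | x = w" using vw \<open>x \<in> \<sigma>\<close> by blast
  then show False using \<open>\<rho> = \<sigma> - {x}\<close> \<rho> by auto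
 qed
 qed (use mem in auto)
 also have "\<dots> = simp_mat R \<tau> (\<sigma> - {v}) \<otimes> simp_mat R (\<sigma> - {v}) \<sigma> \<oplus>
  simp_mat R \<tau> (\<sigma> - {w}) \<otimes> simp_mat R (\<sigma> - {w}) \<sigma>"
 using ne by simp
 also have "\<dots> = orientation_sign R w (\<sigma> - {v}) \<otimes> orientation_sign R v \<sigma> \<oplus>
  orientation_sign R v (\<sigma> - {w}) \<otimes> orientation_sign R w \<sigma>"
 proof -
 have "simp_mat R \<tau> (\<sigma> - {v}) = orientation_sign R w (\<sigma> - {v})"
  unfolding t(1) by (rule simp_mat_remove) (use vw in auto)
 moreover have "simp_mat R \<tau> (\<sigma> - {w}) = orientation_sign R v (\<sigma> - {w})"
  unfolding t(2) by (rule simp_mat_remove) (use vw in auto)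
 ultimately show ?thesis using vw by (simp only: simp_mat_remove)
 qed
 also have "\<dots> = \<zero>"
 using fin vw not_less_iff_gr_or_eq[of w v] by (simp add: orientation_sign_remove l_minus m_comm[of "orientation_sign R w \<sigma>"] l_neg)
 finally show ?thesis .
next
 case False
 have "simp_mat R \<tau> \<rho> \<otimes> simp_mat R \<rho> \<sigma> = \<zero>" for \<rho>
 proof (rule ccontr)
 assume "simp_mat R \<tau> \<rho> \<otimes> simp_mat R \<rho> \<sigma> ~= \<zero>"
 then have "simp_mat R \<tau> \<rho> ~= \<zero>" "simp_mat R \<rho> \<sigma> ~= \<zero>" by auto
 then obtain x y where xy: "\<rho> = \<sigma> - {x}" "x \<in> \<sigma>" "\<tau> = \<rho> - {y}" "y \<in> \<rho>"
  by (metis simp_mat_nonzero)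
 then have "\<tau> = \<sigma> - {x, y}" "\<tau> = \<sigma> - {y, x}" "x ~= y" "y \<in> \<sigma>" by auto
 then show False using False xy(2) by (metis linorder_neqE)
 qed
 then show ?thesis unfolding mat_mul_def by (intro add.finprod_one_eqI)
qed
moreover have "int (card \<sigma>) = int (card \<tau>) + 1"
 if s: "\<sigma> \<in> K" and nz: "simp_mat R \<tau> \<sigma> ~= \<zero>" for \<sigma> \<tau>
proof -
 obtain v where v: "v \<in> \<sigma>" "\<tau> = \<sigma> - {v}" using nz by (rule simp_mat_nonzero)
 show ?thesis using card_Suc_Diff1[OF complex_face_finite[OF K s] v(1)] v(2) by simp
qed
ultimately show ?thesis using finK by (auto simp: mcomplex_def is_mat_def)
qed

lemma chains_mchains: "chains R K d = mchains R K (%\<sigma>. int (card \<sigma>)) (d + 1)"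
"chains R K d = mchains R K (%\<sigma>. - int (card \<sigma>)) (- d - 1)"
unfolding chains_def mchains_def simplices_def by (rule arg_cong[where f = "free_mod R"]; auto)+

lemma boundary_mat:
assumes K: "simplicial_complex V K" and c: "c \<in> carrier (free_mod R K)"
shows "boundary R K c = mat_app R K K (simp_mat R) c"
proof
fix \<tau>
have cR: "c \<sigma> \<in> carrier R" for \<sigma> using free_mod_closed[OF c] .
have c0: "c \<sigma> = \<zero>" if "\<sigma> \<notin> K" for \<sigma> using free_mod_outside[OF c that] .
have finV: "finite (\<Union>K)" using complex_finite[OF K] complex_face_finite[OF K] by auto
show "boundary R K c \<tau> = mat_app R K K (simp_mat R) c \<tau>"
proof (cases "\<tau> \<in> K")
 case True
 let ?V = "{v \<in> \<Union>K - \<tau>. insert v \<tau> \<in> K}"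
 have inj: "inj_on (%v. insert v \<tau>) ?V" by (auto simp: inj_on_def)
 have "boundary R K c \<tau> = (\<Oplus>v\<in>?V. simp_mat R \<tau> (insert v \<tau>) \<otimes> c (insert v \<tau>))"
 unfolding boundary_def
 by (rule add.finprod_mono_neutral_cong_right)
  (use finV cR c0 in \<open>auto simp: simp_mat_insert\<close>)
 also have "\<dots> = (\<Oplus>\<sigma>\<in>(%v. insert v \<tau>) ` ?V. simp_mat R \<tau> \<sigma> \<otimes> c \<sigma>)"
 by (rule finsum_reindex[symmetric, OF _ inj]) (use cR in auto)
 also have "\<dots> = (\<Oplus>\<sigma>\<in>K. simp_mat R \<tau> \<sigma> \<otimes> c \<sigma>)"
 proof (rule add.finprod_mono_neutral_cong_left[OF complex_finite[OF K]])
 show "simp_mat R \<tau> \<sigma> \<otimes> c \<sigma> = \<zero>" if \<sigma>: "\<sigma> \<in> K - (%v. insert v \<tau>) ` ?V" for \<sigma>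
 proof (rule ccontr)
  assume "simp_mat R \<tau> \<sigma> \<otimes> c \<sigma> ~= \<zero>"
  then have "simp_mat R \<tau> \<sigma> ~= \<zero>" using cR by auto
  then obtain v where "v \<in> \<sigma>" "\<tau> = \<sigma> - {v}" by (rule simp_mat_nonzero)
  then have "\<sigma> = insert v \<tau>" "v \<in> ?V" using \<sigma> by (auto simp: insert_absorb)
  then show False using \<sigma> by blast
 qed
 qed (use cR in auto)
 finally show ?thesis using True by (simp add: mat_app_def)
next
 case False
 then have "c (insert v \<tau>) = \<zero>" for v using c0 complex_closed[OF K, of "insert v \<tau>" \<tau>] by blast
 then show ?thesis using False
 unfolding boundary_def mat_app_def by (simp add: add.finprod_one_eqI)
qed
qed

lemma coboundary_mat:
assumes K: "simplicial_complex V K" and c: "c \<in> carrier (free_mod R K)"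
shows "coboundary R K c = mat_app R K K (%\<sigma> \<tau>. simp_mat R \<tau> \<sigma>) c"
proof
fix \<sigma>
have cR: "c \<tau> \<in> carrier R" for \<tau> using free_mod_closed[OF c] .
show "coboundary R K c \<sigma> = mat_app R K K (%\<sigma> \<tau>. simp_mat R \<tau> \<sigma>) c \<sigma>"
proof (cases "\<sigma> \<in> K")
 case True
 have inj: "inj_on (%v. \<sigma> - {v}) \<sigma>" by (auto simp: inj_on_def)
 have "coboundary R K c \<sigma> = (\<Oplus>v\<in>\<sigma>. simp_mat R (\<sigma> - {v}) \<sigma> \<otimes> c (\<sigma> - {v}))"
 unfolding coboundary_def using True cR by (auto simp: simp_mat_remove intro!: finsum_cong')
 also have "\<dots> = (\<Oplus>\<tau>\<in>(%v. \<sigma> - {v}) ` \<sigma>. simp_mat R \<tau> \<sigma> \<otimes> c \<tau>)"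
 by (rule finsum_reindex[symmetric, OF _ inj]) (use cR in auto)
 also have "\<dots> = (\<Oplus>\<tau>\<in>K. simp_mat R \<tau> \<sigma> \<otimes> c \<tau>)"
 proof (rule add.finprod_mono_neutral_cong_left[OF complex_finite[OF K]])
 show "(%v. \<sigma> - {v}) ` \<sigma> <= K" using complex_closed[OF K True] by auto
 show "simp_mat R \<tau> \<sigma> \<otimes> c \<tau> = \<zero>" if \<tau>: "\<tau> \<in> K - (%v. \<sigma> - {v}) ` \<sigma>" for \<tau>
 proof (rule ccontr)
  assume "simp_mat R \<tau> \<sigma> \<otimes> c \<tau> ~= \<zero>"
  then have "simp_mat R \<tau> \<sigma> ~= \<zero>" using cR by auto
  then obtain v where "v \<in> \<sigma>" "\<tau> = \<sigma> - {v}" by (rule simp_mat_nonzero)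
  then show False using \<tau> by blast
 qed
 qed (use cR in auto)
 finally show ?thesis using True by (simp add: mat_app_def)
qed (simp add: coboundary_def mat_app_def)
qed

lemma cycles_mat: "simplicial_complex V K ==>
 cycles R K d = mcycles R K (%\<sigma>. int (card \<sigma>)) (simp_mat R) (d + 1)"
unfolding cycles_def mcycles_def chains_mchains(1)
by (rule Collect_cong, rule conj_cong[OF refl]) (simp add: boundary_mat mchains_subset[OF complex_finite])

lemma boundaries_mat: "simplicial_complex V K ==>
 boundaries R K d = mbounds R K (%\<sigma>. int (card \<sigma>)) (simp_mat R) (d + 1)"
unfolding boundaries_def mbounds_def chains_mchains(1)
by (rule image_cong[OF refl]) (rule boundary_mat, assumption, rule mchains_subset[OF complex_finite])

lemma cocycles_mat: "simplicial_complex V K ==>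
 cocycles R K d = mcycles R K (%\<sigma>. - int (card \<sigma>)) (%\<sigma> \<tau>. simp_mat R \<tau> \<sigma>) (- d - 1)"
unfolding cocycles_def mcycles_def chains_mchains(2)
by (rule Collect_cong, rule conj_cong[OF refl]) (simp add: coboundary_mat mchains_subset[OF complex_finite])

lemma coboundaries_mat: "simplicial_complex V K ==>
 coboundaries R K d = mbounds R K (%\<sigma>. - int (card \<sigma>)) (%\<sigma> \<tau>. simp_mat R \<tau> \<sigma>) (- d - 1)"
proof -
assume K: "simplicial_complex V K"
have e: "- (d - 1) - 1 = - d - 1 + (1::int)" by simp
show ?thesis
 unfolding coboundaries_def mbounds_def chains_mchains(2) e
 by (rule image_cong[OF refl]) (rule coboundary_mat[OF K], rule mchains_subset[OF complex_finite[OF K]])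
qed

lemma homology_mhom: "simplicial_complex V K ==>
 homology R K d = mhom R K (%\<sigma>. int (card \<sigma>)) (simp_mat R) (d + 1)"
by (simp add: homology_def mhom_def cycles_mat boundaries_mat chains_mchains(1))

lemma cohomology_mhom: "simplicial_complex V K ==>
 cohomology R K d = mhom R K (%\<sigma>. - int (card \<sigma>)) (%\<sigma> \<tau>. simp_mat R \<tau> \<sigma>) (- d - 1)"
by (simp add: cohomology_def mhom_def cocycles_mat coboundaries_mat chains_mchains(2))

definition cone_mat :: "'v::linorder => 'v set => 'v set => 'a"
where "cone_mat k \<tau> \<sigma> = (if k \<notin> \<sigma> & \<tau> = insert k \<sigma> then orientation_sign R k \<tau> else \<zero>)"

lemma cone_mat_closed: "cone_mat k \<tau> \<sigma> \<in> carrier R"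
unfolding cone_mat_def by (split if_split) (intro conjI impI orientation_sign_closed zero_closed)

lemma cone_mat_zero: "~ (k \<notin> \<sigma> & \<tau> = insert k \<sigma>) ==> cone_mat k \<tau> \<sigma> = \<zero>"
unfolding cone_mat_def by (rule if_not_P)

lemma cone_mat_insert: "k \<notin> \<sigma> ==> cone_mat k (insert k \<sigma>) \<sigma> = orientation_sign R k (insert k \<sigma>)"
by (simp add: cone_mat_def)

lemma cone_homotopy:
assumes K: "simplicial_complex V K" and cone: "!!\<sigma>. \<sigma> \<in> K ==> insert k \<sigma> \<in> K"
 and \<tau>: "\<tau> \<in> K" and \<sigma>: "\<sigma> \<in> K"
shows "mat_mul R K (simp_mat R) (cone_mat k) \<tau> \<sigma> \<oplus> mat_mul R K (cone_mat k) (simp_mat R) \<tau> \<sigma> = delta R \<tau> \<sigma>"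
proof -
note finK = complex_finite[OF K]
have "mat_mul R K (simp_mat R) (cone_mat k) \<tau> \<sigma> =
 (if insert k \<sigma> \<in> K then simp_mat R \<tau> (insert k \<sigma>) \<otimes> cone_mat k (insert k \<sigma>) \<sigma> else \<zero>)"
 unfolding mat_mul_def
proof (rule finsum_single[OF finK])
 show "simp_mat R \<tau> \<rho> \<otimes> cone_mat k \<rho> \<sigma> \<in> carrier R" for \<rho>
 by (intro m_closed simp_mat_closed cone_mat_closed)
 show "simp_mat R \<tau> \<rho> \<otimes> cone_mat k \<rho> \<sigma> = \<zero>" if "\<rho> ~= insert k \<sigma>" for \<rho>
 using that cone_mat_zero[of k \<sigma> \<rho>] by simp
qed
then have 1: "mat_mul R K (simp_mat R) (cone_mat k) \<tau> \<sigma> =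
 (if k \<notin> \<sigma> then simp_mat R \<tau> (insert k \<sigma>) \<otimes> orientation_sign R k (insert k \<sigma>) else \<zero>)"
 using cone[OF \<sigma>] cone_mat_insert[of k \<sigma>] cone_mat_zero[of k \<sigma> "insert k \<sigma>"]
 by (cases "k \<in> \<sigma>") simp_all
have z: "cone_mat k \<tau> (\<tau> - {k}) = \<zero>" if "k \<notin> \<tau>"
 by (rule cone_mat_zero) (use that in auto)
have "mat_mul R K (cone_mat k) (simp_mat R) \<tau> \<sigma> =
 (if \<tau> - {k} \<in> K then cone_mat k \<tau> (\<tau> - {k}) \<otimes> simp_mat R (\<tau> - {k}) \<sigma> else \<zero>)"
 unfolding mat_mul_def
proof (rule finsum_single[OF finK])
 show "cone_mat k \<tau> \<rho> \<otimes> simp_mat R \<rho> \<sigma> \<in> carrier R" for \<rho>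
 by (intro m_closed simp_mat_closed cone_mat_closed)
 show "cone_mat k \<tau> \<rho> \<otimes> simp_mat R \<rho> \<sigma> = \<zero>" if "\<rho> ~= \<tau> - {k}" for \<rho>
 proof -
 have "~ (k \<notin> \<rho> & \<tau> = insert k \<rho>)" using that by auto
 then show ?thesis using cone_mat_zero[of k \<rho> \<tau>] by simp
 qed
qed
then have 2: "mat_mul R K (cone_mat k) (simp_mat R) \<tau> \<sigma> =
 (if k \<in> \<tau> then orientation_sign R k \<tau> \<otimes> simp_mat R (\<tau> - {k}) \<sigma> else \<zero>)"
 using complex_closed[OF K \<tau> Diff_subset, of "{k}"] cone_mat_insert[of k "\<tau> - {k}"]
 z by (cases "k \<in> \<tau>") (simp_all add: insert_absorb)
have sq: "orientation_sign R k \<rho> \<otimes> orientation_sign R k \<rho> = \<one>" for \<rho>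
 by (simp add: orientation_sign_neg_pow)
consider "k \<notin> \<sigma>" "k \<notin> \<tau>" | "k \<notin> \<sigma>" "k \<in> \<tau>" | "k \<in> \<sigma>" "k \<notin> \<tau>" | "k \<in> \<sigma>" "k \<in> \<tau>" by blast
then show ?thesis
proof cases
 case c1: 1
 have "simp_mat R \<tau> (insert k \<sigma>) = (if \<tau> = \<sigma> then orientation_sign R k (insert k \<sigma>) else \<zero>)"
 proof (cases "simp_mat R \<tau> (insert k \<sigma>) = \<zero>")
 case False
 then obtain v where "v \<in> insert k \<sigma>" "\<tau> = insert k \<sigma> - {v}" by (rule simp_mat_nonzero)
 then have "\<tau> = \<sigma>" using c1 by auto
 then show ?thesis using simp_mat_insert c1 by simp
 qed (use simp_mat_insert[of k \<sigma> R] c1 in auto)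
 then show ?thesis using 1 2 c1 sq by (auto simp: delta_def)
next
 case c2: 2
 have "simp_mat R \<tau> (insert k \<sigma>) \<otimes> orientation_sign R k (insert k \<sigma>) \<oplus>
 orientation_sign R k \<tau> \<otimes> simp_mat R (\<tau> - {k}) \<sigma> = \<zero>"
 proof (cases "EX v:\<sigma>. \<tau> = insert k \<sigma> - {v}")
 case True
 then obtain v where v: "v \<in> \<sigma>" "\<tau> = insert k \<sigma> - {v}" by blast
 let ?\<rho> = "insert k \<sigma>"
 have fin: "finite ?\<rho>" using complex_face_finite[OF K \<sigma>] by simp
 have "v ~= k" using v c2 by auto
 have a: "simp_mat R \<tau> ?\<rho> = orientation_sign R v ?\<rho>" using v by (simp add: simp_mat_remove)
 have "\<tau> - {k} = \<sigma> - {v}" using v c2 by auto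
 then have b: "simp_mat R (\<tau> - {k}) \<sigma> = orientation_sign R v (?\<rho> - {k})"
  using v c2 by (simp add: simp_mat_remove)
 have c: "orientation_sign R k \<tau> = orientation_sign R k (?\<rho> - {v})" using v by simp
 have cancel: "x \<otimes> y \<oplus> y \<otimes> \<ominus> x = \<zero>" "x \<otimes> y \<oplus> \<ominus> y \<otimes> x = \<zero>"
  if "x \<in> carrier R" "y \<in> carrier R" for x y
  using that m_comm[OF that] by (simp_all add: r_minus l_minus r_neg)
 show ?thesis
 proof (cases "k < v")
  case True
  then have "orientation_sign R v (?\<rho> - {k}) = \<ominus> orientation_sign R v ?\<rho>"
  "orientation_sign R k (?\<rho> - {v}) = orientation_sign R k ?\<rho>"
  using orientation_sign_remove[OF fin, of k v] orientation_sign_remove[OF fin, of v k] v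
   True by auto
  then show ?thesis unfolding a b c by (simp only: cancel orientation_sign_closed)
 next
  case False
  then have "v < k" using \<open>v ~= k\<close> by simp
  then have "orientation_sign R v (?\<rho> - {k}) = orientation_sign R v ?\<rho>"
  "orientation_sign R k (?\<rho> - {v}) = \<ominus> orientation_sign R k ?\<rho>"
  using orientation_sign_remove[OF fin, of k v] orientation_sign_remove[OF fin, of v k] v False
  by simp_all
  then show ?thesis unfolding a b c by (simp only: cancel orientation_sign_closed)
 qed
 next
 case False
 have "simp_mat R \<tau> (insert k \<sigma>) = \<zero>"
 proof (rule ccontr)
  assume "~ ?thesis"
  then obtain v where "v \<in> insert k \<sigma>" "\<tau> = insert k \<sigma> - {v}" by (rule simp_mat_nonzero)
  then show False using False c2 by auto
 qed
 moreover have "simp_mat R (\<tau> - {k}) \<sigma> = \<zero>"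
 proof (rule ccontr)
  assume "~ ?thesis"
  then obtain v where "v \<in> \<sigma>" "\<tau> - {k} = \<sigma> - {v}" by (rule simp_mat_nonzero)
  then have "\<tau> = insert k \<sigma> - {v}" using c2 by auto
  then show False using False \<open>v \<in> \<sigma>\<close> by auto
 qed
 ultimately show ?thesis by simp
 qed
 moreover have "\<tau> ~= \<sigma>" using c2 by auto
 ultimately show ?thesis using 1 2 c2 by (simp add: delta_def)
next
 case 3
 then have "\<tau> ~= \<sigma>" by auto
 then show ?thesis using 1 2 3 by (simp add: delta_def)
next
 case 4
 have "simp_mat R (\<tau> - {k}) \<sigma> = (if \<tau> = \<sigma> then orientation_sign R k \<sigma> else \<zero>)"
 proof (cases "simp_mat R (\<tau> - {k}) \<sigma> = \<zero>")
 case False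
 then obtain v where "v \<in> \<sigma>" "\<tau> - {k} = \<sigma> - {v}" by (rule simp_mat_nonzero)
 then have "\<tau> = \<sigma>" using 4 by auto
 then show ?thesis using simp_mat_remove 4 by simp
 qed (use simp_mat_remove[of k \<sigma> R] 4 in auto)
 then show ?thesis using 1 2 4 sq by (auto simp: delta_def)
qed
qed

lemma cone_trivial:
assumes K: "simplicial_complex V K" and cone: "!!\<sigma>. \<sigma> \<in> K ==> insert k \<sigma> \<in> K"
shows "carrier (homology R K d) = {\<zero>\<^bsub>homology R K d\<^esub>}"
 and "carrier (cohomology R K d) = {\<zero>\<^bsub>cohomology R K d\<^esub>}"
proof -
have H: "is_mat R K K (cone_mat k)"
 using complex_finite[OF K] by (auto simp: is_mat_def cone_mat_def)
have deg: "int (card \<tau>) = int (card \<sigma>) + 1" if "\<sigma> \<in> K" "cone_mat k \<tau> \<sigma> ~= \<zero>" for \<tau> \<sigma>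
 using that complex_face_finite[OF K that(1)] by (auto simp: cone_mat_def split: if_splits)
show "carrier (homology R K d) = {\<zero>\<^bsub>homology R K d\<^esub>}"
 unfolding homology_mhom[OF K]
 by (rule contractible_trivial[OF simplicial_mcomplex[OF K] H deg cone_homotopy[OF K cone]])
show "carrier (cohomology R K d) = {\<zero>\<^bsub>cohomology R K d\<^esub>}"
 unfolding cohomology_mhom[OF K]
 by (rule contractible_trivial_transpose[OF simplicial_mcomplex[OF K] H deg cone_homotopy[OF K cone]])
qed

lemma homology_module: "simplicial_complex V K ==> module R (homology R K d)"
using mhom_module[OF simplicial_mcomplex] by (simp add: homology_mhom)

lemma cohomology_module: "simplicial_complex V K ==> module R (cohomology R K d)"
using mhom_module[OF mcomplex_transpose[OF simplicial_mcomplex]] by (simp add: cohomology_mhom)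

end

section \<open>Bases of modules of functions\<close>

context cring begin

definition lincomb :: "('x => 'a) set => (('x => 'a) => 'a) => 'x => 'a"
where "lincomb B c = (%x. \<Oplus>b\<in>B. c b \<otimes> b x)"

definition basis_of :: "('x => 'a) set => ('x => 'a) set => bool"
where "basis_of M B \<longleftrightarrow> finite B & B <= M &
 (ALL x:M. EX c:B \<rightarrow> carrier R. x = lincomb B c) &
 (ALL c:B \<rightarrow> carrier R. lincomb B c = (%_. \<zero>) --> (ALL b:B. c b = \<zero>))"

abbreviation fspace :: "'x set => ('a, 'x => 'a) module"
where "fspace S \<equiv> free_mod R S"

lemma fspace_module: "module R (fspace S)"
by (rule free_mod_module[OF is_cring])

lemma submodule_valued: "submodule M R (fspace S) ==> b \<in> M ==> b x \<in> carrier R"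
using submodule_subset by (fastforce simp: free_mod_carrier)

lemma lincomb_empty [simp]: "lincomb {} c = (%_. \<zero>)"
by (simp add: lincomb_def)

lemma lincomb_insert:
assumes "finite B" "b \<notin> B" "!!x. b x \<in> carrier R" "!!b x. b \<in> B ==> b x \<in> carrier R"
 "c b \<in> carrier R" "c \<in> B \<rightarrow> carrier R"
shows "lincomb (insert b B) c = (%x. c b \<otimes> b x \<oplus> lincomb B c x)"
unfolding lincomb_def using assms by (intro ext finsum_insert) auto

lemma lincomb_Un:
assumes "finite B" "finite B'" "B \<inter> B' = {}" "!!b x. b \<in> B \<union> B' ==> b x \<in> carrier R"
 "c \<in> B \<union> B' \<rightarrow> carrier R"
shows "lincomb (B \<union> B') c = (%x. lincomb B c x \<oplus> lincomb B' c x)"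
unfolding lincomb_def using assms by (intro ext finsum_Un_disjoint) auto

lemma lincomb_cong:
assumes "!!b. b \<in> B ==> c b = d b" "d \<in> B \<rightarrow> carrier R" "!!b x. b \<in> B ==> b x \<in> carrier R"
shows "lincomb B c = lincomb B d"
unfolding lincomb_def using assms by (intro ext finsum_cong') auto

text \<open>Sums of images under a linear map, of which \<open>lincomb_mem\<close> is the case of the identity.\<close>

lemma hom_lincomb:
assumes M: "submodule M R (fspace S)" and g: "g \<in> mod_hom R (restrict_mod (fspace S) M) (fspace S')"
 and B: "finite B" "B <= M" and c: "c \<in> B \<rightarrow> carrier R"
shows "lincomb B c \<in> M & g (lincomb B c) = (%x. \<Oplus>b\<in>B. c b \<otimes> g b x)"
using B c
proof (induction B rule: finite_induct)
case empty
have "g \<zero>\<^bsub>restrict_mod (fspace S) M\<^esub> = \<zero>\<^bsub>fspace S'\<^esub>"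
 by (rule mod_hom_zero[OF restrict_mod_module[OF fspace_module M] fspace_module g])
then show ?case using submodule_zero_mem[OF M] by simp
next
case (insert b B)
let ?M = "restrict_mod (fspace S) M"
have v: "!!x. b x \<in> carrier R" "!!b x. b \<in> B ==> b x \<in> carrier R"
 using insert.prems submodule_valued[OF M] by auto
have cb: "c b \<in> carrier R" "c \<in> B \<rightarrow> carrier R" "b \<in> M" "B <= M" using insert.prems by auto
have IH: "lincomb B c \<in> M" "g (lincomb B c) = (%x. \<Oplus>b\<in>B. c b \<otimes> g b x)"
 using insert.IH cb by auto
have gv: "g b x \<in> carrier R" if "b \<in> M" for b x
 using mod_hom_closed[OF g, of b] that by (auto simp: free_mod_carrier)
have sm: "c b \<odot>\<^bsub>fspace S\<^esub> b \<in> M" using submodule_smult_mem[OF M cb(1,3)] .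
have eq: "lincomb (insert b B) c = (c b \<odot>\<^bsub>?M\<^esub> b) \<oplus>\<^bsub>?M\<^esub> lincomb B c"
proof -
 have "lincomb (insert b B) c = (%x. c b \<otimes> b x \<oplus> lincomb B c x)"
 by (rule lincomb_insert) (use insert.hyps v cb in auto)
 then show ?thesis by simp
qed
have mem: "lincomb (insert b B) c \<in> M"
 using submodule_add_mem[OF M sm IH(1)] eq by simp
have "g (lincomb (insert b B) c) = g (c b \<odot>\<^bsub>?M\<^esub> b) \<oplus>\<^bsub>fspace S'\<^esub> g (lincomb B c)"
 unfolding eq using mod_hom_add[OF g, of "c b \<odot>\<^bsub>?M\<^esub> b" "lincomb B c"] sm IH(1) by simp
also have "g (c b \<odot>\<^bsub>?M\<^esub> b) = c b \<odot>\<^bsub>fspace S'\<^esub> g b"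
 using mod_hom_smult[OF g cb(1), of b] cb by simp
finally have "g (lincomb (insert b B) c) = (%x. c b \<otimes> g b x \<oplus> (\<Oplus>b\<in>B. c b \<otimes> g b x))"
 unfolding IH(2) by simp
also have "\<dots> = (%x. \<Oplus>b\<in>insert b B. c b \<otimes> g b x)"
 using insert.hyps cb gv by (intro ext finsum_insert[symmetric]) (auto simp: subset_iff Pi_def)
finally show ?case using mem by simp
qed

lemma mod_hom_restrict_id: "submodule M R (fspace S) ==> (%x. x) \<in> mod_hom R (restrict_mod (fspace S) M) (fspace S)"
using submodule_subset[of M R "fspace S"] by (auto simp: mod_hom_def)

lemma lincomb_mem:
assumes "submodule M R (fspace S)" "finite B" "B <= M" "c \<in> B \<rightarrow> carrier R"
shows "lincomb B c \<in> M"
by (rule conjunct1[OF hom_lincomb[OF assms(1) mod_hom_restrict_id[OF assms(1)] assms(2-4)]])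

lemma basis_indep:
assumes "basis_of M B" "c \<in> B \<rightarrow> carrier R" "lincomb B c = (%_. \<zero>)" "b \<in> B"
shows "c b = \<zero>"
using assms unfolding basis_of_def by blast

lemma generator_closed: "generator R s x \<in> carrier R"
by (simp add: generator_def)

lemma basis_unique:
assumes B: "basis_of M B" and M: "submodule M R (fspace S)"
 and c: "c \<in> B \<rightarrow> carrier R" "d \<in> B \<rightarrow> carrier R" and eq: "lincomb B c = lincomb B d" and b: "b \<in> B"
shows "c b = d b"
proof -
have v: "b x \<in> carrier R" if "b \<in> B" for b x
 using submodule_valued[OF M] B that by (auto simp: basis_of_def)
have "lincomb B (%b. c b \<ominus> d b) x = lincomb B c x \<ominus> lincomb B d x" for x
proof -
 have "(\<Oplus>b\<in>B. (c b \<ominus> d b) \<otimes> b x) \<oplus> (\<Oplus>b\<in>B. d b \<otimes> b x) = (\<Oplus>b\<in>B. (c b \<ominus> d b) \<otimes> b x \<oplus> d b \<otimes> b x)"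
 using c v by (intro finsum_addf[symmetric]) (auto simp: a_minus_def Pi_def)
 also have "\<dots> = (\<Oplus>b\<in>B. c b \<otimes> b x)"
 proof (rule finsum_cong'[OF refl])
 fix b assume b: "b \<in> B"
 then have R: "c b \<in> carrier R" "d b \<in> carrier R" "b x \<in> carrier R" using c v by auto
 then have "(c b \<ominus> d b) \<otimes> b x \<oplus> d b \<otimes> b x = (c b \<ominus> d b \<oplus> d b) \<otimes> b x" by (simp add: l_distr)
 also have "c b \<ominus> d b \<oplus> d b = c b" using R by (simp add: a_minus_def a_assoc l_neg)
 finally show "(c b \<ominus> d b) \<otimes> b x \<oplus> d b \<otimes> b x = c b \<otimes> b x" .
 qed (use c v in auto)
 finally have "lincomb B (%b. c b \<ominus> d b) x \<oplus> lincomb B d x = lincomb B c x" by (simp add: lincomb_def)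
 moreover have "lincomb B (%b. c b \<ominus> d b) x \<in> carrier R" "lincomb B d x \<in> carrier R"
 using c v by (auto simp: lincomb_def a_minus_def Pi_def intro!: finsum_closed)
 moreover have "(u \<oplus> w) \<ominus> w = u" if "u \<in> carrier R" "w \<in> carrier R" for u w
 using that by (simp add: a_minus_def a_assoc r_neg)
 ultimately show ?thesis by metis
qed
moreover have "lincomb B d x \<in> carrier R" for x
 using c v by (auto simp: lincomb_def intro!: finsum_closed)
ultimately have "lincomb B (%b. c b \<ominus> d b) = (%_. \<zero>)"
 using eq by (auto simp: a_minus_def r_neg)
moreover have "(%b. c b \<ominus> d b) \<in> B \<rightarrow> carrier R" using c by auto
ultimately have "c b \<ominus> d b = \<zero>" using basis_indep[OF B, of "%b. c b \<ominus> d b"] b by blast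
moreover have "c b \<in> carrier R" "d b \<in> carrier R" using c b by auto
ultimately show ?thesis by (simp add: diff_eq_zero_iff)
qed

text \<open>
A basis of the kernel of a linear map together with lifts of a basis of its image is a basis of
the source.
\<close>

lemma extend_basis:
assumes M: "submodule M R (fspace S)"
 and g: "g \<in> mod_hom R (restrict_mod (fspace S) M) (fspace S')"
 and B1: "basis_of {x \<in> M. g x = (%_. \<zero>)} B1" and B2: "basis_of (g ` M) B2"
 and l: "!!b. b \<in> B2 ==> l b \<in> M & g (l b) = b"
 and nontrivial: "\<one> ~= \<zero>"
shows "basis_of M (B1 \<union> l ` B2)" "B1 \<inter> l ` B2 = {}"
proof -
have fin: "finite B1" "finite B2" and B1M: "B1 <= M" and g0: "!!b. b \<in> B1 ==> g b = (%_. \<zero>)"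
 using B1 B2 by (auto simp: basis_of_def)
have inj: "inj_on l B2" using l by (metis inj_onI)
have lM: "l ` B2 <= M" using l by auto
have sub: "submodule (g ` M) R (fspace S')"
proof -
 have "submodule M R (restrict_mod (fspace S) M)"
 by (intro submodule_restrict fspace_module M order_refl)
 from submodule_image[OF restrict_mod_module[OF fspace_module M] fspace_module g this]
 show ?thesis .
qed
have v2: "b x \<in> carrier R" if "b \<in> B2" for b x
 using submodule_valued[OF sub] B2 that by (auto simp: basis_of_def)
have vM: "b x \<in> carrier R" if "b \<in> M" for b x using submodule_valued[OF M that] .
have B2ne: "b ~= (%_. \<zero>)" if b: "b \<in> B2" for b
proof
 assume z: "b = (%_. \<zero>)"
 let ?c = "%b'. if b' = b then \<one> else \<zero>"
 have "lincomb B2 ?c x = \<zero>" for x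
 unfolding lincomb_def using z v2 by (intro add.finprod_one_eqI) auto
 then have "lincomb B2 ?c = (%_. \<zero>)" by auto
 moreover have "?c \<in> B2 \<rightarrow> carrier R" by auto
 ultimately have "?c b = \<zero>" by (intro basis_indep[OF B2 _ _ b])
 then show False using nontrivial by simp
qed
show disj: "B1 \<inter> l ` B2 = {}"
 using g0 l B2ne by force
have glc: "g (lincomb (l ` B2) c) = lincomb B2 (%b. c (l b))" if c: "c \<in> l ` B2 \<rightarrow> carrier R" for c
proof
 fix x
 have cl: "c (l b) \<in> carrier R" if "b \<in> B2" for b using funcset_mem[OF c] that by blast
 have gl: "(%b. c b \<otimes> g b x) \<in> l ` B2 \<rightarrow> carrier R" using cl l v2 by auto
 have "g (lincomb (l ` B2) c) x = (\<Oplus>b\<in>l ` B2. c b \<otimes> g b x)"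
 using hom_lincomb[OF M g finite_imageI[OF fin(2)] lM c] by simp
 also have "\<dots> = (\<Oplus>b\<in>B2. c (l b) \<otimes> g (l b) x)" by (rule finsum_reindex[OF gl inj])
 also have "\<dots> = lincomb B2 (%b. c (l b)) x"
 unfolding lincomb_def using cl l v2 by (intro finsum_cong') auto
 finally show "g (lincomb (l ` B2) c) x = lincomb B2 (%b. c (l b)) x" .
qed
have g1: "g (lincomb B1 c) = (%_. \<zero>)" if c: "c \<in> B1 \<rightarrow> carrier R" for c
proof -
 have "(\<Oplus>b\<in>B1. c b \<otimes> g b x) = \<zero>" for x
 using g0 c by (intro add.finprod_one_eqI) (auto simp: Pi_def)
 then show ?thesis using hom_lincomb[OF M g fin(1) B1M c] by simp
qed
have split: "lincomb (B1 \<union> l ` B2) c = lincomb B1 c \<oplus>\<^bsub>fspace S\<^esub> lincomb (l ` B2) c"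
 if c: "c \<in> B1 \<union> l ` B2 \<rightarrow> carrier R" for c
proof -
 have "b x \<in> carrier R" if "b \<in> B1 \<union> l ` B2" for b x using vM B1M lM that by blast
 then show ?thesis using lincomb_Un[OF fin(1) finite_imageI[OF fin(2)] disj _ c] by simp
qed
let ?M = "restrict_mod (fspace S) M"
note Mm = restrict_mod_module[OF fspace_module M]
show "basis_of M (B1 \<union> l ` B2)"
 unfolding basis_of_def
proof (intro conjI ballI impI)
 show "finite (B1 \<union> l ` B2)" "B1 \<union> l ` B2 <= M" using fin B1M lM by auto
 fix x assume x: "x \<in> M"
 then obtain d where d: "d \<in> B2 \<rightarrow> carrier R" "g x = lincomb B2 d"
 using B2 unfolding basis_of_def by blast
 define d' where "d' = (%b. d (g b))"
 have d': "d' \<in> l ` B2 \<rightarrow> carrier R" using d l by (auto simp: d'_def)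
 have y: "lincomb (l ` B2) d' \<in> M" by (rule lincomb_mem[OF M finite_imageI[OF fin(2)] lM d'])
 have "lincomb B2 (%b. d' (l b)) = lincomb B2 d"
 using l d v2 by (intro lincomb_cong) (auto simp: d'_def)
 then have gy: "g (lincomb (l ` B2) d') = g x" using glc[OF d'] d by simp
 let ?z = "x \<ominus>\<^bsub>?M\<^esub> lincomb (l ` B2) d'"
 interpret Mi: module R ?M by (rule Mm)
 interpret Fi: module R "fspace S'" by (rule fspace_module)
 have z: "?z \<in> M" using x y Mi.minus_closed by simp
 have gx: "g x \<in> carrier (fspace S')" using mod_hom_closed[OF g, of x] x by simp
 have "g ?z = \<zero>\<^bsub>fspace S'\<^esub>"
 using mod_hom_diff[OF Mm fspace_module g, of x "lincomb (l ` B2) d'"] x y gy gx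
 by (simp add: Fi.diff_eq_zero_iff del: free_mod_simps)
 then obtain c where c: "c \<in> B1 \<rightarrow> carrier R" "?z = lincomb B1 c"
 using z B1 unfolding basis_of_def by auto
 let ?c = "%b. if b \<in> B1 then c b else d' b"
 have cc: "?c \<in> B1 \<union> l ` B2 \<rightarrow> carrier R" using c(1) d' by (simp add: Pi_def)
 have "lincomb B1 ?c = lincomb B1 c"
 by (rule lincomb_cong[OF _ c(1)]) (use vM B1M in auto)
 moreover have "lincomb (l ` B2) ?c = lincomb (l ` B2) d'"
 by (rule lincomb_cong[OF _ d']) (use vM lM disj in auto)
 ultimately
 have "lincomb (B1 \<union> l ` B2) ?c = ?z \<oplus>\<^bsub>?M\<^esub> lincomb (l ` B2) d'"
 unfolding split[OF cc] c(2) by simp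
 also have "\<dots> = x" using x y Mi.a_closed Mi.a_assoc[of x "\<ominus>\<^bsub>?M\<^esub> lincomb (l ` B2) d'" "lincomb (l ` B2) d'"]
  Mi.l_neg[of "lincomb (l ` B2) d'"] Mi.r_zero[of x] Mi.a_inv_closed
 by (simp add: a_minus_def del: free_mod_simps)
 finally show "EX c:B1 \<union> l ` B2 \<rightarrow> carrier R. x = lincomb (B1 \<union> l ` B2) c"
 by (intro bexI[OF _ cc]) simp
next
 fix c b assume c: "c \<in> B1 \<union> l ` B2 \<rightarrow> carrier R" and z: "lincomb (B1 \<union> l ` B2) c = (%_. \<zero>)"
 and b: "b \<in> B1 \<union> l ` B2"
 have c1: "c \<in> B1 \<rightarrow> carrier R" and c2: "c \<in> l ` B2 \<rightarrow> carrier R" using c by auto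
 have m1: "lincomb B1 c \<in> M" and m2: "lincomb (l ` B2) c \<in> M"
 using lincomb_mem[OF M fin(1) B1M c1] lincomb_mem[OF M finite_imageI[OF fin(2)] lM c2] by auto
 have "g (lincomb B1 c \<oplus>\<^bsub>?M\<^esub> lincomb (l ` B2) c) = g (lincomb B1 c) \<oplus>\<^bsub>fspace S'\<^esub> g (lincomb (l ` B2) c)"
 by (rule mod_hom_add[OF g]) (simp_all add: m1 m2)
 moreover have "lincomb B1 c \<oplus>\<^bsub>?M\<^esub> lincomb (l ` B2) c = \<zero>\<^bsub>?M\<^esub>" using split[OF c] z by simp
 moreover have "g \<zero>\<^bsub>?M\<^esub> = \<zero>\<^bsub>fspace S'\<^esub>" by (rule mod_hom_zero[OF Mm fspace_module g])
 moreover have "g (lincomb (l ` B2) c) x \<in> carrier R" for x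
 using mod_hom_closed[OF g, of "lincomb (l ` B2) c"] m2 by (auto simp: free_mod_carrier)
 ultimately have "g (lincomb (l ` B2) c) = (%_. \<zero>)"
 using g1[OF c1] by (simp add: fun_eq_iff)
 then have "lincomb B2 (%b. c (l b)) = (%_. \<zero>)" using glc[OF c2] by simp
 moreover have "(%b. c (l b)) \<in> B2 \<rightarrow> carrier R" using c2 by auto
 ultimately have z2: "ALL b:B2. c (l b) = \<zero>" using basis_indep[OF B2, of "%b. c (l b)"] by blast
 have "lincomb (l ` B2) c x = \<zero>" for x
 unfolding lincomb_def using z2 vM lM by (intro add.finprod_one_eqI) auto
 moreover have "lincomb B1 c x \<in> carrier R" for x using vM[OF m1] .
 ultimately have "lincomb B1 c = (%_. \<zero>)" using split[OF c] z by (simp add: fun_eq_iff)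
 then have "ALL b:B1. c b = \<zero>" using B1 c1 unfolding basis_of_def by blast
 then show "c b = \<zero>" using z2 b by auto
qed
qed

lemma basis_nonzero:
assumes "basis_of M B" "\<one> ~= \<zero>" "submodule M R (fspace S)"
shows "(%_. \<zero>) \<notin> B"
proof
assume z: "(%_. \<zero>) \<in> B"
let ?c = "%b. if b = (%_. \<zero>) then \<one> else \<zero>"
have "b x \<in> carrier R" if "b \<in> B" for b x
 using submodule_valued[OF assms(3)] assms(1) that by (auto simp: basis_of_def)
then have "lincomb B ?c x = \<zero>" for x
 unfolding lincomb_def by (intro add.finprod_one_eqI) auto
then have 1: "lincomb B ?c = (%_. \<zero>)" by auto
have 2: "?c \<in> B \<rightarrow> carrier R" by auto
show False using basis_indep[OF assms(1) 2 1 z] assms(2) by simp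
qed

lemma basis_of_generators:
fixes S :: "'x set"
assumes "finite S" shows "basis_of (carrier (fspace S)) (generator R ` S)"
unfolding basis_of_def
proof (intro conjI ballI impI)
show "finite (generator R ` S)" "generator R ` S <= carrier (fspace S)"
 using assms generator_mem[OF is_cring] by auto
have lc: "lincomb (generator R ` S) c x = (if x \<in> S then c (generator R x) else \<zero>)"
 if c: "c \<in> generator R ` S \<rightarrow> carrier R" for c x
proof (cases "\<one> = \<zero>")
 case True
 then have "a = \<zero>" if "a \<in> carrier R" for a using that by (metis l_one l_null)
 moreover have "lincomb (generator R ` S) c x \<in> carrier R" unfolding lincomb_def
 using c by (intro finsum_closed) (auto simp: generator_closed Pi_def)
 moreover have "(if x \<in> S then c (generator R x) else \<zero>) \<in> carrier R" using c by auto
 ultimately show ?thesis by metis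
next
 case False
 have inj: "inj_on (generator R) S"
 proof (rule inj_onI)
 fix s t :: 'x assume "generator R s = (generator R t :: 'x => 'a)"
 then have "generator R s s = generator R t s" by simp
 then show "s = t" using False by (auto simp: generator_def split: if_splits)
 qed
 have "lincomb (generator R ` S) c x = (\<Oplus>s\<in>S. c (generator R s) \<otimes> generator R s x)"
 unfolding lincomb_def using c by (intro finsum_reindex[OF _ inj]) (auto simp: generator_closed Pi_def)
 also have "\<dots> = (if x \<in> S then c (generator R x) \<otimes> generator R x x else \<zero>)"
 using c by (intro finsum_single assms) (auto simp: generator_closed Pi_def)
 finally show ?thesis using c by (auto simp: Pi_def)
qed
show "EX c:generator R ` S \<rightarrow> carrier R. x = lincomb (generator R ` S) c"
 if x: "x \<in> carrier (fspace S)" for x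
proof (cases "\<one> = \<zero>")
 case True
 then have "a = \<zero>" if "a \<in> carrier R" for a using that by (metis l_one l_null)
 then have xz: "x s = \<zero>" for s using free_mod_closed[OF x] by blast
 have "x = lincomb (generator R ` S) (%_. \<zero>)"
 using xz lc[of "%_. \<zero>"] by (auto simp: fun_eq_iff)
 then show ?thesis by auto
next
 case False
 let ?c = "%b. x (SOME s. b = generator R s)"
 have e: "(SOME t. generator R s = (generator R t :: 'x => 'a)) = s" for s
 proof (rule some_equality)
 fix t :: 'x assume "generator R s = (generator R t :: 'x => 'a)"
 then have "generator R s s = generator R t s" by simp
 then show "t = s" using False by (auto simp: generator_def split: if_splits)
 qed simp
 have cc: "?c \<in> generator R ` S \<rightarrow> carrier R" using free_mod_closed[OF x] by auto
 have "x = lincomb (generator R ` S) ?c"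
 using lc[OF cc] free_mod_outside[OF x] e by (auto simp: fun_eq_iff)
 then show ?thesis using cc by blast
qed
show "c b = \<zero>" if c: "c \<in> generator R ` S \<rightarrow> carrier R"
 and z: "lincomb (generator R ` S) c = (%_. \<zero>)" and b: "b \<in> generator R ` S" for c b
proof -
 obtain s where "s \<in> S" "b = generator R s" using b by auto
 then show ?thesis using lc[OF c, of s] z by simp
qed
qed

end

text \<open>Both fields and the integers are instances of the following locale.\<close>

locale pid = domain +
assumes principal: "[|J <= carrier R; \<zero> \<in> J; !!x y. x \<in> J ==> y \<in> J ==> x \<oplus> y \<in> J;
 !!r x. r \<in> carrier R ==> x \<in> J ==> r \<otimes> x \<in> J|] ==>
 EX a:J. ALL x:J. EX r:carrier R. x = r \<otimes> a"

lemma (in pid) submodule_basis: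
assumes "finite S" "submodule N R (fspace S)"
shows "EX B. basis_of N B"
using assms
proof (induction S arbitrary: N rule: finite_induct)
case empty
have "N = {%_. \<zero>}"
 using submodule_subset[OF empty.prems] submodule_zero_mem[OF empty.prems]
 by (auto simp: free_mod_carrier fun_eq_iff subset_iff)
then have "basis_of N {}" by (auto simp: basis_of_def)
then show ?case by blast
next
case (insert s S)
note N = insert.prems
let ?F = "fspace (insert s S)" and ?g = "%f (_::unit). f s"
let ?N' = "{f \<in> N. ?g f = (%_. \<zero>)}"
have NF: "N <= carrier ?F" by (rule submodule_subset[OF N])
have fs: "f x \<in> carrier R" if "f \<in> N" for f x using submodule_valued[OF N that] .
have finS: "finite (insert s S)" using insert.hyps by simp
have N'S: "f \<in> carrier (fspace S)" if "f \<in> N" "f s = \<zero>" for f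
 using subsetD[OF NF that(1)] that(2)
 unfolding free_mod_carrier_finite[OF finS] free_mod_carrier_finite[OF insert.hyps(1)] by auto
have "submodule ?N' R (fspace S)"
 using N'S submodule_zero_mem[OF N] submodule_add_mem[OF N] submodule_smult_mem[OF N]
 by (intro submodule_criterion fspace_module) (auto simp: fun_eq_iff)
then obtain B1 where B1: "basis_of ?N' B1" using insert.IH by blast
let ?J = "(%f. f s) ` N"
have "EX a:?J. ALL x:?J. EX r:carrier R. x = r \<otimes> a"
proof (rule principal)
 show "?J <= carrier R" using fs by auto
 show "\<zero> \<in> ?J" using submodule_zero_mem[OF N] by (auto intro!: image_eqI[of _ _ "%_. \<zero>"])
 show "x \<oplus> y \<in> ?J" if "x \<in> ?J" "y \<in> ?J" for x y
 proof -
 obtain f h where "f \<in> N" "h \<in> N" "x = f s" "y = h s" using \<open>x \<in> ?J\<close> \<open>y \<in> ?J\<close> by auto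
 then show ?thesis using submodule_add_mem[OF N, of f h] by (auto intro!: image_eqI[of _ _ "f \<oplus>\<^bsub>?F\<^esub> h"])
 qed
 show "x \<otimes> a \<in> ?J" if a: "a \<in> ?J" and x: "x \<in> carrier R" for a x
 proof -
 obtain f where f: "f \<in> N" "a = f s" using a by auto
 have "x \<odot>\<^bsub>?F\<^esub> f \<in> N" using submodule_smult_mem[OF N x f(1)] .
 then show "x \<otimes> a \<in> ?J" using f by (auto intro!: image_eqI[of _ _ "x \<odot>\<^bsub>?F\<^esub> f"])
 qed
qed
then obtain a where aJ: "a \<in> ?J" and ap: "!!f. f \<in> N ==> EX r:carrier R. f s = r \<otimes> a" by blast
then have a: "a \<in> carrier R" using fs by auto
from aJ obtain f0 where f0: "f0 \<in> N" "f0 s = a" by auto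
have g: "?g \<in> mod_hom R (restrict_mod ?F N) (fspace (UNIV :: unit set))"
 using fs by (intro mod_homI) (auto simp: free_mod_carrier)
show ?case
proof (cases "a = \<zero>")
 case True
 then have "f s = \<zero>" if "f \<in> N" for f
 using ap[OF that] by auto
 then have "?N' = N" by auto
 then show ?thesis using B1 by metis
next
 case False
 have "basis_of (?g ` N) {%_. a}"
 unfolding basis_of_def
 proof (intro conjI ballI impI)
 show "{%_. a} <= ?g ` N" using f0 by auto
 fix y assume "y \<in> ?g ` N"
 then obtain f where f: "f \<in> N" "y = ?g f" by auto
 obtain r where r: "r \<in> carrier R" "f s = r \<otimes> a" using ap[OF f(1)] by blast
 have "lincomb {%_::unit. a} (%_. r) = (%_. r \<otimes> a)"
  using r a by (auto simp: lincomb_def)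
 then show "EX c:{%_. a} \<rightarrow> carrier R. y = lincomb {%_. a} c"
  using r f by (intro bexI[of _ "%_. r"]) auto
 next
 fix c :: "(unit => 'a) => 'a" and b :: "unit => 'a"
 assume c: "c \<in> {%_. a} \<rightarrow> carrier R" "lincomb {%_. a} c = (%_. \<zero>)" and b: "b \<in> {%_. a}"
 have "lincomb {%_. a} c () = c (%_. a) \<otimes> a" using c(1) a by (auto simp: lincomb_def)
 then have "c (%_. a) \<otimes> a = \<zero>" using c(2) by simp
 then show "c b = \<zero>" using False a c(1) b integral[of "c (%_. a)" a] by auto
 qed simp
 from extend_basis(1)[OF N g B1 this, of "%_. f0"] f0 show ?thesis by auto
qed
qed

section \<open>Homology classes and induced maps\<close>

lemma quot_map_coset:
assumes M: "module R M" and N: "submodule N R M" and M': "module R M'" and N': "submodule N' R M'"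
 and f: "f \<in> mod_hom R M M'" and sub: "!!x. x \<in> N ==> f x \<in> N'" and x: "x \<in> carrier M"
shows "quot_map M' N' f (N +>\<^bsub>M\<^esub> x) = N' +>\<^bsub>M'\<^esub> f x"
unfolding quot_map_def
proof (rule UN_constant_eq[OF coset_self_mem[OF M N x]], intro ballI)
fix z assume z: "z \<in> N +>\<^bsub>M\<^esub> x"
then have zM: "z \<in> carrier M" using coset_subset[OF M N x] by blast
have "z \<ominus>\<^bsub>M\<^esub> x \<in> N" using coset_eq_iff[OF M N zM x] coset_mem_eq[OF M N x z] by simp
then have "f (z \<ominus>\<^bsub>M\<^esub> x) \<in> N'" by (rule sub)
then have "f z \<ominus>\<^bsub>M'\<^esub> f x \<in> N'" using mod_hom_diff[OF M M' f zM x] by simp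
then show "N' +>\<^bsub>M'\<^esub> f z = N' +>\<^bsub>M'\<^esub> f x"
 using coset_eq_iff[OF M' N' mod_hom_closed[OF f zM] mod_hom_closed[OF f x]] by simp
qed

lemma quot_map_hom:
assumes M: "module R M" and N: "submodule N R M" and M': "module R M'" and N': "submodule N' R M'"
 and f: "f \<in> mod_hom R M M'" and sub: "!!x. x \<in> N ==> f x \<in> N'"
shows "quot_map M' N' f \<in> mod_hom R (quot_mod M N) (quot_mod M' N')"
proof -
interpret M: module R M by (rule M)
note c = quot_map_coset[OF M N M' N' f sub]
note fc = mod_hom_closed[OF f]
show ?thesis
 by (intro mod_homI)
 (auto simp: quot_mod_carrier quot_mod_add[OF M N] quot_mod_smult[OF M N] c
  quot_mod_add[OF M' N'] quot_mod_smult[OF M' N'] fc mod_hom_add[OF f] mod_hom_smult[OF f])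
qed

lemma quot_map_cong: "add M = add M' ==> quot_map M N f = quot_map M' N f"
unfolding quot_map_def by (intro ext SUP_cong refl) (rule coset_cong)

lemma mod_hom_restrict_target:
"f \<in> mod_hom R M N ==> (!!x. x \<in> carrier M ==> f x \<in> L) ==> f \<in> mod_hom R M (restrict_mod N L)"
by (auto simp: mod_hom_def)

lemma mod_hom_restrict_source:
"f \<in> mod_hom R M N ==> L <= carrier M ==> f \<in> mod_hom R (restrict_mod M L) N"
by (auto simp: mod_hom_def subset_iff Pi_def)

lemma ker_mod_module:
assumes "module R M" "module R N" "h \<in> mod_hom R M N" shows "module R (ker_mod M N h)"
unfolding ker_mod_def a_kernel_def' by (intro restrict_mod_module assms(1) submodule_kernel assms)

lemma im_mod_module:
assumes "module R M" "module R N" "h \<in> mod_hom R M N" shows "module R (im_mod M N h)"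
unfolding im_mod_def
by (intro restrict_mod_module assms(2) submodule_image[OF assms] submodule_self[OF assms(1)])

lemma coker_mod_module:
assumes "module R M" "module R N" "h \<in> mod_hom R M N" shows "module R (coker_mod M N h)"
unfolding coker_mod_def
by (intro quot_mod_module assms(2) submodule_image[OF assms] submodule_self[OF assms(1)])

definition mcls :: "('r, 's) ring_scheme => 'x set => ('x => int) => ('x => 'x => 'r) => int => ('x => 'r) => ('x => 'r) set"
where "mcls R S sz D d c = mbounds R S sz D d +>\<^bsub>mchains R S sz d\<^esub> c"

lemma mhom_carrier: "carrier (mhom R S sz D d) = mcls R S sz D d ` mcycles R S sz D d"
proof -
have "mbounds R S sz D d +>\<^bsub>restrict_mod (mchains R S sz d) (mcycles R S sz D d)\<^esub> c = mcls R S sz D d c" for c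
 unfolding mcls_def by (rule coset_cong) simp
then show ?thesis by (auto simp: mhom_def quot_mod_carrier)
qed

lemma mhom_zero: "\<zero>\<^bsub>mhom R S sz D d\<^esub> = mbounds R S sz D d"
by (simp add: mhom_def)

context cring begin

lemma mcls_coset: "mcls R S sz D d c = mbounds R S sz D d +>\<^bsub>restrict_mod (mchains R S sz d) (mcycles R S sz D d)\<^esub> c"
unfolding mcls_def by (rule coset_cong) simp

lemma mcls_hom:
assumes C: "mcomplex R S sz D"
shows "mcls R S sz D d \<in> mod_hom R (restrict_mod (mchains R S sz d) (mcycles R S sz D d)) (mhom R S sz D d)"
using coset_mod_hom[OF mcycles_module[OF C] mbounds_submodule_mcycles[OF C]]
unfolding mhom_def mcls_coset[abs_def] .

lemma mcls_zero_iff: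
assumes C: "mcomplex R S sz D" and c: "c \<in> mcycles R S sz D d"
shows "mcls R S sz D d c = mbounds R S sz D d \<longleftrightarrow> c \<in> mbounds R S sz D d"
unfolding mcls_coset
by (rule coset_eq_zero_iff[OF mcycles_module[OF C] mbounds_submodule_mcycles[OF C]]) (simp add: c)

context
fixes S :: "'x set" and sz :: "'x => int" and D :: "'x => 'x => 'a"
 and S' :: "'y set" and sz' :: "'y => int" and D' :: "'y => 'y => 'a" and d :: int and f
assumes C: "mcomplex R S sz D" and C': "mcomplex R S' sz' D'"
 and f: "f \<in> mod_hom R (mchains R S sz d) (mchains R S' sz' d)"
 and cyc: "!!c. c \<in> mcycles R S sz D d ==> f c \<in> mcycles R S' sz' D' d"
 and bnd: "!!c. c \<in> mbounds R S sz D d ==> f c \<in> mbounds R S' sz' D' d"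
begin

lemma f_cycles_hom: "f \<in> mod_hom R (restrict_mod (mchains R S sz d) (mcycles R S sz D d))
 (restrict_mod (mchains R S' sz' d) (mcycles R S' sz' D' d))"
by (rule mod_hom_restrict_target[OF mod_hom_restrict_source[OF f submodule_subset[OF mcycles_submodule[OF C]]]])
 (simp add: cyc)

lemma induced_map_class:
assumes "c \<in> mcycles R S sz D d"
shows "quot_map (mchains R S' sz' d) (mbounds R S' sz' D' d) f (mcls R S sz D d c) = mcls R S' sz' D' d (f c)"
proof -
have "quot_map (mchains R S' sz' d) (mbounds R S' sz' D' d) f =
 quot_map (restrict_mod (mchains R S' sz' d) (mcycles R S' sz' D' d)) (mbounds R S' sz' D' d) f"
 by (rule quot_map_cong) simp
then show ?thesis
 using quot_map_coset[OF mcycles_module[OF C] mbounds_submodule_mcycles[OF C] mcycles_module[OF C']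
  mbounds_submodule_mcycles[OF C'] f_cycles_hom bnd, of c] assms
 by (simp add: mcls_coset)
qed

lemma induced_map_hom:
"quot_map (mchains R S' sz' d) (mbounds R S' sz' D' d) f \<in> mod_hom R (mhom R S sz D d) (mhom R S' sz' D' d)"
proof -
have "quot_map (mchains R S' sz' d) (mbounds R S' sz' D' d) f =
 quot_map (restrict_mod (mchains R S' sz' d) (mcycles R S' sz' D' d)) (mbounds R S' sz' D' d) f"
 by (rule quot_map_cong) simp
then show ?thesis
 using quot_map_hom[OF mcycles_module[OF C] mbounds_submodule_mcycles[OF C] mcycles_module[OF C']
  mbounds_submodule_mcycles[OF C'] f_cycles_hom bnd]
 by (simp add: mhom_def)
qed

end

section \<open>Bases adapted to a pair of complexes\<close>

lemma mchains_restrict: "restrict_mod (mchains R S sz d) M = restrict_mod (fspace B) M"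
by (simp add: restrict_mod_def free_mod_def mchains_def)

lemma submodule_fspace:
assumes "submodule M R (mchains R S sz d)" "finite S'" "S <= S'"
shows "submodule M R (fspace S')"
proof (rule submodule_criterion[OF fspace_module])
have "finite S" using assms finite_subset by blast
show "M <= carrier (fspace S')"
proof
 fix c assume "c \<in> M"
 then have "c \<in> carrier (mchains R S sz d)" using submodule_subset[OF assms(1)] by blast
 then have "c \<in> carrier (fspace S)" by (rule mchains_subset[OF \<open>finite S\<close>])
 then show "c \<in> carrier (fspace S')"
 unfolding free_mod_carrier_finite[OF \<open>finite S\<close>] free_mod_carrier_finite[OF assms(2)]
 using assms(3) by blast
qed
show "\<zero>\<^bsub>fspace S'\<^esub> \<in> M" using submodule_zero_mem[OF assms(1)] by simp
show "x \<oplus>\<^bsub>fspace S'\<^esub> y \<in> M" if "x \<in> M" "y \<in> M" for x y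
 using submodule_add_mem[OF assms(1) that] by simp
show "r \<odot>\<^bsub>fspace S'\<^esub> x \<in> M" if "r \<in> carrier R" "x \<in> M" for r x
 using submodule_smult_mem[OF assms(1) that] by simp
qed

text \<open>
Lifts of a basis of a free quotient \<open>Q\<close> complete a basis of the kernel of \<open>q\<close>, whichever module
above \<open>M\<^sub>0\<close> is chosen as the domain of \<open>q\<close>.
\<close>

definition basis_lifts :: "'x set => ('a, 'q) module => (('x => 'a) => 'q) => ('x => 'a) set => ('x => 'a) set => bool"
where "basis_lifts S Q q M0 U \<longleftrightarrow> U <= M0 & (ALL M B. submodule M R (fspace S) --> M0 <= M -->
 q \<in> mod_hom R (restrict_mod (fspace S) M) Q --> basis_of {x \<in> M. q x = \<zero>\<^bsub>Q\<^esub>} B -->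
 basis_of M (B \<union> U) & B \<inter> U = {})"

lemma basis_liftsD:
assumes "basis_lifts S Q q M0 U" "submodule M R (fspace S)" "M0 <= M"
 "q \<in> mod_hom R (restrict_mod (fspace S) M) Q" "basis_of {x \<in> M. q x = \<zero>\<^bsub>Q\<^esub>} B"
shows "basis_of M (B \<union> U) & B \<inter> U = {}"
using assms unfolding basis_lifts_def by blast

lemma quotient_lifts:
fixes S :: "'x set" and q :: "('x => 'a) => 'q"
assumes Q: "module R Q" and iso: "mod_isomorphic R Q (fspace {..<r::nat})" and nontriv: "\<one> ~= \<zero>"
 and surj: "!!y. y \<in> carrier Q ==> EX x:M0. q x = y"
shows "EX U. basis_lifts S Q q M0 U"
proof -
obtain \<phi> where \<phi>: "\<phi> \<in> mod_iso R Q (fspace {..<r})" using iso by (auto simp: mod_isomorphic_def)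
let ?G = "generator R ` {..<r}"
have G: "basis_of (carrier (fspace {..<r})) ?G" by (rule basis_of_generators) simp
have "ALL b:?G. EX x. x \<in> M0 & \<phi> (q x) = b"
proof
 fix b assume "b \<in> ?G"
 then have "b \<in> carrier (fspace {..<r})" using G by (auto simp: basis_of_def)
 then obtain y where y: "y \<in> carrier Q" "\<phi> y = b" using mod_iso_surjD[OF \<phi>] by blast
 then obtain x where "x \<in> M0" "q x = y" using surj by blast
 then show "EX x. x \<in> M0 & \<phi> (q x) = b" using y by blast
qed
then have "EX l. ALL b:?G. l b \<in> M0 & \<phi> (q (l b)) = b" by (rule bchoice)
then obtain l where l: "!!b. b \<in> ?G ==> l b \<in> M0 & \<phi> (q (l b)) = b" by blast
have "basis_lifts S Q q M0 (l ` ?G)"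
 unfolding basis_lifts_def
proof (intro conjI allI impI)
 show "l ` ?G <= M0" using l by blast
 fix M B assume M: "submodule M R (fspace S)" and M0: "M0 <= M"
 and q: "q \<in> mod_hom R (restrict_mod (fspace S) M) Q" and B: "basis_of {x \<in> M. q x = \<zero>\<^bsub>Q\<^esub>} B"
 have qM: "q x \<in> carrier Q" if "x \<in> M" for x using mod_hom_closed[OF q] that by simp
 have g: "(%x. \<phi> (q x)) \<in> mod_hom R (restrict_mod (fspace S) M) (fspace {..<r})"
 by (rule mod_hom_compose[OF q mod_iso_hom[OF \<phi>]])
 have "{x \<in> M. \<phi> (q x) = (%_. \<zero>)} = {x \<in> M. q x = \<zero>\<^bsub>Q\<^esub>}"
 using mod_iso_zero_iff[OF Q fspace_module \<phi> qM] by auto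
 then have B': "basis_of {x \<in> M. \<phi> (q x) = (%_. \<zero>)} B" using B by simp
 have "(%x. \<phi> (q x)) ` M = carrier (fspace {..<r})"
 proof
 show "(%x. \<phi> (q x)) ` M <= carrier (fspace {..<r})"
  using mod_hom_closed[OF mod_iso_hom[OF \<phi>] qM] by blast
 show "carrier (fspace {..<r}) <= (%x. \<phi> (q x)) ` M"
 proof
  fix b assume "b \<in> carrier (fspace {..<r})"
  then obtain y where y: "y \<in> carrier Q" "\<phi> y = b" using mod_iso_surjD[OF \<phi>] by blast
  then obtain x where "x \<in> M0" "q x = y" using surj by blast
  then show "b \<in> (%x. \<phi> (q x)) ` M" using y M0 by blast
 qed
 qed
 then have G': "basis_of ((%x. \<phi> (q x)) ` M) ?G" using G by simp
 have l': "l b \<in> M & \<phi> (q (l b)) = b" if "b \<in> ?G" for b using l[OF that] M0 by blast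
 show "basis_of M (B \<union> l ` ?G)" "B \<inter> l ` ?G = {}"
 using extend_basis[OF M g B' G' l' nontriv] by blast+
qed
then show ?thesis by blast
qed

end

context pid begin

lemma basis_lift:
assumes M: "submodule M R (fspace S)" and g: "g \<in> mod_hom R (restrict_mod (fspace S) M) (fspace S')"
 and B1: "basis_of {x \<in> M. g x = (%_. \<zero>)} B1" and B2: "basis_of (g ` M) B2"
obtains l where "!!b. b \<in> B2 ==> l b \<in> M & g (l b) = b" "basis_of M (B1 \<union> l ` B2)" "B1 \<inter> l ` B2 = {}"
proof -
have "ALL b:B2. EX x. x \<in> M & g x = b" using B2 by (auto simp: basis_of_def)
then have "EX l. ALL b:B2. l b \<in> M & g (l b) = b" by (rule bchoice)
then obtain l where l: "!!b. b \<in> B2 ==> l b \<in> M & g (l b) = b" by blast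
show thesis by (rule that[OF l extend_basis[OF M g B1 B2 l one_not_zero]])
qed

context
fixes S T :: "'x set" and sz :: "'x => int" and D :: "'x => 'x => 'a"
assumes C: "mcomplex R S sz D" and TS: "T <= S"
 and sub_closed: "ALL s:S. ALL t:T. D s t ~= \<zero> --> s \<in> T"
begin

lemma sub: "s \<in> S ==> t \<in> T ==> D s t ~= \<zero> ==> s \<in> T"
using sub_closed by blast

lemma finST: "finite S" "finite T"
using mcomplex_finite[OF C] TS finite_subset by auto

lemma D_closed: "s \<in> S ==> t \<in> S ==> D s t \<in> carrier R"
using is_matD[OF mcomplex_mat[OF C]] by blast

lemma sub_mcomplex: "mcomplex R T sz D"
proof -
have "mat_mul R T D D s t = \<zero>" if st: "s \<in> T" "t \<in> T" for s t
proof -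
 have "mat_mul R T D D s t = mat_mul R S D D s t"
 unfolding mat_mul_def
 proof (rule add.finprod_mono_neutral_cong_left[OF finST(1) TS])
 show "D s u \<otimes> D u t = \<zero>" if u: "u \<in> S - T" for u
 proof -
  have "D u t = \<zero>" using sub[of u t] u st by blast
  then show ?thesis using D_closed[of s u] st u TS by auto
 qed
 qed (use D_closed st TS in auto)
 moreover have "mat_mul R S D D s t = \<zero>" using C subsetD[OF TS] st by (simp add: mcomplex_def)
 ultimately show ?thesis by simp
qed
then show ?thesis using C TS finST by (auto simp: mcomplex_def is_mat_def subset_iff)
qed

lemma sub_app:
assumes c: "c \<in> carrier (fspace T)"
shows "mat_app R T T D c = mat_app R S S D c"
proof
fix s
have c0: "c t = \<zero>" if "t \<notin> T" for t using free_mod_outside[OF c that] .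
have cR: "c t \<in> carrier R" for t using free_mod_closed[OF c] .
have "(\<Oplus>t\<in>T. D s t \<otimes> c t) = (\<Oplus>t\<in>S. D s t \<otimes> c t)" if "s \<in> S"
 by (rule add.finprod_mono_neutral_cong_left[OF finST(1) TS])
 (use D_closed that TS c0 cR in auto)
moreover have "(\<Oplus>t\<in>S. D s t \<otimes> c t) = \<zero>" if "s \<in> S" "s \<notin> T"
proof (rule add.finprod_one_eqI)
 fix t assume t: "t \<in> S"
 show "D s t \<otimes> c t = \<zero>"
 proof (cases "t \<in> T")
 case True
 then have "D s t = \<zero>" using sub[of s t] that by blast
 then show ?thesis using cR by simp
 qed (use c0 D_closed that t in simp)
qed
ultimately show "mat_app R T T D c s = mat_app R S S D c s"
 using TS by (auto simp: mat_app_def)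
qed

lemma sub_chains_iff: "c \<in> carrier (mchains R T sz d) \<longleftrightarrow>
 c \<in> carrier (mchains R S sz d) & (ALL s. s \<notin> T --> c s = \<zero>)"
using TS by (auto simp: mchains_carrier[OF finST(1)] mchains_carrier[OF finST(2)])

lemma sub_cycles_iff: "c \<in> mcycles R T sz D d \<longleftrightarrow> c \<in> mcycles R S sz D d & c \<in> carrier (mchains R T sz d)"
proof (cases "c \<in> carrier (mchains R T sz d)")
case True
then show ?thesis
 using sub_app[OF mchains_subset[OF finST(2) True]] sub_chains_iff[of c d] by (simp add: mcycles_def)
qed (simp add: mcycles_def)

lemma sub_bounds: "mbounds R T sz D d = mat_app R S S D ` carrier (mchains R T sz (d + 1))"
unfolding mbounds_def by (rule image_cong[OF refl]) (rule sub_app[OF mchains_subset[OF finST(2)]])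

lemma sub_bounds_subset: "mbounds R T sz D d <= mbounds R S sz D d"
unfolding sub_bounds using sub_chains_iff by (auto simp: mbounds_def)

lemma incl_hom: "(%c. c) \<in> mod_hom R (mchains R T sz d) (mchains R S sz d)"
using sub_chains_iff by (intro mod_homI) auto

abbreviation "incl d \<equiv> quot_map (mchains R S sz d) (mbounds R S sz D d) (%c. c)"

lemma incl_class: "c \<in> mcycles R T sz D d ==> incl d (mcls R T sz D d c) = mcls R S sz D d c"
by (rule induced_map_class[OF sub_mcomplex C incl_hom]) (use sub_cycles_iff sub_bounds_subset in auto)

lemma incl_mod_hom: "incl d \<in> mod_hom R (mhom R T sz D d) (mhom R S sz D d)"
by (rule induced_map_hom[OF sub_mcomplex C incl_hom]) (use sub_cycles_iff sub_bounds_subset in auto)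

text \<open>
The five kinds of basis elements in degree \<open>d\<close>: boundaries in \<open>T\<close>, classes killed in \<open>S\<close>, classes of
\<open>T\<close> that survive in \<open>S\<close>, boundaries of \<open>S\<close> modulo \<open>T\<close>, and classes of \<open>S\<close> that do not come from \<open>T\<close>.
\<close>

lemma cycles_basis:
assumes ker: "\<exists>r::nat. mod_isomorphic R (ker_mod (mhom R T sz D d) (mhom R S sz D d) (incl d)) (fspace {..<r})"
 and im: "\<exists>r::nat. mod_isomorphic R (im_mod (mhom R T sz D d) (mhom R S sz D d) (incl d)) (fspace {..<r})"
 and coker: "\<exists>r::nat. mod_isomorphic R (coker_mod (mhom R T sz D d) (mhom R S sz D d) (incl d)) (fspace {..<r})"
shows "EX PA PK UI PX UC.
 basis_of (mbounds R T sz D d) PA & basis_of (mcycles R T sz D d) (PA \<union> PK \<union> UI) &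
 basis_of (mbounds R S sz D d) (PA \<union> PK \<union> PX) &
 basis_of (mcycles R S sz D d) (PA \<union> PK \<union> PX \<union> UI \<union> UC) &
 (PA \<union> PK \<union> PX) \<inter> (UI \<union> UC) = {} & PA \<inter> (PK \<union> PX) = {}"
proof -
let ?ZA = "mcycles R T sz D d" and ?BA = "mbounds R T sz D d"
 and ?ZX = "mcycles R S sz D d" and ?BX = "mbounds R S sz D d"
 and ?HA = "mhom R T sz D d" and ?HX = "mhom R S sz D d"
let ?F = "fspace S"
note CT = sub_mcomplex
have ZA: "submodule ?ZA R ?F" and BA: "submodule ?BA R ?F" and ZX: "submodule ?ZX R ?F" and BX: "submodule ?BX R ?F"
 using mcycles_submodule[OF CT] mbounds_submodule[OF CT] mcycles_submodule[OF C] mbounds_submodule[OF C]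
 submodule_fspace finST TS by blast+
have HA: "module R ?HA" and HX: "module R ?HX" using mhom_module CT C by auto
note inc = incl_mod_hom[of d]
have ZAX: "?ZA <= ?ZX" and BAZ: "?BA <= ?ZA" and BXZ: "?BX <= ?ZX" and BAX: "?BA <= ?BX"
 using sub_cycles_iff mbounds_subset[OF CT] mbounds_subset[OF C] sub_bounds_subset by auto
have clsA: "mcls R T sz D d \<in> mod_hom R (restrict_mod ?F ?ZA) ?HA"
 using mcls_hom[OF CT] unfolding mchains_restrict[of _ _ _ _ S] .
have clsX: "mcls R S sz D d \<in> mod_hom R (restrict_mod ?F ?ZX) ?HX"
 using mcls_hom[OF C] unfolding mchains_restrict[of _ _ _ _ S] .
have restr: "f \<in> mod_hom R (restrict_mod ?F L) N" if "f \<in> mod_hom R (restrict_mod ?F M) N" "L <= M" for f N L M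
 using that by (auto simp: mod_hom_def subset_iff Pi_def)
obtain PA where PA: "basis_of ?BA PA" using submodule_basis[OF finST(1) BA] by blast
\<comment> \<open>lifts of a basis of the kernel\<close>
let ?K = "ker_mod ?HA ?HX (incl d)"
have "EX PK. basis_lifts S ?K (mcls R T sz D d) (?ZA \<inter> ?BX) PK"
proof -
 obtain r where r: "mod_isomorphic R ?K (fspace {..<r::nat})" using ker by blast
 have surj: "EX x:?ZA \<inter> ?BX. mcls R T sz D d x = y" if y: "y \<in> carrier ?K" for y
 proof -
 obtain c where c: "c \<in> ?ZA" "y = mcls R T sz D d c" "incl d y = ?BX"
  using y by (auto simp: ker_mod_def a_kernel_def' mhom_carrier mhom_zero)
 then have "c \<in> ?BX" using incl_class[OF c(1)] mcls_zero_iff[OF C, of c d] ZAX by auto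
 then show ?thesis using c by blast
 qed
 show ?thesis by (rule quotient_lifts[OF ker_mod_module[OF HA HX inc] r one_not_zero surj])
qed
then obtain PK where PK: "basis_lifts S ?K (mcls R T sz D d) (?ZA \<inter> ?BX) PK" by blast
have ZB: "submodule (?ZA \<inter> ?BX) R ?F"
 using submodule_zero_mem[OF ZA] submodule_zero_mem[OF BX] submodule_add_mem[OF ZA] submodule_add_mem[OF BX]
 submodule_smult_mem[OF ZA] submodule_smult_mem[OF BX] submodule_subset[OF ZA]
 by (intro submodule_criterion fspace_module) auto
have 1: "basis_of (?ZA \<inter> ?BX) (PA \<union> PK) & PA \<inter> PK = {}"
proof (rule basis_liftsD[OF PK ZB order_refl])
 show "mcls R T sz D d \<in> mod_hom R (restrict_mod ?F (?ZA \<inter> ?BX)) ?K"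
 unfolding ker_mod_def
 proof (rule mod_hom_restrict_target[OF restr[OF clsA Int_lower1]])
 fix x assume x: "x \<in> carrier (restrict_mod ?F (?ZA \<inter> ?BX))"
 then show "mcls R T sz D d x \<in> a_kernel ?HA ?HX (incl d)"
  using incl_class[of x d] mcls_zero_iff[OF C, of x d] ZAX
  by (auto simp: a_kernel_def' mhom_carrier mhom_zero)
 qed
 have "{x \<in> ?ZA \<inter> ?BX. mcls R T sz D d x = \<zero>\<^bsub>?K\<^esub>} = ?BA"
 using mcls_zero_iff[OF CT, of _ d] BAZ BAX by (auto simp: ker_mod_def mhom_zero)
 then show "basis_of {x \<in> ?ZA \<inter> ?BX. mcls R T sz D d x = \<zero>\<^bsub>?K\<^esub>} PA" using PA by simp
qed
\<comment> \<open>lifts of a basis of the image\<close>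
let ?I = "im_mod ?HA ?HX (incl d)"
have "EX UI. basis_lifts S ?I (mcls R S sz D d) ?ZA UI"
proof -
 obtain r where r: "mod_isomorphic R ?I (fspace {..<r::nat})" using im by blast
 have surj: "EX x:?ZA. mcls R S sz D d x = y" if y: "y \<in> carrier ?I" for y
 using y incl_class by (auto simp: im_mod_def mhom_carrier)
 show ?thesis by (rule quotient_lifts[OF im_mod_module[OF HA HX inc] r one_not_zero surj])
qed
then obtain UI where UI: "basis_lifts S ?I (mcls R S sz D d) ?ZA UI" by blast
let ?IM = "incl d ` carrier ?HA"
have IM: "submodule ?IM R ?HX" by (rule submodule_image[OF HA HX inc submodule_self[OF HA]])
let ?M = "{x \<in> ?ZX. mcls R S sz D d x \<in> ?IM}"
have M: "submodule ?M R ?F"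
 using submodule_of_restrict[OF fspace_module ZX, of ?M]
 submodule_vimage[OF restrict_mod_module[OF fspace_module ZX] HX clsX IM] by simp
have ZAM: "?ZA <= ?M" using ZAX incl_class by (auto simp: mhom_carrier image_iff)
have clsI: "mcls R S sz D d \<in> mod_hom R (restrict_mod ?F L) ?I" if "L <= ?M" for L
 unfolding im_mod_def
 by (rule mod_hom_restrict_target[OF restr[OF clsX]]) (use that in auto)
have 2: "basis_of ?ZA ((PA \<union> PK) \<union> UI) & (PA \<union> PK) \<inter> UI = {}"
proof (rule basis_liftsD[OF UI ZA order_refl clsI[OF ZAM]])
 have "{x \<in> ?ZA. mcls R S sz D d x = \<zero>\<^bsub>?I\<^esub>} = ?ZA \<inter> ?BX"
 using mcls_zero_iff[OF C, of _ d] ZAX by (auto simp: im_mod_def mhom_zero)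
 then show "basis_of {x \<in> ?ZA. mcls R S sz D d x = \<zero>\<^bsub>?I\<^esub>} (PA \<union> PK)" using 1 by simp
qed
\<comment> \<open>the boundaries of \<open>S\<close>, by restriction to \<open>S - T\<close>\<close>
let ?\<rho> = "%c s. if s \<in> T then \<zero> else c s"
have \<rho>: "?\<rho> \<in> mod_hom R (restrict_mod ?F ?BX) ?F"
 using submodule_subset[OF BX] finST(1) by (intro mod_homI) (auto simp: free_mod_carrier_finite)
have "submodule (?\<rho> ` ?BX) R ?F"
proof -
 have "submodule ?BX R (restrict_mod ?F ?BX)" by (intro submodule_restrict fspace_module BX order_refl)
 from submodule_image[OF restrict_mod_module[OF fspace_module BX] fspace_module \<rho> this] show ?thesis .
qed
then obtain B2 where B2: "basis_of (?\<rho> ` ?BX) B2" using submodule_basis[OF finST(1)] by blast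
have "{c \<in> ?BX. ?\<rho> c = (%_. \<zero>)} = ?ZA \<inter> ?BX"
proof -
 have "?\<rho> c = (%_. \<zero>) \<longleftrightarrow> (ALL s. s \<notin> T --> c s = \<zero>)" for c :: "'x => 'a" by (auto simp: fun_eq_iff)
 moreover have "c \<in> carrier (mchains R S sz d)" "c \<in> ?ZX" if "c \<in> ?BX" for c
 using that BXZ by (auto simp: mcycles_def)
 ultimately show ?thesis using sub_cycles_iff sub_chains_iff by auto
qed
then have kr: "basis_of {c \<in> ?BX. ?\<rho> c = (%_. \<zero>)} (PA \<union> PK)" using 1 by simp
obtain l where l: "!!b. b \<in> B2 ==> l b \<in> ?BX & ?\<rho> (l b) = b" "basis_of ?BX ((PA \<union> PK) \<union> l ` B2)" "(PA \<union> PK) \<inter> l ` B2 = {}"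
 using basis_lift[OF BX \<rho> kr B2] by blast
let ?PX = "l ` B2"
have BXM: "?BX <= ?M"
proof
 fix c assume c: "c \<in> ?BX"
 then have "mcls R S sz D d c = ?BX" using mcls_zero_iff[OF C, of c d] BXZ by blast
 then show "c \<in> ?M" using c BXZ submodule_zero_mem[OF IM] by (simp add: mhom_zero subset_iff)
qed
have 3: "basis_of ?M ((PA \<union> PK \<union> ?PX) \<union> UI) & (PA \<union> PK \<union> ?PX) \<inter> UI = {}"
proof (rule basis_liftsD[OF UI M ZAM clsI[OF order_refl]])
 have "{x \<in> ?M. mcls R S sz D d x = \<zero>\<^bsub>?I\<^esub>} = ?BX"
 using mcls_zero_iff[OF C, of _ d] BXM by (auto simp: im_mod_def mhom_zero)
 then show "basis_of {x \<in> ?M. mcls R S sz D d x = \<zero>\<^bsub>?I\<^esub>} (PA \<union> PK \<union> ?PX)" using l(2) by simp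
qed
\<comment> \<open>lifts of a basis of the cokernel\<close>
let ?Q = "coker_mod ?HA ?HX (incl d)" and ?q = "%x. ?IM +>\<^bsub>?HX\<^esub> mcls R S sz D d x"
have q: "?q \<in> mod_hom R (restrict_mod ?F ?ZX) ?Q"
 unfolding coker_mod_def by (rule mod_hom_compose[OF clsX coset_mod_hom[OF HX IM]])
have "EX UC. basis_lifts S ?Q ?q ?ZX UC"
proof -
 obtain r where r: "mod_isomorphic R ?Q (fspace {..<r::nat})" using coker by blast
 have surj: "EX x:?ZX. ?q x = y" if y: "y \<in> carrier ?Q" for y
 using y by (auto simp: coker_mod_def quot_mod_carrier mhom_carrier)
 show ?thesis by (rule quotient_lifts[OF coker_mod_module[OF HA HX inc] r one_not_zero surj])
qed
then obtain UC where UC: "basis_lifts S ?Q ?q ?ZX UC" by blast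
have 4: "basis_of ?ZX ((PA \<union> PK \<union> ?PX \<union> UI) \<union> UC) & (PA \<union> PK \<union> ?PX \<union> UI) \<inter> UC = {}"
proof (rule basis_liftsD[OF UC ZX order_refl q])
 have "{x \<in> ?ZX. ?q x = \<zero>\<^bsub>?Q\<^esub>} = ?M"
 proof (rule Collect_cong, rule conj_cong[OF refl])
 fix x assume "x \<in> ?ZX"
 then have "mcls R S sz D d x \<in> carrier ?HX" by (simp add: mhom_carrier)
 then show "?q x = \<zero>\<^bsub>?Q\<^esub> \<longleftrightarrow> mcls R S sz D d x \<in> ?IM"
  using coset_eq_zero_iff[OF HX IM] by (simp add: coker_mod_def)
 qed
 then show "basis_of {x \<in> ?ZX. ?q x = \<zero>\<^bsub>?Q\<^esub>} (PA \<union> PK \<union> ?PX \<union> UI)" using 3 by simp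
qed
have "(PA \<union> PK \<union> ?PX) \<inter> (UI \<union> UC) = {}" using conjunct2[OF 3] conjunct2[OF 4] by blast
moreover have "PA \<inter> (PK \<union> ?PX) = {}" using conjunct2[OF 1] l(3) by blast
ultimately show ?thesis using PA conjunct1[OF 2] l(2) conjunct1[OF 4] by blast
qed

end

end

context cring begin

text \<open>
\<open>B\<close> is a homogeneous basis of the chains of \<open>S\<close>, with coordinates \<open>W\<close>, whose part \<open>BA\<close> is a basis
of the chains of \<open>T\<close>, and on which the differential is the matching \<open>G\<close>.
\<close>

definition adapted :: "'x set => 'x set => ('x => int) => ('x => 'x => 'a) => 'y set => 'y set => ('y \<times> 'y) set =>
 ('y => int) => ('x => 'y => 'a) => ('y => 'x => 'a) => bool"
where "adapted S T sz D B BA G bz V W \<longleftrightarrow>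
 base_change R S sz D B bz (match_mat G) V W & matching B bz G & BA <= B &
 (ALL p q. (p, q) \<in> G --> q \<in> BA --> p \<in> BA) &
 (ALL s:S. ALL b:BA. s \<notin> T --> V s b = \<zero>) & (ALL s:T. ALL b:B. b \<notin> BA --> W b s = \<zero>)"

end

context pid begin

theorem adapted_basis:
fixes S T :: "'x set"
assumes C: "mcomplex R S sz D" and TS: "T <= S"
 and sub: "ALL s:S. ALL t:T. D s t ~= \<zero> --> s \<in> T"
 and ker: "!!d. \<exists>r::nat. mod_isomorphic R (ker_mod (mhom R T sz D d) (mhom R S sz D d)
 (quot_map (mchains R S sz d) (mbounds R S sz D d) (%c. c))) (fspace {..<r})"
 and im: "!!d. \<exists>r::nat. mod_isomorphic R (im_mod (mhom R T sz D d) (mhom R S sz D d)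
 (quot_map (mchains R S sz d) (mbounds R S sz D d) (%c. c))) (fspace {..<r})"
 and coker: "!!d. \<exists>r::nat. mod_isomorphic R (coker_mod (mhom R T sz D d) (mhom R S sz D d)
 (quot_map (mchains R S sz d) (mbounds R S sz D d) (%c. c))) (fspace {..<r})"
shows "\<exists>(B :: ('x => 'a) set) BA G bz V W. adapted S T sz D B BA G bz V W"
proof -
let ?F = "fspace S" and ?bd = "mat_app R S S D"
let ?CX = "%d. carrier (mchains R S sz d)" and ?CA = "%d. carrier (mchains R T sz d)"
note finST = finST[OF C TS sub] and CT = sub_mcomplex[OF C TS sub]
have "ALL d. EX PA PK UI PX UC.
 basis_of (mbounds R T sz D d) PA & basis_of (mcycles R T sz D d) (PA \<union> PK \<union> UI) &
 basis_of (mbounds R S sz D d) (PA \<union> PK \<union> PX) &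
 basis_of (mcycles R S sz D d) (PA \<union> PK \<union> PX \<union> UI \<union> UC) &
 (PA \<union> PK \<union> PX) \<inter> (UI \<union> UC) = {} & PA \<inter> (PK \<union> PX) = {}"
 by (intro allI cycles_basis[OF C TS sub ker im coker])
then obtain PA PK UI PX UC where
 b1: "!!d. basis_of (mbounds R T sz D d) (PA d)" and
 b2: "!!d. basis_of (mcycles R T sz D d) (PA d \<union> PK d \<union> UI d)" and
 b3: "!!d. basis_of (mbounds R S sz D d) (PA d \<union> PK d \<union> PX d)" and
 b4: "!!d. basis_of (mcycles R S sz D d) (PA d \<union> PK d \<union> PX d \<union> UI d \<union> UC d)"
 by metis
define P where "P = (%d. PA d \<union> PK d \<union> PX d)"
define Z where "Z = (%d. PA d \<union> PK d \<union> PX d \<union> UI d \<union> UC d)"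
have PAP: "PA d <= P d" for d by (auto simp: P_def)
have ex: "EX x. p \<in> P d --> x \<in> ?CX (d + 1) & ?bd x = p & (p \<in> PA d --> x \<in> ?CA (d + 1))" for d p
proof (cases "p \<in> PA d")
 case True
 then have "p \<in> mbounds R T sz D d" using b1[of d] by (auto simp: basis_of_def)
 then obtain x where "x \<in> ?CA (d + 1)" "p = ?bd x" unfolding sub_bounds[OF C TS sub] by blast
 then show ?thesis using sub_chains_iff[OF C TS sub] by blast
next
 case False
 show ?thesis
 proof (cases "p \<in> P d")
 case True
 then have "p \<in> mbounds R S sz D d" using b3[of d] by (auto simp: basis_of_def P_def)
 then show ?thesis using False unfolding mbounds_def by blast
 qed blast
qed
define l where "l = (%d p. SOME x. p \<in> P d --> x \<in> ?CX (d + 1) & ?bd x = p & (p \<in> PA d --> x \<in> ?CA (d + 1)))"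
have l': "p \<in> P d --> l d p \<in> ?CX (d + 1) & ?bd (l d p) = p & (p \<in> PA d --> l d p \<in> ?CA (d + 1))" for d p
 unfolding l_def by (rule someI_ex[OF ex])
have l: "p \<in> P d ==> l d p \<in> ?CX (d + 1)" "p \<in> P d ==> ?bd (l d p) = p"
 "p \<in> PA d ==> l d p \<in> ?CA (d + 1)" for d p using l'[of p d] PAP by auto
define Bd where "Bd = (%d. Z d \<union> l (d - 1) ` P (d - 1))"
define BAd where "BAd = (%d. PA d \<union> PK d \<union> UI d \<union> l (d - 1) ` PA (d - 1))"
have CXF: "submodule (?CX d) R ?F" and CAF: "submodule (?CA d) R ?F" for d
 using submodule_fspace[OF submodule_self[OF mchains_module]] finST TS by blast+
have bdhom: "?bd \<in> mod_hom R (restrict_mod ?F M) ?F" if "submodule M R ?F" for M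
 by (rule mod_hom_restrict_source[OF mat_app_hom[OF mcomplex_mat[OF C]] submodule_subset[OF that]])
have Bd: "basis_of (?CX d) (Bd d)" for d
 unfolding Bd_def
proof (rule extend_basis(1)[OF CXF bdhom[OF CXF] _ _ _ one_not_zero])
 show "basis_of {x \<in> ?CX d. ?bd x = (%_. \<zero>)} (Z d)" using b4[of d] by (simp add: mcycles_def Z_def)
 show "basis_of (?bd ` ?CX d) (P (d - 1))" using b3[of "d - 1"] by (simp add: mbounds_def P_def)
 show "l (d - 1) b \<in> ?CX d & ?bd (l (d - 1) b) = b" if "b \<in> P (d - 1)" for b
 using l(1)[of b "d - 1"] l(2)[of b "d - 1"] that by simp
qed
have BAd: "basis_of (?CA d) (BAd d)" for d
 unfolding BAd_def
proof (rule extend_basis(1)[OF CAF bdhom[OF CAF] _ _ _ one_not_zero])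
 have "{x \<in> ?CA d. ?bd x = (%_. \<zero>)} = mcycles R T sz D d"
 using sub_cycles_iff[OF C TS sub] sub_chains_iff[OF C TS sub] by (auto simp: mcycles_def)
 then show "basis_of {x \<in> ?CA d. ?bd x = (%_. \<zero>)} (PA d \<union> PK d \<union> UI d)" using b2[of d] by simp
 show "basis_of (?bd ` ?CA d) (PA (d - 1))"
 using b1[of "d - 1"] by (simp add: sub_bounds[OF C TS sub])
 show "l (d - 1) b \<in> ?CA d & ?bd (l (d - 1) b) = b" if "b \<in> PA (d - 1)" for b
 using l(3)[of b "d - 1"] l(2)[of b "d - 1"] PAP that by auto
qed
have sub_Bd: "BAd d <= Bd d" for d using PAP by (auto simp: BAd_def Bd_def Z_def)
define bz where "bz = (%b::'x => 'a. sz (SOME s. b s ~= \<zero>))"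
have BdC: "b \<in> ?CX d" if "b \<in> Bd d" for b d using Bd[of d] that by (auto simp: basis_of_def)
have nz: "EX s. b s ~= \<zero>" if "b \<in> Bd d" for b d
proof (rule ccontr)
 assume "~ ?thesis"
 then have "b = (%_. \<zero>)" by (simp add: fun_eq_iff)
 then show False using basis_nonzero[OF Bd one_not_zero CXF, of d] that by blast
qed
have supp: "s \<in> S" "sz s = d" if "b \<in> Bd d" "b s ~= \<zero>" for b d s
 using BdC[OF that(1)] that(2) by (auto simp: mchains_carrier[OF finST(1)])
have bz: "bz b = d" if "b \<in> Bd d" for b d
 using supp(2)[OF that someI_ex[OF nz[OF that]]] by (simp add: bz_def)
have bR: "b s \<in> carrier R" if "b \<in> Bd d" for b d s
 using BdC[OF that] by (auto simp: mchains_carrier[OF finST(1)])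
define B where "B = (\<Union>d. Bd d)"
define BA where "BA = (\<Union>d. BAd d)"
have B_bz: "b \<in> Bd (bz b)" if "b \<in> B" for b using that bz by (auto simp: B_def)
have finBd: "finite (Bd d)" for d using Bd[of d] by (simp add: basis_of_def)
have finB: "finite B"
proof -
 have "B <= (\<Union>d\<in>sz ` S. Bd d)"
 proof
 fix b assume "b \<in> B"
 then obtain d where d: "b \<in> Bd d" by (auto simp: B_def)
 obtain s where "b s ~= \<zero>" using nz[OF d] by blast
 then have "d \<in> sz ` S" using supp[OF d] by blast
 then show "b \<in> (\<Union>d\<in>sz ` S. Bd d)" using d by blast
 qed
 moreover have "finite (\<Union>d\<in>sz ` S. Bd d)"
 by (rule finite_UN_I[OF finite_imageI[OF finST(1)] finBd])
 ultimately show ?thesis by (rule finite_subset)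
qed
define G where "G = {(p, q). EX d. p \<in> P d & q = l d p}"
have PBd: "P d <= Bd d" for d by (auto simp: P_def Bd_def Z_def)
have lBd: "l d p \<in> Bd (d + 1)" if "p \<in> P d" for d p using that by (simp add: Bd_def)
have Zcyc: "?bd z = (%_. \<zero>)" if "z \<in> Z d" for z d
 using b4[of d] that by (auto simp: basis_of_def mcycles_def Z_def)
have PZ: "P d <= Z d" for d by (auto simp: P_def Z_def)
have Pnz: "p ~= (%_. \<zero>)" if "p \<in> P d" for p d using nz[of p d] PBd that by auto
have Gbd: "?bd q = p" "p ~= (%_. \<zero>)" "p \<in> P (bz p)" "q = l (bz p) p" "?bd p = (%_. \<zero>)" "bz q = bz p + 1"
 if pq: "(p, q) \<in> G" for p q
proof -
 obtain d where d: "p \<in> P d" "q = l d p" using pq by (auto simp: G_def)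
 then have "bz p = d" using bz PBd by blast
 then show "?bd q = p" "p ~= (%_. \<zero>)" "p \<in> P (bz p)" "q = l (bz p) p" "?bd p = (%_. \<zero>)" "bz q = bz p + 1"
 using d l(2)[OF d(1)] Pnz[OF d(1)] Zcyc[OF subsetD[OF PZ d(1)]] bz[OF lBd[OF d(1)]] by auto
qed
have matching: "matching B bz G"
 unfolding matching_def
proof (intro conjI)
 show "G <= B \<times> B"
 proof clarify
 fix p q assume "(p, q) \<in> G"
 then obtain d where d: "p \<in> P d" "q = l d p" by (auto simp: G_def)
 then show "p \<in> B & q \<in> B" using subsetD[OF PBd d(1)] lBd[OF d(1)] unfolding B_def by blast
 qed
 show "single_valued G" using Gbd(4) by (intro single_valuedI) metis
 show "single_valued (G\<inverse>)" using Gbd(1) by (intro single_valuedI) (metis converse_iff)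
 show "Domain G \<inter> Range G = {}"
 proof (rule ccontr)
 assume "Domain G \<inter> Range G ~= {}"
 then obtain p q x where "(p, q) \<in> G" "(x, p) \<in> G" by blast
 then show False using Gbd(5)[of p q] Gbd(1,2)[of x p] by simp
 qed
 show "\<forall>(p, q)\<in>G. bz q = bz p + 1" using Gbd(6) by auto
qed (rule finB)
define V where "V = (%s (b :: 'x => 'a). b s)"
define coord where "coord = (%s. SOME c. c \<in> Bd (sz s) \<rightarrow> carrier R & generator R s = lincomb (Bd (sz s)) c)"
define W where "W = (%b s. if b \<in> Bd (sz s) then coord s b else \<zero>)"
have gen: "generator R s \<in> ?CX (sz s)" if "s \<in> S" for s
 using that by (auto simp: mchains_carrier[OF finST(1)] generator_def)
have coord: "coord s \<in> Bd (sz s) \<rightarrow> carrier R" "generator R s = lincomb (Bd (sz s)) (coord s)" if s: "s \<in> S" for s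
proof -
 have "EX c. c \<in> Bd (sz s) \<rightarrow> carrier R & generator R s = lincomb (Bd (sz s)) c"
 using Bd[of "sz s"] gen[OF s] unfolding basis_of_def by blast
 from someI_ex[OF this] show "coord s \<in> Bd (sz s) \<rightarrow> carrier R" "generator R s = lincomb (Bd (sz s)) (coord s)"
 unfolding coord_def by blast+
qed
have WR: "W b s \<in> carrier R" if "s \<in> S" for b s
 using funcset_mem[OF coord(1)[OF that]] by (auto simp: W_def)
have BR: "b s \<in> carrier R" if "b \<in> B" for b s using bR[OF B_bz[OF that]] .
have W_sum: "(\<Oplus>b\<in>Bd (sz s). W b s \<otimes> b x) = generator R s x" if s: "s \<in> S" for s x
proof -
 have "(\<Oplus>b\<in>Bd (sz s). W b s \<otimes> b x) = lincomb (Bd (sz s)) (coord s) x"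
 unfolding lincomb_def using coord(1)[OF s] bR by (intro finsum_cong') (auto simp: W_def)
 then show ?thesis using coord(2)[OF s] by simp
qed
have BdB: "Bd d <= B" for d by (auto simp: B_def)
have VW: "mat_mul R B V W s s' = delta R s s'" if s: "s \<in> S" "s' \<in> S" for s s'
proof -
 have "mat_mul R B V W s s' = (\<Oplus>b\<in>Bd (sz s'). W b s' \<otimes> b s)"
 unfolding mat_mul_def V_def
 proof (rule add.finprod_mono_neutral_cong_right[OF finB BdB])
 show "b s \<otimes> W b s' = \<zero>" if "b \<in> B - Bd (sz s')" for b
  using that BR[of b s] by (simp add: W_def)
 show "b s \<otimes> W b s' = W b s' \<otimes> b s" if "b \<in> Bd (sz s')" for b
  by (rule m_comm[OF bR[OF that] WR[OF s(2)]])
 show "(%b. b s \<otimes> W b s') \<in> B \<rightarrow> carrier R" using BR WR[OF s(2)] by (intro Pi_I m_closed) auto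
 qed
 then show ?thesis using W_sum[OF s(2)] by (simp add: delta_def generator_def eq_commute)
qed
have WV: "mat_mul R S W V b b' = delta R b b'" if b: "b \<in> B" "b' \<in> B" for b b'
proof -
 let ?d = "bz b'"
 have b': "b' \<in> Bd ?d" using B_bz b by blast
 have off: "b' s = \<zero>" if "sz s ~= ?d" for s using supp(2)[OF b'] that by blast
 show ?thesis
 proof (cases "b \<in> Bd ?d")
 case False
 then have "b ~= b'" using b' by blast
 have "W b s \<otimes> b' s = \<zero>" if "s \<in> S" for s
  using off[of s] False WR[OF that] BR[OF b(2)] by (cases "sz s = ?d") (auto simp: W_def)
 then have "mat_mul R S W V b b' = \<zero>"
  unfolding mat_mul_def V_def by (intro add.finprod_one_eqI)
 then show ?thesis using \<open>b ~= b'\<close> by (simp add: delta_def)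
 next
 case True
 define c where "c = (%b. \<Oplus>s\<in>S. W b s \<otimes> b' s)"
 have cR: "c \<in> Bd ?d \<rightarrow> carrier R" unfolding c_def using WR BR[OF b(2)] by auto
 have "lincomb (Bd ?d) c x = b' x" for x
 proof -
  have "lincomb (Bd ?d) c x = (\<Oplus>b\<in>Bd ?d. \<Oplus>s\<in>S. b' s \<otimes> (W b s \<otimes> b x))"
  unfolding lincomb_def
  proof (rule finsum_cong'[OF refl])
  show "(%b. \<Oplus>s\<in>S. b' s \<otimes> (W b s \<otimes> b x)) \<in> Bd ?d \<rightarrow> carrier R"
   using WR BR[OF b(2)] bR by (auto intro!: finsum_closed)
  fix e assume e: "e \<in> Bd ?d"
  have "c e \<otimes> e x = (\<Oplus>s\<in>S. (W e s \<otimes> b' s) \<otimes> e x)"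
   unfolding c_def using finST(1) WR BR[OF b(2)] bR[OF e] by (intro finsum_ldistr) auto
  also have "\<dots> = (\<Oplus>s\<in>S. b' s \<otimes> (W e s \<otimes> e x))"
   using WR BR[OF b(2)] bR[OF e] by (intro finsum_cong') (auto simp: m_ac)
  finally show "c e \<otimes> e x = (\<Oplus>s\<in>S. b' s \<otimes> (W e s \<otimes> e x))" .
  qed
  also have "\<dots> = (\<Oplus>s\<in>S. \<Oplus>b\<in>Bd ?d. b' s \<otimes> (W b s \<otimes> b x))"
  using finST(1) finBd WR BR[OF b(2)] bR by (intro finsum_swap) auto
  also have "\<dots> = (\<Oplus>s\<in>S. b' s \<otimes> generator R s x)"
  proof (rule finsum_cong'[OF refl])
  show "(%s. b' s \<otimes> generator R s x) \<in> S \<rightarrow> carrier R"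
   using BR[OF b(2)] by (auto simp: generator_closed)
  fix s assume s: "s \<in> S"
  have "(\<Oplus>b\<in>Bd ?d. b' s \<otimes> (W b s \<otimes> b x)) = b' s \<otimes> (\<Oplus>b\<in>Bd ?d. W b s \<otimes> b x)"
   using finBd WR[OF s] BR[OF b(2)] bR by (intro finsum_rdistr[symmetric]) auto
  moreover have "(\<Oplus>b\<in>Bd ?d. W b s \<otimes> b x) \<in> carrier R"
   using WR[OF s] bR by (intro finsum_closed) auto
  ultimately show "(\<Oplus>b\<in>Bd ?d. b' s \<otimes> (W b s \<otimes> b x)) = b' s \<otimes> generator R s x"
   using W_sum[OF s, of x] off[of s] by (cases "sz s = ?d") (auto simp: generator_closed)
  qed
  also have "\<dots> = (if x \<in> S then b' x \<otimes> generator R x x else \<zero>)"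
  using BR[OF b(2)] finST(1)
  by (intro finsum_single) (auto simp: generator_def)
  also have "\<dots> = b' x"
  proof (cases "x \<in> S")
  case False
  then have "b' x = \<zero>" using supp(1)[OF b', of x] by blast
  then show ?thesis using False by simp
  qed (simp add: BR[OF b(2)])
  finally show ?thesis .
 qed
 moreover have "lincomb (Bd ?d) (%b. delta R b b') x = b' x" for x
 proof -
  have "lincomb (Bd ?d) (%b. delta R b b') x = (if b' \<in> Bd ?d then delta R b' b' \<otimes> b' x else \<zero>)"
  unfolding lincomb_def using finBd bR by (intro finsum_single) (auto simp: delta_def)
  then show ?thesis using b' BR[OF b(2)] by (simp add: delta_def)
 qed
 ultimately have "lincomb (Bd ?d) c = lincomb (Bd ?d) (%b. delta R b b')" by (simp add: fun_eq_iff)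
 then have "c b = delta R b b'" by (intro basis_unique[OF Bd CXF cR _ _ True]) auto
 then show ?thesis by (simp add: c_def mat_mul_def V_def)
 qed
qed
have DV: "mat_mul R S D V s b = mat_mul R B V (match_mat G) s b" if s: "s \<in> S" and b: "b \<in> B" for s b
proof -
 have 1: "mat_mul R S D V s b = ?bd b s" using s by (simp add: mat_mul_def mat_app_def V_def)
 show ?thesis
 proof (cases "EX p. (p, b) \<in> G")
 case True
 then obtain p where p: "(p, b) \<in> G" by blast
 then have pB: "p \<in> B" using matching by (auto simp: matching_def)
 have "mat_mul R B V (match_mat G) s b = (if p \<in> B then V s p \<otimes> match_mat G p b else \<zero>)"
  unfolding mat_mul_def using finB BR p matching
  by (intro finsum_single) (auto simp: V_def match_mat_def matching_def single_valued_def)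
 then show ?thesis using 1 Gbd(1)[OF p] p pB BR by (simp add: V_def match_mat_def)
 next
 case False
 have "b \<in> Z (bz b)" using B_bz[OF b] False by (auto simp: Bd_def G_def)
 then have "?bd b s = \<zero>" using Zcyc by simp
 moreover have "mat_mul R B V (match_mat G) s b = \<zero>"
  unfolding mat_mul_def using False BR by (intro add.finprod_one_eqI) (auto simp: V_def match_mat_def)
 ultimately show ?thesis using 1 by simp
 qed
qed
have bc: "base_change R S sz D B bz (match_mat G) V W"
 unfolding base_change_def
proof (intro conjI ballI impI VW WV DV)
 show "is_mat R S B V" "is_mat R B S W" "is_mat R B B (match_mat G)"
 using finST finB BR WR by (auto simp: is_mat_def V_def match_mat_def)
 show "sz s = bz b" if "b \<in> B" "V s b ~= \<zero>" for s b
 using supp(2)[OF B_bz[OF that(1)]] that by (simp add: V_def)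
 show "sz s = bz b" if "W b s ~= \<zero>" for s b
 using bz[of b "sz s"] that by (simp add: W_def split: if_splits)
qed
have "adapted S T sz D B BA G bz V W"
 unfolding adapted_def
proof (intro conjI bc matching allI ballI impI)
 show "BA <= B" using sub_Bd by (auto simp: BA_def B_def)
 show "p \<in> BA" if pq: "(p, q) \<in> G" and q: "q \<in> BA" for p q
 proof -
 obtain d where d: "q \<in> BAd d" using q by (auto simp: BA_def)
 have "q \<notin> Z d" using Zcyc[of q d] Gbd(1,2)[OF pq] by auto
 then have "q \<in> l (d - 1) ` PA (d - 1)" using d by (auto simp: BAd_def Z_def)
 then obtain p' where p': "p' \<in> PA (d - 1)" "q = l (d - 1) p'" by blast
 then have "p = p'" using Gbd(1)[OF pq] l(2)[of p' "d - 1"] PAP by auto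
 then show ?thesis using p' by (auto simp: BA_def BAd_def)
 qed
 show "V s b = \<zero>" if bA: "b \<in> BA" and sT: "s \<notin> T" for s b
 proof -
 obtain d where "b \<in> BAd d" using bA by (auto simp: BA_def)
 then have "b \<in> ?CA d" using BAd[of d] by (auto simp: basis_of_def)
 then show ?thesis using sT by (auto simp: V_def mchains_carrier[OF finST(2)])
 qed
 show "W b s = \<zero>" if s: "s \<in> T" and b: "b \<in> B" "b \<notin> BA" for s b
 proof (cases "b \<in> Bd (sz s)")
 case True
 have sS: "s \<in> S" using s TS by blast
 have "generator R s \<in> ?CA (sz s)" using s by (auto simp: mchains_carrier[OF finST(2)] generator_def)
 then obtain c where c: "c \<in> BAd (sz s) \<rightarrow> carrier R" "generator R s = lincomb (BAd (sz s)) c"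
  using BAd[of "sz s"] unfolding basis_of_def by blast
 let ?c = "%b. if b \<in> BAd (sz s) then c b else \<zero>"
 have cc: "?c \<in> Bd (sz s) \<rightarrow> carrier R" using c(1) by (auto simp: Pi_def)
 have "lincomb (BAd (sz s)) c x = lincomb (Bd (sz s)) ?c x" for x
  unfolding lincomb_def
  by (rule add.finprod_mono_neutral_cong_left[OF finBd sub_Bd]) (use c(1) bR sub_Bd in \<open>auto simp: Pi_def\<close>)
 then have "lincomb (Bd (sz s)) (coord s) = lincomb (Bd (sz s)) ?c"
  using c(2) coord(2)[OF sS] by (simp add: fun_eq_iff)
 then have "coord s b = ?c b" by (rule basis_unique[OF Bd CXF coord(1)[OF sS] cc _ True])
 then show ?thesis using b by (auto simp: W_def BA_def)
 qed (simp add: W_def)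
qed
then show ?thesis by blast
qed

end

section \<open>Tensor products of based complexes\<close>

context cring begin

lemma finsum_prod_distrib:
assumes "finite I" "!!i. i \<in> I ==> finite (S i)" "!!i x. i \<in> I ==> x \<in> S i ==> f i x \<in> carrier R"
shows "(\<Oplus>p\<in>PiE I S. \<Otimes>i\<in>I. f i (p i)) = (\<Otimes>i\<in>I. \<Oplus>x\<in>S i. f i x)"
using assms
proof (induction I rule: finite_induct)
case (insert j I)
have finP: "finite (PiE I S)" using insert by (intro finite_PiE) auto
have un: "PiE (insert j I) S = (\<Union>x\<in>S j. (%p. p(j := x)) ` PiE I S)"
 unfolding PiE_insert_eq by auto
have prodR: "(\<Otimes>i\<in>I. f i (p i)) \<in> carrier R" if "p \<in> PiE I S" for p
 using that insert.prems by (intro finprod_closed) (auto simp: PiE_iff)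
have val: "(\<Otimes>i\<in>insert j I. f i ((p(j := x)) i)) = f j x \<otimes> (\<Otimes>i\<in>I. f i (p i))"
 if "x \<in> S j" "p \<in> PiE I S" for x p
proof -
 have "(\<Otimes>i\<in>insert j I. f i ((p(j := x)) i)) = f j ((p(j := x)) j) \<otimes> (\<Otimes>i\<in>I. f i ((p(j := x)) i))"
 using insert.hyps insert.prems that by (intro finprod_insert) (auto simp: PiE_iff)
 also have "(\<Otimes>i\<in>I. f i ((p(j := x)) i)) = (\<Otimes>i\<in>I. f i (p i))"
 using insert.hyps insert.prems that by (intro finprod_cong') (auto simp: PiE_iff)
 finally show ?thesis by simp
qed
have inj: "inj_on (%p. p(j := x)) (PiE I S)" for x
proof (rule inj_onI)
 fix p q assume pq: "p \<in> PiE I S" "q \<in> PiE I S" "p(j := x) = q(j := x)"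
 show "p = q"
 proof
 fix i show "p i = q i"
 proof (cases "i = j")
  case True
  then show ?thesis using pq(1,2) insert.hyps by (simp add: PiE_iff extensional_def)
 next
  case False
  then show ?thesis using fun_cong[OF pq(3), of i] by simp
 qed
 qed
qed
have "(\<Oplus>p\<in>PiE (insert j I) S. \<Otimes>i\<in>insert j I. f i (p i)) =
 (\<Oplus>x\<in>S j. \<Oplus>p\<in>(%p. p(j := x)) ` PiE I S. \<Otimes>i\<in>insert j I. f i (p i))"
 unfolding un
proof (rule add.finprod_UN_disjoint)
 show "finite (S j)" using insert.prems by simp
 show "finite ((%p. p(j := x)) ` PiE I S)" for x using finP by simp
 show "pairwise (%x y. disjnt ((%p. p(j := x)) ` PiE I S) ((%p. p(j := y)) ` PiE I S)) (S j)"
 by (auto simp: pairwise_def disjnt_def) (metis fun_upd_same)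
 show "(\<Otimes>i\<in>insert j I. f i (q i)) \<in> carrier R" if "x \<in> S j" "q \<in> (%p. p(j := x)) ` PiE I S" for x q
 proof -
 obtain p where p: "p \<in> PiE I S" "q = p(j := x)" using \<open>q \<in> _\<close> by blast
 show ?thesis unfolding p(2) val[OF \<open>x \<in> S j\<close> p(1)]
  by (intro m_closed prodR p(1)) (use insert.prems \<open>x \<in> S j\<close> in auto)
 qed
qed
also have "\<dots> = (\<Oplus>x\<in>S j. f j x \<otimes> (\<Oplus>p\<in>PiE I S. \<Otimes>i\<in>I. f i (p i)))"
proof (rule finsum_cong'[OF refl])
 show "(%x. f j x \<otimes> (\<Oplus>p\<in>PiE I S. \<Otimes>i\<in>I. f i (p i))) \<in> S j \<rightarrow> carrier R"
 using insert.prems prodR by (intro Pi_I m_closed finsum_closed) auto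
 fix x assume x: "x \<in> S j"
 have fx: "f j x \<in> carrier R" using insert.prems x by auto
 have "(\<Oplus>p\<in>(%p. p(j := x)) ` PiE I S. \<Otimes>i\<in>insert j I. f i (p i)) =
 (\<Oplus>p\<in>PiE I S. \<Otimes>i\<in>insert j I. f i ((p(j := x)) i))"
 proof (rule finsum_reindex[OF _ inj])
 show "(%p. \<Otimes>i\<in>insert j I. f i (p i)) \<in> (%p. p(j := x)) ` PiE I S \<rightarrow> carrier R"
 proof
  fix q assume "q \<in> (%p. p(j := x)) ` PiE I S"
  then obtain p where p: "p \<in> PiE I S" "q = p(j := x)" by blast
  show "(\<Otimes>i\<in>insert j I. f i (q i)) \<in> carrier R"
  unfolding p(2) val[OF x p(1)] by (intro m_closed prodR p(1) fx)
 qed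
 qed
 also have "\<dots> = (\<Oplus>p\<in>PiE I S. f j x \<otimes> (\<Otimes>i\<in>I. f i (p i)))"
 by (rule finsum_cong'[OF refl _ val[OF x]]) (use fx prodR in \<open>intro Pi_I m_closed\<close>)
 also have "\<dots> = f j x \<otimes> (\<Oplus>p\<in>PiE I S. \<Otimes>i\<in>I. f i (p i))"
 using prodR by (intro finsum_rdistr[symmetric] finP fx) auto
 finally show "(\<Oplus>p\<in>(%p. p(j := x)) ` PiE I S. \<Otimes>i\<in>insert j I. f i (p i)) =
 f j x \<otimes> (\<Oplus>p\<in>PiE I S. \<Otimes>i\<in>I. f i (p i))" .
qed
also have "\<dots> = (\<Oplus>x\<in>S j. f j x) \<otimes> (\<Oplus>p\<in>PiE I S. \<Otimes>i\<in>I. f i (p i))"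
 using insert.prems prodR by (intro finsum_ldistr[symmetric]) (auto intro!: finsum_closed)
also have "(\<Oplus>p\<in>PiE I S. \<Otimes>i\<in>I. f i (p i)) = (\<Otimes>i\<in>I. \<Oplus>x\<in>S i. f i x)"
 using insert by simp
also have "(\<Oplus>x\<in>S j. f j x) \<otimes> (\<Otimes>i\<in>I. \<Oplus>x\<in>S i. f i x) = (\<Otimes>i\<in>insert j I. \<Oplus>x\<in>S i. f i x)"
 using insert by (intro finprod_insert[symmetric]) (auto intro!: finsum_closed)
finally show ?case .
qed simp

text \<open>Signs with integer exponents, as degrees are integers.\<close>

definition isign :: "int => 'a" where "isign z = (if even z then \<one> else \<ominus> \<one>)"

lemma isign_closed [simp]: "isign z \<in> carrier R"
by (simp add: isign_def)

lemma isign_0 [simp]: "isign 0 = \<one>"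
by (simp add: isign_def)

lemma isign_add: "isign (x + y) = isign x \<otimes> isign y"
by (simp add: isign_def l_minus r_minus)

lemma isign_square [simp]: "isign z \<otimes> isign z = \<one>"
by (simp add: isign_def l_minus r_minus)

lemma neg_pow_isign: "neg_pow n = isign (int n)"
proof (induction n)
case (Suc n)
then show ?case by (simp add: isign_def)
qed simp

lemma finprod_isign:
assumes "finite J"
shows "(\<Otimes>i\<in>J. if Q i then isign (f i) else \<one>) = isign (\<Sum>i\<in>{i \<in> J. Q i}. f i)"
using assms
proof (induction J rule: finite_induct)
case (insert j J)
have "{i \<in> insert j J. Q i} = (if Q j then insert j {i \<in> J. Q i} else {i \<in> J. Q i})" by auto
then show ?case using insert by (subst finprod_insert) (auto simp: isign_add)
qed simp

lemma finprod_zero: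
assumes "finite J" "j \<in> J" "f j = \<zero>" "f \<in> J \<rightarrow> carrier R"
shows "finprod R f J = \<zero>"
proof -
have "finprod R f (J - {j}) \<in> carrier R" using assms by (intro finprod_closed) auto
then show ?thesis using finprod_split_at[OF assms(1,2,4)] assms(3) by simp
qed

definition factor_mat :: "(nat => 'x => int) => (nat => 'x => 'x => 'a) => nat => nat => 'x => 'x => 'a"
where "factor_mat sz D k i x y =
 (if i < k then if x = y then isign (sz i x) else \<zero> else if i = k then D i x y else delta R x y)"

text \<open>The differential of a tensor product of complexes, with the usual signs.\<close>

definition tensor_mat :: "nat set => (nat => 'x => int) => (nat => 'x => 'x => 'a) => (nat => 'x) => (nat => 'x) => 'a"
where "tensor_mat I sz D p q = (\<Oplus>k\<in>I. \<Otimes>i\<in>I. factor_mat sz D k i (p i) (q i))"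

definition prod_mat :: "nat set => (nat => 'x => 'y => 'a) => (nat => 'x) => (nat => 'y) => 'a"
where "prod_mat I V p q = (\<Otimes>i\<in>I. V i (p i) (q i))"

lemma mat_mul_prod_mat:
assumes I: "finite I" and M: "!!i. i \<in> I ==> is_mat R (S i) (T i) (M i)" and N: "!!i. i \<in> I ==> is_mat R (T i) (U i) (N i)"
 and p: "p \<in> PiE I S" and q: "q \<in> PiE I U"
shows "mat_mul R (PiE I T) (prod_mat I M) (prod_mat I N) p q = (\<Otimes>i\<in>I. mat_mul R (T i) (M i) (N i) (p i) (q i))"
proof -
have pi: "p i \<in> S i" and qi: "q i \<in> U i" if "i \<in> I" for i using p q that by auto
have Mc: "M i (p i) x \<in> carrier R" and Nc: "N i x (q i) \<in> carrier R" if "i \<in> I" "x \<in> T i" for i x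
 using is_matD[OF M[OF that(1)] pi[OF that(1)] that(2)] is_matD[OF N[OF that(1)] that(2) qi[OF that(1)]] by auto
have "mat_mul R (PiE I T) (prod_mat I M) (prod_mat I N) p q =
 (\<Oplus>t\<in>PiE I T. \<Otimes>i\<in>I. M i (p i) (t i) \<otimes> N i (t i) (q i))"
 unfolding mat_mul_def prod_mat_def
proof (rule finsum_cong'[OF refl])
 show "(%t. \<Otimes>i\<in>I. M i (p i) (t i) \<otimes> N i (t i) (q i)) \<in> PiE I T \<rightarrow> carrier R"
 using Mc Nc by (intro Pi_I finprod_closed m_closed) (auto simp: PiE_iff)
 show "(\<Otimes>i\<in>I. M i (p i) (t i)) \<otimes> (\<Otimes>i\<in>I. N i (t i) (q i)) = (\<Otimes>i\<in>I. M i (p i) (t i) \<otimes> N i (t i) (q i))"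
 if "t \<in> PiE I T" for t
 using Mc Nc that by (intro finprod_multf[symmetric]) (auto simp: PiE_iff)
qed
also have "\<dots> = (\<Otimes>i\<in>I. \<Oplus>x\<in>T i. M i (p i) x \<otimes> N i x (q i))"
 using Mc Nc N I by (intro finsum_prod_distrib) (auto simp: is_mat_def)
finally show ?thesis by (simp add: mat_mul_def)
qed

lemma is_mat_prod_mat:
assumes "finite I" "!!i. i \<in> I ==> is_mat R (S i) (T i) (M i)"
shows "is_mat R (PiE I S) (PiE I T) (prod_mat I M)"
unfolding is_mat_def
proof (intro conjI ballI)
show "finite (PiE I S)" "finite (PiE I T)"
 using assms by (auto intro!: finite_PiE simp: is_mat_def)
show "prod_mat I M p q \<in> carrier R" if "p \<in> PiE I S" "q \<in> PiE I T" for p q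
 unfolding prod_mat_def using that is_matD[OF assms(2)] by (intro finprod_closed) (auto simp: PiE_iff)
qed

lemma factor_mat_is_mat:
"is_mat R T T (D i) ==> is_mat R T T (factor_mat sz D k i)"
by (auto simp: is_mat_def factor_mat_def)

lemma tensor_mat_prod: "tensor_mat I sz D p q = (\<Oplus>k\<in>I. prod_mat I (factor_mat sz D k) p q)"
by (simp add: tensor_mat_def prod_mat_def)

lemma is_mat_tensor:
assumes I: "finite I" and D: "!!i. i \<in> I ==> is_mat R (S i) (S i) (D i)"
shows "is_mat R (PiE I S) (PiE I S) (tensor_mat I sz D)"
proof -
have M: "is_mat R (PiE I S) (PiE I S) (prod_mat I (factor_mat sz D k))" for k
 by (intro is_mat_prod_mat I factor_mat_is_mat D)
have "tensor_mat I sz D p q \<in> carrier R" if "p \<in> PiE I S" "q \<in> PiE I S" for p q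
 unfolding tensor_mat_prod by (intro finsum_closed Pi_I is_matD[OF M that])
then show ?thesis using M[of 0] by (auto simp: is_mat_def)
qed

lemma tensor_mat_nonzero:
assumes I: "finite I" and D: "!!i. i \<in> I ==> is_mat R (S i) (S i) (D i)" and p: "p \<in> PiE I S" "q \<in> PiE I S"
 and nz: "tensor_mat I sz D p q ~= \<zero>"
shows "EX k:I. D k (p k) (q k) ~= \<zero> & (ALL i:I. i ~= k --> p i = q i)"
proof (rule ccontr)
assume neg: "~ ?thesis"
have "(\<Otimes>i\<in>I. factor_mat sz D k i (p i) (q i)) = \<zero>" if k: "k \<in> I" for k
proof -
 have "EX i:I. factor_mat sz D k i (p i) (q i) = \<zero>"
 proof (cases "D k (p k) (q k) = \<zero>")
 case True then show ?thesis using k by (intro bexI[of _ k]) (auto simp: factor_mat_def)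
 next
 case False
 then obtain i where "i \<in> I" "i ~= k" "p i ~= q i" using neg k by blast
 then show ?thesis by (intro bexI[of _ i]) (auto simp: factor_mat_def delta_def)
 qed
 then obtain i where i: "i \<in> I" "factor_mat sz D k i (p i) (q i) = \<zero>" by blast
 show ?thesis
 proof (rule finprod_zero[where j = i])
 have "is_mat R (S i) (S i) (factor_mat sz D k i)" if "i \<in> I" for i
  by (rule factor_mat_is_mat) (rule D[OF that])
 then show "(%i. factor_mat sz D k i (p i) (q i)) \<in> I \<rightarrow> carrier R"
  using p by (intro Pi_I) (auto simp: PiE_iff is_mat_def)
 qed (use I i in auto)
qed
then have "tensor_mat I sz D p q = \<zero>" unfolding tensor_mat_def by (intro add.finprod_one_eqI)
then show False using nz by simp
qed

lemma tensor_mat_single: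
assumes I: "finite I" and D: "!!i. i \<in> I ==> is_mat R (S i) (S i) (D i)" and p: "p \<in> PiE I S" "q \<in> PiE I S"
 and k: "k \<in> I" and eq: "!!i. i \<in> I ==> i ~= k ==> p i = q i" and ne: "p k ~= q k"
shows "tensor_mat I sz D p q = isign (\<Sum>i\<in>{i \<in> I. i < k}. sz i (q i)) \<otimes> D k (p k) (q k)"
proof -
have fm: "is_mat R (S i) (S i) (factor_mat sz D k' i)" if "i \<in> I" for k' i
 by (rule factor_mat_is_mat) (rule D[OF that])
have fc: "factor_mat sz D k' i (p i) (q i) \<in> carrier R" if "i \<in> I" for k' i
 using fm[OF that] p that by (auto simp: PiE_iff is_mat_def)
have z: "(\<Otimes>i\<in>I. factor_mat sz D k' i (p i) (q i)) = \<zero>" if "k' \<in> I" "k' ~= k" for k'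
 using I k fc that ne by (intro finprod_zero[where j = k]) (auto simp: factor_mat_def delta_def)
have "tensor_mat I sz D p q = (if k \<in> I then \<Otimes>i\<in>I. factor_mat sz D k i (p i) (q i) else \<zero>)"
 unfolding tensor_mat_def
 by (rule finsum_single[OF I _ z]) (use fc in \<open>auto intro!: finprod_closed\<close>)
also have "\<dots> = factor_mat sz D k k (p k) (q k) \<otimes> (\<Otimes>i\<in>I - {k}. factor_mat sz D k i (p i) (q i))"
 using k fc by (simp add: finprod_split_at[OF I k])
also have "(\<Otimes>i\<in>I - {k}. factor_mat sz D k i (p i) (q i)) = (\<Otimes>i\<in>I - {k}. if i < k then isign (sz i (q i)) else \<one>)"
 using eq by (intro finprod_cong') (auto simp: factor_mat_def delta_def)
also have "\<dots> = isign (\<Sum>i\<in>{i \<in> I - {k}. i < k}. sz i (q i))" using I by (intro finprod_isign) auto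
also have "{i \<in> I - {k}. i < k} = {i \<in> I. i < k}" by auto
finally show ?thesis using fc[OF k, of k] by (simp add: factor_mat_def m_comm)
qed

lemma tensor_mat_degree:
assumes I: "finite I" and C: "!!i. i \<in> I ==> mcomplex R (S i) (sz i) (D i)" and p: "p \<in> PiE I S" "q \<in> PiE I S"
 and nz: "tensor_mat I sz' D p q ~= \<zero>"
shows "(\<Sum>i\<in>I. sz i (q i)) = (\<Sum>i\<in>I. sz i (p i)) + 1"
proof -
obtain k where k: "k \<in> I" "D k (p k) (q k) ~= \<zero>" "ALL i:I. i ~= k --> p i = q i"
 using tensor_mat_nonzero[OF I mcomplex_mat[OF C] p nz] by blast
have "sz k (q k) = sz k (p k) + 1" using C[OF k(1)] k p by (auto simp: mcomplex_def PiE_iff)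
moreover have "(\<Sum>i\<in>I - {k}. sz i (q i)) = (\<Sum>i\<in>I - {k}. sz i (p i))"
 using k by (intro sum.cong) auto
ultimately show ?thesis using I k(1) by (simp add: sum.remove[of I k])
qed

text \<open>
Adapted bases of the pairs \<open>(S i, T i)\<close> give a basis of the subcomplex of \<open>\<Otimes>\<^sub>i S i\<close> that is spanned
by the tuples whose entries lie in \<open>T i\<close> except for a set of indices in \<open>K\<close>.
\<close>

definition supported_tuples :: "nat set => nat set set => (nat => 'x set) => (nat => 'x set) => (nat => 'x) set"
where "supported_tuples I K S T = {p \<in> PiE I S. {i \<in> I. p i \<notin> T i} \<in> K}"

theorem tensor_base_change:
fixes S :: "nat => 'x set" and B :: "nat => 'y set"
assumes I: "finite I" and K: "!!\<sigma> \<tau>. \<sigma> \<in> K ==> \<tau> <= \<sigma> ==> \<tau> \<in> K"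
 and C: "!!i. i \<in> I ==> mcomplex R (S i) (sz i) (D i)"
 and ad: "!!i. i \<in> I ==> adapted (S i) (T i) (sz i) (D i) (B i) (BA i) (G i) (bz i) (V i) (W i)"
shows "base_change R (supported_tuples I K S T) (%p. \<Sum>i\<in>I. sz i (p i)) (tensor_mat I sz D)
 (supported_tuples I K B BA) (%b. \<Sum>i\<in>I. bz i (b i)) (tensor_mat I bz (%i. match_mat (G i)))
 (prod_mat I V) (prod_mat I W)"
proof -
let ?X = "supported_tuples I K S T" and ?Y = "supported_tuples I K B BA"
let ?E = "%i. match_mat (G i)"
have bc: "base_change R (S i) (sz i) (D i) (B i) (bz i) (?E i) (V i) (W i)" and m: "matching (B i) (bz i) (G i)"
 and BAB: "BA i <= B i" and GA: "(p, q) \<in> G i ==> q \<in> BA i ==> p \<in> BA i"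
 and V0: "s \<in> S i ==> b \<in> BA i ==> s \<notin> T i ==> V i s b = \<zero>"
 and W0: "s \<in> T i ==> b \<in> B i ==> b \<notin> BA i ==> W i b s = \<zero>" if "i \<in> I" for i p q s b
 using ad[OF that] unfolding adapted_def by blast+
have Dm: "is_mat R (S i) (S i) (D i)" and Em: "is_mat R (B i) (B i) (?E i)"
 and Vm: "is_mat R (S i) (B i) (V i)" and Wm: "is_mat R (B i) (S i) (W i)" if "i \<in> I" for i
 using bc_mats[OF C[OF that] bc[OF that]] by auto
have XS: "?X <= PiE I S" and YB: "?Y <= PiE I B" by (auto simp: supported_tuples_def)
have VP: "is_mat R (PiE I S) (PiE I B) (prod_mat I V)" and WP: "is_mat R (PiE I B) (PiE I S) (prod_mat I W)"
 by (intro is_mat_prod_mat I Vm Wm; assumption)+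
have DP: "is_mat R (PiE I S) (PiE I S) (tensor_mat I sz D)" and EP: "is_mat R (PiE I B) (PiE I B) (tensor_mat I bz ?E)"
 by (intro is_mat_tensor I Dm Em; assumption)+
have finS: "finite (PiE I S)" and finB: "finite (PiE I B)" using VP by (auto simp: is_mat_def)
have nzI: "f i ~= \<zero>" if "(\<Otimes>i\<in>I. f i) ~= \<zero>" "f \<in> I \<rightarrow> carrier R" "i \<in> I" for f i
 using finprod_zero[OF I that(3) _ that(2)] that(1) by blast
have V_nz: "V i (p i) (b i) ~= \<zero>" if "p \<in> PiE I S" "b \<in> PiE I B" "prod_mat I V p b ~= \<zero>" "i \<in> I" for p b i
proof (rule nzI[OF that(3)[unfolded prod_mat_def] _ that(4)])
 show "(%i. V i (p i) (b i)) \<in> I \<rightarrow> carrier R"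
 using is_matD[OF Vm] that(1,2) by (intro Pi_I) (auto simp: PiE_iff)
qed
have W_nz: "W i (b i) (p i) ~= \<zero>" if "p \<in> PiE I S" "b \<in> PiE I B" "prod_mat I W b p ~= \<zero>" "i \<in> I" for p b i
proof (rule nzI[OF that(3)[unfolded prod_mat_def] _ that(4)])
 show "(%i. W i (b i) (p i)) \<in> I \<rightarrow> carrier R"
 using is_matD[OF Wm] that(1,2) by (intro Pi_I) (auto simp: PiE_iff)
qed
have V_supp: "p \<in> ?X" if "p \<in> PiE I S" "b \<in> ?Y" "prod_mat I V p b ~= \<zero>" for p b
proof -
 have b: "b \<in> PiE I B" "{i \<in> I. b i \<notin> BA i} \<in> K" using that(2) by (auto simp: supported_tuples_def)
 have "b i \<notin> BA i" if "i \<in> I" "p i \<notin> T i" for i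
 using V_nz[OF \<open>p \<in> PiE I S\<close> b(1) \<open>prod_mat I V p b ~= \<zero>\<close> that(1)]
  V0[OF that(1) PiE_mem[OF \<open>p \<in> PiE I S\<close> that(1)] _ that(2)] by blast
 then have "{i \<in> I. p i \<notin> T i} <= {i \<in> I. b i \<notin> BA i}" by blast
 then show ?thesis using K[OF b(2)] \<open>p \<in> PiE I S\<close> by (simp add: supported_tuples_def)
qed
have W_supp: "b \<in> ?Y" if "p \<in> ?X" "b \<in> PiE I B" "prod_mat I W b p ~= \<zero>" for p b
proof -
 have p: "p \<in> PiE I S" "{i \<in> I. p i \<notin> T i} \<in> K" using that(1) by (auto simp: supported_tuples_def)
 have "p i \<notin> T i" if "i \<in> I" "b i \<notin> BA i" for i
 using W_nz[OF p(1) \<open>b \<in> PiE I B\<close> \<open>prod_mat I W b p ~= \<zero>\<close> that(1)]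
  W0[OF that(1) _ PiE_mem[OF \<open>b \<in> PiE I B\<close> that(1)] that(2)] by blast
 then have "{i \<in> I. b i \<notin> BA i} <= {i \<in> I. p i \<notin> T i}" by blast
 then show ?thesis using K[OF p(2)] \<open>b \<in> PiE I B\<close> by (simp add: supported_tuples_def)
qed
have E_supp: "b \<in> ?Y" if "b \<in> PiE I B" "b' \<in> ?Y" "tensor_mat I bz ?E b b' ~= \<zero>" for b b'
proof -
 have b': "b' \<in> PiE I B" "{i \<in> I. b' i \<notin> BA i} \<in> K" using that(2) by (auto simp: supported_tuples_def)
 note nz = tensor_mat_nonzero[OF I Em that(1) b'(1) that(3)]
 obtain k where k: "k \<in> I" "?E k (b k) (b' k) ~= \<zero>" "ALL i:I. i ~= k --> b i = b' i"
 using nz by blast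
 then have "(b k, b' k) \<in> G k" by (auto simp: match_mat_def split: if_splits)
 then have "b' k \<in> BA k --> b k \<in> BA k" using GA k(1) by blast
 then have "{i \<in> I. b i \<notin> BA i} <= {i \<in> I. b' i \<notin> BA i}" using k by auto
 then show ?thesis using K[OF b'(2)] that(1) by (simp add: supported_tuples_def)
qed
have deltaP: "(\<Otimes>i\<in>I. delta R (p i) (q i)) = delta R p q" if "p \<in> PiE I U" "q \<in> PiE I U"
 for p q :: "nat => 'z" and U
 using finprod_delta[OF I, of p q] PiE_ext[OF that] by (auto simp: delta_def)
have restrict_sum: "(\<Oplus>t\<in>Y. f t) = (\<Oplus>t\<in>Z. f t)"
 if "finite Z" "Y <= Z" "!!t. t \<in> Z ==> f t \<in> carrier R" "!!t. t \<in> Z ==> t \<notin> Y ==> f t = \<zero>" for f Y and Z :: "'z set"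
 by (rule add.finprod_mono_neutral_cong_left) (use that in auto)
have VW: "mat_mul R ?Y (prod_mat I V) (prod_mat I W) p q = delta R p q" if p: "p \<in> ?X" and q: "q \<in> ?X" for p q
proof -
 have pS: "p \<in> PiE I S" and qS: "q \<in> PiE I S" using p q XS by auto
 have "mat_mul R ?Y (prod_mat I V) (prod_mat I W) p q = mat_mul R (PiE I B) (prod_mat I V) (prod_mat I W) p q"
 unfolding mat_mul_def
 proof (rule restrict_sum[OF finB YB])
 show "prod_mat I V p b \<otimes> prod_mat I W b q \<in> carrier R" if "b \<in> PiE I B" for b
  by (intro m_closed is_matD[OF VP pS that] is_matD[OF WP that qS])
 show "prod_mat I V p b \<otimes> prod_mat I W b q = \<zero>" if b: "b \<in> PiE I B" "b \<notin> ?Y" for b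
  using W_supp[OF q b(1)] b(2) is_matD[OF VP pS b(1)] by (cases "prod_mat I W b q = \<zero>") auto
 qed
 also have "\<dots> = (\<Otimes>i\<in>I. mat_mul R (B i) (V i) (W i) (p i) (q i))"
 by (rule mat_mul_prod_mat[OF I Vm Wm pS qS])
 also have "\<dots> = (\<Otimes>i\<in>I. delta R (p i) (q i))"
 using bc pS qS by (intro finprod_cong') (auto simp: base_change_def PiE_iff)
 finally show ?thesis using deltaP[OF pS qS] by simp
qed
have WV: "mat_mul R ?X (prod_mat I W) (prod_mat I V) b c = delta R b c" if b: "b \<in> ?Y" and c: "c \<in> ?Y" for b c
proof -
 have bB: "b \<in> PiE I B" and cB: "c \<in> PiE I B" using b c YB by auto
 have "mat_mul R ?X (prod_mat I W) (prod_mat I V) b c = mat_mul R (PiE I S) (prod_mat I W) (prod_mat I V) b c"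
 unfolding mat_mul_def
 proof (rule restrict_sum[OF finS XS])
 show "prod_mat I W b p \<otimes> prod_mat I V p c \<in> carrier R" if "p \<in> PiE I S" for p
  by (intro m_closed is_matD[OF VP that cB] is_matD[OF WP bB that])
 show "prod_mat I W b p \<otimes> prod_mat I V p c = \<zero>" if p: "p \<in> PiE I S" "p \<notin> ?X" for p
  using V_supp[OF p(1) c] p(2) is_matD[OF WP bB p(1)] by (cases "prod_mat I V p c = \<zero>") auto
 qed
 also have "\<dots> = (\<Otimes>i\<in>I. mat_mul R (S i) (W i) (V i) (b i) (c i))"
 by (rule mat_mul_prod_mat[OF I Wm Vm bB cB])
 also have "\<dots> = (\<Otimes>i\<in>I. delta R (b i) (c i))"
 using bc bB cB by (intro finprod_cong') (auto simp: base_change_def PiE_iff)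
 finally show ?thesis using deltaP[OF bB cB] by simp
qed
have factor_comm: "mat_mul R (S i) (factor_mat sz D k i) (V i) s b = mat_mul R (B i) (V i) (factor_mat bz ?E k i) s b"
 if i: "i \<in> I" and s: "s \<in> S i" and b: "b \<in> B i" for i k s b
proof -
 have Vc: "V i x y \<in> carrier R" if "x \<in> S i" "y \<in> B i" for x y using is_matD[OF Vm[OF i] that] .
 have fin: "finite (S i)" "finite (B i)" using Vm[OF i] by (auto simp: is_mat_def)
 note single = finsum_single
 consider "i < k" | "i = k" | "k < i" by linarith
 then show ?thesis
 proof cases
 case 1
 have "mat_mul R (S i) (factor_mat sz D k i) (V i) s b = (if s \<in> S i then factor_mat sz D k i s s \<otimes> V i s b else \<zero>)"
  unfolding mat_mul_def using fin 1 Vc b by (intro single) (auto simp: factor_mat_def)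
 moreover have "mat_mul R (B i) (V i) (factor_mat bz ?E k i) s b =
  (if b \<in> B i then V i s b \<otimes> factor_mat bz ?E k i b b else \<zero>)"
  unfolding mat_mul_def using fin 1 Vc s by (intro single) (auto simp: factor_mat_def)
 moreover have "V i s b ~= \<zero> --> sz i s = bz i b" using bc[OF i] s b by (auto simp: base_change_def)
 ultimately show ?thesis using s b 1 Vc[OF s b]
  by (cases "V i s b = \<zero>") (auto simp: factor_mat_def m_comm)
 next
 case 2
 then show ?thesis using bc[OF i] s b by (simp add: factor_mat_def mat_mul_def base_change_def)
 next
 case 3
 have "mat_mul R (S i) (factor_mat sz D k i) (V i) s b = (if s \<in> S i then factor_mat sz D k i s s \<otimes> V i s b else \<zero>)"
  unfolding mat_mul_def using fin 3 Vc b by (intro single) (auto simp: factor_mat_def delta_def)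
 moreover have "mat_mul R (B i) (V i) (factor_mat bz ?E k i) s b =
  (if b \<in> B i then V i s b \<otimes> factor_mat bz ?E k i b b else \<zero>)"
  unfolding mat_mul_def using fin 3 Vc s by (intro single) (auto simp: factor_mat_def delta_def)
 ultimately show ?thesis using s b 3 Vc[OF s b] by (auto simp: factor_mat_def delta_def)
 qed
qed
have DV: "mat_mul R ?X (tensor_mat I sz D) (prod_mat I V) p b = mat_mul R ?Y (prod_mat I V) (tensor_mat I bz ?E) p b"
 if p: "p \<in> ?X" and b: "b \<in> ?Y" for p b
proof -
 have pS: "p \<in> PiE I S" and bB: "b \<in> PiE I B" using p b XS YB by auto
 have FDm: "is_mat R (S i) (S i) (factor_mat sz D k i)" if "i \<in> I" for i k
 by (rule factor_mat_is_mat) (rule Dm[OF that])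
 have FEm: "is_mat R (B i) (B i) (factor_mat bz ?E k i)" if "i \<in> I" for i k
 by (rule factor_mat_is_mat) (rule Em[OF that])
 have FD: "is_mat R (PiE I S) (PiE I S) (prod_mat I (factor_mat sz D k))" for k
 by (rule is_mat_prod_mat[OF I FDm])
 have FE: "is_mat R (PiE I B) (PiE I B) (prod_mat I (factor_mat bz ?E k))" for k
 by (rule is_mat_prod_mat[OF I FEm])
 have "mat_mul R ?X (tensor_mat I sz D) (prod_mat I V) p b = mat_mul R (PiE I S) (tensor_mat I sz D) (prod_mat I V) p b"
 unfolding mat_mul_def
 proof (rule restrict_sum[OF finS XS])
 show "tensor_mat I sz D p q \<otimes> prod_mat I V q b \<in> carrier R" if "q \<in> PiE I S" for q
  by (intro m_closed is_matD[OF VP that bB] is_matD[OF DP pS that])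
 show "tensor_mat I sz D p q \<otimes> prod_mat I V q b = \<zero>" if q: "q \<in> PiE I S" "q \<notin> ?X" for q
  using V_supp[OF q(1) b] q(2) is_matD[OF DP pS q(1)] by (cases "prod_mat I V q b = \<zero>") auto
 qed
 also have "\<dots> = (\<Oplus>q\<in>PiE I S. \<Oplus>k\<in>I. prod_mat I (factor_mat sz D k) p q \<otimes> prod_mat I V q b)"
 unfolding mat_mul_def
 proof (rule finsum_cong'[OF refl])
 show "(%q. \<Oplus>k\<in>I. prod_mat I (factor_mat sz D k) p q \<otimes> prod_mat I V q b) \<in> PiE I S \<rightarrow> carrier R"
  by (intro Pi_I finsum_closed m_closed is_matD[OF FD pS] is_matD[OF VP _ bB])
 show "tensor_mat I sz D p q \<otimes> prod_mat I V q b =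
  (\<Oplus>k\<in>I. prod_mat I (factor_mat sz D k) p q \<otimes> prod_mat I V q b)" if "q \<in> PiE I S" for q
  unfolding tensor_mat_prod
  by (intro finsum_ldistr I is_matD[OF VP that bB] Pi_I is_matD[OF FD pS that])
 qed
 also have "\<dots> = (\<Oplus>k\<in>I. mat_mul R (PiE I S) (prod_mat I (factor_mat sz D k)) (prod_mat I V) p b)"
 unfolding mat_mul_def
 by (intro finsum_swap I finS m_closed is_matD[OF FD pS] is_matD[OF VP _ bB])
 also have "\<dots> = (\<Oplus>k\<in>I. mat_mul R (PiE I B) (prod_mat I V) (prod_mat I (factor_mat bz ?E k)) p b)"
 proof (rule finsum_cong'[OF refl])
 show "(%k. mat_mul R (PiE I B) (prod_mat I V) (prod_mat I (factor_mat bz ?E k)) p b) \<in> I \<rightarrow> carrier R"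
  by (intro Pi_I mat_mul_closed[OF VP FE pS bB])
 fix k assume "k \<in> I"
 have "mat_mul R (PiE I S) (prod_mat I (factor_mat sz D k)) (prod_mat I V) p b =
  (\<Otimes>i\<in>I. mat_mul R (S i) (factor_mat sz D k i) (V i) (p i) (b i))"
  by (rule mat_mul_prod_mat[OF I FDm Vm pS bB])
 also have "\<dots> = (\<Otimes>i\<in>I. mat_mul R (B i) (V i) (factor_mat bz ?E k i) (p i) (b i))"
  using factor_comm pS bB mat_mul_closed[OF Vm FEm]
  by (intro finprod_cong') (auto simp: PiE_iff)
 also have "\<dots> = mat_mul R (PiE I B) (prod_mat I V) (prod_mat I (factor_mat bz ?E k)) p b"
  by (rule mat_mul_prod_mat[OF I Vm FEm pS bB, symmetric])
 finally show "mat_mul R (PiE I S) (prod_mat I (factor_mat sz D k)) (prod_mat I V) p b =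
  mat_mul R (PiE I B) (prod_mat I V) (prod_mat I (factor_mat bz ?E k)) p b" .
 qed
 also have "\<dots> = (\<Oplus>c\<in>PiE I B. \<Oplus>k\<in>I. prod_mat I V p c \<otimes> prod_mat I (factor_mat bz ?E k) c b)"
 unfolding mat_mul_def
 by (intro finsum_swap I finB m_closed is_matD[OF FE _ bB] is_matD[OF VP pS])
 also have "\<dots> = mat_mul R (PiE I B) (prod_mat I V) (tensor_mat I bz ?E) p b"
 unfolding mat_mul_def
 proof (rule finsum_cong'[OF refl])
 show "(%c. prod_mat I V p c \<otimes> tensor_mat I bz ?E c b) \<in> PiE I B \<rightarrow> carrier R"
  by (intro Pi_I m_closed is_matD[OF EP _ bB] is_matD[OF VP pS])
 show "(\<Oplus>k\<in>I. prod_mat I V p c \<otimes> prod_mat I (factor_mat bz ?E k) c b) =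
  prod_mat I V p c \<otimes> tensor_mat I bz ?E c b" if "c \<in> PiE I B" for c
  unfolding tensor_mat_prod
  by (intro finsum_rdistr[symmetric] I is_matD[OF VP pS that] Pi_I is_matD[OF FE that bB])
 qed
 also have "\<dots> = mat_mul R ?Y (prod_mat I V) (tensor_mat I bz ?E) p b"
 unfolding mat_mul_def
 proof (rule restrict_sum[OF finB YB, symmetric])
 show "prod_mat I V p c \<otimes> tensor_mat I bz ?E c b \<in> carrier R" if "c \<in> PiE I B" for c
  by (intro m_closed is_matD[OF EP that bB] is_matD[OF VP pS that])
 show "prod_mat I V p c \<otimes> tensor_mat I bz ?E c b = \<zero>" if c: "c \<in> PiE I B" "c \<notin> ?Y" for c
  using E_supp[OF c(1) b] c(2) is_matD[OF VP pS c(1)] by (cases "tensor_mat I bz ?E c b = \<zero>") auto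
 qed
 finally show ?thesis .
qed
have sz: "(\<Sum>i\<in>I. sz i (p i)) = (\<Sum>i\<in>I. bz i (b i))"
 if p: "p \<in> PiE I S" "b \<in> PiE I B" and nz: "!!i. i \<in> I ==> V i (p i) (b i) ~= \<zero> | W i (b i) (p i) ~= \<zero>" for p b
proof (rule sum.cong[OF refl])
 fix i assume i: "i \<in> I"
 then show "sz i (p i) = bz i (b i)" using bc[OF i] nz[OF i] p by (auto simp: base_change_def PiE_iff)
qed
have sub_mat: "is_mat R X' Y' M" if "is_mat R X Y M" "X' <= X" "Y' <= Y" for M X' Y' and X :: "'z set" and Y :: "'w set"
 using that finite_subset[OF that(2)] finite_subset[OF that(3)] by (simp add: is_mat_def subset_iff)
show ?thesis
 unfolding base_change_def
proof (intro conjI ballI impI VW WV DV)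
 show "is_mat R ?X ?Y (prod_mat I V)" by (rule sub_mat[OF VP XS YB])
 show "is_mat R ?Y ?X (prod_mat I W)" by (rule sub_mat[OF WP YB XS])
 show "is_mat R ?Y ?Y (tensor_mat I bz ?E)" by (rule sub_mat[OF EP YB YB])
 show "(\<Sum>i\<in>I. sz i (p i)) = (\<Sum>i\<in>I. bz i (b i))" if "p \<in> ?X" "b \<in> ?Y" "prod_mat I V p b ~= \<zero>" for p b
 using that XS YB by (intro sz disjI1 V_nz) blast+
 show "(\<Sum>i\<in>I. sz i (p i)) = (\<Sum>i\<in>I. bz i (b i))" if "b \<in> ?Y" "p \<in> ?X" "prod_mat I W b p ~= \<zero>" for p b
 using that XS YB by (intro sz disjI2 W_nz) blast+
qed
qed

end

section \<open>The chain complex of a polyhedral product\<close>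

lemma block_disjoint: "i < k ==> u \<in> block n i ==> v \<in> block n k ==> u < v"
proof -
assume ik: "i < k" and u: "u \<in> block n i" and v: "v \<in> block n k"
have "(\<Sum>j=1..i. n j) \<le> (\<Sum>j=1..k - 1. n j)" using ik by (intro sum_mono2) auto
then show "u < v" using u v by (simp add: block_def)
qed

lemma block_cover: "v \<in> {1..\<Sum>i=1..m. n i} \<longleftrightarrow> (EX k:{1..m}. v \<in> block n k)"
proof (induction m)
case (Suc m)
have split: "v \<in> {1..\<Sum>i=1..Suc m. n i} \<longleftrightarrow> v \<in> block n (Suc m) | v \<in> {1..\<Sum>i=1..m. n i}"
 by (auto simp: block_def)
have ins: "{1..Suc m} = insert (Suc m) {1..m}" by auto
show ?case unfolding split Suc.IH unfolding ins by (simp only: Set.bex_simps)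
qed simp

lemma mhom_shift: "mhom R S (%s. sz s + a) D d = mhom R S sz D (d - a)"
proof -
have [simp]: "x + a = d \<longleftrightarrow> x = d - a" "x + a = d + 1 \<longleftrightarrow> x = d - a + 1" for x :: int by auto
show ?thesis unfolding mhom_def mcycles_def mbounds_def mchains_def by simp
qed

context cring begin

lemma isign_cong: "even (x - y) ==> isign x = isign y"
by (auto simp: isign_def)

context
fixes m :: nat and n :: "nat => nat" and K :: "nat set set" and X A :: "nat => nat set set"
assumes K: "simplicial_complex {1..m} K"
 and XA: "!!k. k \<in> {1..m} ==> simplicial_pair (block n k) (X k) (A k)"
begin

abbreviation "pp \<equiv> polyhedral_product m n K X A"
abbreviation "parts \<sigma> \<equiv> (\<lambda>k\<in>{1..m}. \<sigma> \<inter> block n k)"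

lemma pair_complexes: "k \<in> {1..m} ==> simplicial_complex (block n k) (X k)"
 "k \<in> {1..m} ==> simplicial_complex (block n k) (A k)" "k \<in> {1..m} ==> A k <= X k"
using XA by (auto simp: simplicial_pair_def)

lemma mem_polyhedral_product:
"\<sigma> \<in> pp \<longleftrightarrow> \<sigma> <= {1..\<Sum>i=1..m. n i} & parts \<sigma> \<in> supported_tuples {1..m} K X A"
proof
assume "\<sigma> \<in> pp"
then obtain \<tau> where \<tau>: "\<tau> \<in> K" "\<sigma> <= {1..\<Sum>i=1..m. n i}"
 "!!k. k \<in> {1..m} ==> \<sigma> \<inter> block n k \<in> (if k \<in> \<tau> then X k else A k)"
 by (auto simp: polyhedral_product_def join_complexes_def)
have "k \<in> \<tau>" if "k \<in> {1..m}" "\<sigma> \<inter> block n k \<notin> A k" for k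
 using \<tau>(3)[OF that(1)] that(2) by (auto split: if_splits)
then have "{k \<in> {1..m}. parts \<sigma> k \<notin> A k} <= \<tau>" by auto
then have "{k \<in> {1..m}. parts \<sigma> k \<notin> A k} \<in> K" using complex_closed[OF K \<tau>(1)] by blast
moreover have "parts \<sigma> \<in> PiE {1..m} X"
proof (rule restrict_PiE_iff[THEN iffD2], rule ballI)
 fix k assume "k \<in> {1..m}"
 then show "\<sigma> \<inter> block n k \<in> X k" using \<tau>(3)[of k] pair_complexes(3)[of k] by (auto split: if_splits)
qed
ultimately show "\<sigma> <= {1..\<Sum>i=1..m. n i} & parts \<sigma> \<in> supported_tuples {1..m} K X A"
 using \<tau>(2) by (simp add: supported_tuples_def)
next
assume s: "\<sigma> <= {1..\<Sum>i=1..m. n i} & parts \<sigma> \<in> supported_tuples {1..m} K X A"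
then have \<tau>: "{k \<in> {1..m}. parts \<sigma> k \<notin> A k} \<in> K" and X: "\<sigma> \<inter> block n k \<in> X k" if "k \<in> {1..m}" for k
 using that by (auto simp: supported_tuples_def PiE_iff)
have "{k \<in> {1..m}. parts \<sigma> k \<notin> A k} \<in> K" using s by (simp add: supported_tuples_def)
moreover have "\<sigma> \<in> join_complexes m n (%k. if k \<in> {k \<in> {1..m}. parts \<sigma> k \<notin> A k} then X k else A k)"
 using s X by (auto simp: join_complexes_def)
ultimately show "\<sigma> \<in> pp" unfolding polyhedral_product_def by blast
qed

lemma union_parts: "\<sigma> <= {1..\<Sum>i=1..m. n i} ==> (\<Union>k\<in>{1..m}. \<sigma> \<inter> block n k) = \<sigma>"
using block_cover[of _ n m] by blast

lemma disjoint_blocks: "i ~= k ==> block n i \<inter> block n k = {}"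
using block_disjoint[of i k _ n] block_disjoint[of k i _ n] by (cases "i < k") (fastforce simp: disjoint_iff)+

lemma pp_complex: "simplicial_complex {1..\<Sum>i=1..m. n i} pp"
unfolding simplicial_complex_def
proof (intro conjI ballI allI impI)
show "pp <= Pow {1..\<Sum>i=1..m. n i}" using mem_polyhedral_product by blast
fix \<sigma> \<tau> assume s: "\<sigma> \<in> pp" and sub: "\<tau> <= \<sigma>"
have parts: "\<tau> \<inter> block n k <= \<sigma> \<inter> block n k" for k using sub by blast
have s': "\<sigma> <= {1..\<Sum>i=1..m. n i}" "{k \<in> {1..m}. parts \<sigma> k \<notin> A k} \<in> K"
 "!!k. k \<in> {1..m} ==> \<sigma> \<inter> block n k \<in> X k"
 using s unfolding mem_polyhedral_product by (auto simp: supported_tuples_def PiE_iff)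
have "{k \<in> {1..m}. parts \<tau> k \<notin> A k} <= {k \<in> {1..m}. parts \<sigma> k \<notin> A k}"
 using complex_closed[OF pair_complexes(2) _ parts] by auto
then have "{k \<in> {1..m}. parts \<tau> k \<notin> A k} \<in> K" using complex_closed[OF K s'(2)] by blast
moreover have "\<tau> \<inter> block n k \<in> X k" if "k \<in> {1..m}" for k
 using complex_closed[OF pair_complexes(1)[OF that] s'(3)[OF that] parts] .
ultimately show "\<tau> \<in> pp" unfolding mem_polyhedral_product using s'(1) sub
 by (auto simp: supported_tuples_def PiE_iff)
qed simp

lemma parts_bij: "bij_betw (%\<sigma>. parts \<sigma>) pp (supported_tuples {1..m} K X A)"
proof (rule bij_betw_byWitness[where f' = "%p. \<Union>k\<in>{1..m}. p k"])
have p3: "parts (\<Union>j\<in>{1..m}. p j) = p" "(\<Union>j\<in>{1..m}. p j) <= {1..\<Sum>i=1..m. n i}"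
 if p: "p \<in> supported_tuples {1..m} K X A" for p
proof -
 have pb: "p j <= block n j" if "j \<in> {1..m}" for j
 proof -
 have "p j \<in> X j" using p that by (auto simp: supported_tuples_def PiE_iff)
 then show ?thesis using pair_complexes(1)[OF that] unfolding simplicial_complex_def by blast
 qed
 have U: "(\<Union>j\<in>{1..m}. p j) \<inter> block n k = p k" if k: "k \<in> {1..m}" for k
 proof -
 have "p j \<inter> block n k <= p k" if "j \<in> {1..m}" for j
  using pb[OF that] disjoint_blocks[of j k] by (cases "j = k") auto
 then show ?thesis using pb[OF k] k by blast
 qed

 show "parts (\<Union>j\<in>{1..m}. p j) = p"
 proof
 fix j show "parts (\<Union>j\<in>{1..m}. p j) j = p j"
  using U[of j] p by (cases "j \<in> {1..m}") (auto simp: supported_tuples_def PiE_iff extensional_def)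
 qed
 show "(\<Union>j\<in>{1..m}. p j) <= {1..\<Sum>i=1..m. n i}" using pb block_cover[of _ n m] by blast
qed
show "ALL \<sigma>:pp. (\<Union>k\<in>{1..m}. parts \<sigma> k) = \<sigma>"
 using union_parts by (simp add: mem_polyhedral_product)
show "ALL p:supported_tuples {1..m} K X A. parts (\<Union>k\<in>{1..m}. p k) = p" by (intro ballI p3(1))
show "(%\<sigma>. parts \<sigma>) ` pp <= supported_tuples {1..m} K X A" by (intro image_subsetI) (simp only: mem_polyhedral_product)
show "(%p. \<Union>k\<in>{1..m}. p k) ` supported_tuples {1..m} K X A <= pp"
proof (rule image_subsetI)
 fix p assume p: "p \<in> supported_tuples {1..m} K X A"
 show "(\<Union>k\<in>{1..m}. p k) \<in> pp" unfolding mem_polyhedral_product p3(1)[OF p] using p3(2)[OF p] p by blast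
qed
qed

lemma card_parts:
assumes "\<sigma> <= {1..\<Sum>i=1..m. n i}" "J <= {1..m}"
shows "(\<Sum>k\<in>J. card (\<sigma> \<inter> block n k)) = card (\<Union>k\<in>J. \<sigma> \<inter> block n k)"
proof (rule card_UN_disjoint[symmetric])
show "finite J" using assms(2) finite_subset by blast
show "ALL k:J. finite (\<sigma> \<inter> block n k)" by (simp add: block_def)
show "ALL i:J. ALL j:J. i ~= j --> \<sigma> \<inter> block n i \<inter> (\<sigma> \<inter> block n j) = {}"
proof (intro ballI impI)
 fix i j :: nat assume "i ~= j"
 then show "\<sigma> \<inter> block n i \<inter> (\<sigma> \<inter> block n j) = {}" using disjoint_blocks[of i j] by blast
qed
qed

abbreviation "parts_mat \<equiv> tensor_mat {1..m} (%_ \<sigma>. int (card \<sigma>)) (%_. simp_mat R)"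

lemma parts_mats: "k \<in> {1..m} ==> is_mat R (X k) (X k) (simp_mat R)"
by (rule mcomplex_mat[OF simplicial_mcomplex[OF pair_complexes(1)]])

lemma parts_differential:
assumes \<sigma>: "\<sigma> \<in> pp" and \<tau>: "\<tau> \<in> pp"
shows "simp_mat R \<tau> \<sigma> = parts_mat (parts \<tau>) (parts \<sigma>)"
proof -
have P: "parts \<sigma> \<in> PiE {1..m} X" "parts \<tau> \<in> PiE {1..m} X"
 and sub: "\<sigma> <= {1..\<Sum>i=1..m. n i}" "\<tau> <= {1..\<Sum>i=1..m. n i}"
 using \<sigma> \<tau> unfolding mem_polyhedral_product by (simp_all add: supported_tuples_def)
show ?thesis
proof (cases "EX v:\<sigma>. \<tau> = \<sigma> - {v}")
 case True
 then obtain v where v: "v \<in> \<sigma>" "\<tau> = \<sigma> - {v}" by blast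
 then obtain k where k: "k \<in> {1..m}" "v \<in> block n k" using sub(1) block_cover[of v n m] by blast
 have ne: "parts \<tau> k ~= parts \<sigma> k" using v k by auto
 have eq: "parts \<tau> i = parts \<sigma> i" if "i \<in> {1..m}" "i ~= k" for i
 using that disjoint_blocks[of i k] v k by auto
 let ?J = "{i \<in> {1..m}. i < k}"
 have J: "(\<Sum>i\<in>?J. int (card (parts \<sigma> i))) = int (card (\<Union>i\<in>?J. \<sigma> \<inter> block n i))"
 using card_parts[OF sub(1), of ?J, OF Collect_restrict] by (simp flip: of_nat_sum)
 have split: "{u \<in> \<sigma>. u < v} = (\<Union>i\<in>?J. \<sigma> \<inter> block n i) \<union> {u \<in> \<sigma> \<inter> block n k. u < v}"
 proof (rule equalityI; rule subsetI)
 fix u assume u: "u \<in> {u \<in> \<sigma>. u < v}"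
 then obtain i where i: "i \<in> {1..m}" "u \<in> block n i" using sub(1) block_cover[of u n m] by blast
 have "~ k < i" using block_disjoint[of k i v n u] k(2) i(2) u by auto
 then show "u \<in> (\<Union>i\<in>?J. \<sigma> \<inter> block n i) \<union> {u \<in> \<sigma> \<inter> block n k. u < v}"
  using u i by (cases "i = k") auto
 next
 fix u assume "u \<in> (\<Union>i\<in>?J. \<sigma> \<inter> block n i) \<union> {u \<in> \<sigma> \<inter> block n k. u < v}"
 then show "u \<in> {u \<in> \<sigma>. u < v}" using block_disjoint[of _ k u n v] k(2) by blast
 qed
 have "card {u \<in> \<sigma>. u < v} = card (\<Union>i\<in>?J. \<sigma> \<inter> block n i) + card {u \<in> \<sigma> \<inter> block n k. u < v}"
 unfolding split
 proof (rule card_Un_disjoint)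
 have "block n i \<inter> block n k = {}" if "i \<in> ?J" for i using disjoint_blocks[of i k] that by simp
 then show "(\<Union>i\<in>?J. \<sigma> \<inter> block n i) \<inter> {u \<in> \<sigma> \<inter> block n k. u < v} = {}" by blast
 qed (auto simp: block_def)
 moreover have "parts_mat (parts \<tau>) (parts \<sigma>) =
 isign (\<Sum>i\<in>?J. int (card (parts \<sigma> i))) \<otimes> simp_mat R (parts \<tau> k) (parts \<sigma> k)"
 by (rule tensor_mat_single[OF _ parts_mats P(2,1) k(1) eq ne]) simp_all
 moreover have "parts \<tau> k = parts \<sigma> k - {v}" "v \<in> parts \<sigma> k" using v k by auto
 ultimately show ?thesis unfolding J using v k
 by (simp add: simp_mat_remove orientation_sign_neg_pow neg_pow_isign isign_add)
next
 case False
 then have "simp_mat R \<tau> \<sigma> = \<zero>" using simp_mat_nonzero[of R \<tau> \<sigma>] by blast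
 moreover have "parts_mat (parts \<tau>) (parts \<sigma>) = \<zero>"
 proof (rule ccontr)
 assume nz: "parts_mat (parts \<tau>) (parts \<sigma>) ~= \<zero>"
 have "EX k:{1..m}. simp_mat R (parts \<tau> k) (parts \<sigma> k) ~= \<zero> & (ALL i:{1..m}. i ~= k --> parts \<tau> i = parts \<sigma> i)"
  by (rule tensor_mat_nonzero[OF _ parts_mats P(2,1) nz]) simp_all
 then obtain k where k: "k \<in> {1..m}" "simp_mat R (\<tau> \<inter> block n k) (\<sigma> \<inter> block n k) ~= \<zero>"
  "!!i. i \<in> {1..m} ==> i ~= k ==> \<tau> \<inter> block n i = \<sigma> \<inter> block n i" by auto
 obtain v where v: "v \<in> \<sigma> \<inter> block n k" "\<tau> \<inter> block n k = \<sigma> \<inter> block n k - {v}" by (rule simp_mat_nonzero[OF k(2)])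
 have "u \<in> \<tau> \<longleftrightarrow> u \<in> \<sigma> - {v}" for u
 proof (cases "EX i:{1..m}. u \<in> block n i")
  case True
  then obtain i where i: "i \<in> {1..m}" "u \<in> block n i" by blast
  show ?thesis
  proof (cases "i = k")
  case True then show ?thesis using v(2) i(2) by blast
  next
  case False
  then have "u ~= v" using disjoint_blocks[of i k] i v(1) by blast
  then show ?thesis using k(3)[OF i(1) False] i(2) by blast
  qed
 next
  case False
  then show ?thesis using sub block_cover[of u n m] by blast
 qed
 then have "\<tau> = \<sigma> - {v}" by blast
 then show False using \<open>~ (EX v:\<sigma>. \<tau> = \<sigma> - {v})\<close> v(1) by blast
 qed
 ultimately show ?thesis by simp
qed
qed

lemma parts_base_change:
"base_change R pp (%\<sigma>. int (card \<sigma>)) (simp_mat R) (supported_tuples {1..m} K X A)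
 (%p. \<Sum>i\<in>{1..m}. int (card (p i))) parts_mat
 (%s t. if parts s = t then \<one> else \<zero>) (%t s. if parts s = t then \<one> else \<zero>)"
proof (rule base_change_relabel[OF simplicial_mcomplex[OF pp_complex] parts_bij])
have "is_mat R (PiE {1..m} X) (PiE {1..m} X) parts_mat" by (rule is_mat_tensor[OF _ parts_mats]) simp_all
then show "is_mat R (supported_tuples {1..m} K X A) (supported_tuples {1..m} K X A) parts_mat"
 by (auto simp: is_mat_def supported_tuples_def)
show "(\<Sum>i\<in>{1..m}. int (card (parts s i))) = int (card s)" if "s \<in> pp" for s
 using card_parts[of s "{1..m}"] union_parts[of s] that by (simp add: mem_polyhedral_product flip: of_nat_sum)
show "simp_mat R s t \<otimes> \<one> = \<one> \<otimes> parts_mat (parts s) (parts t)" if "s \<in> pp" "t \<in> pp" for s t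
 using parts_differential[OF that(2,1)] by (metis l_one r_one simp_mat_closed)
qed simp_all

lemma parts_mcomplex:
"mcomplex R (supported_tuples {1..m} K X A) (%p. \<Sum>i\<in>{1..m}. int (card (p i))) parts_mat"
proof (rule bc_mcomplex[OF simplicial_mcomplex[OF pp_complex] parts_base_change])
fix p q assume pq: "p \<in> supported_tuples {1..m} K X A" "q \<in> supported_tuples {1..m} K X A" "parts_mat p q ~= \<zero>"
show "(\<Sum>i\<in>{1..m}. int (card (q i))) = (\<Sum>i\<in>{1..m}. int (card (p i))) + 1"
 by (rule tensor_mat_degree[OF _ simplicial_mcomplex[OF pair_complexes(1)] _ _ pq(3)])
 (use pq in \<open>auto simp: supported_tuples_def\<close>)
qed

end

end

section \<open>Decomposition of the tensor product of matchings\<close>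

text \<open>
Of the generators that are not the target of an arrow of the matching, those which contribute to the
homology of a polyhedral product: the unmatched ones, and those of the subcomplex that become a
boundary in the complex but not in the subcomplex.
\<close>

definition core :: "'y set => 'y set => ('y \<times> 'y) set => 'y set"
where "core B BA G = (B - Field G) \<union> {p \<in> BA. EX q. (p, q) \<in> G & q \<notin> BA}"

definition core_index :: "nat set => (nat => 'y set) => (nat => ('y \<times> 'y) set) => (nat => 'y) => index"
where "core_index I BA G t = ({i \<in> I. t i \<notin> BA i}, {i \<in> I. t i \<in> Domain (G i)})"

definition mate :: "('y \<times> 'y) set => 'y => 'y" where "mate G p = (THE q. (p, q) \<in> G)"

lemma mate_eq: "single_valued G ==> (p, q) \<in> G ==> mate G p = q"
unfolding mate_def by (rule the_equality) (auto dest: single_valuedD)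

definition rep :: "('y \<times> 'y) set => 'y => 'y"
where "rep G x = (if x \<in> Range G then mate (G\<inverse>) x else x)"

text \<open>
The block of the tuple \<open>t\<close> consists of the tuples in which some of the entries \<open>t i\<close> are replaced by
their partners; as simplices, the sets of positions of these replacements.
\<close>

definition matched_complex :: "nat set => nat set set => (nat => 'y set) => (nat => ('y \<times> 'y) set) => (nat => 'y) => nat set set"
where "matched_complex I K BA G t = {\<tau>. \<tau> <= {i \<in> I. t i \<in> Domain (G i)} &
 {i \<in> I. t i \<notin> BA i} \<union> {i \<in> \<tau>. mate (G i) (t i) \<notin> BA i} \<in> K}"

context cring begin

context
fixes I :: "nat set" and K :: "nat set set" and B BA :: "nat => 'y set" and G :: "nat => ('y \<times> 'y) set"
 and bz :: "nat => 'y => int"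
assumes I: "finite I" and K: "simplicial_complex I K"
 and m: "!!i. i \<in> I ==> matching (B i) (bz i) (G i)" and BAB: "!!i. i \<in> I ==> BA i <= B i"
 and GA: "!!i p q. i \<in> I ==> (p, q) \<in> G i ==> q \<in> BA i ==> p \<in> BA i"
 and C: "mcomplex R (supported_tuples I K B BA) (%b. \<Sum>i\<in>I. bz i (b i)) (tensor_mat I bz (%i. match_mat (G i)))"
begin

abbreviation "Y \<equiv> supported_tuples I K B BA"
abbreviation "tz \<equiv> %b. \<Sum>i\<in>I. bz i (b i)"
abbreviation "tm \<equiv> tensor_mat I bz (%i. match_mat (G i))"
abbreviation "reps \<equiv> PiE I (%i. B i - Range (G i))"
abbreviation "rep_tuple b \<equiv> \<lambda>i\<in>I. rep (G i) (b i)"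
abbreviation "moved t b \<equiv> {i \<in> I. b i ~= t i}"

lemma matching_facts:
assumes i: "i \<in> I"
shows "single_valued (G i)" "single_valued ((G i)\<inverse>)" "G i <= B i \<times> B i" "Domain (G i) \<inter> Range (G i) = {}"
 "(p, q) \<in> G i ==> bz i q = bz i p + 1" "finite (B i)" "(p, q) \<in> G i ==> p ~= q"
using m[OF i] by (auto simp: matching_def)

lemma matches: "i \<in> I ==> is_mat R (B i) (B i) (match_mat (G i))"
using is_mat_match matching_facts(6) by blast

lemma rep_cases:
assumes i: "i \<in> I" and x: "x \<in> B i"
shows "rep (G i) x \<in> B i - Range (G i)" and "x = rep (G i) x | (rep (G i) x, x) \<in> G i"
proof -
have "(mate ((G i)\<inverse>) x, x) \<in> G i" if "x \<in> Range (G i)"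
 using that mate_eq[OF matching_facts(2)[OF i]] by auto
then show "x = rep (G i) x | (rep (G i) x, x) \<in> G i" "rep (G i) x \<in> B i - Range (G i)"
 using x matching_facts(3,4)[OF i] by (auto simp: rep_def)
qed

lemma rep_simps:
assumes i: "i \<in> I"
shows "x \<notin> Range (G i) ==> rep (G i) x = x" and "(p, q) \<in> G i ==> rep (G i) q = p"
using mate_eq[OF matching_facts(2)[OF i], of q p] by (auto simp: rep_def)

lemma tuple_iff: "b \<in> Y \<longleftrightarrow> b \<in> PiE I B & {i \<in> I. b i \<notin> BA i} \<in> K"
by (auto simp: supported_tuples_def)

lemma rep_tuple_mem: "b \<in> Y ==> rep_tuple b \<in> reps"
using rep_cases(1) by (auto simp: tuple_iff PiE_iff)

lemma differential_arrow:
assumes "b \<in> PiE I B" "c \<in> PiE I B" "tm b c ~= \<zero>"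
obtains k where "k \<in> I" "(b k, c k) \<in> G k" "!!i. i \<in> I ==> i ~= k ==> b i = c i"
proof -
have "EX k:I. match_mat (G k) (b k) (c k) ~= \<zero> & (ALL i:I. i ~= k --> b i = c i)"
 by (rule tensor_mat_nonzero[OF I matches assms])
then show ?thesis using that by (auto simp: match_mat_def split: if_splits)
qed

lemma differential_block:
assumes "b \<in> Y" "c \<in> Y" "tm b c ~= \<zero>" shows "rep_tuple b = rep_tuple c"
proof -
have bc: "b \<in> PiE I B" "c \<in> PiE I B" using assms by (auto simp: tuple_iff)
obtain k where k: "k \<in> I" "(b k, c k) \<in> G k" "!!i. i \<in> I ==> i ~= k ==> b i = c i"
 using differential_arrow[OF bc assms(3)] by metis
have "b k \<notin> Range (G k)" using k matching_facts(4)[OF k(1)] by blast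
then have "rep (G k) (b k) = rep (G k) (c k)" using rep_simps[OF k(1)] k(2) by simp
then show ?thesis using k(3) by (intro restrict_ext) metis
qed

lemma finite_reps: "finite reps"
using I matching_facts(6) by (intro finite_PiE) auto

lemmas blocks = C finite_reps rep_tuple_mem differential_block

context
fixes t assumes t: "t \<in> reps"
begin

abbreviation "block_complex \<equiv> matched_complex I K BA G t"
abbreviation "blk \<equiv> block_part Y rep_tuple t"

lemma t_mem: "i \<in> I ==> t i \<in> B i" "i \<in> I ==> t i \<notin> Range (G i)"
using t by (auto simp: PiE_iff)

lemma mate_t: "i \<in> I ==> t i \<in> Domain (G i) ==> (t i, mate (G i) (t i)) \<in> G i"
using mate_eq[OF matching_facts(1)] by auto

lemma block_mem:
"b \<in> blk \<longleftrightarrow> b \<in> Y & (ALL i:I. b i = t i | (t i, b i) \<in> G i)"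
proof -
have r: "rep (G i) (b i) = t i \<longleftrightarrow> b i = t i | (t i, b i) \<in> G i" if b: "b \<in> Y" and i: "i \<in> I" for i
proof
 have "b i \<in> B i" using b i by (auto simp: tuple_iff PiE_iff)
 then show "b i = t i | (t i, b i) \<in> G i" if "rep (G i) (b i) = t i"
 using rep_cases(2)[OF i, of "b i"] that by simp
 show "rep (G i) (b i) = t i" if "b i = t i | (t i, b i) \<in> G i"
 using that rep_simps(1)[OF i t_mem(2)[OF i]] rep_simps(2)[OF i, of "t i" "b i"] by auto
qed
have "rep_tuple b = t \<longleftrightarrow> (ALL i:I. rep (G i) (b i) = t i)"
proof
 assume "rep_tuple b = t"
 then show "ALL i:I. rep (G i) (b i) = t i" using restrict_apply'[of _ I "%i. rep (G i) (b i)"] by metis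
next
 assume "ALL i:I. rep (G i) (b i) = t i"
 then show "rep_tuple b = t" using t by (intro extensionalityI[of _ I]) (auto simp: PiE_iff)
qed
moreover have "blk = {b \<in> Y. rep_tuple b = t}"
 by (rule block_part_def) (rule blocks, assumption?)+
ultimately show ?thesis using r by (simp cong: conj_cong ball_cong)
qed

lemma moved_iff:
assumes b: "b \<in> blk" and i: "i \<in> I"
shows "i \<in> moved t b \<longleftrightarrow> (t i, b i) \<in> G i" and "i \<in> moved t b ==> b i = mate (G i) (t i)"
 and "i \<in> moved t b ==> t i \<in> Domain (G i)"
proof -
have "b i = t i | (t i, b i) \<in> G i" using b i block_mem by blast
then show e: "i \<in> moved t b \<longleftrightarrow> (t i, b i) \<in> G i" using matching_facts(7)[OF i, of "t i" "b i"] i by auto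
show "i \<in> moved t b ==> b i = mate (G i) (t i)" using e mate_eq[OF matching_facts(1)[OF i]] by auto
show "i \<in> moved t b ==> t i \<in> Domain (G i)" using e by auto
qed

lemma moved_support:
assumes b: "!!i. i \<in> I ==> i \<in> \<tau> ==> t i \<in> Domain (G i) & b i = mate (G i) (t i)"
 "!!i. i \<in> I ==> i \<notin> \<tau> ==> b i = t i" and \<tau>: "\<tau> <= I"
shows "{i \<in> I. b i \<notin> BA i} = {i \<in> I. t i \<notin> BA i} \<union> {i \<in> \<tau>. mate (G i) (t i) \<notin> BA i}"
proof -
have "b i \<notin> BA i \<longleftrightarrow> t i \<notin> BA i | i \<in> \<tau> & mate (G i) (t i) \<notin> BA i" if i: "i \<in> I" for i
 using b[OF i] GA[OF i mate_t[OF i]] by (cases "i \<in> \<tau>") auto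
then show ?thesis using \<tau> by auto
qed

lemma moved_bij: "bij_betw (moved t) blk block_complex"
proof (rule bij_betw_byWitness[where f' = "%\<tau>. \<lambda>i\<in>I. if i \<in> \<tau> then mate (G i) (t i) else t i"])
show "ALL b:blk. (\<lambda>i\<in>I. if i \<in> moved t b then mate (G i) (t i) else t i) = b"
proof (intro ballI ext)
 fix b i assume b: "b \<in> blk"
 then have "b \<in> extensional I" by (auto simp: block_mem tuple_iff PiE_iff)
 then show "(\<lambda>i\<in>I. if i \<in> moved t b then mate (G i) (t i) else t i) i = b i"
 using moved_iff(2)[OF b, of i] by (cases "i \<in> I") (auto simp: extensional_def)
qed
show "ALL \<tau>:block_complex. moved t (\<lambda>i\<in>I. if i \<in> \<tau> then mate (G i) (t i) else t i) = \<tau>"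
proof
 fix \<tau> assume "\<tau> \<in> block_complex"
 then have \<tau>: "\<tau> <= {i \<in> I. t i \<in> Domain (G i)}" by (simp add: matched_complex_def)
 have "mate (G i) (t i) ~= t i" if "i \<in> \<tau>" for i
 using \<tau> that matching_facts(7)[OF _ mate_t] by force
 then show "moved t (\<lambda>i\<in>I. if i \<in> \<tau> then mate (G i) (t i) else t i) = \<tau>" using \<tau> by auto
qed
show "moved t ` blk <= block_complex"
proof (rule image_subsetI)
 fix b assume b: "b \<in> blk"
 have "{i \<in> I. b i \<notin> BA i} \<in> K" using b by (simp add: block_mem tuple_iff)
 moreover have "{i \<in> I. b i \<notin> BA i} = {i \<in> I. t i \<notin> BA i} \<union> {i \<in> moved t b. mate (G i) (t i) \<notin> BA i}"
 by (rule moved_support) (use moved_iff(2,3)[OF b] in auto)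
 ultimately show "moved t b \<in> block_complex" using moved_iff(3)[OF b] by (auto simp: matched_complex_def)
qed
show "(%\<tau>. \<lambda>i\<in>I. if i \<in> \<tau> then mate (G i) (t i) else t i) ` block_complex <= blk"
proof (rule image_subsetI)
 fix \<tau> assume "\<tau> \<in> block_complex"
 then have \<tau>: "\<tau> <= {i \<in> I. t i \<in> Domain (G i)}"
 "{i \<in> I. t i \<notin> BA i} \<union> {i \<in> \<tau>. mate (G i) (t i) \<notin> BA i} \<in> K" by (auto simp: matched_complex_def)
 let ?b = "\<lambda>i\<in>I. if i \<in> \<tau> then mate (G i) (t i) else t i"
 have "{i \<in> I. ?b i \<notin> BA i} = {i \<in> I. t i \<notin> BA i} \<union> {i \<in> \<tau>. mate (G i) (t i) \<notin> BA i}"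
 by (rule moved_support) (use \<tau>(1) in auto)
 moreover have mt: "(t i, mate (G i) (t i)) \<in> G i" if "i \<in> I" "i \<in> \<tau>" for i
 using \<tau>(1) that(2) by (intro mate_t that(1)) blast
 moreover have "?b i \<in> B i" if "i \<in> I" for i
 using mt[OF that] t_mem(1)[OF that] matching_facts(3)[OF that] that by (cases "i \<in> \<tau>") auto
 ultimately show "?b \<in> blk" using \<tau>(2) unfolding block_mem tuple_iff by (auto simp: PiE_iff)
qed
qed

lemma block_complex: "simplicial_complex I block_complex"
proof -
have "\<tau>' \<in> block_complex" if \<tau>: "\<tau> \<in> block_complex" "\<tau>' <= \<tau>" for \<tau> \<tau>'
proof -
 have "{i \<in> I. t i \<notin> BA i} \<union> {i \<in> \<tau>'. mate (G i) (t i) \<notin> BA i} \<in> K"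
 by (rule complex_closed[OF K, of "{i \<in> I. t i \<notin> BA i} \<union> {i \<in> \<tau>. mate (G i) (t i) \<notin> BA i}"])
  (use \<tau> in \<open>auto simp: matched_complex_def\<close>)
 then show ?thesis using \<tau> by (auto simp: matched_complex_def)
qed
moreover have "block_complex <= Pow I" by (auto simp: matched_complex_def)
ultimately show ?thesis unfolding simplicial_complex_def using I by blast
qed

lemma moved_degree:
assumes b: "b \<in> blk" and i: "i \<in> I"
shows "bz i (b i) = bz i (t i) + (if i \<in> moved t b then 1 else 0)"
proof (cases "b i = t i")
case False
then have "i \<in> moved t b" using i by simp
then show ?thesis using matching_facts(5)[OF i, of "t i" "b i"] moved_iff(1)[OF b i] by simp
qed simp

lemma moved_degrees:
assumes b: "b \<in> blk" and J: "J <= I"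
shows "(\<Sum>i\<in>J. bz i (b i)) = (\<Sum>i\<in>J. bz i (t i)) + int (card (J \<inter> moved t b))"
proof -
have fin: "finite J" using J I finite_subset by blast
have "(\<Sum>i\<in>J. bz i (b i)) = (\<Sum>i\<in>J. bz i (t i) + (if i \<in> moved t b then 1 else 0))"
 by (rule sum.cong[OF refl moved_degree[OF b]]) (use J in blast)
also have "\<dots> = (\<Sum>i\<in>J. bz i (t i)) + (\<Sum>i\<in>J. if i \<in> moved t b then 1 else 0)"
 by (rule sum.distrib)
also have "(\<Sum>i\<in>J. if i \<in> moved t b then 1 else 0) = (\<Sum>i\<in>J \<inter> moved t b. 1::int)"
 by (rule sum.inter_restrict[OF fin, symmetric])
finally show ?thesis by simp
qed

lemma block_degree:
assumes b: "b \<in> blk" shows "tz b = int (card (moved t b)) + tz t"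
proof -
have "I \<inter> moved t b = moved t b" by blast
then show ?thesis using moved_degrees[OF b order_refl] by simp
qed

text \<open>
The sign by which the generator with \<open>\<tau>\<close> moved differs from the simplex \<open>\<tau>\<close>: the sign in the
differential of a tensor product counts all degrees before the moved position, the one in a simplicial
boundary only the moved positions.
\<close>

definition "block_sign b = isign (\<Sum>k\<in>moved t b. \<Sum>i\<in>{i \<in> I. i < k}. bz i (t i))"

lemma block_differential:
assumes b: "b \<in> blk" and c: "c \<in> blk"
shows "tm b c \<otimes> block_sign c = block_sign b \<otimes> simp_mat R (moved t b) (moved t c)"
proof -
have P: "b \<in> PiE I B" "c \<in> PiE I B" using b c by (auto simp: block_mem tuple_iff)
show ?thesis
proof (cases "EX k:moved t c. moved t b = moved t c - {k}")
 case True
 then obtain k where k: "k \<in> moved t c" "moved t b = moved t c - {k}" by blast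
 then have kI: "k \<in> I" by simp
 have bk: "b k = t k" "(t k, c k) \<in> G k" using k kI moved_iff(1)[OF c kI] by auto
 have eq: "b i = c i" if "i \<in> I" "i ~= k" for i
 proof (cases "i \<in> moved t c")
 case True
 then have "i \<in> moved t b" using k that by blast
 then show ?thesis using True moved_iff(2)[OF b that(1)] moved_iff(2)[OF c that(1)] by simp
 next
 case False
 then have "i \<notin> moved t b" using k by blast
 then show ?thesis using False that by simp
 qed
 have "b k ~= c k" using bk matching_facts(7)[OF kI] by auto
 then have tm: "tm b c = isign (\<Sum>i\<in>{i \<in> I. i < k}. bz i (c i)) \<otimes> match_mat (G k) (b k) (c k)"
 by (intro tensor_mat_single[OF I matches P kI eq])
 have mm: "match_mat (G k) (b k) (c k) = \<one>" using bk by (simp add: match_mat_def)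
 have deg: "(\<Sum>i\<in>{i \<in> I. i < k}. bz i (c i)) =
 (\<Sum>i\<in>{i \<in> I. i < k}. bz i (t i)) + int (card {u \<in> moved t c. u < k})"
 proof -
 have "{i \<in> I. i < k} \<inter> moved t c = {u \<in> moved t c. u < k}" by blast
 then show ?thesis using moved_degrees[OF c, of "{i \<in> I. i < k}"] by simp
 qed
 have sm: "simp_mat R (moved t b) (moved t c) = isign (int (card {u \<in> moved t c. u < k}))"
 unfolding k(2) using k(1) by (simp only: simp_mat_remove orientation_sign_neg_pow neg_pow_isign)
 have bs: "block_sign c = isign (\<Sum>i\<in>{i \<in> I. i < k}. bz i (t i)) \<otimes> block_sign b"
 unfolding block_sign_def k(2) using I k(1) by (subst sum.remove[of _ k]) (auto simp: isign_add)
 let ?a = "\<Sum>i\<in>{i \<in> I. i < k}. bz i (t i)" and ?n = "int (card {u \<in> moved t c. u < k})"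
 and ?e = "\<Sum>k\<in>moved t b. \<Sum>i\<in>{i \<in> I. i < k}. bz i (t i)"
 have e: "block_sign b = isign ?e" by (rule block_sign_def)
 have "isign (?a + ?n) \<otimes> (isign ?a \<otimes> isign ?e) = isign (?a + ?n + (?a + ?e))" by (simp only: isign_add)
 also have "\<dots> = isign (?e + ?n)" by (rule isign_cong) simp
 finally show ?thesis unfolding tm mm deg sm bs e isign_add[of ?e] by simp
next
 case False
 have "tm b c = \<zero>"
 proof (rule ccontr)
 assume "tm b c ~= \<zero>"
 then obtain k where k: "k \<in> I" "(b k, c k) \<in> G k" "!!i. i \<in> I ==> i ~= k ==> b i = c i"
  using differential_arrow[OF P] by metis
 have "b k = t k" using moved_iff(1)[OF b k(1)] k(1,2) matching_facts(4)[OF k(1)] by blast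
 moreover have "b k ~= c k" by (rule matching_facts(7)[OF k(1,2)])
 moreover have "i \<in> moved t b \<longleftrightarrow> i \<in> moved t c & i ~= k" for i
  using k(3)[of i] \<open>b k = t k\<close> by (cases "i = k") auto
 ultimately have "k \<in> moved t c" "moved t b = moved t c - {k}" using k(1) by auto
 then show False using False by blast
 qed
 moreover have "simp_mat R (moved t b) (moved t c) = \<zero>"
 using False simp_mat_nonzero[of R "moved t b" "moved t c"] by blast
 ultimately show ?thesis by (simp add: block_sign_def)
qed
qed

lemma block_base_change:
"EX V W. base_change R blk tz tm block_complex (%\<tau>. int (card \<tau>) + tz t) (simp_mat R) V W"
proof -
have "base_change R blk tz tm block_complex (%\<tau>. int (card \<tau>) + tz t) (simp_mat R)
 (%b \<tau>. if moved t b = \<tau> then block_sign b else \<zero>) (%\<tau> b. if moved t b = \<tau> then block_sign b else \<zero>)"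
proof (rule base_change_relabel[OF _ moved_bij mcomplex_mat[OF simplicial_mcomplex[OF block_complex]]])
 show "mcomplex R blk tz tm" by (rule block_mcomplex[OF blocks])
 show "tm b c \<otimes> block_sign c = block_sign b \<otimes> simp_mat R (moved t b) (moved t c)"
 if "b \<in> blk" "c \<in> blk" for b c by (rule block_differential[OF that])
qed (simp_all add: block_sign_def block_degree)
then show ?thesis by blast
qed

lemma block_cone:
assumes "t \<notin> PiE I (%i. core (B i) (BA i) (G i))"
shows "carrier (homology R block_complex d) = {\<zero>\<^bsub>homology R block_complex d\<^esub>}"
 and "carrier (cohomology R block_complex d) = {\<zero>\<^bsub>cohomology R block_complex d\<^esub>}"
proof -
obtain k where k: "k \<in> I" "t k \<notin> core (B k) (BA k) (G k)"
 using assms t by (auto simp: PiE_iff)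
have dom: "t k \<in> Domain (G k)" using k t_mem[OF k(1)] by (auto simp: core_def Field_def)
have tk: "t k \<notin> BA k | mate (G k) (t k) \<in> BA k"
 using k(2) mate_t[OF k(1) dom] by (auto simp: core_def)
have "insert k \<tau> \<in> block_complex" if \<tau>: "\<tau> \<in> block_complex" for \<tau>
proof -
 have "{i \<in> I. t i \<notin> BA i} \<union> {i \<in> insert k \<tau>. mate (G i) (t i) \<notin> BA i} =
 {i \<in> I. t i \<notin> BA i} \<union> {i \<in> \<tau>. mate (G i) (t i) \<notin> BA i}" using tk k(1) by blast
 then show ?thesis using \<tau> k(1) dom by (auto simp: matched_complex_def)
qed
then show "carrier (homology R block_complex d) = {\<zero>\<^bsub>homology R block_complex d\<^esub>}"
 "carrier (cohomology R block_complex d) = {\<zero>\<^bsub>cohomology R block_complex d\<^esub>}"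
 using cone_trivial[OF block_complex] by blast+
qed

lemma block_link:
assumes tc: "t \<in> PiE I (%i. core (B i) (BA i) (G i))"
shows "block_complex = link_restriction K (core_index I BA G t)"
proof -
have "mate (G i) (t i) \<notin> BA i" if i: "i \<in> I" "t i \<in> Domain (G i)" for i
proof -
 have "t i \<in> core (B i) (BA i) (G i)" using tc i by auto
 then obtain q where "(t i, q) \<in> G i" "q \<notin> BA i" using i(2) by (auto simp: core_def Field_def)
 then show ?thesis using mate_eq[OF matching_facts(1)[OF i(1)]] by simp
qed
then have "{i \<in> \<tau>. mate (G i) (t i) \<notin> BA i} = \<tau>" if "\<tau> <= {i \<in> I. t i \<in> Domain (G i)}" for \<tau>
 using that by blast
then show ?thesis unfolding matched_complex_def link_restriction_def core_index_def by (simp cong: conj_cong)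
qed

end

lemma core_subset_reps: "PiE I (%i. core (B i) (BA i) (G i)) <= reps"
proof (rule PiE_mono)
fix i assume i: "i \<in> I"
show "core (B i) (BA i) (G i) <= B i - Range (G i)"
 using BAB[OF i] matching_facts(4)[OF i] by (auto simp: core_def Field_def)
qed

lemma core_reindex:
assumes "!!t. t \<in> reps ==> module R (N t)"
 "!!t. t \<in> reps ==> t \<notin> PiE I (%i. core (B i) (BA i) (G i)) ==> carrier (N t) = {\<zero>\<^bsub>N t\<^esub>}"
 "!!t. t \<in> PiE I (%i. core (B i) (BA i) (G i)) ==> N t = L t"
shows "mod_isomorphic R (direct_sum reps N) (direct_sum (PiE I (%i. core (B i) (BA i) (G i))) L)"
proof (rule direct_sum_reindex[OF is_cring, where \<phi> = "%t. t"])
let ?core = "PiE I (%i. core (B i) (BA i) (G i))"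
have tr: "t \<in> reps" if "t \<in> ?core" for t by (rule subsetD[OF core_subset_reps that])
show "module R (N t)" if "t \<in> reps" for t by (rule assms(1)[OF that])
show "module R (L t)" if "t \<in> ?core" for t
 unfolding assms(3)[OF that, symmetric] by (rule assms(1)[OF tr[OF that]])
show "mod_isomorphic R (N t) (L t)" if "t \<in> ?core" for t
 unfolding assms(3)[OF that, symmetric] by (rule mod_isomorphic_refl)
show "carrier (N t) = {\<zero>\<^bsub>N t\<^esub>}" if "t \<in> reps" "t \<notin> (%t. t) ` ?core" for t
 using that by (intro assms(2)) auto
qed (use core_subset_reps in auto)

theorem matching_tensor_homology:
"mod_isomorphic R (mhom R Y tz tm d)
 (direct_sum (PiE I (%i. core (B i) (BA i) (G i))) (%t. complex_homology R K (core_index I BA G t) (d - tz t)))"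
proof -
have "mod_isomorphic R (mhom R Y tz tm d) (direct_sum reps (%t. mhom R (block_part Y rep_tuple t) tz tm d))"
 by (rule block_decomposition[OF blocks])
also have "mod_isomorphic R \<dots> (direct_sum reps (%t. homology R (matched_complex I K BA G t) (d - tz t - 1)))"
proof (rule direct_sum_cong[OF is_cring])
 fix t assume t: "t \<in> reps"
 have bm: "mcomplex R (block_part Y rep_tuple t) tz tm" by (rule block_mcomplex[OF blocks])
 show "module R (mhom R (block_part Y rep_tuple t) tz tm d)" by (rule mhom_module[OF bm])
 show "module R (homology R (matched_complex I K BA G t) (d - tz t - 1))" by (rule homology_module[OF block_complex[OF t]])
 obtain V W where bc: "base_change R (block_part Y rep_tuple t) tz tm (matched_complex I K BA G t)
 (%\<tau>. int (card \<tau>) + tz t) (simp_mat R) V W" using block_base_change[OF t] by blast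
 have "mcomplex R (matched_complex I K BA G t) (%\<tau>. int (card \<tau>) + tz t) (simp_mat R)"
 using simplicial_mcomplex[OF block_complex[OF t]] by (simp add: mcomplex_def)
 from base_change_iso[OF bm bc this, of d]
 show "mod_isomorphic R (mhom R (block_part Y rep_tuple t) tz tm d) (homology R (matched_complex I K BA G t) (d - tz t - 1))"
 by (simp add: mhom_shift homology_mhom[OF block_complex[OF t]])
qed
also have "mod_isomorphic R \<dots> (direct_sum (PiE I (%i. core (B i) (BA i) (G i)))
 (%t. complex_homology R K (core_index I BA G t) (d - tz t)))"
proof (rule core_reindex)
 fix t assume "t \<in> PiE I (%i. core (B i) (BA i) (G i))"
 then show "homology R (matched_complex I K BA G t) (d - tz t - 1) = complex_homology R K (core_index I BA G t) (d - tz t)"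
 by (simp only: complex_homology_def suspension_def block_link[OF subsetD[OF core_subset_reps]])
qed (rule homology_module[OF block_complex] block_cone(1), assumption+)+
finally show ?thesis .
qed

theorem matching_tensor_cohomology:
"mod_isomorphic R (mhom R Y (%b. - tz b) (%b c. tm c b) (- d))
 (direct_sum (PiE I (%i. core (B i) (BA i) (G i))) (%t. complex_cohomology R K (core_index I BA G t) (d - tz t)))"
proof -
note CT = mcomplex_transpose[OF C]
have off: "rep_tuple b = rep_tuple c" if "b \<in> Y" "c \<in> Y" "tm c b ~= \<zero>" for b c
 using differential_block[OF that(2,1,3)] by simp
have "mod_isomorphic R (mhom R Y (%b. - tz b) (%b c. tm c b) (- d))
 (direct_sum reps (%t. mhom R (block_part Y rep_tuple t) (%b. - tz b) (%b c. tm c b) (- d)))"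
 by (rule block_decomposition[OF CT finite_reps rep_tuple_mem off])
also have "mod_isomorphic R \<dots> (direct_sum reps (%t. cohomology R (matched_complex I K BA G t) (d - tz t - 1)))"
proof (rule direct_sum_cong[OF is_cring])
 fix t assume t: "t \<in> reps"
 have bm: "mcomplex R (block_part Y rep_tuple t) tz tm" by (rule block_mcomplex[OF blocks])
 note bmt = mcomplex_transpose[OF bm]
 show "module R (mhom R (block_part Y rep_tuple t) (%b. - tz b) (%b c. tm c b) (- d))" by (rule mhom_module[OF bmt])
 show "module R (cohomology R (matched_complex I K BA G t) (d - tz t - 1))" by (rule cohomology_module[OF block_complex[OF t]])
 obtain V W where bc: "base_change R (block_part Y rep_tuple t) tz tm (matched_complex I K BA G t)
 (%\<tau>. int (card \<tau>) + tz t) (simp_mat R) V W" using block_base_change[OF t] by blast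
 have E: "mcomplex R (matched_complex I K BA G t) (%\<tau>. int (card \<tau>) + tz t) (simp_mat R)"
 using simplicial_mcomplex[OF block_complex[OF t]] by (simp add: mcomplex_def)
 have neg: "(%\<tau>. - (int (card \<tau>) + tz t)) = (%\<tau>. - int (card \<tau>) + - tz t)" for \<tau> by auto
 have e: "- d - (- tz t) = - (d - tz t - 1) - 1" by simp
 have "mhom R (matched_complex I K BA G t) (%\<tau>. - (int (card \<tau>) + tz t)) (%\<sigma> \<tau>. simp_mat R \<tau> \<sigma>) (- d) =
 cohomology R (matched_complex I K BA G t) (d - tz t - 1)"
 unfolding cohomology_mhom[OF block_complex[OF t]] neg mhom_shift e ..
 with base_change_iso[OF bmt base_change_transpose[OF bm bc] mcomplex_transpose[OF E], of "- d"]
 show "mod_isomorphic R (mhom R (block_part Y rep_tuple t) (%b. - tz b) (%b c. tm c b) (- d))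
 (cohomology R (matched_complex I K BA G t) (d - tz t - 1))" by simp
qed
also have "mod_isomorphic R \<dots> (direct_sum (PiE I (%i. core (B i) (BA i) (G i)))
 (%t. complex_cohomology R K (core_index I BA G t) (d - tz t)))"
proof (rule core_reindex)
 fix t assume "t \<in> PiE I (%i. core (B i) (BA i) (G i))"
 then show "cohomology R (matched_complex I K BA G t) (d - tz t - 1) = complex_cohomology R K (core_index I BA G t) (d - tz t)"
 by (simp only: complex_cohomology_def suspension_def block_link[OF subsetD[OF core_subset_reps]])
qed (rule cohomology_module[OF block_complex] block_cone(2), assumption+)+
finally show ?thesis .
qed

end

text \<open>
The homology of a polyhedral product, in terms of adapted bases of the pairs.
\<close>

theorem polyhedral_product_homology:
fixes B :: "nat => 'y set"
assumes K: "simplicial_complex {1..m} K"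
 and XA: "!!k. k \<in> {1..m} ==> simplicial_pair (block n k) (X k) (A k)"
 and ad: "!!k. k \<in> {1..m} ==> adapted (X k) (A k) (%\<sigma>. int (card \<sigma>)) (simp_mat R) (B k) (BA k) (G k) (bz k) (V k) (W k)"
shows "mod_isomorphic R (suspension (homology R (polyhedral_product m n K X A)) d)
 (direct_sum (PiE {1..m} (%k. core (B k) (BA k) (G k)))
  (%t. complex_homology R K (core_index {1..m} BA G t) (d - (\<Sum>k\<in>{1..m}. bz k (t k)))))" (is ?hom)
 and "mod_isomorphic R (suspension (cohomology R (polyhedral_product m n K X A)) d)
 (direct_sum (PiE {1..m} (%k. core (B k) (BA k) (G k)))
  (%t. complex_cohomology R K (core_index {1..m} BA G t) (d - (\<Sum>k\<in>{1..m}. bz k (t k)))))" (is ?coh)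
proof -
let ?I = "{1..m}" and ?P = "polyhedral_product m n K X A"
let ?S = "supported_tuples ?I K X A" and ?Y = "supported_tuples ?I K B BA"
let ?sz = "%p. \<Sum>i\<in>?I. int (card (p i))" and ?tz = "%b. \<Sum>i\<in>?I. bz i (b i)"
let ?pm = "tensor_mat ?I (%_ \<sigma>. int (card \<sigma>)) (%_. simp_mat R)" and ?tm = "tensor_mat ?I bz (%i. match_mat (G i))"
have ad': "matching (B i) (bz i) (G i)" "BA i <= B i" "!!p q. (p, q) \<in> G i ==> q \<in> BA i ==> p \<in> BA i"
 if "i \<in> ?I" for i using ad[OF that] unfolding adapted_def by blast+
note PC = simplicial_mcomplex[OF pp_complex[OF K XA]] and bc1 = parts_base_change[OF K XA]
 and SC = parts_mcomplex[OF K XA]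
have XC: "mcomplex R (X i) (%\<sigma>. int (card \<sigma>)) (simp_mat R)" if "i \<in> ?I" for i
 by (rule simplicial_mcomplex[OF pair_complexes(1)[OF K XA that]])
have bc2: "base_change R ?S ?sz ?pm ?Y ?tz ?tm (prod_mat ?I V) (prod_mat ?I W)"
 by (rule tensor_base_change[OF _ complex_closed[OF K] XC ad]) simp
have YC: "mcomplex R ?Y ?tz ?tm"
proof (rule bc_mcomplex[OF SC bc2])
 fix p q assume pq: "p \<in> ?Y" "q \<in> ?Y" "?tm p q ~= \<zero>"
 show "?tz q = ?tz p + 1"
 by (rule tensor_mat_degree[OF _ match_mcomplex[OF ad'(1)] _ _ pq(3)])
  (use pq in \<open>auto simp: supported_tuples_def\<close>)
qed
have "mod_isomorphic R (suspension (homology R ?P) d) (mhom R ?S ?sz ?pm d)"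
 using base_change_iso[OF PC bc1 SC, of d] homology_mhom[OF pp_complex[OF K XA], of "d - 1"]
 by (simp only: suspension_def diff_add_cancel)
also have "mod_isomorphic R \<dots> (mhom R ?Y ?tz ?tm d)" by (rule base_change_iso[OF SC bc2 YC])
also have "mod_isomorphic R \<dots> (direct_sum (PiE ?I (%k. core (B k) (BA k) (G k)))
  (%t. complex_homology R K (core_index ?I BA G t) (d - ?tz t)))"
 by (rule matching_tensor_homology[OF _ K ad' YC]) simp_all
finally show ?hom .
have e: "- (d - 1) - 1 = - d" by simp
have "mod_isomorphic R (suspension (cohomology R ?P) d) (mhom R ?S (%p. - ?sz p) (%p q. ?pm q p) (- d))"
 using base_change_iso[OF mcomplex_transpose[OF PC] base_change_transpose[OF PC bc1] mcomplex_transpose[OF SC], of "- d"]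
 cohomology_mhom[OF pp_complex[OF K XA], of "d - 1"] by (simp only: suspension_def e)
also have "mod_isomorphic R \<dots> (mhom R ?Y (%b. - ?tz b) (%b c. ?tm c b) (- d))"
 by (rule base_change_iso[OF mcomplex_transpose[OF SC] base_change_transpose[OF SC bc2] mcomplex_transpose[OF YC]])
also have "mod_isomorphic R \<dots> (direct_sum (PiE ?I (%k. core (B k) (BA k) (G k)))
  (%t. complex_cohomology R K (core_index ?I BA G t) (d - ?tz t)))"
 by (rule matching_tensor_cohomology[OF _ K ad' YC]) simp_all
finally show ?coh .
qed

end

section \<open>The homology of a pair in terms of an adapted basis\<close>

lemma restrict_iso:
assumes f: "f \<in> mod_iso R M N" and P: "P <= carrier M" and Q: "Q <= carrier N"
 and PQ: "!!x. x \<in> carrier M ==> x \<in> P \<longleftrightarrow> f x \<in> Q"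
shows "f \<in> mod_iso R (restrict_mod M P) (restrict_mod N Q)"
proof (rule mod_isoI)
note h = mod_iso_hom[OF f] and b = mod_iso_bij[OF f]
show "f \<in> mod_hom R (restrict_mod M P) (restrict_mod N Q)"
 by (rule mod_hom_restrict_target[OF mod_hom_restrict_source[OF h P]]) (use P PQ in auto)
have "f ` P = Q"
proof
 show "f ` P <= Q" using P PQ by blast
 show "Q <= f ` P"
 proof
 fix y assume y: "y \<in> Q"
 then obtain x where "x \<in> carrier M" "f x = y" using mod_iso_surjD[OF f] Q by blast
 then show "y \<in> f ` P" using y PQ by blast
 qed
qed
then show "bij_betw f (carrier (restrict_mod M P)) (carrier (restrict_mod N Q))"
 using b P by (auto simp: bij_betw_def intro: inj_on_subset)
qed

lemma free_mod_restrict: "restrict_mod (free_mod R S) (carrier (free_mod R T)) = free_mod R T"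
by (simp add: restrict_mod_def free_mod_def)

lemma free_mod_mono: "S <= T ==> carrier (free_mod R S) <= carrier (free_mod R T)"
by (auto simp: free_mod_def)

context cring begin

lemma projection_hom: "(%c u. if u \<in> V then c u else \<zero>) \<in> mod_hom R (fspace U) (fspace V)"
proof (rule mod_homI)
fix c assume c: "c \<in> carrier (fspace U)"
have "finite {x. c x ~= \<zero>}" using c by (simp add: free_mod_carrier)
then have "finite {x. (if x \<in> V then c x else \<zero>) ~= \<zero>}" by (rule rev_finite_subset) auto
then show "(%u. if u \<in> V then c u else \<zero>) \<in> carrier (fspace V)" using c by (simp add: free_mod_carrier)
qed auto

text \<open>
A homomorphism that in suitable coordinates is the identity on the common coordinates and zero elsewhere
has kernel, image and cokernel with the evident coordinates.
\<close>

lemma coordinate_isomorphisms: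
assumes M: "module R M" and N: "module R N" and h: "h \<in> mod_hom R M N"
 and f1: "f1 \<in> mod_iso R M (fspace U1)" and f2: "f2 \<in> mod_iso R N (fspace U2)"
 and coord: "!!x u. x \<in> carrier M ==> u \<in> U2 ==> f2 (h x) u = (if u \<in> U1 then f1 x u else \<zero>)"
shows "mod_isomorphic R (ker_mod M N h) (fspace (U1 - U2))"
 and "mod_isomorphic R (im_mod M N h) (fspace (U1 \<inter> U2))"
 and "mod_isomorphic R (coker_mod M N h) (fspace (U2 - U1))"
proof -
have f1c: "f1 x \<in> carrier (fspace U1)" if "x \<in> carrier M" for x using mod_hom_closed[OF mod_iso_hom[OF f1] that] .
have f2c: "f2 y \<in> carrier (fspace U2)" if "y \<in> carrier N" for y using mod_hom_closed[OF mod_iso_hom[OF f2] that] .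
have hc: "h x \<in> carrier N" if "x \<in> carrier M" for x using mod_hom_closed[OF h that] .
have f2h: "f2 (h x) = (%u. if u \<in> U1 \<inter> U2 then f1 x u else \<zero>)" if x: "x \<in> carrier M" for x
proof
 fix u show "f2 (h x) u = (if u \<in> U1 \<inter> U2 then f1 x u else \<zero>)"
 using coord[OF x, of u] free_mod_outside[OF f2c[OF hc[OF x]], of u] by (cases "u \<in> U2") auto
qed

have "f1 \<in> mod_iso R (ker_mod M N h) (restrict_mod (fspace U1) (carrier (fspace (U1 - U2))))"
 unfolding ker_mod_def
proof (rule restrict_iso[OF f1])
 show "a_kernel M N h <= carrier M" by (auto simp: a_kernel_def')
 show "carrier (fspace (U1 - U2)) <= carrier (fspace U1)" by (rule free_mod_mono) auto
 fix x assume x: "x \<in> carrier M"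
 have "x \<in> a_kernel M N h \<longleftrightarrow> f2 (h x) = (%_. \<zero>)"
 using x mod_iso_zero_iff[OF N fspace_module f2 hc[OF x]] by (simp add: a_kernel_def')
 also have "\<dots> \<longleftrightarrow> (ALL u:U1 \<inter> U2. f1 x u = \<zero>)" unfolding f2h[OF x] by (auto simp: fun_eq_iff)
 also have "\<dots> \<longleftrightarrow> f1 x \<in> carrier (fspace (U1 - U2))"
 using f1c[OF x] by (auto simp: free_mod_carrier)
 finally show "x \<in> a_kernel M N h \<longleftrightarrow> f1 x \<in> carrier (fspace (U1 - U2))" .
qed
then show "mod_isomorphic R (ker_mod M N h) (fspace (U1 - U2))"
 unfolding free_mod_restrict by (rule mod_isomorphicI)
have img: "y \<in> h ` carrier M \<longleftrightarrow> (ALL u. u \<notin> U1 \<inter> U2 --> f2 y u = \<zero>)" if y: "y \<in> carrier N" for y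
proof
 assume "y \<in> h ` carrier M"
 then show "ALL u. u \<notin> U1 \<inter> U2 --> f2 y u = \<zero>" using f2h by auto
next
 assume z: "ALL u. u \<notin> U1 \<inter> U2 --> f2 y u = \<zero>"
 then have "f2 y \<in> carrier (fspace U1)" using f2c[OF y] by (auto simp: free_mod_carrier)
 then obtain x where x: "x \<in> carrier M" "f1 x = f2 y" using mod_iso_surjD[OF f1] by blast
 have "f2 (h x) = f2 y" unfolding f2h[OF x(1)] x(2) using z by auto
 then have "h x = y" using mod_iso_bij[OF f2] hc[OF x(1)] y by (auto simp: bij_betw_def inj_on_def)
 then show "y \<in> h ` carrier M" using x(1) by blast
qed
have "f2 \<in> mod_iso R (im_mod M N h) (restrict_mod (fspace U2) (carrier (fspace (U1 \<inter> U2))))"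
 unfolding im_mod_def
proof (rule restrict_iso[OF f2])
 show "h ` carrier M <= carrier N" using hc by blast
 show "carrier (fspace (U1 \<inter> U2)) <= carrier (fspace U2)" by (rule free_mod_mono) auto
 show "y \<in> h ` carrier M \<longleftrightarrow> f2 y \<in> carrier (fspace (U1 \<inter> U2))" if "y \<in> carrier N" for y
 unfolding img[OF that] using f2c[OF that] by (auto simp: free_mod_carrier)
qed
then show "mod_isomorphic R (im_mod M N h) (fspace (U1 \<inter> U2))"
 unfolding free_mod_restrict by (rule mod_isomorphicI)
show "mod_isomorphic R (coker_mod M N h) (fspace (U2 - U1))"
 unfolding coker_mod_def
proof (rule quot_mod_isomorphic[OF N submodule_image[OF M N h submodule_self[OF M]] fspace_module
  mod_hom_compose[OF mod_iso_hom[OF f2] projection_hom]])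
 fix y assume y: "y \<in> carrier N"
 have "(ALL u. u \<in> U2 - U1 --> f2 y u = \<zero>) \<longleftrightarrow> (ALL u. u \<notin> U1 \<inter> U2 --> f2 y u = \<zero>)"
 using free_mod_outside[OF f2c[OF y]] by blast
 then show "(%u. if u \<in> U2 - U1 then f2 y u else \<zero>) = \<zero>\<^bsub>fspace (U2 - U1)\<^esub> \<longleftrightarrow> y \<in> h ` carrier M"
 unfolding img[OF y] by (simp add: fun_eq_iff)
next
 fix c assume c: "c \<in> carrier (fspace (U2 - U1))"
 then have "c \<in> carrier (fspace U2)" using free_mod_mono[of "U2 - U1" U2] by blast
 then obtain y where y: "y \<in> carrier N" "f2 y = c" using mod_iso_surjD[OF f2] by blast
 moreover have "(%u. if u \<in> U2 - U1 then c u else \<zero>) = c" using free_mod_outside[OF c] by auto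
 ultimately show "EX y:carrier N. (%u. if u \<in> U2 - U1 then f2 y u else \<zero>) = c" by blast
qed
qed

lemma finsum_subset:
assumes "finite S" "T <= S" "!!s. s \<in> S ==> f s \<in> carrier R" "!!s. s \<in> S ==> s \<notin> T ==> f s = \<zero>"
shows "(\<Oplus>s\<in>T. f s) = (\<Oplus>s\<in>S. f s)"
by (rule add.finprod_mono_neutral_cong_left) (use assms in auto)

end

lemma set_parts:
assumes "Kp \<inter> (B - F) = {}" "BA <= B"
shows "{u \<in> (BA - F) \<union> Kp. P u} - {u \<in> B - F. P u} = {u \<in> Kp. P u}"
 and "{u \<in> (BA - F) \<union> Kp. P u} \<inter> {u \<in> B - F. P u} = {u \<in> BA - F. P u}"
 and "{u \<in> B - F. P u} - {u \<in> (BA - F) \<union> Kp. P u} = {u \<in> (B - F) - BA. P u}"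
using assms by blast+

definition ker_part :: "'y set => ('y \<times> 'y) set => 'y set"
where "ker_part BA G = {p \<in> BA. EX q. (p, q) \<in> G & q \<notin> BA}"

context pid begin

context
fixes S T :: "'x set" and sz D and B BA :: "'y set" and G bz V W
assumes C: "mcomplex R S sz D" and TS: "T <= S" and sub: "ALL s:S. ALL t:T. D s t ~= \<zero> --> s \<in> T"
 and ad: "adapted S T sz D B BA G bz V W"
begin

abbreviation "GA \<equiv> G \<inter> BA \<times> BA"

lemma ad_facts:
shows "base_change R S sz D B bz (match_mat G) V W" and "matching B bz G" and "BA <= B"
 and "(p, q) \<in> G ==> q \<in> BA ==> p \<in> BA"
 "s \<in> S ==> b \<in> BA ==> s \<notin> T ==> V s b = \<zero>" "s \<in> T ==> b \<in> B ==> b \<notin> BA ==> W b s = \<zero>"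
using ad unfolding adapted_def by blast+

lemma ad_mats: "s \<in> S ==> b \<in> B ==> V s b \<in> carrier R" "s \<in> S ==> b \<in> B ==> W b s \<in> carrier R"
 "finite S" "finite B" "s \<in> S ==> t \<in> S ==> D s t \<in> carrier R"
using ad_facts(1) mcomplex_mat[OF C] by (auto simp: base_change_def is_mat_def)

lemma sub_matching: "matching BA bz GA"
using ad_facts(2,3) finite_subset[OF ad_facts(3) ad_mats(4)]
by (auto simp: matching_def single_valued_def)

lemma sub_base_change: "base_change R T sz D BA bz (match_mat GA) V W"
proof -
have TSs: "s \<in> S" if "s \<in> T" for s using TS that by blast
have BB: "b \<in> B" if "b \<in> BA" for b using ad_facts(3) that by blast
have fin: "finite T" "finite BA" using finite_subset[OF TS ad_mats(3)] finite_subset[OF ad_facts(3) ad_mats(4)] by auto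
note bc = ad_facts(1)[unfolded base_change_def]
have VW: "mat_mul R BA V W s s' = delta R s s'" if s: "s \<in> T" "s' \<in> T" for s s'
proof -
 have "mat_mul R BA V W s s' = mat_mul R B V W s s'" unfolding mat_mul_def
 by (rule finsum_subset[OF ad_mats(4) ad_facts(3)]) (simp_all add: ad_mats(1,2) TSs s ad_facts(6))
 then show ?thesis using bc TSs s by auto
qed
have WV: "mat_mul R T W V b c = delta R b c" if b: "b \<in> BA" "c \<in> BA" for b c
proof -
 have "mat_mul R T W V b c = mat_mul R S W V b c" unfolding mat_mul_def
 by (rule finsum_subset[OF ad_mats(3) TS]) (simp_all add: ad_mats(1,2) BB b ad_facts(5))
 then show ?thesis using bc BB b by auto
qed
have DV: "mat_mul R T D V s b = mat_mul R BA V (match_mat GA) s b" if sb: "s \<in> T" "b \<in> BA" for s b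
proof -
 have "mat_mul R T D V s b = mat_mul R S D V s b" unfolding mat_mul_def
 by (rule finsum_subset[OF ad_mats(3) TS]) (simp_all add: ad_mats(1,5) TSs BB sb ad_facts(5))
 also have "\<dots> = mat_mul R B V (match_mat G) s b" using bc TSs BB sb by auto
 also have "\<dots> = (\<Oplus>b'\<in>B. V s b' \<otimes> match_mat GA b' b)"
 proof -
 have "match_mat G b' b = match_mat GA b' b" for b'
  using ad_facts(4)[of b' b] sb(2) by (auto simp: match_mat_def)
 then show ?thesis by (simp add: mat_mul_def)
 qed
 also have "\<dots> = mat_mul R BA V (match_mat GA) s b" unfolding mat_mul_def
 by (rule finsum_subset[OF ad_mats(4) ad_facts(3), symmetric]) (simp_all add: ad_mats(1) TSs sb match_mat_def)
 finally show ?thesis .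
qed
have deg: "sz s = bz b" if "s \<in> T" "b \<in> BA" "V s b ~= \<zero> | W b s ~= \<zero>" for s b
 using bc TSs[OF that(1)] BB[OF that(2)] that(3) by blast
show ?thesis unfolding base_change_def
 by (intro conjI ballI impI VW WV DV deg) (use fin in \<open>auto simp: is_mat_def TSs BB ad_mats match_mat_def\<close>)
qed

lemma sub_unmatched: "u \<in> BA ==> u \<notin> Field GA \<longleftrightarrow> u \<notin> Field G | u \<in> ker_part BA G"
proof -
assume u: "u \<in> BA"
have sv: "q = q'" if "(u, q) \<in> G" "(u, q') \<in> G" for q q'
 using ad_facts(2) that unfolding matching_def single_valued_def by blast
have dr: "(p, u) \<notin> G" if "(u, q) \<in> G" for p q using ad_facts(2) that unfolding matching_def by blast
show ?thesis
proof
 assume n: "u \<notin> Field GA"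
 have "(p, u) \<notin> G" for p using n u ad_facts(4)[of p u] by (auto simp: Field_def)
 then show "u \<notin> Field G | u \<in> ker_part BA G" using n u by (auto simp: Field_def ker_part_def)
next
 assume "u \<notin> Field G | u \<in> ker_part BA G"
 then show "u \<notin> Field GA" using sv dr by (fastforce simp: Field_def ker_part_def)
qed
qed

lemma ker_part_facts: "u \<in> ker_part BA G ==> u \<in> BA & u \<in> Field G"
by (auto simp: ker_part_def Field_def)

lemma part_sets:
"{u \<in> BA - Field GA. P u} - {u \<in> B - Field G. P u} = {u \<in> ker_part BA G. P u}"
"{u \<in> BA - Field GA. P u} \<inter> {u \<in> B - Field G. P u} = {u \<in> BA - Field G. P u}"
"{u \<in> B - Field G. P u} - {u \<in> BA - Field GA. P u} = {u \<in> (B - Field G) - BA. P u}"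
proof -
have e: "BA - Field GA = (BA - Field G) \<union> ker_part BA G"
proof (rule Set.set_eqI)
 fix u show "u \<in> BA - Field GA \<longleftrightarrow> u \<in> (BA - Field G) \<union> ker_part BA G"
 using sub_unmatched[of u] ker_part_facts[of u] by auto
qed
have k: "ker_part BA G \<inter> (B - Field G) = {}" using ker_part_facts by blast
show "{u \<in> BA - Field GA. P u} - {u \<in> B - Field G. P u} = {u \<in> ker_part BA G. P u}"
 "{u \<in> BA - Field GA. P u} \<inter> {u \<in> B - Field G. P u} = {u \<in> BA - Field G. P u}"
 "{u \<in> B - Field G. P u} - {u \<in> BA - Field GA. P u} = {u \<in> (B - Field G) - BA. P u}"
 unfolding e by (rule set_parts[OF k ad_facts(3)])+
qed

theorem pair_homology_parts:
defines "h d \<equiv> quot_map (mchains R S sz d) (mbounds R S sz D d) (%c. c)"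
shows "mod_isomorphic R (ker_mod (mhom R T sz D d) (mhom R S sz D d) (h d)) (fspace {u \<in> ker_part BA G. bz u = d})" (is ?k)
 and "mod_isomorphic R (im_mod (mhom R T sz D d) (mhom R S sz D d) (h d)) (fspace {u \<in> BA - Field G. bz u = d})" (is ?i)
 and "mod_isomorphic R (coker_mod (mhom R T sz D d) (mhom R S sz D d) (h d)) (fspace {u \<in> (B - Field G) - BA. bz u = d})" (is ?c)
proof -
note CT = sub_mcomplex[OF C TS sub]
let ?U1 = "{u \<in> BA - Field GA. bz u = d}" and ?U2 = "{u \<in> B - Field G. bz u = d}"
obtain f1 where f1: "f1 \<in> mod_iso R (mhom R T sz D d) (fspace ?U1)"
 "!!c. c \<in> mcycles R T sz D d ==> f1 (mbounds R T sz D d +>\<^bsub>mchains R T sz d\<^esub> c) = class_coord T bz BA GA W d c"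
 by (rule matching_homology[OF CT sub_matching sub_base_change, where d = d]) (rule that)
obtain f2 where f2: "f2 \<in> mod_iso R (mhom R S sz D d) (fspace ?U2)"
 "!!c. c \<in> mcycles R S sz D d ==> f2 (mbounds R S sz D d +>\<^bsub>mchains R S sz d\<^esub> c) = class_coord S bz B G W d c"
 by (rule matching_homology[OF C ad_facts(2,1), where d = d]) (rule that)
have "f2 (h d x) u = (if u \<in> ?U1 then f1 x u else \<zero>)" if x: "x \<in> carrier (mhom R T sz D d)" and u: "u \<in> ?U2" for x u
proof -
 obtain c where c: "c \<in> mcycles R T sz D d" "x = mcls R T sz D d c" using x unfolding mhom_carrier by blast
 have cS: "c \<in> mcycles R S sz D d" and cT: "c \<in> carrier (mchains R T sz d)"
 using c(1) sub_cycles_iff[OF C TS sub] by blast+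
 have cR: "c s \<in> carrier R" for s using cT unfolding mchains_def by (rule free_mod_closed)
 have c0: "c s = \<zero>" if "s \<notin> T" for s using cT sub_chains_iff[OF C TS sub] that by blast
 have "h d x = mcls R S sz D d c" unfolding h_def c(2) by (rule incl_class[OF C TS sub c(1)])
 then have "f2 (h d x) u = (\<Oplus>s\<in>S. W u s \<otimes> c s)"
 using f2(2)[OF cS] u by (simp add: mcls_def class_coord_def)
 also have "\<dots> = (\<Oplus>s\<in>T. W u s \<otimes> c s)"
 by (rule finsum_subset[OF ad_mats(3) TS, symmetric]) (use u in \<open>simp_all add: ad_mats(2) cR c0\<close>)
 also have "\<dots> = (if u \<in> ?U1 then f1 x u else \<zero>)"
 proof (cases "u \<in> ?U1")
 case True
 then show ?thesis using f1(2)[OF c(1)] by (simp add: c(2) mcls_def class_coord_def)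
 next
 case False
 then have "u \<notin> BA" using u sub_unmatched by blast
 then have "(\<Oplus>s\<in>T. W u s \<otimes> c s) = \<zero>" using u ad_facts(6)[of _ u] cR by (intro add.finprod_one_eqI) simp
 then show ?thesis unfolding if_not_P[OF False] .
 qed
 finally show ?thesis .
qed
note * = coordinate_isomorphisms[OF mhom_module[OF CT] mhom_module[OF C] incl_mod_hom[OF C TS sub, folded h_def] f1(1) f2(1) this]
show ?k using *(1) unfolding part_sets .
show ?i using *(2) unfolding part_sets .
show ?c using *(3) unfolding part_sets .
qed

lemma restrict_cochain:
assumes c: "!!s. s \<in> S ==> c s \<in> carrier R"
shows "mat_app R T T (%s t. D t s) (%s. if s \<in> T then c s else \<zero>) =
 (%s. if s \<in> T then mat_app R S S (%s t. D t s) c s else \<zero>)"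
proof
fix t
have "(\<Oplus>s\<in>T. D s t \<otimes> (if s \<in> T then c s else \<zero>)) = (\<Oplus>s\<in>S. D s t \<otimes> c s)" if t: "t \<in> T"
proof -
 have tS: "t \<in> S" using TS t by blast
 have "(\<Oplus>s\<in>T. D s t \<otimes> (if s \<in> T then c s else \<zero>)) = (\<Oplus>s\<in>T. D s t \<otimes> c s)"
 by (rule finsum_cong'[OF refl]) (use TS tS c ad_mats(5) in auto)
 also have "\<dots> = (\<Oplus>s\<in>S. D s t \<otimes> c s)"
 proof (rule finsum_subset[OF ad_mats(3) TS])
 show "D s t \<otimes> c s \<in> carrier R" if "s \<in> S" for s using ad_mats(5)[OF that tS] c[OF that] by simp
 show "D s t \<otimes> c s = \<zero>" if "s \<in> S" "s \<notin> T" for s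
 proof -
  have "D s t = \<zero>" using sub that t by blast
  then show ?thesis using c[OF that(1)] by simp
 qed
 qed
 finally show ?thesis .
qed
then show "mat_app R T T (%s t. D t s) (%s. if s \<in> T then c s else \<zero>) t =
 (if t \<in> T then mat_app R S S (%s t. D t s) c t else \<zero>)"
 using TS by (auto simp: mat_app_def)
qed

theorem pair_cohomology_parts:
fixes d :: int
defines "E \<equiv> %s t. D t s" and "nz \<equiv> %s. - sz s"
defines "h \<equiv> quot_map (mchains R T nz d) (mbounds R T nz E d) (%c s. if s \<in> T then c s else \<zero>)"
shows "mod_isomorphic R (ker_mod (mhom R S nz E d) (mhom R T nz E d) h) (fspace {u \<in> (B - Field G) - BA. - bz u = d})" (is ?k)
 and "mod_isomorphic R (im_mod (mhom R S nz E d) (mhom R T nz E d) h) (fspace {u \<in> BA - Field G. - bz u = d})" (is ?i)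
 and "mod_isomorphic R (coker_mod (mhom R S nz E d) (mhom R T nz E d) h) (fspace {u \<in> ker_part BA G. - bz u = d})" (is ?c)
 and "h \<in> mod_hom R (mhom R S nz E d) (mhom R T nz E d)"
proof -
note CT0 = sub_mcomplex[OF C TS sub]
have CS: "mcomplex R S nz E" and CT: "mcomplex R T nz E"
 using mcomplex_transpose[OF C] mcomplex_transpose[OF CT0] by (simp_all add: nz_def E_def)
have bcS: "base_change R S nz E B (%t. - bz t) (match_mat (G\<inverse>)) (%s t. W t s) (%t s. V s t)"
 using base_change_transpose[OF C ad_facts(1)] by (simp add: nz_def E_def match_mat_transpose)
have bcT: "base_change R T nz E BA (%t. - bz t) (match_mat (GA\<inverse>)) (%s t. W t s) (%t s. V s t)"
 using base_change_transpose[OF CT0 sub_base_change] unfolding nz_def E_def match_mat_transpose .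
note mS = matching_converse[OF ad_facts(2)] and mT = matching_converse[OF sub_matching]
let ?U1 = "{u \<in> B - Field G. - bz u = d}" and ?U2 = "{u \<in> BA - Field GA. - bz u = d}"
obtain f1 where f1: "f1 \<in> mod_iso R (mhom R S nz E d) (fspace ?U1)"
 "!!c. c \<in> mcycles R S nz E d ==> f1 (mbounds R S nz E d +>\<^bsub>mchains R S nz d\<^esub> c) =
 class_coord S (%t. - bz t) B (G\<inverse>) (%t s. V s t) d c"
 by (rule matching_homology[OF CS mS bcS, where d = d, unfolded Field_converse]) (rule that)
obtain f2 where f2: "f2 \<in> mod_iso R (mhom R T nz E d) (fspace ?U2)"
 "!!c. c \<in> mcycles R T nz E d ==> f2 (mbounds R T nz E d +>\<^bsub>mchains R T nz d\<^esub> c) =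
 class_coord T (%t. - bz t) BA (GA\<inverse>) (%t s. V s t) d c"
 by (rule matching_homology[OF CT mT bcT, where d = d, unfolded Field_converse]) (rule that)
let ?r = "%c s. if s \<in> T then c s else \<zero>"
have finT: "finite T" by (rule finite_subset[OF TS ad_mats(3)])
have chR: "c s \<in> carrier R" if "c \<in> carrier (mchains R S nz e)" for c s e
 using that unfolding mchains_def by (rule free_mod_closed)
have rch: "?r c \<in> carrier (mchains R T nz e)" if "c \<in> carrier (mchains R S nz e)" for c e
 using that TS unfolding mchains_carrier[OF ad_mats(3)] mchains_carrier[OF finT] by auto
have rapp: "mat_app R T T E (?r c) = ?r (mat_app R S S E c)" if "c \<in> carrier (mchains R S nz e)" for c e
 unfolding E_def by (rule restrict_cochain) (rule chR[OF that])
have rhom: "?r \<in> mod_hom R (mchains R S nz d) (mchains R T nz d)"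
 by (rule mod_homI) (simp_all add: rch, auto simp: mchains_def)
have rcyc: "?r c \<in> mcycles R T nz E d" if c: "c \<in> mcycles R S nz E d" for c
proof -
 have c': "c \<in> carrier (mchains R S nz d)" "mat_app R S S E c = (%_. \<zero>)" using c by (auto simp: mcycles_def)
 have "mat_app R T T E (?r c) = (%_. \<zero>)" unfolding rapp[OF c'(1)] c'(2) by simp
 then show ?thesis using rch[OF c'(1)] by (simp add: mcycles_def)
qed
have rbnd: "?r c \<in> mbounds R T nz E d" if c: "c \<in> mbounds R S nz E d" for c
proof -
 obtain e where e: "e \<in> carrier (mchains R S nz (d + 1))" "c = mat_app R S S E e"
 using c by (auto simp: mbounds_def)
 show ?thesis unfolding e(2) rapp[OF e(1), symmetric] mbounds_def by (rule imageI[OF rch[OF e(1)]])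
qed
show hhom: "h \<in> mod_hom R (mhom R S nz E d) (mhom R T nz E d)"
 unfolding h_def by (rule induced_map_hom[OF CS CT rhom]) (erule rcyc, erule rbnd)
have hcls: "h (mcls R S nz E d c) = mcls R T nz E d (?r c)" if "c \<in> mcycles R S nz E d" for c
 unfolding h_def by (rule induced_map_class[OF CS CT rhom]) (erule rcyc, erule rbnd, rule that)
have "f2 (h x) u = (if u \<in> ?U1 then f1 x u else \<zero>)" if x: "x \<in> carrier (mhom R S nz E d)" and u: "u \<in> ?U2" for x u
proof -
 obtain c where c: "c \<in> mcycles R S nz E d" "x = mcls R S nz E d c" using x unfolding mhom_carrier by blast
 have cR: "c s \<in> carrier R" for s using c(1) chR by (auto simp: mcycles_def)
 have uB: "u \<in> BA" "u \<in> B" using u ad_facts(3) by auto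
 have "h x = mcls R T nz E d (?r c)" unfolding c(2) by (rule hcls[OF c(1)])
 then have "f2 (h x) u = (\<Oplus>s\<in>T. V s u \<otimes> ?r c s)"
 using f2(2)[OF rcyc[OF c(1)]] u by (simp add: mcls_def class_coord_def)
 also have "\<dots> = (\<Oplus>s\<in>T. V s u \<otimes> c s)"
 by (rule finsum_cong'[OF refl]) (use TS cR uB ad_mats(1) in auto)
 also have "\<dots> = (\<Oplus>s\<in>S. V s u \<otimes> c s)"
 by (rule finsum_subset[OF ad_mats(3) TS]) (use uB in \<open>simp_all add: ad_mats(1) cR ad_facts(5)\<close>)
 also have "\<dots> = (if u \<in> ?U1 then f1 x u else \<zero>)"
 proof (cases "u \<in> ?U1")
 case True
 then show ?thesis using f1(2)[OF c(1)] by (simp add: c(2) mcls_def class_coord_def)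
 next
 case False
 then have "u \<in> ker_part BA G" using u sub_unmatched ad_facts(3) by blast
 then have "u \<in> Range (G\<inverse>)" by (auto simp: ker_part_def)
 moreover have "mat_app R B S (%t s. V s t) c \<in> mcycles R B (%t. - bz t) (match_mat (G\<inverse>)) d"
  by (rule bc_W_cycles[OF CS bcS c(1)])
 ultimately have "mat_app R B S (%t s. V s t) c u = \<zero>" unfolding match_cycles[OF mS] by blast
 then show ?thesis unfolding if_not_P[OF False] using uB by (simp add: mat_app_def)
 qed
 finally show ?thesis .
qed
note * = coordinate_isomorphisms[OF mhom_module[OF CS] mhom_module[OF CT] hhom f1(1) f2(1) this]
show ?k using *(1) unfolding part_sets .
show ?i using *(2) unfolding part_sets Int_commute[of ?U1] .
show ?c using *(3) unfolding part_sets .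
qed

end

end

section \<open>Tensor products of free graded modules\<close>

context cring begin

definition graded_basis :: "'i set => ('i => 'y set) => ('i => 'y => int) => int => (('i => int) \<times> ('i => 'y)) set"
where "graded_basis I U bz j = Sigma {e \<in> PiE I (%_. UNIV). (\<Sum>k\<in>I. e k) = j} (%e. PiE I (%k. {u \<in> U k. bz k u = e k}))"

lemma graded_basis_iff:
"(e, w) \<in> graded_basis I U bz j \<longleftrightarrow> w \<in> PiE I U & e = (\<lambda>k\<in>I. bz k (w k)) & (\<Sum>k\<in>I. bz k (w k)) = j"
proof
assume "(e, w) \<in> graded_basis I U bz j"
then have e: "e \<in> extensional I" "(\<Sum>k\<in>I. e k) = j" and w: "w \<in> extensional I" "!!k. k \<in> I ==> w k \<in> U k & bz k (w k) = e k"
 by (auto simp: graded_basis_def PiE_iff)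
have e': "e = (\<lambda>k\<in>I. bz k (w k))" using e(1) w(2) by (intro extensionalityI[of _ I]) auto
have s: "(\<Sum>k\<in>I. bz k (w k)) = j" using e(2) w(2) by simp
have "w \<in> PiE I U" using w by (simp add: PiE_iff)
then show "w \<in> PiE I U & e = (\<lambda>k\<in>I. bz k (w k)) & (\<Sum>k\<in>I. bz k (w k)) = j"
 by (intro conjI e' s)
qed (auto simp: graded_basis_def PiE_iff)

lemma finite_graded_basis:
assumes "finite I" "!!k. k \<in> I ==> finite (U k)" shows "finite (graded_basis I U bz j)"
proof (rule finite_subset)
show "graded_basis I U bz j <= (%w. (\<lambda>k\<in>I. bz k (w k), w)) ` PiE I U"
 by (auto simp: graded_basis_iff)
show "finite ((%w. (\<lambda>k\<in>I. bz k (w k), w)) ` PiE I U)" using assms by (intro finite_imageI finite_PiE)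
qed

lemma graded_tensor_family_free:
assumes I: "finite I" and M: "!!k e. k \<in> I ==> module R (P k e)" and U: "!!k. k \<in> I ==> finite (U k)"
 and iso: "!!k e. k \<in> I ==> mod_isomorphic R (P k e) (fspace {u \<in> U k. bz k u = e})"
shows "mod_isomorphic R (graded_tensor_family R I P j) (fspace (graded_basis I U bz j))"
 and "module R (graded_tensor_family R I P j)"
proof -
let ?E = "{e \<in> PiE I (%_. UNIV). (\<Sum>k\<in>I. e k) = j}"
have tm: "module R (tensor_family R I (%k. P k (e k)))" for e
 by (rule tensor_family_module[OF is_cring M])
show "module R (graded_tensor_family R I P j)" unfolding graded_tensor_family_def
 by (rule direct_sum_module[OF is_cring tm])
have tf: "mod_isomorphic R (tensor_family R I (%k. P k (e k))) (fspace (PiE I (%k. {u \<in> U k. bz k u = e k})))"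
 for e
proof -
 have "(SOME f. f \<in> mod_iso R (P k (e k)) (fspace {u \<in> U k. bz k u = e k})) \<in>
  mod_iso R (P k (e k)) (fspace {u \<in> U k. bz k u = e k})" if "k \<in> I" for k
 using iso[OF that, of "e k"] unfolding mod_isomorphic_def by (intro some_in_eq[THEN iffD2])
 then show ?thesis by (intro tensor_family_free[OF is_cring I M]) (use U in auto)
qed
have "mod_isomorphic R (graded_tensor_family R I P j)
 (direct_sum ?E (%e. fspace (PiE I (%k. {u \<in> U k. bz k u = e k}))))"
 unfolding graded_tensor_family_def by (rule direct_sum_cong[OF is_cring tm fspace_module tf])
also have "mod_isomorphic R \<dots> (fspace (graded_basis I U bz j))"
 unfolding graded_basis_def by (rule direct_sum_free[OF is_cring])
finally show "mod_isomorphic R (graded_tensor_family R I P j) (fspace (graded_basis I U bz j))" .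
qed

lemma diagonal_tensor_free:
assumes H: "!!\<alpha> i. \<alpha> \<in> \<Lambda> ==> module R (H \<alpha> i)" and Q: "!!\<alpha> j. \<alpha> \<in> \<Lambda> ==> module R (Q \<alpha> j)"
 and W: "!!\<alpha> j. \<alpha> \<in> \<Lambda> ==> finite (W \<alpha> j)"
 and iso: "!!\<alpha> j. \<alpha> \<in> \<Lambda> ==> mod_isomorphic R (Q \<alpha> j) (fspace (W \<alpha> j))"
shows "mod_isomorphic R (diagonal_tensor R \<Lambda> H Q d)
 (direct_sum (Sigma \<Lambda> (%\<alpha>. Sigma {(i, j). i + j = d} (%(i, j). W \<alpha> j))) (%(\<alpha>, p, w). H \<alpha> (fst p)))"
 and "module R (diagonal_tensor R \<Lambda> H Q d)"
proof -
let ?P = "{(i, j). i + j = d}"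
have tm: "module R (case p of (i, j) => tensor R (H \<alpha> i) (Q \<alpha> j))" if "\<alpha> \<in> \<Lambda>" for \<alpha> p
 using tensor_module[OF is_cring H[OF that] Q[OF that]] by (cases p) simp
have gm: "module R (graded_tensor R (H \<alpha>) (Q \<alpha>) d)" if "\<alpha> \<in> \<Lambda>" for \<alpha>
 unfolding graded_tensor_def by (rule direct_sum_module[OF is_cring tm[OF that]])
show "module R (diagonal_tensor R \<Lambda> H Q d)"
 unfolding diagonal_tensor_def graded_direct_sum_def by (rule direct_sum_module[OF is_cring gm])
have hm: "module R (direct_sum (case p of (i, j) => W \<alpha> j) (%w. H \<alpha> (fst p)))" if "\<alpha> \<in> \<Lambda>" for \<alpha> p
 by (rule direct_sum_module[OF is_cring H[OF that]])
have t: "mod_isomorphic R (case p of (i, j) => tensor R (H \<alpha> i) (Q \<alpha> j))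
 (direct_sum (case p of (i, j) => W \<alpha> j) (%w. H \<alpha> (fst p)))" if a: "\<alpha> \<in> \<Lambda>" for \<alpha> p
proof -
 obtain i j where p: "p = (i, j)" by (cases p)
 obtain f where "f \<in> mod_iso R (Q \<alpha> j) (fspace (W \<alpha> j))" using iso[OF a, of j] by (auto simp: mod_isomorphic_def)
 then show ?thesis unfolding p using tensor_free[OF is_cring H[OF a] Q[OF a] _ W[OF a]] by simp
qed
have g: "mod_isomorphic R (graded_tensor R (H \<alpha>) (Q \<alpha>) d)
 (direct_sum (Sigma ?P (%(i, j). W \<alpha> j)) (%(p, w). H \<alpha> (fst p)))" if a: "\<alpha> \<in> \<Lambda>" for \<alpha>
 unfolding graded_tensor_def
 by (rule mod_isomorphic_trans[OF direct_sum_cong[OF is_cring tm[OF a] hm[OF a] t[OF a]]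
  direct_sum_Sigma[OF is_cring H[OF a]]])
have gm': "module R (direct_sum (Sigma ?P (%(i, j). W \<alpha> j)) (%(p, w). H \<alpha> (fst p)))" if "\<alpha> \<in> \<Lambda>" for \<alpha>
 by (rule direct_sum_module[OF is_cring]) (auto simp: H[OF that] split: prod.splits)
have "mod_isomorphic R (diagonal_tensor R \<Lambda> H Q d)
 (direct_sum \<Lambda> (%\<alpha>. direct_sum (Sigma ?P (%(i, j). W \<alpha> j)) (%(p, w). H \<alpha> (fst p))))"
 unfolding diagonal_tensor_def graded_direct_sum_def by (rule direct_sum_cong[OF is_cring gm gm' g])
also have "mod_isomorphic R \<dots> (direct_sum (Sigma \<Lambda> (%\<alpha>. Sigma ?P (%(i, j). W \<alpha> j))) (%(\<alpha>, q). case q of (p, w) => H \<alpha> (fst p)))"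
 by (rule direct_sum_Sigma[OF is_cring]) (auto simp: H split: prod.splits)
finally show "mod_isomorphic R (diagonal_tensor R \<Lambda> H Q d)
 (direct_sum (Sigma \<Lambda> (%\<alpha>. Sigma ?P (%(i, j). W \<alpha> j))) (%(\<alpha>, p, w). H \<alpha> (fst p)))" .
qed

text \<open>The part of a basis adapted to a pair that belongs to the position \<open>k\<close> of an index.\<close>

definition index_part :: "index => nat => 'y set => 'y set => ('y \<times> 'y) set => 'y set"
where "index_part \<alpha> k B BA G = (if k \<in> fst \<alpha> then (B - Field G) - BA else if k \<in> snd \<alpha> then ker_part BA G else BA - Field G)"

lemma core_index_part:
assumes BA: "!!k. k \<in> I ==> BA k <= B k" and R: "!!k. k \<in> I ==> Domain (G k) \<inter> Range (G k) = {}"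
 and \<alpha>: "fst \<alpha> <= I" "snd \<alpha> <= I" "fst \<alpha> \<inter> snd \<alpha> = {}"
shows "t \<in> PiE I (%k. index_part \<alpha> k (B k) (BA k) (G k)) \<longleftrightarrow>
 t \<in> PiE I (%k. core (B k) (BA k) (G k)) & core_index I BA G t = \<alpha>"
proof -
have p: "x \<in> index_part \<alpha> k (B k) (BA k) (G k) \<longleftrightarrow> x \<in> core (B k) (BA k) (G k) &
 (k \<in> fst \<alpha> \<longleftrightarrow> x \<notin> BA k) & (k \<in> snd \<alpha> \<longleftrightarrow> x \<in> Domain (G k))" if "k \<in> I" for k x
 using BA[OF that] \<alpha>(3) by (auto simp: index_part_def core_def ker_part_def Field_def)
have "core_index I BA G t = \<alpha> \<longleftrightarrow> (ALL k:I. (k \<in> fst \<alpha> \<longleftrightarrow> t k \<notin> BA k) & (k \<in> snd \<alpha> \<longleftrightarrow> t k \<in> Domain (G k)))"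
 using \<alpha>(1,2) by (cases \<alpha>) (auto simp: core_index_def)
then show ?thesis using p by (auto simp: PiE_iff)
qed

theorem diagonal_tensor_core:
assumes H: "!!\<alpha> i. module R (H \<alpha> i)" and \<Lambda>: "\<Lambda> <= index_X m"
 and BA: "!!k. k \<in> {1..m} ==> BA k <= B k" and m: "!!k. k \<in> {1..m} ==> matching (B k) (bz k) (G k)"
 and cov: "!!t. t \<in> PiE {1..m} (%k. core (B k) (BA k) (G k)) ==> core_index {1..m} BA G t \<in> \<Lambda>"
 and M: "!!\<alpha> k e. k \<in> {1..m} ==> module R (P \<alpha> k e)"
 and iso: "!!\<alpha> k e. k \<in> {1..m} ==> mod_isomorphic R (P \<alpha> k e) (fspace {u \<in> index_part \<alpha> k (B k) (BA k) (G k). bz k u = e})"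
 and Q: "!!\<alpha>. Q \<alpha> = graded_tensor_family R {1..m} (P \<alpha>)"
shows "mod_isomorphic R (direct_sum (PiE {1..m} (%k. core (B k) (BA k) (G k)))
 (%t. H (core_index {1..m} BA G t) (d - (\<Sum>k\<in>{1..m}. bz k (t k))))) (diagonal_tensor R \<Lambda> H Q d)"
proof -
let ?I = "{1..m}" and ?part = "%\<alpha> k. index_part \<alpha> k (B k) (BA k) (G k)"
let ?J = "PiE ?I (%k. core (B k) (BA k) (G k))" and ?ci = "core_index ?I BA G" and ?tz = "%t. \<Sum>k\<in>?I. bz k (t k)"
let ?W = "%\<alpha>. graded_basis ?I (?part \<alpha>) bz"
have fin: "finite (?part \<alpha> k)" if "k \<in> ?I" for \<alpha> k
 by (rule finite_subset[of _ "B k"]) (use BA[OF that] m[OF that] in \<open>auto simp: index_part_def ker_part_def matching_def\<close>)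
have free: "mod_isomorphic R (Q \<alpha> j) (fspace (?W \<alpha> j))" "module R (Q \<alpha> j)" for \<alpha> j
 unfolding Q by (rule graded_tensor_family_free[OF _ M fin iso]; simp)+
have fgb: "finite (?W \<alpha> j)" for \<alpha> j by (rule finite_graded_basis) (simp, rule fin)
note diag = diagonal_tensor_free[where H = H and Q = Q and W = ?W and \<Lambda> = \<Lambda> and d = d, OF H free(2) fgb free(1)]
let ?L = "Sigma \<Lambda> (%\<alpha>. Sigma {(i, j). i + j = d} (%(i, j). ?W \<alpha> j))"
let ?\<phi> = "%t. (?ci t, (d - ?tz t, ?tz t), (\<lambda>k\<in>?I. bz k (t k), t))"
have part: "t \<in> PiE ?I (?part \<alpha>) \<longleftrightarrow> t \<in> ?J & ?ci t = \<alpha>" if "\<alpha> \<in> \<Lambda>" for t \<alpha>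
proof (rule core_index_part[OF BA])
 show "Domain (G k) \<inter> Range (G k) = {}" if "k \<in> ?I" for k using m[OF that] by (simp add: matching_def)
 have "\<alpha> \<in> index_X m" by (rule subsetD[OF \<Lambda> that])
 then show "fst \<alpha> <= ?I" "snd \<alpha> <= ?I" "fst \<alpha> \<inter> snd \<alpha> = {}" by (auto simp: index_X_def)
qed
have img: "?\<phi> ` ?J = ?L"
proof
 show "?\<phi> ` ?J <= ?L"
 proof (rule image_subsetI)
 fix t assume t: "t \<in> ?J"
 have "t \<in> PiE ?I (?part (?ci t))" using part[OF cov[OF t]] t by simp
 then show "?\<phi> t \<in> ?L" using cov[OF t] by (simp add: graded_basis_iff)
 qed
 show "?L <= ?\<phi> ` ?J"
 proof
 fix x assume "x \<in> ?L"
 then obtain \<alpha> i j e w where x: "x = (\<alpha>, (i, j), (e, w))" "\<alpha> \<in> \<Lambda>" "i + j = d" "(e, w) \<in> ?W \<alpha> j" by auto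
 have w: "w \<in> PiE ?I (?part \<alpha>)" "e = (\<lambda>k\<in>?I. bz k (w k))" "?tz w = j" using x(4) unfolding graded_basis_iff by auto
 have wJ: "w \<in> ?J" "?ci w = \<alpha>" using part[OF x(2)] w(1) by auto
 have "x = ?\<phi> w" using x(1,3) w(2,3) wJ(2) by simp
 then show "x \<in> ?\<phi> ` ?J" using wJ(1) by (rule image_eqI)
 qed
qed
have "mod_isomorphic R (direct_sum ?L (%(\<alpha>, p, w). H \<alpha> (fst p))) (direct_sum ?J (%t. H (?ci t) (d - ?tz t)))"
proof (rule direct_sum_reindex[OF is_cring, where \<phi> = ?\<phi>])
 show "inj_on ?\<phi> ?J"
 proof (rule inj_onI)
 fix t t' assume "?\<phi> t = ?\<phi> t'"
 then have "snd (snd (snd (?\<phi> t))) = snd (snd (snd (?\<phi> t')))" by (rule arg_cong)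
 then show "t = t'" by (simp only: snd_conv)
 qed
 show "?\<phi> ` ?J <= ?L" using img by (rule equalityD1)
 show "module R (case x of (\<alpha>, p, w) => H \<alpha> (fst p))" for x by (simp add: H split: prod.split)
 show "module R (H (?ci t) (d - ?tz t))" for t by (rule H)
 show "carrier (case x of (\<alpha>, p, w) => H \<alpha> (fst p)) = {\<zero>\<^bsub>case x of (\<alpha>, p, w) => H \<alpha> (fst p)\<^esub>}"
 if "x \<in> ?L" "x \<notin> ?\<phi> ` ?J" for x
 by (rule notE[OF that(2)[unfolded img] that(1)])
 show "mod_isomorphic R (case ?\<phi> t of (\<alpha>, p, w) => H \<alpha> (fst p)) (H (?ci t) (d - ?tz t))" for t
 by (simp add: mod_isomorphic_refl)
qed
from mod_isomorphic_trans[OF diag(1) this] show ?thesis by (rule mod_isomorphic_sym[OF diag(2)])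
qed

end

section \<open>Free modules of finite rank\<close>

context cring begin

lemma free_mod_relabel:
assumes "bij_betw \<phi> S T" "finite S" shows "mod_isomorphic R (fspace T) (fspace S)"
proof -
let ?f = "%c s. if s \<in> S then c (\<phi> s) else \<zero>"
have T: "finite T" "T = \<phi> ` S" "inj_on \<phi> S" using assms by (auto simp: bij_betw_def)
have hom: "?f \<in> mod_hom R (fspace T) (fspace S)"
 by (rule mod_homI) (use assms(2) T(1) in \<open>auto simp: free_mod_carrier_finite\<close>)
have "bij_betw ?f (carrier (fspace T)) (carrier (fspace S))"
proof (rule bij_betw_byWitness[where f' = "%c t. if t \<in> T then c (inv_into S \<phi> t) else \<zero>"])
 show "ALL c:carrier (fspace T). (%t. if t \<in> T then ?f c (inv_into S \<phi> t) else \<zero>) = c"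
 proof (intro ballI ext)
 fix c t assume "c \<in> carrier (fspace T)"
 then show "(if t \<in> T then ?f c (inv_into S \<phi> t) else \<zero>) = c t"
  using free_mod_outside[of c R T t] T(2) by (auto simp: inv_into_into f_inv_into_f)
 qed
 show "ALL c:carrier (fspace S). ?f (%t. if t \<in> T then c (inv_into S \<phi> t) else \<zero>) = c"
 proof (intro ballI ext)
 fix c s assume "c \<in> carrier (fspace S)"
 then show "?f (%t. if t \<in> T then c (inv_into S \<phi> t) else \<zero>) s = c s"
  using free_mod_outside[of c R S s] T(2,3) by auto
 qed
 show "?f ` carrier (fspace T) <= carrier (fspace S)" using mod_hom_closed[OF hom] by blast
 show "(%c t. if t \<in> T then c (inv_into S \<phi> t) else \<zero>) ` carrier (fspace S) <= carrier (fspace T)"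
 using assms(2) T(1) by (auto simp: free_mod_carrier_finite)
qed
then show ?thesis using mod_isomorphicI[OF mod_isoI[OF hom]] by blast
qed

lemma free_mod_rank: "finite S ==> mod_isomorphic R M (fspace S) ==> \<exists>r::nat. mod_isomorphic R M (fspace {..<r})"
proof -
assume S: "finite S" and M: "mod_isomorphic R M (fspace S)"
obtain \<phi> where "bij_betw \<phi> {0..<card S} S" using ex_bij_betw_nat_finite[OF S] by blast
then have "mod_isomorphic R (fspace S) (fspace {..<card S})"
 by (intro free_mod_relabel) (auto simp: atLeast0LessThan)
then show ?thesis using mod_isomorphic_trans[OF M] by blast
qed

lemma mod_basis_iso:
assumes M: "module R M" and B: "mod_basis R M B"
shows "lin_ext R M (%b. b) \<in> mod_iso R (fspace B) M"
proof (rule mod_isoI)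
have BM: "b \<in> carrier M" if "b \<in> B" for b using B that by (auto simp: mod_basis_def)
show hom: "lin_ext R M (%b. b) \<in> mod_hom R (fspace B) M" by (rule lin_ext_hom[OF M BM])
have ex: "\<exists>!c. c \<in> carrier (fspace B) & x = lin_ext R M (%b. b) c" if "x \<in> carrier M" for x
 using B that by (simp add: mod_basis_def lin_ext_def)
show "bij_betw (lin_ext R M (%b. b)) (carrier (fspace B)) (carrier M)"
 unfolding bij_betw_def
proof
 show "inj_on (lin_ext R M (%b. b)) (carrier (fspace B))"
 using ex mod_hom_closed[OF hom] by (intro inj_onI) metis
 show "lin_ext R M (%b. b) ` carrier (fspace B) = carrier M"
 proof
 show "lin_ext R M (%b. b) ` carrier (fspace B) <= carrier M" using mod_hom_closed[OF hom] by blast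
 show "carrier M <= lin_ext R M (%b. b) ` carrier (fspace B)" using ex by blast
 qed
qed
qed

lemma is_free_rank:
assumes M: "module R M" and L: "L \<in> mod_hom R (fspace J) M" and surj: "L ` carrier (fspace J) = carrier M"
 and J: "finite J" and free: "is_free R M" and nontriv: "\<one> ~= \<zero>"
shows "\<exists>r::nat. mod_isomorphic R M (fspace {..<r})"
proof -
obtain B where B: "mod_basis R M B" using free by (auto simp: is_free_def)
obtain \<kappa> where \<kappa>: "\<kappa> \<in> mod_iso R M (fspace B)"
 using mod_iso_inverse[OF fspace_module mod_basis_iso[OF M B]] by blast
let ?g = "%c. \<kappa> (L c)"
have g: "?g \<in> mod_hom R (fspace J) (fspace B)" by (rule mod_hom_compose[OF L mod_iso_hom[OF \<kappa>]])
define B0 where "B0 = (\<Union>j\<in>J. {b. ?g (generator R j) b ~= \<zero>})"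
have gj: "?g (generator R j) \<in> carrier (fspace B)" if "j \<in> J" for j
 by (rule mod_hom_closed[OF g generator_mem[OF is_cring that]])
have fin: "finite B0" unfolding B0_def using J gj by (auto simp: free_mod_carrier)
let ?N = "{c \<in> carrier (fspace J). ?g c \<in> carrier (fspace B0)}"
have sN: "submodule (carrier (fspace (B0 \<inter> B))) R (fspace B)"
proof (rule submodule_criterion[OF fspace_module])
 interpret V: module R "fspace (B0 \<inter> B)" by (rule fspace_module)
 show "carrier (fspace (B0 \<inter> B)) <= carrier (fspace B)" by (auto simp: free_mod_def)
 show "\<zero>\<^bsub>fspace B\<^esub> \<in> carrier (fspace (B0 \<inter> B))" using V.zero_closed by simp
 show "x \<oplus>\<^bsub>fspace B\<^esub> y \<in> carrier (fspace (B0 \<inter> B))"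
 if "x \<in> carrier (fspace (B0 \<inter> B))" "y \<in> carrier (fspace (B0 \<inter> B))" for x y using V.a_closed[OF that] by simp
 show "r \<odot>\<^bsub>fspace B\<^esub> x \<in> carrier (fspace (B0 \<inter> B))"
 if "r \<in> carrier R" "x \<in> carrier (fspace (B0 \<inter> B))" for r x using V.smult_closed[OF that] by simp
qed
have gmem: "c \<in> {c \<in> carrier (fspace J). ?g c \<in> carrier (fspace (B0 \<inter> B))}" if "c \<in> carrier (fspace J)" for c
proof (rule free_mod_span[OF is_cring submodule_vimage[OF fspace_module fspace_module g sN] _ that])
 fix j assume j: "j \<in> J"
 have "?g (generator R j) b = \<zero>" if "b \<notin> B0 \<inter> B" for b
 proof (cases "b \<in> B")
 case True
 then show ?thesis using that j unfolding B0_def by blast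
 next
 case False
 then show ?thesis by (rule free_mod_outside[OF gj[OF j]])
 qed
 then have "?g (generator R j) \<in> carrier (fspace (B0 \<inter> B))"
 using gj[OF j] unfolding free_mod_carrier by blast
 then show "generator R j \<in> {c \<in> carrier (fspace J). ?g c \<in> carrier (fspace (B0 \<inter> B))}"
 using generator_mem[OF is_cring j] by simp
qed
have gB: "?g c \<in> carrier (fspace (B0 \<inter> B))" if "c \<in> carrier (fspace J)" for c using gmem[OF that] by simp
have "B <= B0"
proof
 fix b assume b: "b \<in> B"
 obtain x where x: "x \<in> carrier M" "\<kappa> x = generator R b"
 using mod_iso_surjD[OF \<kappa> generator_mem[OF is_cring b]] by blast
 have "x \<in> L ` carrier (fspace J)" using x(1) surj by simp
 then obtain c where c: "x = L c" "c \<in> carrier (fspace J)" by (rule imageE)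
 have "generator R b \<in> carrier (fspace (B0 \<inter> B))" using gB[OF c(2)] x(2) unfolding c(1) by simp
 then show "b \<in> B0" using free_mod_outside[of "generator R b" R "B0 \<inter> B" b] nontriv by (auto simp: generator_def)
qed
then have "finite B" using fin finite_subset by blast
then show ?thesis by (rule free_mod_rank[OF _ mod_isomorphicI[OF \<kappa>]])
qed

end

context field begin

text \<open>
Over a field a finitely generated module is free: in a minimal generating family no relation can hold,
since it could be solved for one of the generators.
\<close>

lemma vector_space_rank:
assumes M: "module R M" and L: "L \<in> mod_hom R (fspace J) M" and surj: "L ` carrier (fspace J) = carrier M"
 and J: "finite J"
shows "\<exists>r::nat. mod_isomorphic R M (fspace {..<r})"
proof -
define Q where "Q = (%I. I <= J & L ` carrier (fspace I) = carrier M)"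
have "Q J" using surj by (simp add: Q_def)
then obtain I where I: "Q I" and min: "!!I'. Q I' ==> card I \<le> card I'"
 using ex_has_least_nat[of Q J card] by blast
have IJ: "I <= J" and finI: "finite I" using I J finite_subset by (auto simp: Q_def)
have mono: "carrier (fspace I') <= carrier (fspace J)" if "I' <= J" for I' using that by (auto simp: free_mod_def)
have LI: "L \<in> mod_hom R (fspace I) M"
 using mod_hom_restrict_source[OF L mono[OF IJ]] by (auto simp: mod_hom_def free_mod_def)
have ker: "c = (%_. \<zero>)" if c: "c \<in> carrier (fspace I)" "L c = \<zero>\<^bsub>M\<^esub>" for c
proof (rule ccontr)
 assume "c ~= (%_. \<zero>)"
 then obtain j where j: "c j ~= \<zero>" by auto
 have cR: "c i \<in> carrier R" for i by (rule free_mod_closed[OF c(1)])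
 have jI: "j \<in> I" using j free_mod_outside[OF c(1)] by blast
 have u: "c j \<in> Units R" using field_Units cR j by blast
 have gen: "L x \<in> L ` carrier (fspace (I - {j}))" if x: "x \<in> carrier (fspace I)" for x
 proof -
 have xR: "x i \<in> carrier R" for i by (rule free_mod_closed[OF x])
 let ?a = "\<ominus> (x j \<otimes> inv (c j))"
 have a: "?a \<in> carrier R" using xR u by simp
 let ?y = "x \<oplus>\<^bsub>fspace I\<^esub> (?a \<odot>\<^bsub>fspace I\<^esub> c)"
 interpret F: module R "fspace I" by (rule fspace_module)
 interpret M: module R M by (rule M)
 have y: "?y \<in> carrier (fspace I)" by (intro F.a_closed F.smult_closed x a c(1))
 have "?a \<otimes> c j = \<ominus> (x j)" using xR cR u by (simp add: l_minus m_assoc)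
 then have "?y j = \<zero>" using xR by (simp add: r_neg)
 then have y': "?y \<in> carrier (fspace (I - {j}))" using y by (auto simp: free_mod_carrier)
 have "L ?y = L x \<oplus>\<^bsub>M\<^esub> ?a \<odot>\<^bsub>M\<^esub> L c"
  using mod_hom_add[OF LI x F.smult_closed[OF a c(1)]] mod_hom_smult[OF LI a c(1)] by simp
 also have "\<dots> = L x" using c(2) mod_hom_closed[OF LI x] a by simp
 finally show ?thesis using imageI[OF y', of L] by simp
 qed
 have sub: "carrier (fspace (I - {j})) <= carrier (fspace I)" by (auto simp: free_mod_def)
 have "L ` carrier (fspace (I - {j})) = L ` carrier (fspace I)"
 by (rule equalityI[OF image_mono[OF sub] image_subsetI[OF gen]])
 then have "Q (I - {j})" using IJ I by (auto simp: Q_def)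
 then have "card I \<le> card (I - {j})" by (rule min)
 then show False using card_Diff1_less[OF finI jI] by simp
qed
have "inj_on L (carrier (fspace I))"
proof (rule inj_onI)
 fix x y assume xy: "x \<in> carrier (fspace I)" "y \<in> carrier (fspace I)" "L x = L y"
 interpret F: module R "fspace I" by (rule fspace_module)
 interpret M: module R M by (rule M)
 have Lxy: "L x \<in> carrier M" "L y \<in> carrier M" using mod_hom_closed[OF LI] xy(1,2) by blast+
 have "L (x \<ominus>\<^bsub>fspace I\<^esub> y) = L x \<ominus>\<^bsub>M\<^esub> L y" by (rule mod_hom_diff[OF fspace_module M LI xy(1,2)])
 also have "\<dots> = \<zero>\<^bsub>M\<^esub>" using xy(3) Lxy by (simp add: M.r_neg a_minus_def)
 finally have "x \<ominus>\<^bsub>fspace I\<^esub> y = \<zero>\<^bsub>fspace I\<^esub>" using ker[OF F.minus_closed[OF xy(1,2)]] by simp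
 then show "x = y" using abelian_group.diff_eq_zero_iff[OF F.abelian_group_axioms xy(1,2)] by blast
qed
then have "L \<in> mod_iso R (fspace I) M" using I LI by (auto simp: Q_def bij_betw_def intro: mod_isoI)
then have "mod_isomorphic R M (fspace I)" by (intro mod_isomorphic_sym[OF fspace_module] mod_isomorphicI)
then show ?thesis by (rule free_mod_rank[OF finI])
qed

end

lemma field_pid:
assumes "field F" shows "pid F"
proof -
interpret field F by fact
show ?thesis
proof (unfold_locales)
 fix J assume J: "J <= carrier F" "\<zero>\<^bsub>F\<^esub> \<in> J"
 show "EX a:J. ALL x:J. EX r:carrier F. x = r \<otimes>\<^bsub>F\<^esub> a"
 proof (cases "J = {\<zero>\<^bsub>F\<^esub>}")
 case False
 then obtain a where a: "a \<in> J" "a ~= \<zero>\<^bsub>F\<^esub>" using J(2) by blast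
 then have u: "a \<in> Units F" using field_Units J(1) by blast
 have "x = x \<otimes>\<^bsub>F\<^esub> inv\<^bsub>F\<^esub> a \<otimes>\<^bsub>F\<^esub> a & x \<otimes>\<^bsub>F\<^esub> inv\<^bsub>F\<^esub> a \<in> carrier F" if "x \<in> J" for x
  using subsetD[OF J(1) that] u Units_closed[OF u] by (simp add: m_assoc)
 then show ?thesis using a(1) by blast
 qed auto
qed
qed

lemma int_pid: "pid \<Z>"
proof -
interpret domain "\<Z>" by (rule int.domain_axioms)
show ?thesis
proof (unfold_locales)
 fix J :: "int set" assume J0: "\<zero>\<^bsub>\<Z>\<^esub> \<in> J" and add: "!!x y. x \<in> J ==> y \<in> J ==> x \<oplus>\<^bsub>\<Z>\<^esub> y \<in> J"
 and mul: "!!r x. r \<in> carrier \<Z> ==> x \<in> J ==> r \<otimes>\<^bsub>\<Z>\<^esub> x \<in> J"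
 have J0: "0 \<in> J" and add: "!!x y. x \<in> J ==> y \<in> J ==> x + y \<in> J" and mul: "!!r x. x \<in> J ==> r * x \<in> J"
 using J0 add mul by simp_all
 show "EX a:J. ALL x:J. EX r:carrier \<Z>. x = r \<otimes>\<^bsub>\<Z>\<^esub> a"
 proof (cases "J = {0}")
 case True
 then show ?thesis by auto
 next
 case False
 then obtain y where y: "y \<in> J" "y ~= 0" using J0 by blast
 have "int (nat \<bar>y\<bar>) \<in> J & 0 < nat \<bar>y\<bar>" using y mul[OF y(1), of "-1"] by (cases "y > 0") auto
 then obtain k where k: "int k \<in> J" "0 < k" and min: "!!l. int l \<in> J & 0 < l ==> k \<le> l"
  using ex_has_least_nat[of "%k. int k \<in> J & 0 < k" "nat \<bar>y\<bar>" "%k. k"] by auto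
 have "x = (x div int k) * int k" if "x \<in> J" for x
 proof -
  have e: "x mod int k = x + (- (x div int k)) * int k" by (simp add: minus_div_mult_eq_mod[symmetric])
  have m: "x mod int k \<in> J" unfolding e by (rule add[OF that mul[OF k(1)]])
  have "0 \<le> x mod int k" "x mod int k < int k" using k(2) by simp_all
  then have "x mod int k = 0" using min[of "nat (x mod int k)"] m by (cases "x mod int k = 0") auto
  then show ?thesis by auto
 qed
 then show ?thesis using k(1) by auto
 qed
qed
qed

section \<open>Congruence of tensor products and direct sums\<close>

lemma direct_sum_eq: "(!!i. i \<in> I ==> M i = N i) ==> direct_sum I M = direct_sum I N"
proof -
assume eq: "!!i. i \<in> I ==> M i = N i"
have "PiE I (%i. carrier (M i)) = PiE I (%i. carrier (N i))" using eq by (intro PiE_cong) simp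
moreover have "{i \<in> I. f i ~= \<zero>\<^bsub>M i\<^esub>} = {i \<in> I. f i ~= \<zero>\<^bsub>N i\<^esub>}" for f using eq by auto
ultimately show ?thesis using eq unfolding direct_sum_def by (simp cong: restrict_cong)
qed

lemma tensor_family_eq:
assumes eq: "!!k. k \<in> I ==> M k = N k" shows "tensor_family R I M = tensor_family R I N"
proof -
have P: "PiE I (%i. carrier (M i)) = PiE I (%i. carrier (N i))" using eq by (intro PiE_cong) simp
have "multilinear_relations R I M = multilinear_relations R I N"
 unfolding multilinear_relations_def Let_def P
 by (intro arg_cong2[where f = "(\<union>)"] Collect_cong iff_exI) (use eq in auto)
then show ?thesis unfolding tensor_family_def P Let_def by simp
qed

lemma diagonal_tensor_eq:
assumes "!!\<alpha>. \<alpha> \<in> \<Lambda> ==> N \<alpha> = N' \<alpha>" shows "diagonal_tensor R \<Lambda> M N = diagonal_tensor R \<Lambda> M N'"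
unfolding diagonal_tensor_def graded_direct_sum_def by (rule ext, rule direct_sum_eq) (simp add: assms)

lemma pairs_homology_eq:
assumes \<alpha>: "\<alpha> \<in> index_X m"
shows "pairs_homology R m X A \<alpha> =
 indexed_tensor_family R {1..m} (%k. pair_homology R (X k) (A k)) (index_factors m \<alpha>)"
 and "pairs_cohomology R m X A \<alpha> =
 indexed_tensor_family R {1..m} (%k. pair_cohomology R (X k) (A k)) (index_factors m \<alpha>)"
proof -
obtain \<sigma> \<omega> where a: "\<alpha> = (\<sigma>, \<omega>)" by (cases \<alpha>)
have d: "k \<in> \<sigma> ==> k \<notin> \<omega>" for k using \<alpha> by (auto simp: a index_X_def)
show "pairs_homology R m X A \<alpha> =
 indexed_tensor_family R {1..m} (%k. pair_homology R (X k) (A k)) (index_factors m \<alpha>)"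
 unfolding a pairs_homology_def indexed_tensor_family_def graded_tensor_family_def prod.case
 by (intro ext direct_sum_eq tensor_family_eq) (use d in \<open>auto simp: index_factors_apply pair_homology_def\<close>)
show "pairs_cohomology R m X A \<alpha> =
 indexed_tensor_family R {1..m} (%k. pair_cohomology R (X k) (A k)) (index_factors m \<alpha>)"
 unfolding a pairs_cohomology_def indexed_tensor_family_def graded_tensor_family_def prod.case
 by (intro ext direct_sum_eq tensor_family_eq) (use d in \<open>auto simp: index_factors_apply pair_cohomology_def\<close>)
qed

section \<open>Finite generation\<close>

lemma transport_free:
assumes "module R M" "!!x. g (f x) = x" "mod_isomorphic R M N"
shows "mod_isomorphic R (transport_mod f g M) N"
by (rule mod_isomorphic_trans[OF mod_isomorphicI assms(3)]) (rule transport_mod_iso[where f = f, OF assms(1)], rule assms(2))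

context pid begin

lemma lincomb_hom:
assumes Z: "submodule Z R (fspace S)" and B: "basis_of Z B"
shows "lincomb B \<in> mod_hom R (fspace B) (restrict_mod (fspace S) Z)" and "lincomb B ` carrier (fspace B) = Z"
proof -
have finB: "finite B" and BZ: "B <= Z" using B by (auto simp: basis_of_def)
have bR: "b x \<in> carrier R" if "b \<in> B" for b x using submodule_valued[OF Z] BZ that by blast
have cR: "c b \<in> carrier R" if "c \<in> carrier (fspace B)" for c b by (rule free_mod_closed[OF that])
have mem: "lincomb B c \<in> Z" if "c \<in> carrier (fspace B)" for c
 by (rule lincomb_mem[OF Z finB BZ]) (use cR[OF that] in blast)
show "lincomb B \<in> mod_hom R (fspace B) (restrict_mod (fspace S) Z)"
proof (rule mod_homI)
 fix c d assume c: "c \<in> carrier (fspace B)" and d: "d \<in> carrier (fspace B)"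
 have "(\<Oplus>b\<in>B. (c b \<oplus> d b) \<otimes> b x) = (\<Oplus>b\<in>B. c b \<otimes> b x) \<oplus> (\<Oplus>b\<in>B. d b \<otimes> b x)" for x
 proof -
 have "(\<Oplus>b\<in>B. (c b \<oplus> d b) \<otimes> b x) = (\<Oplus>b\<in>B. c b \<otimes> b x \<oplus> d b \<otimes> b x)"
  by (rule finsum_cong'[OF refl]) (use bR cR[OF c] cR[OF d] in \<open>auto simp: l_distr\<close>)
 also have "\<dots> = (\<Oplus>b\<in>B. c b \<otimes> b x) \<oplus> (\<Oplus>b\<in>B. d b \<otimes> b x)"
  by (rule finsum_addf) (use bR cR[OF c] cR[OF d] in auto)
 finally show ?thesis .
 qed
 then show "lincomb B (c \<oplus>\<^bsub>fspace B\<^esub> d) = lincomb B c \<oplus>\<^bsub>restrict_mod (fspace S) Z\<^esub> lincomb B d"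
 by (simp add: lincomb_def)
next
 fix r c assume r: "r \<in> carrier R" and c: "c \<in> carrier (fspace B)"
 have "(\<Oplus>b\<in>B. (r \<otimes> c b) \<otimes> b x) = r \<otimes> (\<Oplus>b\<in>B. c b \<otimes> b x)" for x
 proof -
 have "(\<Oplus>b\<in>B. (r \<otimes> c b) \<otimes> b x) = (\<Oplus>b\<in>B. r \<otimes> (c b \<otimes> b x))"
  by (rule finsum_cong'[OF refl]) (use bR r cR[OF c] in \<open>auto simp: m_assoc\<close>)
 also have "\<dots> = r \<otimes> (\<Oplus>b\<in>B. c b \<otimes> b x)"
  by (rule finsum_rdistr[symmetric, OF finB r]) (use bR cR[OF c] in auto)
 finally show ?thesis .
 qed
 then show "lincomb B (r \<odot>\<^bsub>fspace B\<^esub> c) = r \<odot>\<^bsub>restrict_mod (fspace S) Z\<^esub> lincomb B c"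
 by (simp add: lincomb_def)
qed (simp add: mem)
show "lincomb B ` carrier (fspace B) = Z"
proof (rule equalityI[OF image_subsetI[OF mem] subsetI])
 fix z assume "z \<in> Z"
 then obtain c where c: "c \<in> B \<rightarrow> carrier R" "z = lincomb B c" using B by (auto simp: basis_of_def)
 let ?c = "%b. if b \<in> B then c b else \<zero>"
 have "z = lincomb B ?c" unfolding c(2) by (rule lincomb_cong[symmetric]) (use c(1) bR in auto)
 moreover have "?c \<in> carrier (fspace B)" using c(1) finB by (auto simp: free_mod_carrier_finite)
 ultimately show "z \<in> lincomb B ` carrier (fspace B)" by (rule image_eqI)
qed
qed

text \<open>Subquotients of a homology module are finitely generated, as the chains have submodules with finite bases.\<close>

lemma subquotient_generators:
fixes S :: "'x set"
assumes C: "mcomplex R S sz D" and N: "submodule N R (mhom R S sz D d)"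
 and k: "k \<in> mod_hom R (restrict_mod (mhom R S sz D d) N) M" and surj: "k ` N = carrier M"
shows "\<exists>(J :: ('x => 'a) set) L. finite J & L \<in> mod_hom R (fspace J) M & L ` carrier (fspace J) = carrier M"
proof -
let ?Zd = "restrict_mod (mchains R S sz d) (mcycles R S sz D d)" and ?q = "mcls R S sz D d"
define Z where "Z = {c \<in> carrier ?Zd. ?q c \<in> N}"
have "submodule Z R ?Zd" unfolding Z_def
 by (rule submodule_vimage[OF mcycles_module[OF C] mhom_module[OF C] mcls_hom[OF C] N])
then have "submodule Z R (mchains R S sz d)"
 by (rule submodule_of_restrict[OF mchains_module mcycles_submodule[OF C]])
then have Z: "submodule Z R (fspace S)" by (rule submodule_fspace[OF _ mcomplex_finite[OF C] order_refl])
obtain B where B: "basis_of Z B" using submodule_basis[OF mcomplex_finite[OF C] Z] by blast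
have ZR: "restrict_mod ?Zd Z = restrict_mod (fspace S) Z"
 by (simp add: restrict_mod_def mchains_def free_mod_def)
have "?q \<in> mod_hom R (restrict_mod ?Zd Z) (mhom R S sz D d)"
 by (rule mod_hom_restrict_source[OF mcls_hom[OF C]]) (auto simp: Z_def)
then have q: "?q \<in> mod_hom R (restrict_mod (fspace S) Z) (restrict_mod (mhom R S sz D d) N)"
 unfolding ZR by (rule mod_hom_restrict_target) (simp add: Z_def)
have qZ: "?q ` Z = N"
proof (rule equalityI)
 show "?q ` Z <= N" by (auto simp: Z_def)
 show "N <= ?q ` Z"
 proof
 fix x assume x: "x \<in> N"
 then have "x \<in> carrier (mhom R S sz D d)" using submodule_subset[OF N] by blast
 then obtain c where "c \<in> mcycles R S sz D d" "x = ?q c" unfolding mhom_carrier by blast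
 then show "x \<in> ?q ` Z" using x by (simp add: Z_def)
 qed
qed
have "(%c. k (?q (lincomb B c))) \<in> mod_hom R (fspace B) M"
 by (rule mod_hom_compose[OF mod_hom_compose[OF lincomb_hom(1)[OF Z B] q] k])
moreover have "(%c. k (?q (lincomb B c))) ` carrier (fspace B) = k ` ?q ` lincomb B ` carrier (fspace B)"
 by (simp add: image_image)
then have "(%c. k (?q (lincomb B c))) ` carrier (fspace B) = carrier M"
 unfolding lincomb_hom(2)[OF Z B] qZ surj .
moreover have "finite B" using B by (simp add: basis_of_def)
ultimately show ?thesis by blast
qed

lemma map_generators:
fixes S :: "'x set" and S' :: "'y set"
assumes C: "mcomplex R S sz D" and C': "mcomplex R S' sz' D'" and h: "h \<in> mod_hom R (mhom R S sz D d) (mhom R S' sz' D' d)"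
shows "\<exists>(J :: ('x => 'a) set) L. finite J & L \<in> mod_hom R (fspace J) (ker_mod (mhom R S sz D d) (mhom R S' sz' D' d) h) & L ` carrier (fspace J) = carrier (ker_mod (mhom R S sz D d) (mhom R S' sz' D' d) h)"
 and "\<exists>(J :: ('x => 'a) set) L. finite J & L \<in> mod_hom R (fspace J) (im_mod (mhom R S sz D d) (mhom R S' sz' D' d) h) & L ` carrier (fspace J) = carrier (im_mod (mhom R S sz D d) (mhom R S' sz' D' d) h)"
proof -
let ?M = "mhom R S sz D d" and ?N = "mhom R S' sz' D' d"
have K: "submodule (a_kernel ?M ?N h) R ?M"
 unfolding a_kernel_def' using submodule_kernel[OF mhom_module[OF C] mhom_module[OF C'] h] .
have id: "(%x. x) \<in> mod_hom R (restrict_mod ?M (a_kernel ?M ?N h)) (ker_mod ?M ?N h)"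
 by (rule mod_homI) (simp_all add: ker_mod_def)
show "\<exists>(J :: ('x => 'a) set) L. finite J & L \<in> mod_hom R (fspace J) (ker_mod ?M ?N h) & L ` carrier (fspace J) = carrier (ker_mod ?M ?N h)"
 by (rule subquotient_generators[OF C K id]) (simp add: ker_mod_def)
have h': "h \<in> mod_hom R (restrict_mod ?M (carrier ?M)) (im_mod ?M ?N h)"
 unfolding im_mod_def by (rule mod_hom_restrict_target[OF mod_hom_restrict_source[OF h]]) simp_all
show "\<exists>(J :: ('x => 'a) set) L. finite J & L \<in> mod_hom R (fspace J) (im_mod ?M ?N h) & L ` carrier (fspace J) = carrier (im_mod ?M ?N h)"
 by (rule subquotient_generators[OF C submodule_self[OF mhom_module[OF C]] h']) (simp add: im_mod_def)
qed

lemma coker_generators: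
fixes S' :: "'y set"
assumes C: "mcomplex R S sz D" and C': "mcomplex R S' sz' D'" and h: "h \<in> mod_hom R (mhom R S sz D d) (mhom R S' sz' D' d)"
shows "\<exists>(J :: ('y => 'a) set) L. finite J & L \<in> mod_hom R (fspace J) (coker_mod (mhom R S sz D d) (mhom R S' sz' D' d) h) &
 L ` carrier (fspace J) = carrier (coker_mod (mhom R S sz D d) (mhom R S' sz' D' d) h)"
proof -
let ?M = "mhom R S sz D d" and ?N = "mhom R S' sz' D' d"
note sm = submodule_image[OF mhom_module[OF C] mhom_module[OF C'] h submodule_self[OF mhom_module[OF C]]]
have k: "(%x. (h ` carrier ?M) +>\<^bsub>?N\<^esub> x) \<in> mod_hom R (restrict_mod ?N (carrier ?N)) (coker_mod ?M ?N h)"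
 unfolding coker_mod_def by (rule mod_hom_restrict_source[OF coset_mod_hom[OF mhom_module[OF C'] sm]]) simp
show ?thesis
 by (rule subquotient_generators[OF C' submodule_self[OF mhom_module[OF C']] k])
 (auto simp: coker_mod_def quot_mod_carrier)
qed

section \<open>Simplicial pairs\<close>

abbreviation csz :: "nat set => int" where "csz \<equiv> %\<sigma>. int (card \<sigma>)"
abbreviation nsz :: "nat set => int" where "nsz \<equiv> %\<sigma>. - int (card \<sigma>)"
abbreviation sm :: "nat set => nat set => 'a" where "sm \<equiv> simp_mat R"
abbreviation smt :: "nat set => nat set => 'a" where "smt \<equiv> %\<sigma> \<tau>. simp_mat R \<tau> \<sigma>"

definition finite_rank :: "('a, 'z) module => bool"
where "finite_rank M \<longleftrightarrow> (\<exists>r::nat. mod_isomorphic R M (fspace {..<r}))"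

context
fixes V :: "nat set" and X A :: "nat set set"
assumes pair: "simplicial_pair V X A"
begin

lemma pair_setup: "simplicial_complex V X" "simplicial_complex V A" "A <= X"
 "mcomplex R X csz sm" "mcomplex R A csz sm" "ALL \<sigma>:X. ALL \<tau>:A. sm \<sigma> \<tau> ~= \<zero> --> \<sigma> \<in> A"
proof -
show X: "simplicial_complex V X" and A: "simplicial_complex V A" and "A <= X"
 using pair by (auto simp: simplicial_pair_def)
show "mcomplex R X csz sm" "mcomplex R A csz sm" by (rule simplicial_mcomplex[OF X] simplicial_mcomplex[OF A])+
show "ALL \<sigma>:X. ALL \<tau>:A. sm \<sigma> \<tau> ~= \<zero> --> \<sigma> \<in> A"
proof (intro ballI impI)
 fix \<sigma> \<tau> assume t: "\<tau> \<in> A" and nz: "sm \<sigma> \<tau> ~= \<zero>"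
 obtain v where "\<sigma> = \<tau> - {v}" by (rule simp_mat_nonzero[OF nz])
 then show "\<sigma> \<in> A" using complex_closed[OF A t] by blast
qed
qed

abbreviation "hA \<equiv> %d. mhom R A csz sm (d + 1)"
abbreviation "hX \<equiv> %d. mhom R X csz sm (d + 1)"
abbreviation "cA \<equiv> %d. mhom R A nsz smt (- d - 1)"
abbreviation "cX \<equiv> %d. mhom R X nsz smt (- d - 1)"
abbreviation "hi \<equiv> %d. quot_map (mchains R X csz (d + 1)) (mbounds R X csz sm (d + 1)) (%c. c)"
abbreviation "ci \<equiv> %d. quot_map (mchains R A nsz (- d - 1)) (mbounds R A nsz smt (- d - 1)) (%c \<sigma>. if \<sigma> \<in> A then c \<sigma> else \<zero>)"

lemma pair_mhom: "homology R A d = hA d" "homology R X d = hX d" "cohomology R A d = cA d" "cohomology R X d = cX d"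
 "homology_incl R X A d = hi d" "cohomology_incl R X A d = ci d"
by (simp_all only: homology_mhom[OF pair_setup(1)] homology_mhom[OF pair_setup(2)]
 cohomology_mhom[OF pair_setup(1)] cohomology_mhom[OF pair_setup(2)] homology_incl_def cohomology_incl_def
 boundaries_mat[OF pair_setup(1)] coboundaries_mat[OF pair_setup(2)] chains_mchains(1)[of X] chains_mchains(2)[of A])

lemma hi_hom: "hi d \<in> mod_hom R (hA d) (hX d)"
by (rule incl_mod_hom[OF pair_setup(4,3,6)])

lemma pair_modules: "module R (hA d)" "module R (hX d)" "module R (cA d)" "module R (cX d)"
by (rule mhom_module[OF pair_setup(5)] mhom_module[OF pair_setup(4)]
 mhom_module[OF mcomplex_transpose[OF pair_setup(5)]] mhom_module[OF mcomplex_transpose[OF pair_setup(4)]])+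

lemma pair_generators:
shows "\<exists>(J :: (nat set => 'a) set) L. finite J & L \<in> mod_hom R (fspace J) (ker_mod (hA d) (hX d) (hi d)) & L ` carrier (fspace J) = carrier (ker_mod (hA d) (hX d) (hi d))"
 and "\<exists>(J :: (nat set => 'a) set) L. finite J & L \<in> mod_hom R (fspace J) (im_mod (hA d) (hX d) (hi d)) & L ` carrier (fspace J) = carrier (im_mod (hA d) (hX d) (hi d))"
 and "\<exists>(J :: (nat set => 'a) set) L. finite J & L \<in> mod_hom R (fspace J) (coker_mod (hA d) (hX d) (hi d)) & L ` carrier (fspace J) = carrier (coker_mod (hA d) (hX d) (hi d))"
by (rule map_generators[OF pair_setup(5,4) hi_hom] coker_generators[OF pair_setup(5,4) hi_hom])+

context
fixes B BA :: "'y set" and G bz V' W'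
assumes ad: "adapted X A csz sm B BA G bz V' W'"
begin

lemma pair_homology_free:
"module R (suspension (homology_coker R X A) e)" "module R (suspension (homology_ker R X A) e)" "module R (suspension (homology_im R X A) e)"
"mod_isomorphic R (suspension (homology_coker R X A) e) (fspace {u \<in> (B - Field G) - BA. bz u = e})"
"mod_isomorphic R (suspension (homology_ker R X A) e) (fspace {u \<in> ker_part BA G. bz u = e})"
"mod_isomorphic R (suspension (homology_im R X A) e) (fspace {u \<in> BA - Field G. bz u = e})"
proof -
have e: "e - 1 + 1 = e" by simp
note m = pair_modules(1,2)[of "e - 1", unfolded e] and hom = hi_hom[of "e - 1", unfolded e]
note mods = ker_mod_module[OF m hom] im_mod_module[OF m hom] coker_mod_module[OF m hom]
note parts = pair_homology_parts[OF pair_setup(4,3,6) ad, where d = e]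
note defs = suspension_def homology_coker_def homology_ker_def homology_im_def pair_mhom e
show "module R (suspension (homology_coker R X A) e)" "module R (suspension (homology_ker R X A) e)" "module R (suspension (homology_im R X A) e)"
 unfolding defs by (rule transport_mod_module[OF mods(3)] transport_mod_module[OF mods(1)] transport_mod_module[OF mods(2)]; simp)+
show "mod_isomorphic R (suspension (homology_coker R X A) e) (fspace {u \<in> (B - Field G) - BA. bz u = e})"
 unfolding defs by (rule transport_free[OF mods(3) _ parts(3)]) simp
show "mod_isomorphic R (suspension (homology_ker R X A) e) (fspace {u \<in> ker_part BA G. bz u = e})"
 unfolding defs by (rule transport_free[OF mods(1) _ parts(1)]) simp
show "mod_isomorphic R (suspension (homology_im R X A) e) (fspace {u \<in> BA - Field G. bz u = e})"
 unfolding defs by (rule transport_free[OF mods(2) _ parts(2)]) simp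
qed

lemma pair_cohomology_free:
"module R (suspension (cohomology_ker R X A) e)" "module R (suspension (cohomology_coker R X A) e)" "module R (suspension (cohomology_im R X A) e)"
"mod_isomorphic R (suspension (cohomology_ker R X A) e) (fspace {u \<in> (B - Field G) - BA. bz u = e})"
"mod_isomorphic R (suspension (cohomology_coker R X A) e) (fspace {u \<in> ker_part BA G. bz u = e})"
"mod_isomorphic R (suspension (cohomology_im R X A) e) (fspace {u \<in> BA - Field G. bz u = e})"
proof -
have e: "- (e - 1) - 1 = - e" by simp
note parts = pair_cohomology_parts[OF pair_setup(4,3,6) ad, where d = "- e"]
note p = parts(1-3)[unfolded neg_equal_iff_equal] and hom = parts(4)
note m = pair_modules(4,3)[of "e - 1", unfolded e]
note mods = ker_mod_module[OF m hom] im_mod_module[OF m hom] coker_mod_module[OF m hom]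
note defs = suspension_def cohomology_coker_def cohomology_ker_def cohomology_im_def pair_mhom e
show "module R (suspension (cohomology_ker R X A) e)" "module R (suspension (cohomology_coker R X A) e)" "module R (suspension (cohomology_im R X A) e)"
 unfolding defs by (rule transport_mod_module[OF mods(1)] transport_mod_module[OF mods(3)] transport_mod_module[OF mods(2)]; simp)+
show "mod_isomorphic R (suspension (cohomology_ker R X A) e) (fspace {u \<in> (B - Field G) - BA. bz u = e})"
 unfolding defs by (rule transport_free[OF mods(1) _ p(1)]) simp
show "mod_isomorphic R (suspension (cohomology_coker R X A) e) (fspace {u \<in> ker_part BA G. bz u = e})"
 unfolding defs by (rule transport_free[OF mods(3) _ p(3)]) simp
show "mod_isomorphic R (suspension (cohomology_im R X A) e) (fspace {u \<in> BA - Field G. bz u = e})"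
 unfolding defs by (rule transport_free[OF mods(2) _ p(2)]) simp
qed

lemma epi_no_cokernel:
assumes epi: "!!d. homology_incl R X A d ` carrier (homology R A d) = carrier (homology R X d)"
shows "(B - Field G) - BA = {}"
proof (rule ccontr)
assume "(B - Field G) - BA ~= {}"
then obtain u where u: "u \<in> (B - Field G) - BA" by blast
let ?e = "bz u" and ?M = "suspension (homology_coker R X A) (bz u)" and ?U = "{v \<in> (B - Field G) - BA. bz v = bz u}"
note iso = pair_homology_free(4)[of ?e] and mM = pair_homology_free(1)[of ?e]
obtain f where f: "f \<in> mod_iso R ?M (fspace ?U)" using iso by (auto simp: mod_isomorphic_def)
have uU: "u \<in> ?U" using u by simp
obtain x where x: "x \<in> carrier ?M" "f x = generator R u"
 using mod_iso_surjD[OF f generator_mem[OF is_cring uU]] by blast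
let ?N = "homology R X (?e - 1)"
have N: "module R ?N" by (rule homology_module[OF pair_setup(1)])
have "carrier ?M = Inr ` carrier (quot_mod ?N (carrier ?N))" "\<zero>\<^bsub>?M\<^esub> = Inr (carrier ?N)"
 by (simp_all add: suspension_def homology_coker_def coker_mod_def epi)
moreover have "y = carrier ?N" if "y \<in> carrier (quot_mod ?N (carrier ?N))" for y
 using that coset_eq_zero_iff[OF N submodule_self[OF N]] by (auto simp: quot_mod_carrier)
ultimately have "x = \<zero>\<^bsub>?M\<^esub>" using x(1) by auto
then have "generator R u = (%_. \<zero>)" using mod_hom_zero[OF mM fspace_module mod_iso_hom[OF f]] x(2) by simp
then have "generator R u u = \<zero>" by (rule fun_cong)
then show False using one_not_zero by (simp add: generator_def)
qed

end

text \<open>A splitting of the surjection onto the free module \<open>im \<iota>\<close> identifies \<open>ker \<iota> \<oplus> im \<iota>\<close> with the source.\<close>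

lemma pair_identification:
assumes im: "!!d. finite_rank (im_mod (homology R A d) (homology R X d) (homology_incl R X A d))"
shows "pair_homology_R_identification R X A"
unfolding pair_homology_R_identification_def
proof
fix d :: int
note One_nat_def [simp del]
let ?e = "d - 1"
let ?M = "homology R A ?e" and ?N = "homology R X ?e" and ?h = "homology_incl R X A ?e"
let ?a = "({}, {}) :: index" and ?b = "({}, {1}) :: index"
let ?D = "graded_direct_sum (index_R 1) (pair_homology R X A) d"
have M: "module R ?M" and N: "module R ?N" by (rule homology_module[OF pair_setup(2)] homology_module[OF pair_setup(1)])+
have h: "?h \<in> mod_hom R ?M ?N" unfolding pair_mhom by (rule hi_hom)
interpret M: module R ?M by (rule M)
interpret N: module R ?N by (rule N)
let ?I = "im_mod ?M ?N ?h" and ?K = "ker_mod ?M ?N ?h"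
have I: "module R ?I" by (rule im_mod_module[OF M N h])
obtain r :: nat and f where f: "f \<in> mod_iso R ?I (fspace {..<r})"
 using im[of ?e] by (auto simp: finite_rank_def mod_isomorphic_def)
have hI: "?h \<in> mod_hom R ?M ?I" unfolding im_mod_def by (rule mod_hom_restrict_target[OF h]) simp
have carI: "carrier ?I = ?h ` carrier ?M" by (simp add: im_mod_def)
have "EX x. x \<in> carrier ?M & f (?h x) = generator R i" if "i \<in> {..<r}" for i
 using mod_iso_surjD[OF f generator_mem[OF is_cring that]] unfolding carI by blast
then obtain a where a: "!!i. i \<in> {..<r} ==> a i \<in> carrier ?M" "!!i. i \<in> {..<r} ==> f (?h (a i)) = generator R i"
 by metis
define s where "s = (%y. lin_ext R ?M a (f y))"
note lh = lin_ext_hom[OF M a(1)]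
have s: "s \<in> mod_hom R ?I ?M" unfolding s_def by (rule mod_hom_compose[OF mod_iso_hom[OF f] lh])
have hs: "?h (s y) = y" if y: "y \<in> carrier ?I" for y
proof -
 have fy: "f y \<in> carrier (fspace {..<r})" by (rule mod_hom_closed[OF mod_iso_hom[OF f] y])
 have "f (?h (lin_ext R ?M a (f y))) = f y"
 proof (rule free_mod_hom_eq[OF is_cring fspace_module mod_hom_compose[OF mod_hom_compose[OF lh hI] mod_iso_hom[OF f]] _ _ fy])
 show "(%c. c) \<in> mod_hom R (fspace {..<r}) (fspace {..<r})" by (rule mod_homI) simp_all
 show "f (?h (lin_ext R ?M a (generator R i))) = generator R i" if "i \<in> {..<r}" for i
  using lin_ext_generator[OF M a(1) that] a(2)[OF that] by simp
 qed
 moreover have "?h (s y) \<in> carrier ?I" by (rule mod_hom_closed[OF hI mod_hom_closed[OF s y]])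
 ultimately show ?thesis using mod_iso_injD[OF f _ y] unfolding s_def by blast
qed
have D: "?D = direct_sum {?b, ?a} (%\<alpha>. pair_homology R X A \<alpha> d)"
 unfolding graded_direct_sum_def index_R_1 by (simp add: insert_commute)
have pa: "pair_homology R X A ?a d = transport_mod Inl projl ?I" and pb: "pair_homology R X A ?b d = transport_mod Inl projl ?K"
 by (simp_all add: pair_homology_def suspension_def homology_im_def homology_ker_def)
have ne: "?a ~= ?b" by simp
have carK: "x \<in> carrier ?K \<longleftrightarrow> x \<in> carrier ?M & ?h x = \<zero>\<^bsub>?N\<^esub>" for x
 by (simp add: ker_mod_def a_kernel_def')
have mem: "w \<in> carrier ?D \<longleftrightarrow> (EX k:carrier ?K. w ?b = Inl k) & (EX y:carrier ?I. w ?a = Inl y) & w \<in> extensional {?b, ?a}" for w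
 unfolding D direct_sum_carrier by (auto simp: pa pb)
define \<phi> :: "(index => 'a pair_element) => (nat set => 'a) set" where "\<phi> = (%w. projl (w ?b) \<oplus>\<^bsub>?M\<^esub> s (projl (w ?a)))"
have comp: "projl (w ?b) \<in> carrier ?M" "?h (projl (w ?b)) = \<zero>\<^bsub>?N\<^esub>" "projl (w ?a) \<in> carrier ?I"
 "projl (w ?a) \<in> carrier ?N" "s (projl (w ?a)) \<in> carrier ?M" "\<phi> w \<in> carrier ?M" "?h (\<phi> w) = projl (w ?a)" if w: "w \<in> carrier ?D" for w
proof -
 show b: "projl (w ?b) \<in> carrier ?M" "?h (projl (w ?b)) = \<zero>\<^bsub>?N\<^esub>" and y: "projl (w ?a) \<in> carrier ?I"
 using w carK unfolding mem by auto
 show yN: "projl (w ?a) \<in> carrier ?N" using y carI mod_hom_closed[OF h] by auto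
 show sy: "s (projl (w ?a)) \<in> carrier ?M" by (rule mod_hom_closed[OF s y])
 show "\<phi> w \<in> carrier ?M" unfolding \<phi>_def by (rule M.a_closed[OF b(1) sy])
 show "?h (\<phi> w) = projl (w ?a)" unfolding \<phi>_def mod_hom_add[OF h b(1) sy] b(2) hs[OF y] using yN by simp
qed
have inl: "w ?b = Inl (projl (w ?b))" "w ?a = Inl (projl (w ?a))" if w: "w \<in> carrier ?D" for w
proof -
 obtain k y where "w ?b = Inl k" "w ?a = Inl y" using w unfolding mem by blast
 then show "w ?b = Inl (projl (w ?b))" "w ?a = Inl (projl (w ?a))" by (simp_all only: sum.sel)
qed
have addD: "(w \<oplus>\<^bsub>?D\<^esub> v) ?b = Inl (projl (w ?b) \<oplus>\<^bsub>?M\<^esub> projl (v ?b))" "(w \<oplus>\<^bsub>?D\<^esub> v) ?a = Inl (projl (w ?a) \<oplus>\<^bsub>?I\<^esub> projl (v ?a))" for w v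
 unfolding D by (simp_all add: pa pb ker_mod_def)
have smultD: "(c \<odot>\<^bsub>?D\<^esub> w) ?b = Inl (c \<odot>\<^bsub>?M\<^esub> projl (w ?b))" "(c \<odot>\<^bsub>?D\<^esub> w) ?a = Inl (c \<odot>\<^bsub>?I\<^esub> projl (w ?a))" for w c
 unfolding D by (simp_all add: pa pb ker_mod_def)
have hom: "\<phi> \<in> mod_hom R ?D ?M"
proof (rule mod_homI)
 show "\<phi> w \<in> carrier ?M" if "w \<in> carrier ?D" for w by (rule comp(6)[OF that])
 show "\<phi> (w \<oplus>\<^bsub>?D\<^esub> v) = \<phi> w \<oplus>\<^bsub>?M\<^esub> \<phi> v" if w: "w \<in> carrier ?D" and v: "v \<in> carrier ?D" for w v
 unfolding \<phi>_def addD sum.sel mod_hom_add[OF s comp(3)[OF w] comp(3)[OF v]]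
 using comp(1,5)[OF w] comp(1,5)[OF v] by (simp only: M.a_ac M.a_closed)
 show "\<phi> (c \<odot>\<^bsub>?D\<^esub> w) = c \<odot>\<^bsub>?M\<^esub> \<phi> w" if c: "c \<in> carrier R" and w: "w \<in> carrier ?D" for c w
 unfolding \<phi>_def smultD sum.sel mod_hom_smult[OF s c comp(3)[OF w]]
 by (rule M.smult_r_distr[OF c comp(1,5)[OF w], symmetric])
qed
have "bij_betw \<phi> (carrier ?D) (carrier ?M)"
 unfolding bij_betw_def
proof
 show "inj_on \<phi> (carrier ?D)"
 proof (rule inj_onI)
 fix w v assume w: "w \<in> carrier ?D" and v: "v \<in> carrier ?D" and eq: "\<phi> w = \<phi> v"
 have a: "projl (w ?a) = projl (v ?a)" using comp(7)[OF w] comp(7)[OF v] eq by simp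
 have "projl (w ?b) = projl (v ?b)"
  using eq comp(1,5)[OF w] comp(1,5)[OF v] unfolding \<phi>_def a by (simp only: M.add.right_cancel)
 then have eb: "w ?b = v ?b" and ea: "w ?a = v ?a"
  using inl[OF w] inl[OF v] a by metis+
 have "w i = v i" if "i \<in> {?b, ?a}" for i
  using that by (elim insertE emptyE) (simp_all only: eb ea)
 moreover have "w \<in> extensional {?b, ?a}" "v \<in> extensional {?b, ?a}" using w v mem by blast+
 ultimately show "w = v" by (intro extensionalityI[of _ "{?b, ?a}"])
 qed
 show "\<phi> ` carrier ?D = carrier ?M"
 proof
 show "\<phi> ` carrier ?D <= carrier ?M" using comp(6) by blast
 show "carrier ?M <= \<phi> ` carrier ?D"
 proof
  fix x assume x: "x \<in> carrier ?M"
  let ?y = "?h x" and ?k = "x \<ominus>\<^bsub>?M\<^esub> s (?h x)"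
  have y: "?y \<in> carrier ?I" unfolding carI by (rule imageI[OF x])
  have sy: "s ?y \<in> carrier ?M" by (rule mod_hom_closed[OF s y])
  have hx: "?h x \<in> carrier ?N" by (rule mod_hom_closed[OF h x])
  have "?h ?k = \<zero>\<^bsub>?N\<^esub>" unfolding mod_hom_diff[OF M N h x sy] hs[OF y] using hx by (simp add: N.r_neg a_minus_def)
  then have k: "?k \<in> carrier ?K" unfolding carK using M.minus_closed[OF x sy] by blast
  let ?w = "\<lambda>i\<in>{?b, ?a}. if i = ?b then Inl ?k else Inl ?y"
  have wb: "?w ?b = Inl ?k" and wa: "?w ?a = Inl ?y" using ne by simp_all
  have "?w \<in> extensional {?b, ?a}" by (rule restrict_extensional)
  then have wD: "?w \<in> carrier ?D" unfolding mem wb wa using k y by blast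
  have "\<phi> ?w = x" unfolding \<phi>_def wb wa sum.sel
  using x sy by (simp add: a_minus_def M.a_assoc M.l_neg)
  then show "x \<in> \<phi> ` carrier ?D" by (rule image_eqI[OF sym wD])
 qed
 qed
qed
then have iso: "\<phi> \<in> mod_iso R ?D (suspension (homology R A) d)" unfolding suspension_def by (rule mod_isoI[OF hom])
have kerc: "\<phi> w = projl (w ?b)" if w: "w \<in> carrier ?D" and z: "w ?a = \<zero>\<^bsub>pair_homology R X A ?a d\<^esub>" for w
proof -
 have "projl (w ?a) = \<zero>\<^bsub>?I\<^esub>" unfolding z pa by simp
 then have "s (projl (w ?a)) = \<zero>\<^bsub>?M\<^esub>" using mod_hom_zero[OF I M s] by simp
 then show ?thesis unfolding \<phi>_def using comp(1)[OF w] by simp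
qed
show "EX \<phi>:mod_iso R ?D (suspension (homology R A) d). ALL w:carrier ?D.
 homology_incl R X A (d - 1) (\<phi> w) = projl (w ?a) & (w ?a = \<zero>\<^bsub>pair_homology R X A ?a d\<^esub> --> \<phi> w = projl (w ?b))"
 by (rule bexI[OF _ iso]) (intro ballI conjI impI comp(7) kerc)
qed

end

end

section \<open>The decomposition\<close>

lemma if_cases:
"(c ==> Pr x X) ==> (~ c ==> c' ==> Pr y Y) ==> (~ c ==> ~ c' ==> Pr z Z) ==>
 Pr (if c then x else if c' then y else z) (if c then X else if c' then Y else Z)"
by simp

context pid begin

lemma link_restriction_complex:
assumes "simplicial_complex V K" shows "simplicial_complex V (link_restriction K \<alpha>)"
proof -
obtain \<sigma> \<omega> where a: "\<alpha> = (\<sigma>, \<omega>)" by (cases \<alpha>)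
have "\<tau> \<in> link_restriction K \<alpha>" if "\<rho> \<in> link_restriction K \<alpha>" "\<tau> <= \<rho>" for \<rho> \<tau>
proof -
 have r: "\<rho> <= \<omega>" "\<sigma> \<union> \<rho> \<in> K" using that(1) by (auto simp: a link_restriction_def)
 have "\<sigma> \<union> \<tau> \<in> K" by (rule complex_closed[OF assms r(2)]) (use that(2) in blast)
 then show ?thesis using r(1) that(2) by (auto simp: a link_restriction_def)
qed
moreover have "link_restriction K \<alpha> <= Pow V" "finite V"
 using assms by (auto simp: a link_restriction_def simplicial_complex_def)
ultimately show ?thesis unfolding simplicial_complex_def by blast
qed

theorem polyhedral_product_decomposition:
assumes K: "simplicial_complex {1..m} K"
 and XA: "!!k. k \<in> {1..m} ==> simplicial_pair (block n k) (X k) (A k)"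
 and ker: "!!k d. k \<in> {1..m} ==> finite_rank (ker_mod (homology R (A k) d) (homology R (X k) d) (homology_incl R (X k) (A k) d))"
 and im: "!!k d. k \<in> {1..m} ==> finite_rank (im_mod (homology R (A k) d) (homology R (X k) d) (homology_incl R (X k) (A k) d))"
 and coker: "!!k d. k \<in> {1..m} ==> finite_rank (coker_mod (homology R (A k) d) (homology R (X k) d) (homology_incl R (X k) (A k) d))"
 and \<Lambda>: "\<Lambda> = index_X m | \<Lambda> = index_R m & homology_epi R m X A"
shows "homology_decomposition R \<Lambda> m n K X A" and "cohomology_decomposition R \<Lambda> m n K X A"
proof -
let ?I = "{1..m}"
have "ALL k:?I. \<exists>q :: (nat set => 'a) set \<times> _. adapted (X k) (A k) csz sm (fst q) (fst (snd q)) (fst (snd (snd q)))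
 (fst (snd (snd (snd q)))) (fst (snd (snd (snd (snd q))))) (snd (snd (snd (snd (snd q)))))"
proof
 fix k assume k: "k \<in> ?I"
 note p = XA[OF k] and eqs = pair_mhom[OF XA[OF k]]
 have "\<exists>(B :: (nat set => 'a) set) BA G bz V W. adapted (X k) (A k) csz sm B BA G bz V W"
 proof (rule adapted_basis[OF pair_setup(4,3,6)[OF p]])
 fix d
 show "\<exists>r::nat. mod_isomorphic R (ker_mod (mhom R (A k) csz sm d) (mhom R (X k) csz sm d)
  (quot_map (mchains R (X k) csz d) (mbounds R (X k) csz sm d) (%c. c))) (fspace {..<r})"
  using ker[OF k, of "d - 1"] unfolding eqs finite_rank_def diff_add_cancel .
 show "\<exists>r::nat. mod_isomorphic R (im_mod (mhom R (A k) csz sm d) (mhom R (X k) csz sm d)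
  (quot_map (mchains R (X k) csz d) (mbounds R (X k) csz sm d) (%c. c))) (fspace {..<r})"
  using im[OF k, of "d - 1"] unfolding eqs finite_rank_def diff_add_cancel .
 show "\<exists>r::nat. mod_isomorphic R (coker_mod (mhom R (A k) csz sm d) (mhom R (X k) csz sm d)
  (quot_map (mchains R (X k) csz d) (mbounds R (X k) csz sm d) (%c. c))) (fspace {..<r})"
  using coker[OF k, of "d - 1"] unfolding eqs finite_rank_def diff_add_cancel .
 qed
 then obtain B :: "(nat set => 'a) set" and BA G bz V W where "adapted (X k) (A k) csz sm B BA G bz V W" by blast
 then show "\<exists>q :: (nat set => 'a) set \<times> _. adapted (X k) (A k) csz sm (fst q) (fst (snd q)) (fst (snd (snd q)))
 (fst (snd (snd (snd q)))) (fst (snd (snd (snd (snd q))))) (snd (snd (snd (snd (snd q)))))"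
 by (intro exI[of _ "(B, BA, G, bz, V, W)"]) (simp only: fst_conv snd_conv)
qed
from bchoice[OF this] obtain q :: "nat => (nat set => 'a) set \<times> _" where
 q: "!!k. k \<in> ?I ==> adapted (X k) (A k) csz sm (fst (q k)) (fst (snd (q k))) (fst (snd (snd (q k))))
 (fst (snd (snd (snd (q k))))) (fst (snd (snd (snd (snd (q k)))))) (snd (snd (snd (snd (snd (q k))))))" by blast
define B where "B = (%k. fst (q k))"
define BA where "BA = (%k. fst (snd (q k)))"
define G where "G = (%k. fst (snd (snd (q k))))"
define bz where "bz = (%k. fst (snd (snd (snd (q k)))))"
define V where "V = (%k. fst (snd (snd (snd (snd (q k))))))"
define W where "W = (%k. snd (snd (snd (snd (snd (q k))))))"
have ad: "adapted (X k) (A k) csz sm (B k) (BA k) (G k) (bz k) (V k) (W k)" if "k \<in> ?I" for k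
 unfolding B_def BA_def G_def bz_def V_def W_def by (rule q[OF that])
have mt: "matching (B k) (bz k) (G k)" and BAB: "BA k <= B k" if "k \<in> ?I" for k
 using ad[OF that] unfolding adapted_def by blast+
let ?core = "PiE ?I (%k. core (B k) (BA k) (G k))" and ?ci = "core_index ?I BA G"
have \<Lambda>X: "\<Lambda> <= index_X m" using \<Lambda> by (auto simp: index_R_def index_X_def)
have inX: "?ci t \<in> index_X m" if t: "t \<in> ?core" for t
proof -
 have "t k \<in> BA k" if "k \<in> ?I" "t k \<in> Domain (G k)" for k
 proof -
 have "t k \<in> core (B k) (BA k) (G k)" by (rule PiE_mem[OF t that(1)])
 then show ?thesis using that(2) unfolding core_def Field_def by blast
 qed
 then show ?thesis unfolding core_index_def index_X_def by blast
qed
have cov: "?ci t \<in> \<Lambda>" if t: "t \<in> ?core" for t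
proof (cases "\<Lambda> = index_X m")
 case False
 then have L: "\<Lambda> = index_R m" and epi: "homology_epi R m X A" using \<Lambda> by auto
 have "t k \<in> BA k" if k: "k \<in> ?I" for k
 proof -
 have "(B k - Field (G k)) - BA k = {}"
  by (rule epi_no_cokernel[OF XA[OF k] ad[OF k]]) (use epi k in \<open>simp add: homology_epi_def\<close>)
 moreover have "t k \<in> core (B k) (BA k) (G k)" by (rule PiE_mem[OF t k])
 ultimately show ?thesis unfolding core_def by blast
 qed
 then show ?thesis unfolding L core_index_def index_R_def by blast
qed (use inX[OF t] in simp)
have H: "module R (complex_homology R K \<alpha> i)" "module R (complex_cohomology R K \<alpha> i)" for \<alpha> i
 unfolding complex_homology_def complex_cohomology_def suspension_def
 by (rule homology_module[OF link_restriction_complex[OF K]] cohomology_module[OF link_restriction_complex[OF K]])+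
define P where "P = (%(\<alpha>::index) k. suspension (if k \<in> fst \<alpha> then homology_coker R (X k) (A k)
 else if k \<in> snd \<alpha> then homology_ker R (X k) (A k) else homology_im R (X k) (A k)))"
define P' where "P' = (%(\<alpha>::index) k. suspension (if k \<in> fst \<alpha> then cohomology_ker R (X k) (A k)
 else if k \<in> snd \<alpha> then cohomology_coker R (X k) (A k) else cohomology_im R (X k) (A k)))"
have P: "module R (P \<alpha> k e)" "module R (P' \<alpha> k e)"
 "mod_isomorphic R (P \<alpha> k e) (fspace {u \<in> index_part \<alpha> k (B k) (BA k) (G k). bz k u = e})"
 "mod_isomorphic R (P' \<alpha> k e) (fspace {u \<in> index_part \<alpha> k (B k) (BA k) (G k). bz k u = e})" if k: "k \<in> ?I" for \<alpha> k e
proof -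
 note f = pair_homology_free[OF XA[OF k] ad[OF k], of e] and c = pair_cohomology_free[OF XA[OF k] ad[OF k], of e]
 show "module R (P \<alpha> k e)" "module R (P' \<alpha> k e)" unfolding P_def P'_def using f(1-3) c(1-3) by simp_all
 show "mod_isomorphic R (P \<alpha> k e) (fspace {u \<in> index_part \<alpha> k (B k) (BA k) (G k). bz k u = e})"
 unfolding P_def index_part_def
 by (rule if_cases[where Pr = "%x U. mod_isomorphic R (suspension x e) (fspace {u \<in> U. bz k u = e})"]) (rule f(4-6))+
 show "mod_isomorphic R (P' \<alpha> k e) (fspace {u \<in> index_part \<alpha> k (B k) (BA k) (G k). bz k u = e})"
 unfolding P'_def index_part_def
 by (rule if_cases[where Pr = "%x U. mod_isomorphic R (suspension x e) (fspace {u \<in> U. bz k u = e})"]) (rule c(4-6))+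
qed
have Q: "pairs_homology R m X A \<alpha> = graded_tensor_family R ?I (P \<alpha>)" "pairs_cohomology R m X A \<alpha> = graded_tensor_family R ?I (P' \<alpha>)" for \<alpha>
proof -
 obtain \<sigma> \<omega> where a: "\<alpha> = (\<sigma>, \<omega>)" by (cases \<alpha>)
 show "pairs_homology R m X A \<alpha> = graded_tensor_family R ?I (P \<alpha>)"
 unfolding a pairs_homology_def P_def prod.case fst_conv snd_conv by (rule refl)
 show "pairs_cohomology R m X A \<alpha> = graded_tensor_family R ?I (P' \<alpha>)"
 unfolding a pairs_cohomology_def P'_def prod.case fst_conv snd_conv by (rule refl)
qed
note L = polyhedral_product_homology[OF K XA ad]
have "mod_isomorphic R (suspension (homology R (polyhedral_product m n K X A)) d)
 (diagonal_tensor R \<Lambda> (complex_homology R K) (pairs_homology R m X A) d)" for d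
 by (rule mod_isomorphic_trans[OF L(1) diagonal_tensor_core[OF H(1) \<Lambda>X BAB mt cov P(1) P(3) Q(1)]])
then show "homology_decomposition R \<Lambda> m n K X A"
 unfolding homology_decomposition_def graded_isomorphic_def
 by (intro conjI allI diagonal_tensor_eq pairs_homology_eq(1) subsetD[OF \<Lambda>X])
have "mod_isomorphic R (suspension (cohomology R (polyhedral_product m n K X A)) d)
 (diagonal_tensor R \<Lambda> (complex_cohomology R K) (pairs_cohomology R m X A) d)" for d
 by (rule mod_isomorphic_trans[OF L(2) diagonal_tensor_core[OF H(2) \<Lambda>X BAB mt cov P(2) P(4) Q(2)]])
then show "cohomology_decomposition R \<Lambda> m n K X A"
 unfolding cohomology_decomposition_def graded_isomorphic_def
 by (intro conjI allI diagonal_tensor_eq pairs_homology_eq(2) subsetD[OF \<Lambda>X])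
qed

lemma finite_rank_of_generators:
assumes M: "module R M" and gen: "\<exists>(J :: (nat set => 'a) set) L. finite J & L \<in> mod_hom R (fspace J) M & L ` carrier (fspace J) = carrier M"
 and free: "field R | is_free R M"
shows "finite_rank M"
proof -
obtain J :: "(nat set => 'a) set" and L where g: "L \<in> mod_hom R (fspace J) M" "L ` carrier (fspace J) = carrier M" "finite J"
 using gen by blast
show ?thesis unfolding finite_rank_def
 using free field.vector_space_rank[OF _ M g] is_free_rank[OF M g _ one_not_zero] by blast
qed

theorem polyhedral_product_splitting:
assumes K: "simplicial_complex {1..m} K"
 and XA: "!!k. k \<in> {1..m} ==> simplicial_pair (block n k) (X k) (A k)"
 and split: "field R | homology_split R m X A"
shows "homology_decomposition R (index_X m) m n K X A & cohomology_decomposition R (index_X m) m n K X A &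
 (homology_epi R m X A --> homology_decomposition R (index_R m) m n K X A &
 cohomology_decomposition R (index_R m) m n K X A & (ALL k:{1..m}. pair_homology_R_identification R (X k) (A k)))"
proof -
have rank: "finite_rank (ker_mod (homology R (A k) d) (homology R (X k) d) (homology_incl R (X k) (A k) d))"
 "finite_rank (im_mod (homology R (A k) d) (homology R (X k) d) (homology_incl R (X k) (A k) d))"
 "finite_rank (coker_mod (homology R (A k) d) (homology R (X k) d) (homology_incl R (X k) (A k) d))"
 if k: "k \<in> {1..m}" for k d
proof -
 note p = XA[OF k]
 note mods = pair_modules(1,2)[OF p] and h = hi_hom[OF p] and g = pair_generators[OF p]
 have s: "field R | is_free R (ker_mod (homology R (A k) d) (homology R (X k) d) (homology_incl R (X k) (A k) d))"
 "field R | is_free R (im_mod (homology R (A k) d) (homology R (X k) d) (homology_incl R (X k) (A k) d))"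
 "field R | is_free R (coker_mod (homology R (A k) d) (homology R (X k) d) (homology_incl R (X k) (A k) d))"
 using split k unfolding homology_split_def by blast+
 show "finite_rank (ker_mod (homology R (A k) d) (homology R (X k) d) (homology_incl R (X k) (A k) d))"
 using s(1) unfolding pair_mhom[OF p] by (rule finite_rank_of_generators[OF ker_mod_module[OF mods h] g(1)])
 show "finite_rank (im_mod (homology R (A k) d) (homology R (X k) d) (homology_incl R (X k) (A k) d))"
 using s(2) unfolding pair_mhom[OF p] by (rule finite_rank_of_generators[OF im_mod_module[OF mods h] g(2)])
 show "finite_rank (coker_mod (homology R (A k) d) (homology R (X k) d) (homology_incl R (X k) (A k) d))"
 using s(3) unfolding pair_mhom[OF p] by (rule finite_rank_of_generators[OF coker_mod_module[OF mods h] g(3)])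
qed
note dec = polyhedral_product_decomposition[OF K XA rank]
have "pair_homology_R_identification R (X k) (A k)" if "k \<in> {1..m}" for k
 by (rule pair_identification[OF XA[OF that] rank(2)[OF that]])
then show ?thesis using dec[of "index_X m"] dec[of "index_R m"] by blast
qed

end

theorem theorem3p9:
  fixes m :: nat and n :: "nat \<Rightarrow> nat" and K :: "nat set set"
    and X A :: "nat \<Rightarrow> nat set set"
    and F :: "('f, 's) ring_scheme"
  assumes "\<And>k. k \<in> {1..m} \<Longrightarrow> n k > 0"
    and "simplicial_complex {1..m} K"
    and "\<And>k. k \<in> {1..m} \<Longrightarrow> simplicial_pair (block n k) (X k) (A k)"
  shows
    "(homology_split \<Z> m X A \<longrightarrow>
        homology_decomposition \<Z> (index_X m) m n K X A \<and>
        cohomology_decomposition \<Z> (index_X m) m n K X A \<and>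
        (homology_epi \<Z> m X A \<longrightarrow>
          homology_decomposition \<Z> (index_R m) m n K X A \<and>
          cohomology_decomposition \<Z> (index_R m) m n K X A \<and>
          (\<forall>k\<in>{1..m}. pair_homology_R_identification \<Z> (X k) (A k)))) \<and>
     (field F \<longrightarrow>
        homology_decomposition F (index_X m) m n K X A \<and>
        cohomology_decomposition F (index_X m) m n K X A \<and>
        (homology_epi F m X A \<longrightarrow>
          homology_decomposition F (index_R m) m n K X A \<and>
          cohomology_decomposition F (index_R m) m n K X A \<and>
          (\<forall>k\<in>{1..m}. pair_homology_R_identification F (X k) (A k))))"
proof (intro conjI[of "homology_split \<Z> m X A \<longrightarrow> _"] impI)
  assume "homology_split \<Z> m X A"
  then have "field \<Z> \<or> homology_split \<Z> m X A" by (rule disjI2)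
  from pid.polyhedral_product_splitting[OF int_pid assms(2,3) this]
  show "homology_decomposition \<Z> (index_X m) m n K X A \<and>
        cohomology_decomposition \<Z> (index_X m) m n K X A \<and>
        (homology_epi \<Z> m X A \<longrightarrow>
          homology_decomposition \<Z> (index_R m) m n K X A \<and>
          cohomology_decomposition \<Z> (index_R m) m n K X A \<and>
          (\<forall>k\<in>{1..m}. pair_homology_R_identification \<Z> (X k) (A k)))" .
next
  assume F: "field F"
  then have "field F \<or> homology_split F m X A" by (rule disjI1)
  from pid.polyhedral_product_splitting[OF field_pid[OF F] assms(2,3) this]
  show "homology_decomposition F (index_X m) m n K X A \<and>
        cohomology_decomposition F (index_X m) m n K X A \<and>
        (homology_epi F m X A \<longrightarrow>
          homology_decomposition F (index_R m) m n K X A \<and>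
          cohomology_decomposition F (index_R m) m n K X A \<and>
          (\<forall>k\<in>{1..m}. pair_homology_R_identification F (X k) (A k)))" .
qed

end
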